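(* Let $m \geq 0$, $\lambda \in \mathbb{R}$ and $\mu \geq 0$. Consider the initial value problem \[ i \partial_t u = \sqrt{-\Delta+m^2}\, u + \Big( \frac{\lambda e^{-\mu|x|}}{|x|} \ast |u|^2 \Big) u, \qquad u(0,x) = u_0(x), \qquad u:[0,T)\times\mathbb{R}^3 \to \mathbb{C}. \] This problem is locally well-posed in $H^{1/2}(\mathbb{R}^3)$: for every $u_0 \in H^{1/2}(\mathbb{R}^3)$ there exists a unique solution \[ u \in C^0\big([0,T); H^{1/2}(\mathbb{R}^3)\big) \cap C^1\big([0,T); H^{-1/2}(\mathbb{R}^3)\big), \] and it depends continuously on $u_0$ (i.e. the map $u_0 \mapsto u \in C^0(I;H^{1/2}(\mathbb{R}^3))$ is continuous for every compact interval $I\subset[0,T)$). Here $T \in (0,\infty]$ is the maximal time of existence, and either $T=\infty$, or $T<\infty$ and $\lim_{t\uparrow T}\|u(t)\|_{H^{1/2}} = \infty$.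
   Context: $\sqrt{-\Delta+m^2}$ is the Fourier multiplier with symbol $\sqrt{\xi^2+m^2}$; $\ast$ denotes convolution on $\mathbb{R}^3$; $H^s(\mathbb{R}^3)$ is the Sobolev space with norm $\|\mathcal{F}^{-1}[(1+\xi^2)^{s/2}\mathcal{F}u]\|_{L^2}$. *)

theory Defs
  imports "HOL-Analysis.Analysis"
begin

text \<open>Functions on R^3 are modelled as maps real^3 => complex (elements of L^2 are
  taken up to a.e. equality; all notions below only depend on the a.e. class).\<close>

definition L2 :: "(real^3 \<Rightarrow> complex) \<Rightarrow> bool" where
  "L2 u \<longleftrightarrow> u \<in> borel_measurable lborel \<and> integrable lborel (\<lambda>x. (cmod (u x))^2)"

definition fourier_L1 :: "(real^3 \<Rightarrow> complex) \<Rightarrow> real^3 \<Rightarrow> complex" where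
  "fourier_L1 u \<xi> = complex_of_real ((2 * pi) powr (-3/2)) *
      (LINT x|lborel. cis (- (x \<bullet> \<xi>)) * u x)"

text \<open>Plancherel Fourier transform of an L^2 function: the L^2 limit of the
  transforms of the truncations to balls of radius R, R to infinity.\<close>
definition fourier :: "(real^3 \<Rightarrow> complex) \<Rightarrow> real^3 \<Rightarrow> complex" where
  "fourier u = (SOME g. g \<in> borel_measurable lborel \<and>
      ((\<lambda>R::real. \<integral>\<^sup>+ \<xi>. ennreal ((cmod (fourier_L1 (\<lambda>x. indicator (ball 0 R) x * u x) \<xi> - g \<xi>))^2) \<partial>lborel)
        \<longlongrightarrow> 0) at_top)"

text \<open>Sobolev spaces on the Fourier side: g is the Fourier transform of an H^s element.\<close>
definition in_fsob :: "real \<Rightarrow> (real^3 \<Rightarrow> complex) \<Rightarrow> bool" where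
  "in_fsob s g \<longleftrightarrow> g \<in> borel_measurable lborel \<and>
     integrable lborel (\<lambda>\<xi>. (1 + (norm \<xi>)^2) powr s * (cmod (g \<xi>))^2)"

definition fsob_norm :: "real \<Rightarrow> (real^3 \<Rightarrow> complex) \<Rightarrow> real" where
  "fsob_norm s g = sqrt (LINT \<xi>|lborel. (1 + (norm \<xi>)^2) powr s * (cmod (g \<xi>))^2)"

text \<open>H^s (s >= 0) for functions, with norm ||F^{-1}[(1+xi^2)^{s/2} F u]||_{L^2}
  = ||(1+xi^2)^{s/2} F u||_{L^2} (Plancherel).\<close>
definition in_H :: "real \<Rightarrow> (real^3 \<Rightarrow> complex) \<Rightarrow> bool" where
  "in_H s u \<longleftrightarrow> L2 u \<and> in_fsob s (fourier u)"

definition sob_norm :: "real \<Rightarrow> (real^3 \<Rightarrow> complex) \<Rightarrow> real" where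
  "sob_norm s u = fsob_norm s (fourier u)"

definition hartree :: "real \<Rightarrow> real \<Rightarrow> (real^3 \<Rightarrow> complex) \<Rightarrow> real^3 \<Rightarrow> complex" where
  "hartree lam mu u x =
     complex_of_real (LINT y|lborel. lam * exp (- mu * norm (x - y)) / norm (x - y) * (cmod (u y))^2) * u x"

text \<open>u is a solution on [0,T) in C^0([0,T);H^{1/2}) \<inter> C^1([0,T);H^{-1/2}) with
  u(0) = u0; H^{-1/2} is represented isometrically on the Fourier side, and the
  equation i u' = sqrt(-Delta+m^2) u + N(u) is required to hold in H^{-1/2}.\<close>
definition is_solution ::
  "real \<Rightarrow> real \<Rightarrow> real \<Rightarrow> (real^3 \<Rightarrow> complex) \<Rightarrow> ereal \<Rightarrow> (real \<Rightarrow> real^3 \<Rightarrow> complex) \<Rightarrow> bool" where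
  "is_solution m lam mu u0 T u \<longleftrightarrow> 0 < T \<and>
     (\<forall>t. 0 \<le> t \<and> ereal t < T \<longrightarrow> in_H (1/2) (u t)) \<and>
     (AE x in lborel. u 0 x = u0 x) \<and>
     (\<forall>t. 0 \<le> t \<and> ereal t < T \<longrightarrow>
        ((\<lambda>s. sob_norm (1/2) (\<lambda>x. u s x - u t x)) \<longlongrightarrow> 0) (at t within {s. 0 \<le> s \<and> ereal s < T})) \<and>
     (\<exists>w :: real \<Rightarrow> real^3 \<Rightarrow> complex. \<forall>t. 0 \<le> t \<and> ereal t < T \<longrightarrow>
        in_fsob (-1/2) (w t) \<and>
        ((\<lambda>h. fsob_norm (-1/2) (\<lambda>\<xi>. (fourier (u (t + h)) \<xi> - fourier (u t) \<xi>) / complex_of_real h - w t \<xi>))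
           \<longlongrightarrow> 0) (at 0 within {h. 0 \<le> t + h \<and> ereal (t + h) < T}) \<and>
        ((\<lambda>s. fsob_norm (-1/2) (\<lambda>\<xi>. w s \<xi> - w t \<xi>)) \<longlongrightarrow> 0) (at t within {s. 0 \<le> s \<and> ereal s < T}) \<and>
        (AE \<xi> in lborel. \<i> * w t \<xi> =
            complex_of_real (sqrt ((norm \<xi>)^2 + m^2)) * fourier (u t) \<xi> + fourier (hartree lam mu (u t)) \<xi>))"

end

theory Submission
  imports Defs "HOL-Probability.Probability" "HOL-Real_Asymp.Real_Asymp"
begin

text \<open>
  Let \<open>\<omega>(\<xi>) = sqrt (|\<xi>|^2 + m^2)\<close> and \<open>J(\<xi>) = (1 + |\<xi>|^2)^(1/4)\<close>. The substitution
  \<open>g(t) = exp(i t \<omega>) J F u(t)\<close> maps curves in \<open>H^(1/2)\<close> isometrically to curves in \<open>L^2\<close> and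
  removes the unbounded operator: the equation becomes an ordinary differential equation in \<open>L^2\<close>
  whose right-hand side is a bounded cubic map, hence locally Lipschitz. The derivative exists only in
  \<open>H^(-1/2)\<close> a priori; multiplying by \<open>J^(-2)\<close> makes it an \<open>L^2\<close> derivative, and the integrated
  equation loses the factor again because this multiplier is injective.

  The Yukawa potential is a superposition of heat kernels, so that its Fourier transform is at most a
  multiple of \<open>|\<eta>|^(-2)\<close>. By duality and Plancherel, boundedness of the cubic map reduces to
  the form with kernel
  \<open>J(c + a - b) / (J(a) J(b) J(c) |a - b|^2)\<close> being bounded on four \<open>L^2\<close> functions of
  \<open>a\<close>, \<open>b\<close>, \<open>c\<close>, \<open>c + a - b\<close>, which follows from weighted Schur tests.
\<close>

section \<open>The Hilbert space of square-integrable functions\<close>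

text \<open>The space \<open>H^(1/2)\<close> in three dimensions is not an algebra and does not
  embed into the bounded functions, so the cubic term has no soft bound. The usual remedy is a
  fractional product rule with Sobolev embeddings. Taking moduli of Fourier transforms replaces it
  by the elementary \<open>J(x + y) \<le> |y|^(1/2) + J(x)\<close> and leaves nonnegative
  integrands, for which the order of integration is free. Heat kernels intervene because
  \<open>1/|x|\<close> is neither integrable nor square-integrable on the whole space. Its transform
  is never formed; the exchanges of integrals are made where a Gaussian factor or Kato's inequality
  makes them absolutely convergent. The bounds do not depend on \<open>mu\<close>. On the time side,
  cutting the field off outside a ball makes it globally Lipschitz. Existence, continuation and
  dependence are then read off a global solution for as long as it stays in the ball. That the norm
  tends to infinity at \<open>T\<close>, instead of being merely unbounded, rests on a speed bound:
  a norm below \<open>R\<close> shortly before \<open>T\<close> cannot double in the time that is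
  left.\<close>

lemma cmod_add_sq_le: "(cmod (a + b))\<^sup>2 \<le> 2 * (cmod a)\<^sup>2 + 2 * (cmod b)\<^sup>2"
proof -
  have "(cmod (a + b))\<^sup>2 \<le> (cmod a + cmod b)\<^sup>2"
    by (intro power_mono norm_triangle_ineq norm_ge_zero)
  also have "\<dots> \<le> 2 * (cmod a)\<^sup>2 + 2 * (cmod b)\<^sup>2"
    using zero_le_power2[of "cmod a - cmod b"] by (simp add: power2_eq_square algebra_simps)
  finally show ?thesis .
qed

lemma L2_measurable [measurable_dest]: "L2 u \<Longrightarrow> u \<in> borel_measurable borel"
  by (simp add: L2_def)

lemma L2_integrable: "L2 u \<Longrightarrow> integrable lborel (\<lambda>x. (cmod (u x))\<^sup>2)"
  by (simp add: L2_def)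

lemma L2_bound:
  assumes "L2 v" "u \<in> borel_measurable borel" "AE x in lborel. cmod (u x) \<le> C * cmod (v x)"
  shows "L2 u"
  unfolding L2_def
proof
  show "u \<in> borel_measurable lborel" using assms by simp
  have "integrable lborel (\<lambda>x. C\<^sup>2 * (cmod (v x))\<^sup>2)"
    using L2_integrable[OF assms(1)] by simp
  then show "integrable lborel (\<lambda>x. (cmod (u x))\<^sup>2)"
  proof (rule Bochner_Integration.integrable_bound)
    show "AE x in lborel. norm ((cmod (u x))\<^sup>2) \<le> norm (C\<^sup>2 * (cmod (v x))\<^sup>2)"
      using assms(3) by eventually_elim (auto simp flip: power_mult_distrib intro!: power_mono)
  qed (use assms(2) in measurable)
qed

lemma L2_zero [simp]: "L2 (\<lambda>x. 0)"
  by (simp add: L2_def)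

lemma L2_add:
  assumes "L2 u" "L2 v" shows "L2 (\<lambda>x. u x + v x)"
  unfolding L2_def
proof
  show "(\<lambda>x. u x + v x) \<in> borel_measurable lborel"
    using assms by measurable
  have "integrable lborel (\<lambda>x. 2 * (cmod (u x))\<^sup>2 + 2 * (cmod (v x))\<^sup>2)"
    using assms by (intro Bochner_Integration.integrable_add integrable_mult_right L2_integrable)
  then show "integrable lborel (\<lambda>x. (cmod (u x + v x))\<^sup>2)"
    by (rule Bochner_Integration.integrable_bound) (use assms in \<open>auto intro: cmod_add_sq_le\<close>)
qed

lemma L2_mult_bounded:
  assumes "L2 u" "m \<in> borel_measurable borel" "\<And>x. cmod (m x) \<le> C"
  shows "L2 (\<lambda>x. m x * u x)"
  by (rule L2_bound[OF assms(1), where C=C])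
     (use assms in \<open>auto simp: norm_mult intro!: mult_right_mono\<close>)

lemma L2_cmult: "L2 u \<Longrightarrow> L2 (\<lambda>x. c * u x)"
  by (rule L2_mult_bounded[where C="cmod c"]) auto

lemma L2_minus: "L2 u \<Longrightarrow> L2 (\<lambda>x. - u x)"
  using L2_cmult[of u "-1"] by simp

lemma L2_diff: "L2 u \<Longrightarrow> L2 v \<Longrightarrow> L2 (\<lambda>x. u x - v x)"
  using L2_add[OF _ L2_minus] by fastforce

lemma borel_measurable_cnj [measurable (raw)]:
  "u \<in> borel_measurable M \<Longrightarrow> (\<lambda>x. cnj (u x)) \<in> borel_measurable M"
  by (rule measurable_compose[OF _ borel_measurable_continuous_onI]) (auto intro: continuous_intros)

lemma L2_cnj: "L2 u \<Longrightarrow> L2 (\<lambda>x. cnj (u x))"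
  by (rule L2_bound[where C=1 and v=u]) auto

lemma L2_cong_AE:
  assumes "L2 u" "v \<in> borel_measurable borel" "AE x in lborel. u x = v x" shows "L2 v"
  by (rule L2_bound[OF assms(1), where C=1]) (use assms in auto)

lemma L2_mult_integrable:
  assumes "L2 u" "L2 v" shows "integrable lborel (\<lambda>x. u x * v x)"
proof -
  have "integrable lborel (\<lambda>x. (cmod (u x))\<^sup>2 + (cmod (v x))\<^sup>2)"
    using assms by (intro Bochner_Integration.integrable_add L2_integrable)
  then show ?thesis
  proof (rule Bochner_Integration.integrable_bound)
    have "cmod (u x * v x) \<le> norm ((cmod (u x))\<^sup>2 + (cmod (v x))\<^sup>2)" for x
    proof -
      have "2 * (cmod (u x) * cmod (v x)) \<le> (cmod (u x))\<^sup>2 + (cmod (v x))\<^sup>2"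
        using sum_squares_bound[of "cmod (u x)" "cmod (v x)"] by simp
      moreover have "0 \<le> cmod (u x) * cmod (v x)" by simp
      ultimately show ?thesis unfolding norm_mult real_norm_def by linarith
    qed
    then show "AE x in lborel. cmod (u x * v x) \<le> norm ((cmod (u x))\<^sup>2 + (cmod (v x))\<^sup>2)" by simp
  qed (use assms in measurable)
qed

lemma L2_iff_nn:
  "L2 u \<longleftrightarrow> u \<in> borel_measurable borel \<and> (\<integral>\<^sup>+ x. ennreal ((cmod (u x))\<^sup>2) \<partial>lborel) < \<infinity>"
  by (auto simp: L2_def integrable_iff_bounded)

\<comment> \<open>A partial quotient builds both conventions into the type: only square-integrable
  functions have a class, and functions equal almost everywhere share one. The representative
  \<open>rp f\<close> is arbitrary within its class, so pointwise laws for it hold only almost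
  everywhere.\<close>
quotient_type l2 = "real^3 \<Rightarrow> complex" / partial:
  "\<lambda>f g. L2 f \<and> L2 g \<and> (AE x in lborel. f x = g x)"
  morphisms rp cl
proof (rule part_equivpI)
  show "\<exists>f. L2 f \<and> L2 f \<and> (AE x in lborel. f x = f x)"
    by (rule exI[of _ "\<lambda>x. 0"]) simp
  show "symp (\<lambda>f g. L2 f \<and> L2 g \<and> (AE x in lborel. f x = g x))"
    by (auto intro!: sympI)
  show "transp (\<lambda>f g. L2 f \<and> L2 g \<and> (AE x in lborel. f x = g x))"
    by (auto intro!: transpI elim: AE_mp)
qed

lemma L2_rp [simp, intro]: "L2 (rp f)"
  using Quotient3_rep_reflp[OF Quotient3_l2, of f] by simp

lemma rp_measurable [measurable]: "rp f \<in> borel_measurable borel"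
  using L2_rp by (rule L2_measurable)

lemma cl_rp [simp]: "cl (rp f) = f"
  by (rule Quotient3_abs_rep[OF Quotient3_l2])

lemma rp_cl: "L2 u \<Longrightarrow> AE x in lborel. rp (cl u) x = u x"
  using rep_abs_rsp_left[OF Quotient3_l2, of u u] by simp

lemma cl_cong: "L2 u \<Longrightarrow> L2 v \<Longrightarrow> AE x in lborel. u x = v x \<Longrightarrow> cl u = cl v"
  using Quotient3_rel_abs[OF Quotient3_l2, of u v] by simp

lemma cl_eq_iff: "L2 u \<Longrightarrow> L2 v \<Longrightarrow> cl u = cl v \<longleftrightarrow> (AE x in lborel. u x = v x)"
  using Quotient3_rel[OF Quotient3_l2, of u v] by auto

lemma l2_eq_iff: "f = g \<longleftrightarrow> (AE x in lborel. rp f x = rp g x)"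
  using cl_eq_iff[of "rp f" "rp g"] by simp

lemma l2_eqI: "AE x in lborel. rp f x = rp g x \<Longrightarrow> f = g"
  by (simp add: l2_eq_iff)

lemma cl_eqI: "L2 u \<Longrightarrow> AE x in lborel. u x = rp g x \<Longrightarrow> cl u = g"
  using cl_cong[of u "rp g"] by simp

text \<open>The structure is that of a real Hilbert space, which is what derivatives and integrals
  in time require. Complex scalars act as constant multipliers \<open>mlt (\<lambda>_. c)\<close>,
  and the complex pairing is recovered from the real one in
  \<open>integral_mult_cnj\<close>.\<close>

instantiation l2 :: real_inner
begin

definition "0 = cl (\<lambda>x. 0)"
definition "f + g = cl (\<lambda>x. rp f x + rp g x)"
definition "f - g = cl (\<lambda>x. rp f x - rp g x)"
definition "- f = cl (\<lambda>x. - rp f x)"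
definition "r *\<^sub>R f = cl (\<lambda>x. r *\<^sub>R rp f x)"
definition "inner f g = (LINT x|lborel. Re (rp f x * cnj (rp g x)))"
definition "norm (f::l2) = sqrt (inner f f)"
definition "dist f g = norm (f - g :: l2)"
definition "sgn (f::l2) = inverse (norm f) *\<^sub>R f"
definition [code del]: "uniformity = (INF e\<in>{0 <..}. principal {(f, g). dist (f::l2) g < e})"
definition [code del]: "open (U::l2 set) \<longleftrightarrow> (\<forall>x\<in>U. \<forall>\<^sub>F (x', y) in uniformity. x' = x \<longrightarrow> y \<in> U)"

lemma rp_zero: "AE x in lborel. rp 0 x = 0"
  unfolding zero_l2_def by (rule rp_cl) simp
lemma rp_add: "AE x in lborel. rp (f + g) x = rp f x + rp g x"
  unfolding plus_l2_def by (rule rp_cl) (simp add: L2_add)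
lemma rp_diff: "AE x in lborel. rp (f - g) x = rp f x - rp g x"
  unfolding minus_l2_def by (rule rp_cl) (simp add: L2_diff)
lemma rp_minus: "AE x in lborel. rp (- f) x = - rp f x"
  unfolding uminus_l2_def by (rule rp_cl) (simp add: L2_minus)
lemma rp_scaleR: "AE x in lborel. rp (r *\<^sub>R f) x = r *\<^sub>R rp f x"
  unfolding scaleR_l2_def by (rule rp_cl) (simp add: L2_cmult scaleR_conv_of_real)

lemma inner_integrable: "integrable lborel (\<lambda>x. Re (rp f x * cnj (rp g x)))"
  by (intro integrable_Re L2_mult_integrable L2_cnj L2_rp)

lemma inner_l2_same: "inner f f = (LINT x|lborel. (cmod (rp f x))\<^sup>2)"
  unfolding inner_l2_def complex_norm_square[symmetric] by simp

instance
proof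
  fix f g h :: l2 and r s :: real
  show "f + g + h = f + (g + h)"
    by (rule l2_eqI) (use rp_add[of "f+g" h] rp_add[of f g] rp_add[of f "g+h"] rp_add[of g h] in eventually_elim, simp)
  show "f + g = g + f"
    by (rule l2_eqI) (use rp_add[of f g] rp_add[of g f] in eventually_elim, simp)
  show "0 + f = f"
    by (rule l2_eqI) (use rp_add[of 0 f] rp_zero in eventually_elim, simp)
  show "- f + f = 0"
    by (rule l2_eqI) (use rp_add[of "-f" f] rp_minus[of f] rp_zero in eventually_elim, simp)
  show "f - g = f + - g"
    by (rule l2_eqI) (use rp_add[of f "-g"] rp_minus[of g] rp_diff[of f g] in eventually_elim, simp)
  show "r *\<^sub>R (f + g) = r *\<^sub>R f + r *\<^sub>R g"
    by (rule l2_eqI) (use rp_add[of f g] rp_scaleR[of r "f+g"] rp_scaleR[of r f] rp_scaleR[of r g]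
        rp_add[of "r *\<^sub>R f" "r *\<^sub>R g"] in eventually_elim, simp add: algebra_simps)
  show "(r + s) *\<^sub>R f = r *\<^sub>R f + s *\<^sub>R f"
    by (rule l2_eqI) (use rp_scaleR[of "r+s" f] rp_scaleR[of r f] rp_scaleR[of s f]
        rp_add[of "r *\<^sub>R f" "s *\<^sub>R f"] in eventually_elim, simp add: algebra_simps)
  show "r *\<^sub>R (s *\<^sub>R f) = (r * s) *\<^sub>R f"
    by (rule l2_eqI) (use rp_scaleR[of "r * s" f] rp_scaleR[of r "s *\<^sub>R f"] rp_scaleR[of s f]
        in eventually_elim, simp add: algebra_simps)
  show "1 *\<^sub>R f = f"
    by (rule l2_eqI) (use rp_scaleR[of 1 f] in eventually_elim, simp add: algebra_simps)
  show "dist f g = norm (f - g)" by (rule dist_l2_def)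
  show "sgn f = inverse (norm f) *\<^sub>R f" by (rule sgn_l2_def)
  show "uniformity = (INF e\<in>{0 <..}. principal {(f, g::l2). dist f g < e})"
    by (rule uniformity_l2_def)
  show "open U \<longleftrightarrow> (\<forall>x\<in>U. \<forall>\<^sub>F (x', y) in uniformity. x' = x \<longrightarrow> y \<in> U)" for U :: "l2 set"
    by (rule open_l2_def)
  show "inner f g = inner g f"
    unfolding inner_l2_def by (intro Bochner_Integration.integral_cong) (auto simp: algebra_simps)
  show "inner (f + g) h = inner f h + inner g h"
  proof -
    have "inner (f + g) h = (LINT x|lborel. Re (rp f x * cnj (rp h x)) + Re (rp g x * cnj (rp h x)))"
      unfolding inner_l2_def
      by (rule integral_cong_AE) (measurable, use rp_add[of f g] in eventually_elim, simp add: algebra_simps)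
    then show ?thesis
      unfolding inner_l2_def using inner_integrable by (subst (asm) Bochner_Integration.integral_add) auto
  qed
  show "inner (r *\<^sub>R f) g = r * inner f g"
  proof -
    have "inner (r *\<^sub>R f) g = (LINT x|lborel. r * Re (rp f x * cnj (rp g x)))"
      unfolding inner_l2_def
      by (rule integral_cong_AE) (measurable, use rp_scaleR[of r f] in eventually_elim, simp add: algebra_simps)
    then show ?thesis
      unfolding inner_l2_def by simp
  qed
  show "0 \<le> inner f f"
    unfolding inner_l2_same by simp
  show "norm f = sqrt (inner f f)" by (rule norm_l2_def)
  show "inner f f = 0 \<longleftrightarrow> f = 0"
  proof -
    have "inner f f = 0 \<longleftrightarrow> (AE x in lborel. (cmod (rp f x))\<^sup>2 = 0)"
      unfolding inner_l2_same
      by (rule integral_nonneg_eq_0_iff_AE) (auto intro: L2_integrable)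
    also have "\<dots> \<longleftrightarrow> (AE x in lborel. rp f x = rp 0 x)"
    proof (rule AE_cong_simp[THEN trans, of _ _ _ "\<lambda>x. rp f x = 0"])
      show "(AE x in lborel. rp f x = 0) = (AE x in lborel. rp f x = rp 0 x)"
        using rp_zero by (auto elim!: eventually_elim2)
    qed auto
    finally show ?thesis by (simp add: l2_eq_iff)
  qed
qed

end

lemma norm_l2_sq: "(norm (f::l2))\<^sup>2 = (LINT x|lborel. (cmod (rp f x))\<^sup>2)"
  by (simp add: power2_norm_eq_inner inner_l2_same)

lemma nn_integral_rp: "(\<integral>\<^sup>+ x. ennreal ((cmod (rp f x))\<^sup>2) \<partial>lborel) = ennreal ((norm f)\<^sup>2)"
  unfolding norm_l2_sq by (rule nn_integral_eq_integral) (auto intro: L2_integrable)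

lemma norm_cl_sq: "L2 u \<Longrightarrow> (norm (cl u))\<^sup>2 = (LINT x|lborel. (cmod (u x))\<^sup>2)"
  unfolding norm_l2_sq by (rule integral_cong_AE) (auto dest: L2_measurable elim!: eventually_mono dest!: rp_cl)

lemma norm_cl: "L2 u \<Longrightarrow> norm (cl u) = sqrt (LINT x|lborel. (cmod (u x))\<^sup>2)"
  by (simp flip: norm_cl_sq)

lemma nn_integral_L2: "L2 u \<Longrightarrow> (\<integral>\<^sup>+ x. ennreal ((cmod (u x))\<^sup>2) \<partial>lborel) = ennreal ((norm (cl u))\<^sup>2)"
  unfolding norm_cl_sq by (rule nn_integral_eq_integral) (auto intro: L2_integrable)

lemma L2_norm_le:
  assumes "u \<in> borel_measurable borel" "(\<integral>\<^sup>+ x. ennreal ((cmod (u x))\<^sup>2) \<partial>lborel) \<le> ennreal (c\<^sup>2)" "0 \<le> c"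
  shows "L2 u" "norm (cl u) \<le> c"
proof -
  show L: "L2 u" unfolding L2_iff_nn using assms(1,2) by (auto intro: le_less_trans)
  have "ennreal ((norm (cl u))\<^sup>2) \<le> ennreal (c\<^sup>2)" using assms(2) nn_integral_L2[OF L] by simp
  then have "(norm (cl u))\<^sup>2 \<le> c\<^sup>2" by simp
  then show "norm (cl u) \<le> c" by (rule power2_le_imp_le) (fact assms)
qed

lemma cl_add: "L2 u \<Longrightarrow> L2 v \<Longrightarrow> cl (\<lambda>x. u x + v x) = cl u + cl v"
proof (rule cl_eqI[OF L2_add])
  assume "L2 u" "L2 v"
  from rp_cl[OF this(1)] rp_cl[OF this(2)] rp_add[of "cl u" "cl v"]
  show "AE x in lborel. u x + v x = rp (cl u + cl v) x" by eventually_elim simp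
qed

lemma cl_diff: "L2 u \<Longrightarrow> L2 v \<Longrightarrow> cl (\<lambda>x. u x - v x) = cl u - cl v"
proof (rule cl_eqI[OF L2_diff])
  assume "L2 u" "L2 v"
  from rp_cl[OF this(1)] rp_cl[OF this(2)] rp_diff[of "cl u" "cl v"]
  show "AE x in lborel. u x - v x = rp (cl u - cl v) x" by eventually_elim simp
qed

section \<open>Completeness\<close>

lemma ennreal_finiteE:
  assumes "(x::ennreal) \<noteq> \<infinity>" obtains K where "x = ennreal K" "0 \<le> K"
  using assms by (cases x) auto

text \<open>Riesz-Fischer. A rapidly convergent subsequence converges almost everywhere; Fatou's
  lemma along it, with the index of the full sequence held fixed, shows that the pointwise limit is
  also the limit in norm.\<close>

instance l2 :: banach
proof
  fix X :: "nat \<Rightarrow> l2" assume C: "Cauchy X"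
  have "\<exists>r::nat\<Rightarrow>nat. strict_mono r \<and> (\<forall>n. norm (X (r (Suc n)) - X (r n)) < (1/2)^n)"
  proof -
    have "\<forall>n. \<exists>N. \<forall>a\<ge>N. \<forall>b\<ge>N. norm (X a - X b) < (1/2)^n"
      using C unfolding Cauchy_iff by (auto simp: zero_less_power)
    then obtain N where N: "\<And>n a b. a \<ge> N n \<Longrightarrow> b \<ge> N n \<Longrightarrow> norm (X a - X b) < (1/2)^n" by metis
    have "\<exists>r. \<forall>n. r n \<ge> N n \<and> r n < r (Suc n)"
    proof (rule dependent_nat_choice)
      show "\<exists>x. N 0 \<le> x" by auto
      show "\<exists>y. N (Suc n) \<le> y \<and> x < y" if "N n \<le> x" for x n
        by (rule exI[of _ "max (N (Suc n)) (Suc x)"]) auto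
    qed
    then obtain r where r: "\<And>n. N n \<le> r n" "\<And>n. r n < r (Suc n)" by auto
    have "norm (X (r (Suc n)) - X (r n)) < (1/2)^n" for n
      by (rule N) (use r[of n] in auto)
    then show ?thesis using r(2) by (auto simp: strict_mono_Suc_iff)
  qed
  then obtain r :: "nat \<Rightarrow> nat" where r: "strict_mono r" "\<And>n. norm (X (r (Suc n)) - X (r n)) < (1/2)^n" by blast
  define d where "d n x = cmod (rp (X (r (Suc n))) x - rp (X (r n)) x)" for n x
  have [measurable]: "d n \<in> borel_measurable borel" for n unfolding d_def by measurable
  have nn_diff: "(\<integral>\<^sup>+ x. ennreal ((cmod (rp f x - rp g x))\<^sup>2) \<partial>lborel) = ennreal ((norm (f - g))\<^sup>2)" for f g
    unfolding nn_integral_rp[symmetric]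
    by (rule nn_integral_cong_AE) (use rp_diff[of f g] in eventually_elim, simp)
  \<comment> \<open>The weight \<open>2^n\<close> is affordable since the squared norms are below
    \<open>4^(-n)\<close>. Finiteness of the weighted sum bounds \<open>d n x\<close> by a constant
    times \<open>2^(-n/2)\<close>, so the telescoping series converges absolutely, and Minkowski's
    inequality for infinite sums is avoided.\<close>
  have "(\<integral>\<^sup>+ x. (\<Sum>n. ennreal (2^n * (d n x)\<^sup>2)) \<partial>lborel) = (\<Sum>n. \<integral>\<^sup>+ x. ennreal (2^n * (d n x)\<^sup>2) \<partial>lborel)"
    by (rule nn_integral_suminf) measurable
  also have "\<dots> \<le> (\<Sum>n. ennreal ((1/2)^n))"
  proof (rule suminf_le)
    fix n
    have "(\<integral>\<^sup>+ x. ennreal (2^n * (d n x)\<^sup>2) \<partial>lborel) = ennreal (2^n) * ennreal ((norm (X (r (Suc n)) - X (r n)))\<^sup>2)"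
      unfolding nn_diff[symmetric] d_def by (subst nn_integral_cmult[symmetric]) (auto simp: ennreal_mult')
    also have "\<dots> \<le> ennreal (2^n) * ennreal (((1/2)^n)\<^sup>2)"
      by (intro mult_left_mono ennreal_leI power_mono) (use r(2)[of n] in auto)
    also have "\<dots> = ennreal ((1/2)^n)"
      by (subst ennreal_mult'[symmetric]) (auto simp: power2_eq_square power_divide field_simps)
    finally show "(\<integral>\<^sup>+ x. ennreal (2^n * (d n x)\<^sup>2) \<partial>lborel) \<le> ennreal ((1/2)^n)" .
  qed auto
  also have "\<dots> < \<infinity>"
    by (subst suminf_ennreal2) (auto intro!: summable_geometric)
  finally have fin: "AE x in lborel. (\<Sum>n. ennreal (2^n * (d n x)\<^sup>2)) \<noteq> \<infinity>"
    by (intro nn_integral_noteq_infinite) auto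
  have conv: "AE x in lborel. convergent (\<lambda>n. rp (X (r n)) x)"
    using fin
  proof eventually_elim
    fix x assume fx: "(\<Sum>n. ennreal (2^n * (d n x)\<^sup>2)) \<noteq> \<infinity>"
    obtain K where K: "(\<Sum>n. ennreal (2^n * (d n x)\<^sup>2)) = ennreal K" "0 \<le> K"
      by (rule ennreal_finiteE[OF fx])
    have b: "d n x \<le> sqrt K * (sqrt (1/2))^n" for n
    proof -
      have "ennreal (2^n * (d n x)\<^sup>2) \<le> ennreal K"
        unfolding K(1)[symmetric]
        by (rule order_trans[OF _ sum_le_suminf[of _ "{n}"]]) (auto intro: summableI)
      then have "2^n * (d n x)\<^sup>2 \<le> K" using K(2) by (simp add: ennreal_le_iff)
      then have "(d n x)\<^sup>2 \<le> K * (1/2)^n" by (simp add: power_one_over divide_simps mult.commute)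
      then have "sqrt ((d n x)\<^sup>2) \<le> sqrt (K * (1/2)^n)" by (rule real_sqrt_le_mono)
      then show ?thesis by (simp add: d_def real_sqrt_mult real_sqrt_power)
    qed
    have s: "summable (\<lambda>n. sqrt K * (sqrt (1/2))^n)"
      by (intro summable_mult summable_geometric) (simp add: real_sqrt_divide)
    have "summable (\<lambda>n. rp (X (r (Suc n))) x - rp (X (r n)) x)"
      by (rule summable_comparison_test'[OF s, of 0]) (rule b[unfolded d_def])
    then have "convergent (\<lambda>N. \<Sum>n<N. rp (X (r (Suc n))) x - rp (X (r n)) x)"
      by (simp add: summable_iff_convergent)
    then have "convergent (\<lambda>N. rp (X (r N)) x - rp (X (r 0)) x)"
      unfolding sum_lessThan_telescope[of "\<lambda>n. rp (X (r n)) x"] .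
    then show "convergent (\<lambda>n. rp (X (r n)) x)"
      by (simp add: convergent_diff_const_right_iff)
  qed
  define g where "g x = lim (\<lambda>n. rp (X (r n)) x)" for x
  have gm [measurable]: "g \<in> borel_measurable borel"
    unfolding g_def by measurable
  have key: "(\<integral>\<^sup>+ x. ennreal ((cmod (rp (X n) x - g x))\<^sup>2) \<partial>lborel) \<le> ennreal (e\<^sup>2)"
    if N: "\<And>a b. a \<ge> N \<Longrightarrow> b \<ge> N \<Longrightarrow> norm (X a - X b) < e" "n \<ge> N" for N n e
  proof -
    have "(\<integral>\<^sup>+ x. ennreal ((cmod (rp (X n) x - g x))\<^sup>2) \<partial>lborel)
        = (\<integral>\<^sup>+ x. liminf (\<lambda>m. ennreal ((cmod (rp (X n) x - rp (X (r m)) x))\<^sup>2)) \<partial>lborel)"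
    proof (rule nn_integral_cong_AE, use conv in eventually_elim)
      fix x assume "convergent (\<lambda>n. rp (X (r n)) x)"
      then have "(\<lambda>n. rp (X (r n)) x) \<longlonglongrightarrow> g x" by (simp add: g_def convergent_LIMSEQ_iff)
      then have "(\<lambda>m. ennreal ((cmod (rp (X n) x - rp (X (r m)) x))\<^sup>2)) \<longlonglongrightarrow> ennreal ((cmod (rp (X n) x - g x))\<^sup>2)"
        by (intro tendsto_intros)
      then show "ennreal ((cmod (rp (X n) x - g x))\<^sup>2) = liminf (\<lambda>m. ennreal ((cmod (rp (X n) x - rp (X (r m)) x))\<^sup>2))"
        by (rule lim_imp_Liminf[OF trivial_limit_sequentially, symmetric])
    qed
    also have "\<dots> \<le> liminf (\<lambda>m. \<integral>\<^sup>+ x. ennreal ((cmod (rp (X n) x - rp (X (r m)) x))\<^sup>2) \<partial>lborel)"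
      by (rule nn_integral_liminf) measurable
    also have "\<dots> \<le> liminf (\<lambda>m::nat. ennreal (e\<^sup>2))"
    proof (rule Liminf_mono, rule eventually_sequentiallyI[of N])
      fix m assume "N \<le> m"
      then have "N \<le> r m" using seq_suble[OF r(1), of m] by linarith
      then show "(\<integral>\<^sup>+ x. ennreal ((cmod (rp (X n) x - rp (X (r m)) x))\<^sup>2) \<partial>lborel) \<le> ennreal (e\<^sup>2)"
        unfolding nn_diff using N(1)[of n "r m"] N(2) by (intro ennreal_leI power_mono) auto
    qed
    also have "\<dots> = ennreal (e\<^sup>2)" by (simp add: Liminf_const)
    finally show ?thesis .
  qed
  have L: "L2 g"
  proof -
    obtain N where "\<And>a b. a \<ge> N \<Longrightarrow> b \<ge> N \<Longrightarrow> norm (X a - X b) < 1"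
      using C unfolding Cauchy_iff by (metis zero_less_one)
    from key[OF this, of N] have "L2 (\<lambda>x. rp (X N) x - g x)" by (intro L2_norm_le(1)[where c=1]) auto
    from L2_diff[OF L2_rp[of "X N"] this] show ?thesis by simp
  qed
  have "X \<longlonglongrightarrow> cl g"
  proof (rule LIMSEQ_I)
    fix e :: real assume e: "0 < e"
    then obtain N where N: "\<And>a b. a \<ge> N \<Longrightarrow> b \<ge> N \<Longrightarrow> norm (X a - X b) < e/2"
      using C unfolding Cauchy_iff by (metis half_gt_zero)
    have "norm (X n - cl g) < e" if "n \<ge> N" for n
    proof -
      have "norm (cl (\<lambda>x. rp (X n) x - g x)) \<le> e/2"
        by (rule L2_norm_le) (use key[OF N that] e in auto)
      then show ?thesis using e L by (simp add: cl_diff)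
    qed
    then show "\<exists>N. \<forall>n\<ge>N. norm (X n - cl g) < e" by blast
  qed
  then show "convergent X" by (rule convergentI)
qed

section \<open>Bounded multiplication operators\<close>

definition bmult :: "(real^3 \<Rightarrow> complex) \<Rightarrow> bool" where
  "bmult m \<longleftrightarrow> m \<in> borel_measurable borel \<and> (\<exists>C. \<forall>x. cmod (m x) \<le> C)"

definition mlt :: "(real^3 \<Rightarrow> complex) \<Rightarrow> l2 \<Rightarrow> l2" where
  "mlt m f = cl (\<lambda>x. m x * rp f x)"

lemma bmultI: "m \<in> borel_measurable borel \<Longrightarrow> (\<And>x. cmod (m x) \<le> C) \<Longrightarrow> bmult m"
  by (auto simp: bmult_def)

lemma bmult_measurable [measurable_dest]: "bmult m \<Longrightarrow> m \<in> borel_measurable borel"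
  by (simp add: bmult_def)

lemma bmult_const [simp]: "bmult (\<lambda>x. c)"
  by (rule bmultI[of _ "cmod c"]) auto

lemma bmult_mult [intro]:
  assumes "bmult m" "bmult n" shows "bmult (\<lambda>x. m x * n x)"
proof -
  obtain C D where C: "\<And>x. cmod (m x) \<le> C" and D: "\<And>x. cmod (n x) \<le> D"
    using assms unfolding bmult_def by auto
  show ?thesis
  proof (rule bmultI)
    show "cmod (m x * n x) \<le> C * D" for x
      unfolding norm_mult by (rule mult_mono[OF C D]) (use C[of x] order_trans[OF norm_ge_zero C[of x]] in auto)
  qed (use assms in measurable)
qed

lemma L2_mult_bmult: "bmult m \<Longrightarrow> L2 u \<Longrightarrow> L2 (\<lambda>x. m x * u x)"
  unfolding bmult_def using L2_mult_bounded by blast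

lemma rp_mlt: "bmult m \<Longrightarrow> AE x in lborel. rp (mlt m f) x = m x * rp f x"
  unfolding mlt_def by (rule rp_cl) (rule L2_mult_bmult, auto)

lemma mlt_cl:
  assumes "bmult m" "L2 u" shows "mlt m (cl u) = cl (\<lambda>x. m x * u x)"
  unfolding mlt_def
  by (rule cl_cong) (use rp_cl[OF assms(2)] assms in \<open>auto intro: L2_mult_bmult\<close>)

lemma mlt_add:
  assumes "bmult m" shows "mlt m (f + g) = mlt m f + mlt m g"
  by (rule l2_eqI) (use rp_mlt[OF assms, of "f+g"] rp_mlt[OF assms, of f] rp_mlt[OF assms, of g]
      rp_add[of f g] rp_add[of "mlt m f" "mlt m g"] in eventually_elim, simp add: algebra_simps)

lemma mlt_scaleR:
  assumes "bmult m" shows "mlt m (r *\<^sub>R f) = r *\<^sub>R mlt m f"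
  by (rule l2_eqI) (use rp_mlt[OF assms, of "r *\<^sub>R f"] rp_mlt[OF assms, of f]
      rp_scaleR[of r f] rp_scaleR[of r "mlt m f"] in eventually_elim, simp add: algebra_simps)

lemma mlt_diff:
  assumes "bmult m" shows "mlt m (f - g) = mlt m f - mlt m g"
  using mlt_add[OF assms, of f "(-1) *\<^sub>R g"] mlt_scaleR[OF assms, of "-1" g] by simp

lemma mlt_mlt:
  assumes "bmult m" "bmult n" shows "mlt m (mlt n f) = mlt (\<lambda>x. m x * n x) f"
  by (rule l2_eqI) (use rp_mlt[OF assms(1), of "mlt n f"] rp_mlt[OF assms(2), of f]
      rp_mlt[OF bmult_mult[OF assms], of f] in eventually_elim, simp add: algebra_simps)

lemma mlt_add_left:
  assumes "bmult m" "bmult n" shows "mlt (\<lambda>x. m x + n x) f = mlt m f + mlt n f"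
  unfolding mlt_def[of "\<lambda>x. m x + n x"]
proof (rule cl_eqI)
  show "L2 (\<lambda>x. (m x + n x) * rp f x)"
    using L2_add[OF L2_mult_bmult[OF assms(1), of "rp f"] L2_mult_bmult[OF assms(2), of "rp f"]]
    by (simp add: algebra_simps)
  show "AE x in lborel. (m x + n x) * rp f x = rp (mlt m f + mlt n f) x"
    using rp_mlt[OF assms(1), of f] rp_mlt[OF assms(2), of f] rp_add[of "mlt m f" "mlt n f"]
    by eventually_elim (simp add: algebra_simps)
qed

lemma mlt_real: "mlt (\<lambda>x. complex_of_real r) f = r *\<^sub>R f"
  by (rule l2_eqI) (use rp_mlt[OF bmult_const, of "complex_of_real r" f] rp_scaleR[of r f]
      in eventually_elim, simp add: scaleR_conv_of_real)

lemma mlt_one [simp]: "mlt (\<lambda>x. 1) f = f"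
  using mlt_real[of 1 f] by simp

lemma norm_mlt_sq:
  assumes "bmult m" shows "(norm (mlt m f))\<^sup>2 = (LINT x|lborel. (cmod (m x))\<^sup>2 * (cmod (rp f x))\<^sup>2)"
  unfolding mlt_def using assms
  by (subst norm_cl_sq) (auto intro: L2_mult_bmult simp: norm_mult power_mult_distrib)

lemma norm_mlt_le:
  assumes "m \<in> borel_measurable borel" "\<And>x. cmod (m x) \<le> C"
  shows "norm (mlt m f) \<le> C * norm f"
proof -
  have C: "0 \<le> C" using order_trans[OF norm_ge_zero assms(2)[of 0]] .
  have "(norm (mlt m f))\<^sup>2 \<le> (LINT x|lborel. C\<^sup>2 * (cmod (rp f x))\<^sup>2)"
    unfolding norm_mlt_sq[OF bmultI[OF assms]]
  proof (rule integral_mono)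
    show "integrable lborel (\<lambda>x. (cmod (m x))\<^sup>2 * (cmod (rp f x))\<^sup>2)"
      using L2_integrable[OF L2_mult_bmult[OF bmultI[OF assms] L2_rp, of f]]
      by (simp add: norm_mult power_mult_distrib)
    show "integrable lborel (\<lambda>x. C\<^sup>2 * (cmod (rp f x))\<^sup>2)"
      using L2_integrable[OF L2_rp, of f] by simp
    show "(cmod (m x))\<^sup>2 * (cmod (rp f x))\<^sup>2 \<le> C\<^sup>2 * (cmod (rp f x))\<^sup>2" for x
      by (intro mult_right_mono power_mono assms) auto
  qed
  also have "\<dots> = (C * norm f)\<^sup>2" by (simp add: norm_l2_sq power_mult_distrib)
  finally show ?thesis by (rule power2_le_imp_le) (use C in simp)
qed

lemma bmult_unimod: "m \<in> borel_measurable borel \<Longrightarrow> (\<And>x. cmod (m x) = 1) \<Longrightarrow> bmult m"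
  by (rule bmultI[of _ 1]) auto

lemma norm_mlt_unimod:
  assumes "m \<in> borel_measurable borel" "\<And>x. cmod (m x) = 1"
  shows "norm (mlt m f) = norm f"
proof -
  have "(norm (mlt m f))\<^sup>2 = (norm f)\<^sup>2"
    unfolding norm_mlt_sq[OF bmult_unimod[OF assms]] norm_l2_sq[of f] by (simp add: assms)
  then show ?thesis by (simp add: power2_eq_iff_nonneg)
qed

lemma bounded_linear_mlt:
  assumes "bmult m" shows "bounded_linear (mlt m)"
proof -
  obtain C where "\<And>x. cmod (m x) \<le> C" using assms by (auto simp: bmult_def)
  then show ?thesis
    using assms by (intro bounded_linear_intro[where K=C])
      (auto simp: mlt_add mlt_scaleR mult.commute[of _ C] intro!: norm_mlt_le)
qed

text \<open>Vanishing nowhere is enough: there is no lower bound on \<open>m\<close>, hence in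
  general no bounded inverse. Equations may thus be checked after applying a smoothing
  multiplier.\<close>

lemma mlt_inj:
  assumes "bmult m" "\<And>x. m x \<noteq> 0" "mlt m f = mlt m g" shows "f = g"
  by (rule l2_eqI) (use rp_mlt[OF assms(1), of f] rp_mlt[OF assms(1), of g] assms(2,3) in \<open>auto elim!: eventually_elim2\<close>)

text \<open>Pointwise convergence with a common bound gives strong convergence, by dominated
  convergence of the squared difference. Spatial cutoffs, continuity of the propagator and its
  difference quotients are all instances.\<close>

lemma mlt_tendsto:
  assumes "\<And>n::nat. m n \<in> borel_measurable borel" "\<And>n x. cmod (m n x) \<le> C"
    "\<And>x. (\<lambda>n. m n x) \<longlonglongrightarrow> m0 x"
  shows "(\<lambda>n. mlt (m n) f) \<longlonglongrightarrow> mlt m0 f"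
proof -
  note [measurable] = assms(1)
  have [measurable]: "m0 \<in> borel_measurable borel"
    by (rule borel_measurable_LIMSEQ_metric[OF assms(1,3)])
  have C0: "cmod (m0 x) \<le> C" for x
    by (rule LIMSEQ_le_const2[OF tendsto_norm[OF assms(3)]]) (use assms(2) in auto)
  have b: "bmult (m n)" "bmult m0" for n
    by (rule bmultI[OF assms(1,2)]) (rule bmultI[OF _ C0], measurable)
  have bd: "bmult (\<lambda>x. m n x - m0 x)" for n
    by (rule bmultI[where C="C + C"], measurable) (use norm_triangle_ineq4 add_mono[OF assms(2) C0] order_trans in blast)
  have eq: "mlt (m n) f - mlt m0 f = mlt (\<lambda>x. m n x - m0 x) f" for n
    by (rule l2_eqI) (use rp_mlt[OF b(1), of n f] rp_mlt[OF b(2), of f] rp_mlt[OF bd, of n f]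
        rp_diff[of "mlt (m n) f" "mlt m0 f"] in eventually_elim, simp add: left_diff_distrib)
  have "(\<lambda>n. (norm (mlt (m n) f - mlt m0 f))\<^sup>2) \<longlonglongrightarrow> (LINT x|(lborel::(real^3) measure). 0)"
    unfolding eq norm_mlt_sq[OF bd]
  proof (rule integral_dominated_convergence[where w="\<lambda>x. (C+C)\<^sup>2 * (cmod (rp f x))\<^sup>2"])
    show "integrable lborel (\<lambda>x. (C + C)\<^sup>2 * (cmod (rp f x))\<^sup>2)"
      using L2_integrable[OF L2_rp, of f] by simp
    show "AE x in lborel. (\<lambda>n. (cmod (m n x - m0 x))\<^sup>2 * (cmod (rp f x))\<^sup>2) \<longlonglongrightarrow> 0"
    proof (rule AE_I2)
      fix x
      have "(\<lambda>n. (cmod (m n x - m0 x))\<^sup>2 * (cmod (rp f x))\<^sup>2) \<longlonglongrightarrow> (cmod (m0 x - m0 x))\<^sup>2 * (cmod (rp f x))\<^sup>2"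
        by (intro tendsto_intros assms)
      then show "(\<lambda>n. (cmod (m n x - m0 x))\<^sup>2 * (cmod (rp f x))\<^sup>2) \<longlonglongrightarrow> 0" by simp
    qed
    show "AE x in lborel. norm ((cmod (m n x - m0 x))\<^sup>2 * (cmod (rp f x))\<^sup>2) \<le> (C + C)\<^sup>2 * (cmod (rp f x))\<^sup>2" for n
    proof (rule AE_I2)
      fix x
      have "cmod (m n x - m0 x) \<le> C + C"
        using norm_triangle_ineq4[of "m n x" "m0 x"] assms(2)[of n x] C0[of x] by linarith
      then show "norm ((cmod (m n x - m0 x))\<^sup>2 * (cmod (rp f x))\<^sup>2) \<le> (C + C)\<^sup>2 * (cmod (rp f x))\<^sup>2"
        using power_mono[of "cmod (m n x - m0 x)" "C + C" 2] by (auto intro!: mult_right_mono simp del: mult_2)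
    qed
  qed measurable
  then have "(\<lambda>n. sqrt ((norm (mlt (m n) f - mlt m0 f))\<^sup>2)) \<longlonglongrightarrow> sqrt 0"
    by (intro tendsto_real_sqrt) simp
  then have "(\<lambda>n. mlt (m n) f - mlt m0 f) \<longlonglongrightarrow> 0" by (simp add: tendsto_norm_zero_iff)
  then show ?thesis by (simp add: LIM_zero_iff)
qed

section \<open>Conjugation and the complex pairing\<close>

definition cnjl :: "l2 \<Rightarrow> l2" where "cnjl f = cl (\<lambda>x. cnj (rp f x))"

lemma rp_cnjl: "AE x in lborel. rp (cnjl f) x = cnj (rp f x)"
  unfolding cnjl_def by (rule rp_cl) (simp add: L2_cnj)

lemma cnjl_cl: "L2 u \<Longrightarrow> cnjl (cl u) = cl (\<lambda>x. cnj (u x))"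
  unfolding cnjl_def by (rule cl_cong) (use rp_cl[of u] in \<open>auto intro: L2_cnj\<close>)

lemma cnjl_add: "cnjl (f + g) = cnjl f + cnjl g"
  by (rule l2_eqI) (use rp_cnjl[of f] rp_cnjl[of g] rp_cnjl[of "f+g"] rp_add[of f g] rp_add[of "cnjl f" "cnjl g"]
      in eventually_elim, simp)

lemma cnjl_scaleR: "cnjl (r *\<^sub>R f) = r *\<^sub>R cnjl f"
  by (rule l2_eqI) (use rp_cnjl[of f] rp_cnjl[of "r *\<^sub>R f"] rp_scaleR[of r f] rp_scaleR[of r "cnjl f"]
      in eventually_elim, simp)

lemma norm_cnjl [simp]: "norm (cnjl f) = norm f"
proof -
  have "(norm (cnjl f))\<^sup>2 = (norm f)\<^sup>2"
    unfolding cnjl_def norm_cl_sq[OF L2_cnj[OF L2_rp]] norm_l2_sq[of f] by simp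
  then show ?thesis by (simp add: power2_eq_iff_nonneg)
qed

lemma inner_cl:
  assumes "L2 u" "L2 v" shows "inner (cl u) (cl v) = Re (LINT x|lborel. u x * cnj (v x))"
proof -
  have "inner (cl u) (cl v) = (LINT x|lborel. Re (u x * cnj (v x)))"
    unfolding inner_l2_def
  proof (rule integral_cong_AE)
    show "AE x in lborel. Re (rp (cl u) x * cnj (rp (cl v) x)) = Re (u x * cnj (v x))"
      using rp_cl[OF assms(1)] rp_cl[OF assms(2)] by eventually_elim simp
  qed (use assms in measurable)
  also have "\<dots> = Re (LINT x|lborel. u x * cnj (v x))"
    by (intro integral_Re L2_mult_integrable L2_cnj assms)
  finally show ?thesis .
qed

text \<open>\<open>Im z = Re (- \<i> * z)\<close> turns the imaginary part into a real inner product
  with \<open>\<i> * v\<close>. A real isometry that commutes with \<i> therefore preserves the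
  complex pairing too.\<close>

lemma integral_mult_cnj:
  assumes "L2 u" "L2 v"
  shows "(LINT x|lborel. u x * cnj (v x)) = Complex (inner (cl u) (cl v)) (inner (cl u) (mlt (\<lambda>_. \<i>) (cl v)))"
proof -
  have "Im (LINT x|lborel. u x * cnj (v x)) = Re (LINT x|lborel. u x * cnj (\<i> * v x))"
  proof -
    have "(LINT x|lborel. u x * cnj (\<i> * v x)) = (LINT x|lborel. (- \<i>) * (u x * cnj (v x)))"
      by (simp add: algebra_simps)
    also have "\<dots> = (- \<i>) * (LINT x|lborel. u x * cnj (v x))"
      by (rule integral_mult_right_zero)
    finally show ?thesis by simp
  qed
  then show ?thesis
    using assms by (auto simp: complex_eq_iff inner_cl mlt_cl L2_cmult)
qed

section \<open>Density of bounded continuous integrable functions\<close>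

lemma L2_bounded_support:
  assumes "u \<in> borel_measurable borel" "\<And>x. cmod (u x) \<le> B" "\<And>x. x \<notin> cball 0 R \<Longrightarrow> u x = 0"
  shows "L2 u" "integrable lborel u"
proof -
  have B: "0 \<le> B" using order_trans[OF norm_ge_zero assms(2)[of 0]] .
  have i: "integrable lborel (indicator (cball (0::real^3) R) :: _ \<Rightarrow> real)"
    by (intro integrable_real_indicator emeasure_bounded_finite) auto
  show "integrable lborel u"
  proof (rule Bochner_Integration.integrable_bound[of _ "\<lambda>x. B * indicator (cball (0::real^3) R) x"])
    show "AE x in lborel. norm (u x) \<le> norm (B * indicator (cball 0 R) x :: real)"
      using assms(2,3) B by (intro AE_I2) (auto simp: indicator_def)
    show "integrable lborel (\<lambda>x. B * indicator (cball (0::real^3) R) x)"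
      using i by (rule integrable_mult_right)
  qed (use assms in auto)
  have "integrable lborel (\<lambda>x. (cmod (u x))\<^sup>2)"
  proof (rule Bochner_Integration.integrable_bound[of _ "\<lambda>x. B\<^sup>2 * indicator (cball (0::real^3) R) x"])
    show "AE x in lborel. norm ((cmod (u x))\<^sup>2) \<le> norm (B\<^sup>2 * indicator (cball 0 R) x :: real)"
      using assms(2,3) by (intro AE_I2) (auto simp: indicator_def intro!: power_mono)
  qed (use assms i B in \<open>auto\<close>)
  then show "L2 u" using assms by (simp add: L2_def)
qed

text \<open>The isometry of the Fourier transform is first proved on this class and spread from it
  to all of L2. Lebesgue measurability supplies continuous functions converging almost everywhere;
  they are made to share one bound and one bounded support, so that dominated convergence gives
  convergence in norm.\<close>

lemma continuous_L1_dense: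
  fixes f :: l2
  assumes "0 < e"
  obtains u B where "continuous_on UNIV u" "\<And>x. cmod (u x) \<le> B" "integrable lborel u" "L2 u" "norm (f - cl u) < e"
proof -
  \<comment> \<open>Cutting off in space and in size at once makes \<open>f\<close> bounded with
    bounded support, at a cost below \<open>e/2\<close>.\<close>
  define m where "m n x = (indicator {x. norm x < real n \<and> cmod (rp f x) \<le> real n} x :: complex)" for n :: nat and x
  have [measurable]: "m n \<in> borel_measurable borel" for n unfolding m_def by measurable
  have m1: "cmod (m n x) \<le> 1" for n x by (simp add: m_def indicator_def)
  have bm: "bmult (m n)" for n by (rule bmultI[OF _ m1]) measurable
  have "(\<lambda>n. mlt (m n) f) \<longlonglongrightarrow> mlt (\<lambda>_. 1) f"
  proof (rule mlt_tendsto[OF _ m1])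
    fix x :: "real^3"
    obtain N :: nat where N: "norm x < N" "cmod (rp f x) \<le> N"
      using reals_Archimedean2[of "max (norm x) (cmod (rp f x))"] by auto
    have "eventually (\<lambda>n. m n x = 1) sequentially"
      by (rule eventually_sequentiallyI[of N]) (use N in \<open>auto simp: m_def indicator_def\<close>)
    then show "(\<lambda>n. m n x) \<longlonglongrightarrow> 1" by (rule tendsto_eventually)
  qed measurable
  then have "eventually (\<lambda>n. dist (mlt (m n) f) f < e/2) sequentially"
    using assms by (intro tendstoD) auto
  then obtain n where n: "dist (mlt (m n) f) f < e/2" by (auto simp: eventually_sequentially)
  define v where "v x = m n x * rp f x" for x
  have [measurable]: "v \<in> borel_measurable borel" unfolding v_def by measurable
  have vn: "cmod (v x) \<le> real n" for x by (auto simp: v_def m_def indicator_def)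
  have v0: "norm x \<ge> real n \<Longrightarrow> v x = 0" for x by (auto simp: v_def m_def indicator_def)
  have Lv: "L2 v" by (rule L2_bounded_support(1)[OF _ vn, where R="real n"]) (auto intro: v0)
  have "v \<in> borel_measurable lebesgue" by (rule measurable_completion) simp
  then have "v measurable_on UNIV" by (rule lebesgue_measurable_imp_measurable_on) auto
  then obtain N g where N: "negligible N" and g: "\<And>k. continuous_on UNIV (g k)"
      "\<And>x. x \<notin> N \<Longrightarrow> (\<lambda>k. g k x) \<longlonglongrightarrow> v x"
    unfolding measurable_on_def by auto
  have "AE x in lebesgue. x \<notin> N"
    using N by (auto simp: negligible_iff_null_sets intro: AE_not_in)
  then have AEg: "AE x in lborel. (\<lambda>k. g k x) \<longlonglongrightarrow> v x"
    unfolding AE_completion_iff using g(2) by (auto elim: eventually_mono)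
  \<comment> \<open>\<open>chi\<close> is 1 on the ball of radius \<open>n\<close>, outside of which
    \<open>v\<close> vanishes, and 0 beyond \<open>n + 1\<close>. Projection onto the disc of radius
    \<open>n\<close> is continuous, fixes the values of \<open>v\<close> and bounds the
    approximants.\<close>
  define chi where "chi x = max 0 (min 1 (real n + 1 - norm x))" for x :: "real^3"
  define h where "h k x = chi x *\<^sub>R closest_point (cball 0 (real n)) (g k x)" for k x
  have conth: "continuous_on UNIV (h k)" for k
    unfolding h_def chi_def
    by (intro continuous_intros continuous_on_compose2[OF continuous_on_closest_point[where t=UNIV] g(1)]) auto
  have cp: "cmod (closest_point (cball 0 (real n)) y) \<le> real n" for y
    using closest_point_in_set[of "cball 0 (real n)" y] by simp
  have chi01: "0 \<le> chi x" "chi x \<le> 1" for x by (auto simp: chi_def)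
  have hb: "cmod (h k x) \<le> real n" for k x
    unfolding h_def norm_scaleR
    using mult_mono[OF chi01(2)[of x] cp[of "g k x"]] chi01[of x] by auto
  have h0: "x \<notin> cball 0 (real n + 1) \<Longrightarrow> h k x = 0" for k x by (auto simp: h_def chi_def)
  have hm [measurable]: "h k \<in> borel_measurable borel" for k
    using conth by (rule borel_measurable_continuous_onI)
  have Lh: "L2 (h k)" "integrable lborel (h k)" for k
    using L2_bounded_support[OF hm hb h0] by auto
  have "(\<lambda>k. LINT x|lborel. (cmod (v x - h k x))\<^sup>2) \<longlonglongrightarrow> (LINT x|(lborel::(real^3) measure). 0)"
  proof (rule integral_dominated_convergence[where w="\<lambda>x. (2 * real n)\<^sup>2 * indicator (cball 0 (real n + 1)) x"])
    show "integrable lborel (\<lambda>x. (2 * real n)\<^sup>2 * indicator (cball (0::real^3) (real n + 1)) x :: real)"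
      by (intro integrable_mult_right integrable_real_indicator emeasure_bounded_finite) auto
    show "AE x in lborel. (\<lambda>k. (cmod (v x - h k x))\<^sup>2) \<longlonglongrightarrow> 0"
      using AEg
    proof eventually_elim
      fix x assume "(\<lambda>k. g k x) \<longlonglongrightarrow> v x"
      moreover have "continuous_on UNIV (closest_point (cball (0::complex) (real n)))"
        by (rule continuous_on_closest_point) auto
      ultimately have "(\<lambda>k. closest_point (cball 0 (real n)) (g k x)) \<longlonglongrightarrow> closest_point (cball 0 (real n)) (v x)"
        by (auto simp: continuous_on_def intro: tendsto_compose[where g="closest_point (cball 0 (real n))"])
      moreover have "closest_point (cball 0 (real n)) (v x) = v x"
        by (rule closest_point_self) (simp add: vn)
      ultimately have "(\<lambda>k. h k x) \<longlonglongrightarrow> chi x *\<^sub>R v x"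
        unfolding h_def by (intro tendsto_intros) simp
      moreover have "chi x *\<^sub>R v x = v x"
        by (cases "norm x < real n") (auto simp: v0 chi_def)
      ultimately have "(\<lambda>k. (cmod (v x - h k x))\<^sup>2) \<longlonglongrightarrow> (cmod (v x - v x))\<^sup>2"
        by (intro tendsto_intros) simp
      then show "(\<lambda>k. (cmod (v x - h k x))\<^sup>2) \<longlonglongrightarrow> 0" by simp
    qed
    show "AE x in lborel. norm ((cmod (v x - h k x))\<^sup>2) \<le> (2 * real n)\<^sup>2 * indicator (cball 0 (real n + 1)) x" for k
    proof (rule AE_I2)
      fix x
      have "cmod (v x - h k x) \<le> 2 * real n"
        using norm_triangle_ineq4[of "v x" "h k x"] vn[of x] hb[of k x] by linarith
      then show "norm ((cmod (v x - h k x))\<^sup>2) \<le> (2 * real n)\<^sup>2 * indicator (cball 0 (real n + 1)) x"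
        using v0[of x] h0[of x k] power_mono[of "cmod (v x - h k x)" "2 * real n" 2] by (auto simp: indicator_def)
    qed
  qed measurable
  then have "eventually (\<lambda>k. dist (LINT x|lborel. (cmod (v x - h k x))\<^sup>2) 0 < (e/2)\<^sup>2) sequentially"
    using assms by (intro tendstoD) auto
  then obtain k where k: "(LINT x|lborel. (cmod (v x - h k x))\<^sup>2) < (e/2)\<^sup>2"
    by (auto simp: eventually_sequentially dist_real_def)
  have "(norm (cl v - cl (h k)))\<^sup>2 < (e/2)\<^sup>2"
    using k Lv Lh(1)[of k] by (simp add: norm_cl_sq L2_diff flip: cl_diff)
  then have "norm (cl v - cl (h k)) < e/2" by (rule power2_less_imp_less) (use assms in simp)
  moreover have "mlt (m n) f = cl v" by (simp add: mlt_def v_def[abs_def])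
  ultimately have "norm (f - cl (h k)) < e"
    using n norm_triangle_ineq[of "f - cl v" "cl v - cl (h k)"] by (simp add: dist_norm norm_minus_commute)
  then show ?thesis using that[of "h k" "real n"] conth hb Lh by blast
qed

section \<open>Ordinary differential equations with locally Lipschitz right-hand side\<close>

text \<open>The integral form asks only for continuity, also at the initial time. The end time is an
  \<open>ereal\<close>, so that global solutions are no separate notion; for
  \<open>T \<le> 0\<close> the condition is void.\<close>

definition ode_sol :: "(real \<Rightarrow> 'a::banach \<Rightarrow> 'a) \<Rightarrow> 'a \<Rightarrow> ereal \<Rightarrow> (real \<Rightarrow> 'a) \<Rightarrow> bool" where
  "ode_sol F x0 T x \<longleftrightarrow> continuous_on {t. 0 \<le> t \<and> ereal t < T} x \<and>
     (\<forall>t. 0 \<le> t \<and> ereal t < T \<longrightarrow> x t = x0 + integral {0..t} (\<lambda>s. F s (x s)))"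

text \<open>The Lipschitz bound, uniform in time, controls the change of \<open>z\<close>, so that
  continuity in time is needed only at a fixed vector. This matters because the propagator is
  continuous in time only strongly.\<close>

lemma continuous_on_joint:
  fixes F :: "real \<Rightarrow> 'a::banach \<Rightarrow> 'a"
  assumes cont: "\<And>x. continuous_on UNIV (\<lambda>t. F t x)"
    and lip: "\<And>t x y. x \<in> B \<Longrightarrow> y \<in> B \<Longrightarrow> norm (F t x - F t y) \<le> L * norm (x - y)"
    and z: "continuous_on S z" "\<And>s. s \<in> S \<Longrightarrow> z s \<in> B"
  shows "continuous_on S (\<lambda>s. F s (z s))"
  unfolding continuous_on_def
proof
  fix t assume t: "t \<in> S"
  have "((\<lambda>s. L * norm (z s - z t)) \<longlongrightarrow> L * norm (z t - z t)) (at t within S)"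
    using z(1) t by (intro tendsto_intros) (auto simp: continuous_on_def)
  then have "((\<lambda>s. L * norm (z s - z t)) \<longlongrightarrow> 0) (at t within S)" by simp
  then have "((\<lambda>s. F s (z s) - F s (z t)) \<longlongrightarrow> 0) (at t within S)"
    by (rule Lim_null_comparison[rotated]) (auto simp: eventually_at_filter t intro!: lip z always_eventually)
  moreover have "((\<lambda>s. F s (z t)) \<longlongrightarrow> F t (z t)) (at t within S)"
    using cont[of "z t"] by (meson UNIV_I continuous_on_def subset_UNIV tendsto_within_subset)
  ultimately have "((\<lambda>s. F s (z s) - F s (z t) + F s (z t)) \<longlongrightarrow> 0 + F t (z t)) (at t within S)"
    by (rule tendsto_add)
  then show "((\<lambda>s. F s (z s)) \<longlongrightarrow> F t (z t)) (at t within S)" by simp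
qed

text \<open>The exponential weight turns the Picard operator into a contraction, and gives
  Gronwall's bound with the constant 2.\<close>

lemma gronwall_weighted:
  fixes d :: "real \<Rightarrow> 'a::real_normed_vector"
  assumes cont: "continuous_on {0..T} d" and L: "0 < L" and c: "0 \<le> c"
    and int: "\<And>t. t \<in> {0..T} \<Longrightarrow> norm (d t) \<le> c + L * integral {0..t} (\<lambda>s. norm (d s))"
    and t: "t \<in> {0..T}"
  shows "norm (d t) \<le> 2 * c * exp (2 * L * T)"
proof -
  define w where "w s = exp (- (2 * L * s)) * norm (d s)" for s
  have "continuous_on {0..T} w" unfolding w_def by (intro continuous_intros cont)
  then obtain t0 where t0: "t0 \<in> {0..T}" "\<And>s. s \<in> {0..T} \<Longrightarrow> w s \<le> w t0"
    using continuous_attains_sup[of "{0..T}" w] t by auto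
  have dw: "norm (d s) = exp (2 * L * s) * w s" for s
    by (simp add: w_def exp_minus)
  have "((\<lambda>s. exp (2 * L * s)) has_integral (exp (2 * L * t0) / (2 * L) - exp (2 * L * 0) / (2 * L))) {0..t0}"
    by (rule fundamental_theorem_of_calculus)
       (use t0 L in \<open>auto intro!: derivative_eq_intros simp: has_real_derivative_iff_has_vector_derivative[symmetric]\<close>)
  then have I: "((\<lambda>s. exp (2 * L * s) * w t0) has_integral (exp (2 * L * t0) / (2 * L) - 1 / (2 * L)) * w t0) {0..t0}"
    using has_integral_mult_left[of "\<lambda>s. exp (2 * L * s)" _ "{0..t0}" "w t0"] by simp
  \<comment> \<open>At a maximum point \<open>t0\<close> of the weighted norm, integrating
    \<open>exp (2 * L * s)\<close> produces the factor \<open>1 / (2 * L)\<close>, so the integral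
    term is at most half of \<open>norm (d t0)\<close> and can be absorbed.\<close>
  have "integral {0..t0} (\<lambda>s. norm (d s)) \<le> (exp (2 * L * t0) / (2 * L) - 1 / (2 * L)) * w t0"
  proof (rule has_integral_le[OF integrable_integral I])
    show "(\<lambda>s. norm (d s)) integrable_on {0..t0}"
      by (intro integrable_continuous_interval continuous_intros continuous_on_subset[OF cont]) (use t0 in auto)
    show "norm (d s) \<le> exp (2 * L * s) * w t0" if "s \<in> {0..t0}" for s
      unfolding dw using that t0 by (intro mult_left_mono) auto
  qed
  also have "\<dots> \<le> exp (2 * L * t0) / (2 * L) * w t0"
    using L by (intro mult_right_mono) (auto simp: w_def)
  finally have "L * integral {0..t0} (\<lambda>s. norm (d s)) \<le> L * (exp (2 * L * t0) / (2 * L) * w t0)"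
    using L by (intro mult_left_mono) auto
  then have "norm (d t0) \<le> c + exp (2 * L * t0) * w t0 / 2"
    using int[OF t0(1)] L by (simp add: field_simps)
  then have "norm (d t0) \<le> c + norm (d t0) / 2" by (simp add: dw[symmetric])
  then have d0: "norm (d t0) \<le> 2 * c" by simp
  have "w t0 \<le> norm (d t0)" using L t0 unfolding w_def by (auto intro!: mult_left_le_one_le)
  then have "w t \<le> 2 * c" using t0(2)[OF t] d0 by linarith
  then have "norm (d t) \<le> exp (2 * L * t) * (2 * c)" unfolding dw by (intro mult_left_mono) auto
  also have "\<dots> \<le> exp (2 * L * T) * (2 * c)" using t L c by (intro mult_right_mono) auto
  finally show ?thesis by (simp add: mult_ac)
qed

text \<open>Picard iteration for \<open>x t\<close> divided by \<open>exp (2 * L * t)\<close>, among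
  bounded continuous functions: with this weight the map contracts by 1/2 on the whole half-line,
  and no patching of short intervals occurs. \<open>F t 0 = 0\<close> makes the image of the zero
  function bounded.\<close>

lemma ode_global_exists:
  fixes F :: "real \<Rightarrow> 'a::banach \<Rightarrow> 'a"
  assumes cont: "\<And>x. continuous_on UNIV (\<lambda>t. F t x)"
    and lip: "\<And>t x y. norm (F t x - F t y) \<le> L * norm (x - y)" and L: "0 < L"
    and F0: "\<And>t. F t 0 = 0"
  shows "\<exists>x. ode_sol F x0 \<infinity> x"
proof -
  have contF: "continuous_on S (\<lambda>s. F s (z s))" if "continuous_on S z" for S z
    by (rule continuous_on_joint[OF cont, where B=UNIV and L=L]) (use lip that in auto)
  define e where "e t = exp (2 * L * t)" for t :: real
  have e0: "0 < e t" for t by (simp add: e_def)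
  have conte: "continuous_on S e" for S unfolding e_def by (intro continuous_intros)
  define G where "G y s = F s (e s *\<^sub>R y s)" for y :: "real \<Rightarrow> 'a" and s
  have contG: "continuous_on S (G y)" if "continuous_on S y" for S y
    unfolding G_def by (intro contF continuous_intros conte that)
  \<comment> \<open>\<open>max 0 t\<close> continues the image to negative times without breaking
    continuity or the bound, so that it becomes a bounded continuous function on the whole real
    line.\<close>
  define P where "P y t = (1 / e (max 0 t)) *\<^sub>R (x0 + integral {0..max 0 t} (G y))" for y :: "real \<Rightarrow> 'a" and t
  have inte: "((\<lambda>s. L * e s * K) has_integral (e t - 1) * K / 2) {0..t}" if "0 \<le> t" for t K
  proof -
    have "((\<lambda>s. L * e s * K) has_integral (e t * K / 2 - e 0 * K / 2)) {0..t}"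
      unfolding e_def by (rule fundamental_theorem_of_calculus)
       (use that L in \<open>auto intro!: derivative_eq_intros simp: has_real_derivative_iff_has_vector_derivative[symmetric]\<close>)
    then show ?thesis by (simp add: e_def algebra_simps diff_divide_distrib)
  qed
  have bound: "norm (integral {0..t} (\<lambda>s. H s)) \<le> e t * K / 2"
    if "0 \<le> t" "continuous_on {0..t} H" "\<And>s. s \<in> {0..t} \<Longrightarrow> norm (H s) \<le> L * e s * K" "0 \<le> K" for t K and H :: "real \<Rightarrow> 'a"
  proof -
    have "norm (integral {0..t} H) \<le> integral {0..t} (\<lambda>s. L * e s * K)"
      using that inte[OF that(1)]
      by (intro integral_norm_bound_integral) (auto intro: integrable_continuous_interval has_integral_integrable)
    also have "\<dots> = (e t - 1) * K / 2" by (rule integral_unique[OF inte[OF that(1)]])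
    also have "\<dots> \<le> e t * K / 2" using that(4) by (simp add: algebra_simps)
    finally show ?thesis .
  qed
  have Pcont: "continuous_on UNIV (P y)" if y: "continuous_on UNIV y" for y
  proof -
    have "continuous_on {0..} (\<lambda>t. integral {0..t} (G y))"
      unfolding continuous_on_eq_continuous_within
    proof
      fix t :: real assume t: "t \<in> {0..}"
      have "continuous_on {0..t+1} (\<lambda>t. integral {0..t} (G y))"
        by (intro indefinite_integral_continuous_1 integrable_continuous_interval contG continuous_on_subset[OF y]) auto
      then have "continuous (at t within {0..t+1}) (\<lambda>t. integral {0..t} (G y))"
        using t by (auto simp: continuous_on_eq_continuous_within)
      moreover have "at t within {0..t+1} = at t within {0..}"
        by (rule at_within_nhd[of _ "{..<t+1}"]) (use t in auto)
      ultimately show "continuous (at t within {0..}) (\<lambda>t. integral {0..t} (G y))" by simp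
    qed
    then have "continuous_on UNIV (\<lambda>t. integral {0..max 0 t} (G y))"
      by (rule continuous_on_compose2) (auto intro!: continuous_intros)
    then show ?thesis
      unfolding P_def using e0
      by (intro continuous_intros continuous_on_compose2[OF conte[of UNIV]]) (auto simp: less_imp_neq[symmetric])
  qed
  have Pdiff: "norm (P y t - P y' t) \<le> K / 2"
    if y: "continuous_on UNIV y" "continuous_on UNIV y'" and K: "\<And>s. norm (y s - y' s) \<le> K" for y y' K t
  proof -
    have K0: "0 \<le> K" using order_trans[OF norm_ge_zero K] .
    have iG: "G y integrable_on {0..max 0 t}" "G y' integrable_on {0..max 0 t}"
      using y by (auto intro!: integrable_continuous_interval contG intro: continuous_on_subset)
    have "P y t - P y' t = (1 / e (max 0 t)) *\<^sub>R integral {0..max 0 t} (\<lambda>s. G y s - G y' s)"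
      using Henstock_Kurzweil_Integration.integral_diff[OF iG] by (simp add: P_def flip: scaleR_diff_right)
    moreover have "norm (integral {0..max 0 t} (\<lambda>s. G y s - G y' s)) \<le> e (max 0 t) * K / 2"
    proof (rule bound)
      show "continuous_on {0..max 0 t} (\<lambda>s. G y s - G y' s)"
        using y by (intro continuous_intros contG) (auto intro: continuous_on_subset)
      show "norm (G y s - G y' s) \<le> L * e s * K" for s
      proof -
        have "norm (G y s - G y' s) \<le> L * (e s * norm (y s - y' s))"
          unfolding G_def using lip[of s "e s *\<^sub>R y s" "e s *\<^sub>R y' s"] e0[of s] by (simp flip: scaleR_diff_right)
        also have "\<dots> \<le> L * (e s * K)" using L e0[of s] K[of s] by (intro mult_left_mono) auto
        finally show ?thesis by simp
      qed
    qed (use K0 in auto)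
    ultimately show ?thesis using e0[of "max 0 t"] by (simp add: field_simps)
  qed
  have P0: "norm (P (\<lambda>_. 0) t) \<le> norm x0" for t
  proof -
    have "1 \<le> e (max 0 t)" using L by (simp add: e_def)
    then have "norm x0 \<le> norm x0 * e (max 0 t)" by (simp add: mult_le_cancel_left1)
    then show ?thesis using e0[of "max 0 t"] by (simp add: P_def G_def[abs_def] F0 field_simps)
  qed
  \<comment> \<open>The bound \<open>norm x0 + norm y / 2\<close> compares with the image of the
    zero function through the contraction estimate.\<close>
  have Pb: "P (apply_bcontfun y) \<in> bcontfun" for y :: "real \<Rightarrow>\<^sub>C 'a"
  proof (rule bcontfun_normI)
    show "continuous_on UNIV (P (apply_bcontfun y))" by (rule Pcont) (auto intro: continuous_intros)
    show "norm (P (apply_bcontfun y) t) \<le> norm x0 + norm y / 2" for t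
      using Pdiff[of "apply_bcontfun y" "\<lambda>_. 0" "norm y" t] P0[of t]
        norm_triangle_ineq[of "P (apply_bcontfun y) t - P (\<lambda>_. 0) t" "P (\<lambda>_. 0) t"] norm_bounded[of y]
      by (auto intro: continuous_intros)
  qed
  have "\<exists>!y\<in>UNIV. Bcontfun (P (apply_bcontfun y)) = y"
  proof (rule Banach_fix)
    show "dist (Bcontfun (P (apply_bcontfun y))) (Bcontfun (P (apply_bcontfun y'))) \<le> 1/2 * dist y y'" for y y' :: "real \<Rightarrow>\<^sub>C 'a"
    proof (rule dist_bound)
      show "dist (apply_bcontfun (Bcontfun (P (apply_bcontfun y))) t) (apply_bcontfun (Bcontfun (P (apply_bcontfun y'))) t) \<le> 1/2 * dist y y'" for t
        unfolding Bcontfun_inverse[OF Pb] dist_norm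
        using Pdiff[of "apply_bcontfun y" "apply_bcontfun y'" "norm (y - y')" t] dist_bounded[of y _ y']
        by (auto intro: continuous_intros simp: dist_norm)
    qed
  qed (auto simp: complete_UNIV)
  then obtain y :: "real \<Rightarrow>\<^sub>C 'a" where "Bcontfun (P (apply_bcontfun y)) = y" by auto
  then have y: "apply_bcontfun y t = P (apply_bcontfun y) t" for t
    using Bcontfun_inverse[OF Pb, of y] by metis
  define x where "x t = e t *\<^sub>R apply_bcontfun y t" for t
  have "ode_sol F x0 \<infinity> x"
    unfolding ode_sol_def
  proof (intro conjI allI impI)
    show "continuous_on {t. 0 \<le> t \<and> ereal t < \<infinity>} x"
      unfolding x_def
      by (rule continuous_on_scaleR[OF conte continuous_on_apply_bcontfun])
    fix t assume t: "0 \<le> t \<and> ereal t < \<infinity>"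
    show "x t = x0 + integral {0..t} (\<lambda>s. F s (x s))"
      unfolding x_def y[of t] P_def using t e0[of t] by (simp add: G_def[abs_def])
  qed
  then show ?thesis by blast
qed

text \<open>The set \<open>B\<close> lets one statement serve both the truncated field, with
  \<open>B = UNIV\<close>, and solutions of the original equation that stay in a ball.\<close>

lemma ode_sol_stability:
  fixes F :: "real \<Rightarrow> 'a::banach \<Rightarrow> 'a"
  assumes cont: "\<And>x. continuous_on UNIV (\<lambda>t. F t x)"
    and lip: "\<And>t x y. x \<in> B \<Longrightarrow> y \<in> B \<Longrightarrow> norm (F t x - F t y) \<le> L * norm (x - y)" and L: "0 < L"
    and x: "ode_sol F x0 T x" and y: "ode_sol F y0 T' y"
    and T1: "ereal T1 < T" "ereal T1 < T'"
    and B: "\<And>t. t \<in> {0..T1} \<Longrightarrow> x t \<in> B" "\<And>t. t \<in> {0..T1} \<Longrightarrow> y t \<in> B"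
    and t: "t \<in> {0..T1}"
  shows "norm (x t - y t) \<le> 2 * norm (x0 - y0) * exp (2 * L * T1)"
proof (rule gronwall_weighted[OF _ L _ _ t])
  have lt: "ereal s < T" "ereal s < T'" if "s \<le> T1" for s
    using T1 that by (meson ereal_less_eq(3) le_less_trans)+
  have cx: "continuous_on {0..T1} x" and cy: "continuous_on {0..T1} y"
    using x y lt unfolding ode_sol_def by (auto elim!: continuous_on_subset)
  then show "continuous_on {0..T1} (\<lambda>t. x t - y t)" by (intro continuous_intros)
  show "0 \<le> norm (x0 - y0)" by simp
  fix s assume s: "s \<in> {0..T1}"
  have cFx: "continuous_on {0..s} (\<lambda>r. F r (x r))"
    by (rule continuous_on_joint[OF cont lip]) (use s B in \<open>auto intro: continuous_on_subset[OF cx]\<close>)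
  have cFy: "continuous_on {0..s} (\<lambda>r. F r (y r))"
    by (rule continuous_on_joint[OF cont lip]) (use s B in \<open>auto intro: continuous_on_subset[OF cy]\<close>)
  have iF: "(\<lambda>r. F r (x r)) integrable_on {0..s}" "(\<lambda>r. F r (y r)) integrable_on {0..s}"
    using cFx cFy by (auto intro: integrable_continuous_interval)
  have "x s - y s = (x0 - y0) + integral {0..s} (\<lambda>r. F r (x r) - F r (y r))"
    using x y s lt[of s] Henstock_Kurzweil_Integration.integral_diff[OF iF] unfolding ode_sol_def by auto
  then have "norm (x s - y s) \<le> norm (x0 - y0) + norm (integral {0..s} (\<lambda>r. F r (x r) - F r (y r)))"
    by (simp add: norm_triangle_ineq)
  also have "norm (integral {0..s} (\<lambda>r. F r (x r) - F r (y r))) \<le> integral {0..s} (\<lambda>r. L * norm (x r - y r))"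
  proof (rule integral_norm_bound_integral)
    show "(\<lambda>r. F r (x r) - F r (y r)) integrable_on {0..s}"
      by (intro integrable_continuous_interval continuous_intros cFx cFy)
    show "(\<lambda>r. L * norm (x r - y r)) integrable_on {0..s}"
      by (intro integrable_continuous_interval continuous_intros continuous_on_subset[OF cx] continuous_on_subset[OF cy])
         (use s in auto)
    show "norm (F r (x r) - F r (y r)) \<le> L * norm (x r - y r)" if "r \<in> {0..s}" for r
      using that s B by (intro lip) auto
  qed
  finally show "norm (x s - y s) \<le> norm (x0 - y0) + L * integral {0..s} (\<lambda>r. norm (x r - y r))"
    by simp
qed

section \<open>Radial truncation\<close>

definition retr :: "real \<Rightarrow> 'a::real_normed_vector \<Rightarrow> 'a" where
  "retr R x = (if norm x \<le> R then x else (R / norm x) *\<^sub>R x)"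

lemma retr_id: "norm x \<le> R \<Longrightarrow> retr R x = x"
  by (simp add: retr_def)

lemma norm_retr: "0 \<le> R \<Longrightarrow> norm (retr R x) \<le> R"
  by (auto simp: retr_def)

text \<open>With \<open>norm x \<le> norm y\<close> and \<open>y\<close> outside the ball, both
  projections are compared through the smaller factor \<open>c = R / norm y\<close>; the leftover
  multiple of \<open>x\<close> is bounded by \<open>norm y - norm x\<close>, hence by
  \<open>norm (x - y)\<close>. The argument uses no inner product, at the price of the constant
  2.\<close>

lemma retr_lipschitz:
  assumes R: "0 \<le> R" shows "norm (retr R x - retr R y) \<le> 2 * norm (x - y)"
proof -
  have *: "norm (retr R x - retr R y) \<le> 2 * norm (x - y)" if le: "norm x \<le> norm y" for x y :: 'a
  proof (cases "norm y \<le> R")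
    case True
    then show ?thesis using le by (simp add: retr_def)
  next
    case yR: False
    define c where "c = R / norm y"
    have c: "0 \<le> c" "c \<le> 1" "c * norm y = R" using yR R by (auto simp: c_def divide_le_eq_1 not_le)
    have ry: "retr R y = c *\<^sub>R y" using yR by (simp add: retr_def c_def)
    have tri: "norm y - norm x \<le> norm (x - y)"
      using norm_triangle_ineq2[of y x] by (simp add: norm_minus_commute)
    show ?thesis
    proof (cases "norm x \<le> R")
      case True
      have "retr R x - retr R y = c *\<^sub>R (x - y) + (1 - c) *\<^sub>R x"
        unfolding ry retr_id[OF True] by (simp add: algebra_simps)
      then have "norm (retr R x - retr R y) \<le> c * norm (x - y) + (1 - c) * norm x"
        using norm_triangle_ineq[of "c *\<^sub>R (x - y)" "(1 - c) *\<^sub>R x"] c by simp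
      also have "(1 - c) * norm x \<le> (1 - c) * norm y" using le c by (intro mult_left_mono) auto
      also have "(1 - c) * norm y = norm y - R" using c by (simp add: algebra_simps)
      also have "norm y - R \<le> norm (x - y)" using tri True by linarith
      also have "c * norm (x - y) \<le> 1 * norm (x - y)" using c by (intro mult_right_mono) auto
      finally show ?thesis by simp
    next
      case False
      define a where "a = R / norm x"
      have a: "0 \<le> a" "a \<le> 1" "a * norm x = R" using False R by (auto simp: a_def divide_le_eq_1 not_le)
      have ca: "c \<le> a" unfolding c_def a_def using False R le by (intro divide_left_mono mult_pos_pos) linarith+
      have rx: "retr R x = a *\<^sub>R x" using False by (simp add: retr_def a_def)
      have "retr R x - retr R y = c *\<^sub>R (x - y) + (a - c) *\<^sub>R x"
        unfolding rx ry by (simp add: algebra_simps)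
      then have "norm (retr R x - retr R y) \<le> c * norm (x - y) + (a - c) * norm x"
        using norm_triangle_ineq[of "c *\<^sub>R (x - y)" "(a - c) *\<^sub>R x"] ca c by simp
      also have "(a - c) * norm x = c * (norm y - norm x)" using c a by (simp add: algebra_simps)
      also have "\<dots> \<le> c * norm (x - y)" using tri c by (intro mult_left_mono) auto
      finally have "norm (retr R x - retr R y) \<le> c * (2 * norm (x - y))" by simp
      also have "\<dots> \<le> 1 * (2 * norm (x - y))" using c by (intro mult_right_mono) auto
      finally show ?thesis by simp
    qed
  qed
  show ?thesis
    using *[of x y] *[of y x] by (cases "norm x \<le> norm y") (auto simp: norm_minus_commute)
qed

section \<open>Local solutions, continuation and blow-up\<close>

locale local_ode =
  fixes F :: "real \<Rightarrow> 'a::banach \<Rightarrow> 'a" and L :: "real \<Rightarrow> real"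
  assumes contF: "\<And>x. continuous_on UNIV (\<lambda>t. F t x)"
    and lipF: "\<And>R t x y. norm x \<le> R \<Longrightarrow> norm y \<le> R \<Longrightarrow> norm (F t x - F t y) \<le> L R * norm (x - y)"
    and Lpos: "\<And>R. 0 < L R"
    and F0: "\<And>t. F t 0 = 0"
begin

text \<open>This field is globally Lipschitz, hence has global solutions, and it equals
  \<open>F\<close> on the ball of radius \<open>R\<close>. A curve in this ball solves one equation
  exactly when it solves the other (\<open>FR_sol_iff\<close>), so existence reduces to keeping a
  global solution inside a ball.\<close>

definition FR :: "real \<Rightarrow> real \<Rightarrow> 'a \<Rightarrow> 'a" where "FR R t x = F t (retr R x)"

lemma FR_cont: "continuous_on UNIV (\<lambda>t. FR R t x)"
  unfolding FR_def by (rule contF)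

lemma FR_lipschitz:
  assumes R: "0 \<le> R" shows "norm (FR R t x - FR R t y) \<le> (2 * L R) * norm (x - y)"
proof -
  have "norm (FR R t x - FR R t y) \<le> L R * norm (retr R x - retr R y)"
    unfolding FR_def by (intro lipF norm_retr R)
  also have "\<dots> \<le> L R * (2 * norm (x - y))"
    using Lpos[of R] by (intro mult_left_mono retr_lipschitz R) auto
  finally show ?thesis by simp
qed

lemma FR_exists: "0 \<le> R \<Longrightarrow> \<exists>x. ode_sol (FR R) x0 \<infinity> x"
  by (rule ode_global_exists[OF FR_cont FR_lipschitz])
     (use Lpos[of R] in \<open>auto simp: FR_def retr_def F0\<close>)

lemma FR_stability:
  assumes R: "0 \<le> R" and x: "ode_sol (FR R) x0 T x" and y: "ode_sol (FR R) y0 T' y"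
    and T1: "ereal T1 < T" "ereal T1 < T'" and t: "t \<in> {0..T1}"
  shows "norm (x t - y t) \<le> 2 * norm (x0 - y0) * exp (2 * (2 * L R) * T1)"
  by (rule ode_sol_stability[OF FR_cont FR_lipschitz[OF R] _ x y T1 UNIV_I UNIV_I t]) (use Lpos[of R] in simp)

lemma FR_sol_iff:
  assumes "\<And>t. 0 \<le> t \<Longrightarrow> ereal t < T \<Longrightarrow> norm (x t) \<le> R"
  shows "ode_sol (FR R) x0 T x \<longleftrightarrow> ode_sol F x0 T x"
proof -
  have eq: "integral {0..t} (\<lambda>s. FR R s (x s)) = integral {0..t} (\<lambda>s. F s (x s))" if "ereal t < T" for t
  proof (rule Henstock_Kurzweil_Integration.integral_cong)
    fix s assume s: "s \<in> {0..t}"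
    have "norm (x s) \<le> R"
      by (rule assms) (use s that in \<open>auto intro: le_less_trans[OF _ that]\<close>)
    then show "FR R s (x s) = F s (x s)" by (simp add: FR_def retr_id)
  qed
  then show ?thesis unfolding ode_sol_def by auto
qed

lemma ode_sol_mono: "ode_sol F x0 T x \<Longrightarrow> T' \<le> T \<Longrightarrow> ode_sol F x0 T' x"
  unfolding ode_sol_def by (auto elim!: continuous_on_subset intro: less_le_trans)

lemma ode_sol_bounded:
  assumes "ode_sol F x0 T x" "ereal T1 < T"
  obtains R where "0 \<le> R" "\<And>t. t \<in> {0..T1} \<Longrightarrow> norm (x t) \<le> R"
proof -
  have "{0..T1} \<subseteq> {t. 0 \<le> t \<and> ereal t < T}"
    using assms(2) by (auto intro: le_less_trans[of _ "ereal T1"])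
  then have "continuous_on {0..T1} x"
    using assms(1) unfolding ode_sol_def by (meson continuous_on_subset)
  then have "bounded (x ` {0..T1})" by (intro compact_imp_bounded compact_continuous_image) auto
  then obtain R where "\<And>t. t \<in> {0..T1} \<Longrightarrow> norm (x t) \<le> R" unfolding bounded_iff by blast
  then show ?thesis using that[of "max 0 R"] by (meson max.cobounded1 max.coboundedI2)
qed

lemma ode_sol_unique:
  assumes x: "ode_sol F x0 T x" and y: "ode_sol F x0 T' y" and t: "0 \<le> t" "ereal t < T" "ereal t < T'"
  shows "x t = y t"
proof -
  obtain R1 where R1: "\<And>s. s \<in> {0..t} \<Longrightarrow> norm (x s) \<le> R1" using ode_sol_bounded[OF x t(2)] by blast
  obtain R2 where R2: "\<And>s. s \<in> {0..t} \<Longrightarrow> norm (y s) \<le> R2" using ode_sol_bounded[OF y t(3)] by blast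
  define R where "R = max R1 R2"
  have "norm (x t - y t) \<le> 2 * norm (x0 - x0) * exp (2 * L R * t)"
  proof (rule ode_sol_stability[OF contF _ Lpos x y t(2,3), where B="{x. norm x \<le> R}"])
    show "norm (F t x - F t y) \<le> L R * norm (x - y)" if "x \<in> {x. norm x \<le> R}" "y \<in> {x. norm x \<le> R}" for t x y
      using that by (intro lipF) auto
  qed (use R1 R2 t in \<open>auto simp: R_def le_max_iff_disj\<close>)
  then show ?thesis by simp
qed

text \<open>Inside a ball the velocity is at most \<open>L R * R\<close>, because \<open>F\<close>
  vanishes at the origin. This gives a least time for the norm to grow by a given amount.\<close>

lemma ode_sol_speed:
  assumes x: "ode_sol F x0 T x" and st: "0 \<le> s" "s \<le> t" "ereal t < T" and R: "0 \<le> R" "\<And>r. r \<in> {s..t} \<Longrightarrow> norm (x r) \<le> R"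
  shows "norm (x t - x s) \<le> L R * R * (t - s)"
proof -
  have sub: "{0..t} \<subseteq> {t. 0 \<le> t \<and> ereal t < T}"
    using st(3) by (auto intro: le_less_trans[of _ "ereal t"])
  then have cx: "continuous_on {0..t} x"
    using x unfolding ode_sol_def by (meson continuous_on_subset)
  obtain R' where R': "\<And>r. r \<in> {0..t} \<Longrightarrow> norm (x r) \<le> R'" using ode_sol_bounded[OF x st(3)] by blast
  have c: "continuous_on {0..t} (\<lambda>r. F r (x r))"
    by (rule continuous_on_joint[OF contF, where B="{x. norm x \<le> R'}" and L="L R'"]) (use R' cx lipF in auto)
  then have i: "(\<lambda>r. F r (x r)) integrable_on {0..t}" by (rule integrable_continuous_interval)
  have "ereal s < T" using st by (auto intro: le_less_trans[of _ "ereal t"])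
  then have "x t - x s = integral {0..t} (\<lambda>r. F r (x r)) - integral {0..s} (\<lambda>r. F r (x r))"
    using x st unfolding ode_sol_def by auto
  also have "\<dots> = integral {s..t} (\<lambda>r. F r (x r))"
    using Henstock_Kurzweil_Integration.integral_combine[OF st(1,2) i] by (simp add: algebra_simps)
  finally have "norm (x t - x s) = norm (integral {s..t} (\<lambda>r. F r (x r)))" by simp
  also have "\<dots> \<le> (L R * R) * (t - s)"
  proof (rule integral_bound[OF st(2)])
    show "continuous_on {s..t} (\<lambda>r. F r (x r))" by (rule continuous_on_subset[OF c]) (use st in auto)
    show "norm (F r (x r)) \<le> L R * R" if r: "r \<in> {s..t}" for r
    proof -
      have "norm (F r (x r) - F r 0) \<le> L R * norm (x r - 0)" by (rule lipF) (use R r in auto)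
      also have "\<dots> \<le> L R * R" using R(2)[OF r] Lpos[of R] by (intro mult_left_mono) auto
      finally show ?thesis by (simp add: F0)
    qed
  qed
  finally show ?thesis .
qed

lemma exit_time:
  fixes z :: "real \<Rightarrow> 'a"
  assumes c: "continuous_on {a..} z" and za: "norm (z a) < R"
  obtains b where "a < b" "\<And>s. a \<le> s \<Longrightarrow> s < b \<Longrightarrow> norm (z s) < R"
proof -
  have "((\<lambda>s. norm (z s)) \<longlongrightarrow> norm (z a)) (at a within {a..})"
    using c by (intro tendsto_intros) (auto simp: continuous_on_def)
  then have "eventually (\<lambda>s. norm (z s) < R) (at a within {a..})" using za by (rule order_tendstoD)
  then obtain d where d: "d > 0" "\<And>s. s \<in> {a..} \<Longrightarrow> s \<noteq> a \<Longrightarrow> dist s a < d \<Longrightarrow> norm (z s) < R"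
    unfolding eventually_at by blast
  show ?thesis
  proof (rule that[of "a + d"])
    show "norm (z s) < R" if "a \<le> s" "s < a + d" for s
      using that d(2)[of s] za by (cases "s = a") (auto simp: dist_real_def)
  qed (use d in simp)
qed

text \<open>A solution bounded on a finite interval can be continued: it agrees there with the global
  solution of the truncated equation, whose norm stays below the truncation radius a bit longer.\<close>

lemma ode_extend:
  assumes x: "ode_sol F x0 (ereal T) x" and T: "0 < T" and R: "0 \<le> R" "\<And>t. 0 \<le> t \<Longrightarrow> t < T \<Longrightarrow> norm (x t) \<le> R"
  obtains T' y where "T < T'" "ode_sol F x0 (ereal T') y"
proof -
  have R1: "0 \<le> R + 1" using R by simp
  obtain z where z: "ode_sol (FR (R + 1)) x0 \<infinity> z" using FR_exists[OF R1] by blast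
  have xF: "ode_sol (FR (R + 1)) x0 (ereal T) x"
    using x R(2) by (subst FR_sol_iff) (auto intro: add_increasing2 order_trans[OF R(2)])
  have eq: "x t = z t" if t: "0 \<le> t" "t < T" for t
  proof -
    have "norm (x t - z t) \<le> 2 * norm (x0 - x0) * exp (2 * (2 * L (R+1)) * t)"
      by (rule FR_stability[OF R1 xF z]) (use t in auto)
    then show ?thesis by simp
  qed
  have cz: "continuous_on {0..} z"
    using z unfolding ode_sol_def by (auto elim: continuous_on_subset)
  have zR: "norm (z s) \<le> R" if s: "0 \<le> s" "s < T" for s using R(2)[OF s] eq[OF s] by simp
  have "norm (z T) \<le> R"
  proof (rule tendsto_upperbound)
    have "at T within {0..} \<noteq> bot" "at T within {0..<T} \<noteq> bot" using T by (auto simp: trivial_limit_within islimpt_greaterThanLessThan2 intro: islimpt_subset[OF islimpt_greaterThanLessThan2[OF T]])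
    then show "at T within {0..<T} \<noteq> bot" by simp
    have "(z \<longlongrightarrow> z T) (at T within {0..})" using cz T by (auto simp: continuous_on_def)
    then show "((\<lambda>s. norm (z s)) \<longlongrightarrow> norm (z T)) (at T within {0..<T})"
      by (intro tendsto_norm) (auto elim: tendsto_within_subset)
    show "\<forall>\<^sub>F s in at T within {0..<T}. norm (z s) \<le> R"
      by (auto simp: eventually_at_filter zR intro!: always_eventually)
  qed
  then have "norm (z T) < R + 1" by simp
  from exit_time[OF continuous_on_subset[OF cz] this] T obtain T' where T': "T < T'"
    "\<And>s. T \<le> s \<Longrightarrow> s < T' \<Longrightarrow> norm (z s) < R + 1" by (metis atLeast_subset_iff less_imp_le)
  have "ode_sol (FR (R+1)) x0 (ereal T') z"
    using z unfolding ode_sol_def by (auto elim: continuous_on_subset)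
  then have "ode_sol F x0 (ereal T') z"
  proof (subst (asm) FR_sol_iff)
    show "norm (z s) \<le> R + 1" if "0 \<le> s" "ereal s < ereal T'" for s
      using zR[of s] T'(2)[of s] that by (cases "s < T") auto
  qed
  then show ?thesis using that T'(1) by blast
qed

lemma ode_local_exists: "\<exists>T x. 0 < T \<and> ode_sol F x0 (ereal T) x"
proof -
  define R where "R = norm x0 + 1"
  have R: "0 \<le> R" by (simp add: R_def)
  obtain z where z: "ode_sol (FR R) x0 \<infinity> z" using FR_exists[OF R] by blast
  have cz: "continuous_on {0..} z"
    using z unfolding ode_sol_def by (auto elim: continuous_on_subset)
  have "z 0 = x0" using z unfolding ode_sol_def by (auto dest: spec[of _ 0])
  then have "norm (z 0) < R" by (simp add: R_def)
  from exit_time[OF cz this] obtain b where b: "0 < b" "\<And>s. 0 \<le> s \<Longrightarrow> s < b \<Longrightarrow> norm (z s) < R" by blast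
  have "ode_sol (FR R) x0 (ereal b) z"
    using z unfolding ode_sol_def by (auto elim: continuous_on_subset)
  then have "ode_sol F x0 (ereal b) z"
    using b(2) by (subst (asm) FR_sol_iff) (auto intro: less_imp_le)
  then show ?thesis using b by blast
qed

text \<open>\<open>T\<close> is the supremum of all existence times. Uniqueness makes all solutions
  agree on common intervals, so their union is the maximal solution, and a bounded maximal solution
  with finite \<open>T\<close> could be extended. For continuous dependence the truncated equation
  is solved from the nearby datum, and Gronwall's bound keeps this solution in the ball up to
  \<open>T1\<close>.\<close>

theorem ode_wellposed:
  "\<exists>T x. 0 < T \<and> ode_sol F x0 T x \<and>
     (\<forall>T' y. ode_sol F x0 T' y \<longrightarrow> T' \<le> T \<and> (\<forall>t. 0 \<le> t \<and> ereal t < T' \<longrightarrow> y t = x t)) \<and>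
     (T = \<infinity> \<or> T < \<infinity> \<and> filterlim (\<lambda>t. norm (x t)) at_top (at_left (real_of_ereal T))) \<and>
     (\<forall>T1 e. 0 \<le> T1 \<and> ereal T1 < T \<and> 0 < e \<longrightarrow>
        (\<exists>d>0. \<forall>y0. norm (y0 - x0) < d \<longrightarrow>
          (\<exists>T' y. ereal T1 < T' \<and> ode_sol F y0 T' y \<and> (\<forall>t\<in>{0..T1}. norm (y t - x t) < e))))"
proof -
  define A where "A = {T. 0 < T \<and> (\<exists>x. ode_sol F x0 T x)}"
  define T where "T = Sup A"
  have Aub: "T' \<le> T" if "T' \<in> A" for T' unfolding T_def using that by (rule Sup_upper)
  \<comment> \<open>Any solution that reaches \<open>t\<close> may supply the value;
    \<open>xeq\<close> shows that the choice does not matter.\<close>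
  define x where "x t = (SOME v. \<exists>T' y. ode_sol F x0 T' y \<and> 0 \<le> t \<and> ereal t < T' \<and> v = y t)" for t
  have xeq: "x t = y t" if "ode_sol F x0 T' y" "0 \<le> t" "ereal t < T'" for T' y t
  proof -
    have "\<exists>T'' y'. ode_sol F x0 T'' y' \<and> 0 \<le> t \<and> ereal t < T'' \<and> x t = y' t"
      unfolding x_def by (rule someI_ex) (use that in blast)
    then show ?thesis using ode_sol_unique that by metis
  qed
  have Apos: "0 < T"
  proof -
    obtain T0 z where "0 < T0" "ode_sol F x0 (ereal T0) z" using ode_local_exists by blast
    then have "ereal T0 \<in> A" by (auto simp: A_def)
    then show ?thesis using Aub[of "ereal T0"] \<open>0 < T0\<close> by (meson ereal_less(2) less_le_trans)
  qed
  have ex: "\<exists>T' y. ereal t < T' \<and> ode_sol F x0 T' y" if "ereal t < T" for t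
    using that unfolding T_def less_Sup_iff A_def by auto
  have xsol: "ode_sol F x0 T x"
    unfolding ode_sol_def
  proof (intro conjI allI impI)
    show "continuous_on {t. 0 \<le> t \<and> ereal t < T} x"
      unfolding continuous_on_eq_continuous_within
    proof
      fix t assume "t \<in> {t. 0 \<le> t \<and> ereal t < T}"
      then have t: "0 \<le> t" "ereal t < T" by auto
      obtain T' y where y: "ereal t < T'" "ode_sol F x0 T' y" using ex[OF t(2)] by blast
      obtain b where b: "t < b" "ereal b < T'" using y(1) by (metis ereal_dense2 ereal_less_eq(3) less_ereal.simps(1))
      have bT: "ereal s < T'" if "s < b" for s using b(2) that by (meson ereal_less_eq(3) le_less_trans less_imp_le)
      have "continuous_on {0..<b} y"
        using y(2) bT unfolding ode_sol_def by (auto elim!: continuous_on_subset)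
      then have "continuous_on {0..<b} x"
        by (rule continuous_on_eq) (use xeq[OF y(2)] bT in auto)
      then have "continuous (at t within {0..<b}) x" using t b by (auto simp: continuous_on_eq_continuous_within)
      then have "(x \<longlongrightarrow> x t) (at t within {0..<b})" by (simp add: continuous_within)
      moreover have "at t within {0..<b} = at t within {0..}"
        by (rule at_within_nhd[of _ "{..<b}"]) (use t b in auto)
      ultimately have "(x \<longlongrightarrow> x t) (at t within {0..})" by simp
      then have "(x \<longlongrightarrow> x t) (at t within {t. 0 \<le> t \<and> ereal t < T})" by (rule tendsto_within_subset) auto
      then show "continuous (at t within {t. 0 \<le> t \<and> ereal t < T}) x" by (simp add: continuous_within)
    qed
    fix t assume t: "0 \<le> t \<and> ereal t < T"
    then obtain T' y where y: "ereal t < T'" "ode_sol F x0 T' y" using ex by blast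
    have "integral {0..t} (\<lambda>s. F s (x s)) = integral {0..t} (\<lambda>s. F s (y s))"
    proof (rule Henstock_Kurzweil_Integration.integral_cong)
      fix s assume s: "s \<in> {0..t}"
      then have "ereal s < T'" using y(1) by (auto intro: le_less_trans[of _ "ereal t"])
      then show "F s (x s) = F s (y s)" using xeq[OF y(2), of s] s by simp
    qed
    then show "x t = x0 + integral {0..t} (\<lambda>s. F s (x s))"
      using xeq[OF y(2)] y t unfolding ode_sol_def by metis
  qed
  have uniq: "T' \<le> T \<and> (\<forall>t. 0 \<le> t \<and> ereal t < T' \<longrightarrow> y t = x t)" if y: "ode_sol F x0 T' y" for T' y
  proof -
    have "T' \<le> T"
      using Aub[of T'] y Apos by (cases "0 < T'") (auto simp: A_def)
    then show ?thesis using xeq[OF y] by auto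
  qed
  have blow: "T = \<infinity> \<or> T < \<infinity> \<and> filterlim (\<lambda>t. norm (x t)) at_top (at_left (real_of_ereal T))"
  proof (cases "T = \<infinity>")
    case False
    then obtain b where b: "T = ereal b" using Apos by (cases T) auto
    have b0: "0 < b" using Apos b by simp
    have xb: "ode_sol F x0 (ereal b) x" using xsol b by simp
    have nb: False if R: "0 \<le> R" "\<And>t. 0 \<le> t \<Longrightarrow> t < b \<Longrightarrow> norm (x t) \<le> R" for R
    proof -
      obtain T' y where "b < T'" "ode_sol F x0 (ereal T') y" using ode_extend[OF xb b0 R] by blast
      then show False using uniq[of "ereal T'" y] b by simp
    qed
    have "filterlim (\<lambda>t. norm (x t)) at_top (at_left b)"
      unfolding filterlim_at_top
    proof
      fix Z :: real
      define R where "R = max Z 0 + 1"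
      have R: "0 < R" "Z \<le> R" by (auto simp: R_def)
      \<comment> \<open>At the greatest speed in the ball of radius \<open>2 * R\<close>, the norm
        needs at least time \<open>d\<close> to rise from \<open>R\<close> to \<open>2 * R\<close>.
        A norm below \<open>R\<close> within time \<open>d\<close> of the end thus stays below
        \<open>2 * R\<close> until the end, which contradicts maximality.\<close>
      define d where "d = R / (L (2 * R) * (2 * R))"
      have d: "0 < d" using R(1) Lpos[of "2*R"] by (simp add: d_def)
      have ge: "R \<le> norm (x t)" if t: "max 0 (b - d) < t" "t < b" for t
      proof (rule ccontr)
        assume "\<not> R \<le> norm (x t)"
        then have xt: "norm (x t) < R" by simp
        have cb: "continuous_on {t..<b} x"
          using xb t unfolding ode_sol_def by (auto elim!: continuous_on_subset)
        have lt: "norm (x s) < 2 * R" if s: "t \<le> s" "s < b" for s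
        proof (rule ccontr)
          assume "\<not> norm (x s) < 2 * R"
          then have "2 * R \<le> norm (x s)" by simp
          moreover have "continuous_on {t..s} (\<lambda>r. norm (x r))"
            by (intro continuous_intros continuous_on_subset[OF cb]) (use s in auto)
          \<comment> \<open>The first time at which the norm equals \<open>2 * R\<close>: up to then
            the curve lies in the ball where the speed bound holds.\<close>
          ultimately obtain r where r: "t \<le> r" "r \<le> s" "norm (x r) = 2 * R"
            and rmin: "\<And>q. t \<le> q \<Longrightarrow> q \<le> s \<Longrightarrow> norm (x q) = 2 * R \<Longrightarrow> r \<le> q"
          proof -
            assume le: "2 * R \<le> norm (x s)" and c: "continuous_on {t..s} (\<lambda>r. norm (x r))"
              and th: "\<And>r. t \<le> r \<Longrightarrow> r \<le> s \<Longrightarrow> norm (x r) = 2 * R \<Longrightarrow>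
                (\<And>q. t \<le> q \<Longrightarrow> q \<le> s \<Longrightarrow> norm (x q) = 2 * R \<Longrightarrow> r \<le> q) \<Longrightarrow> thesis"
            define Q where "Q = {r \<in> {t..s}. norm (x r) = 2 * R}"
            have "\<exists>r\<ge>t. r \<le> s \<and> norm (x r) = 2 * R"
              by (rule IVT') (use le c xt R s in auto)
            then have ne: "Q \<noteq> {}" by (auto simp: Q_def)
            have "closed Q" unfolding Q_def by (rule continuous_closed_preimage_constant[OF c]) auto
            then have "compact ({t..s} \<inter> Q)" by (intro compact_Int_closed) auto
            moreover have "{t..s} \<inter> Q = Q" by (auto simp: Q_def)
            ultimately have "compact Q" by simp
            then obtain r where "r \<in> Q" "\<And>q. q \<in> Q \<Longrightarrow> r \<le> q" using compact_attains_inf[of Q] ne by blast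
            then show thesis by (intro th[of r]) (auto simp: Q_def)
          qed
          have le: "norm (x q) \<le> 2 * R" if q: "q \<in> {t..r}" for q
          proof (rule ccontr)
            assume n: "\<not> norm (x q) \<le> 2 * R"
            have "\<exists>p\<ge>t. p \<le> q \<and> norm (x p) = 2 * R"
              by (rule IVT') (use n xt R q r s in \<open>auto intro!: continuous_intros continuous_on_subset[OF cb]\<close>)
            then obtain p where p: "t \<le> p" "p \<le> q" "norm (x p) = 2 * R" by blast
            then have "r \<le> p" using q r by (intro rmin) auto
            then have "p = q" using p q by auto
            then show False using p n by simp
          qed
          have "norm (x r - x t) \<le> L (2 * R) * (2 * R) * (r - t)"
            by (rule ode_sol_speed[OF xb]) (use t r s R le in auto)
          also have "\<dots> < L (2 * R) * (2 * R) * d"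
            using t r s R(1) Lpos[of "2*R"] by (intro mult_strict_left_mono) auto
          also have "\<dots> = R" using R(1) Lpos[of "2*R"] by (simp add: d_def)
          finally have "norm (x r) < 2 * R" using xt norm_triangle_ineq2[of "x r" "x t"] by linarith
          then show False using r by simp
        qed
        obtain R0 where R0: "0 \<le> R0" "\<And>s. s \<in> {0..t} \<Longrightarrow> norm (x s) \<le> R0"
          using ode_sol_bounded[OF xb, of t] t by auto
        show False
        proof (rule nb[of "max R0 (2 * R)"])
          show "norm (x s) \<le> max R0 (2 * R)" if "0 \<le> s" "s < b" for s
            using R0(2)[of s] lt[of s] that by (cases "s \<le> t") auto
        qed (use R0 in auto)
      qed
      have "eventually (\<lambda>t. t \<in> {max 0 (b - d)<..<b}) (at_left b)"
        using b0 d by (intro eventually_at_leftI[of "max 0 (b - d)"]) auto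
      then show "eventually (\<lambda>t. Z \<le> norm (x t)) (at_left b)"
        by eventually_elim (use ge R(2) order_trans in auto)
    qed
    then show ?thesis using b by simp
  qed simp
  have dep: "\<exists>d>0. \<forall>y0. norm (y0 - x0) < d \<longrightarrow>
          (\<exists>T' y. ereal T1 < T' \<and> ode_sol F y0 T' y \<and> (\<forall>t\<in>{0..T1}. norm (y t - x t) < e))"
    if T1: "0 \<le> T1" "ereal T1 < T" and e: "0 < e" for T1 e :: real
  proof -
    \<comment> \<open>A time strictly between \<open>T1\<close> and \<open>T\<close>: the solution
      is bounded on \<open>{0..T2}\<close>, and its restriction to times before \<open>T2\<close>
      still reaches strictly beyond \<open>T1\<close>, as \<open>FR_stability\<close>
      demands.\<close>
    obtain T2 where T2: "T1 < T2" "ereal T2 < T" using T1(2) by (metis ereal_dense2 less_ereal.simps(1))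
    obtain R0 where R0: "0 \<le> R0" "\<And>s. s \<in> {0..T2} \<Longrightarrow> norm (x s) \<le> R0"
      using ode_sol_bounded[OF xsol T2(2)] by blast
    define R where "R = R0 + 1"
    have R: "0 \<le> R" using R0 by (simp add: R_def)
    define K where "K = 2 * exp (2 * (2 * L R) * T1)"
    have K: "0 < K" by (simp add: K_def)
    \<comment> \<open>\<open>K * d\<close> is below both 1 and \<open>e\<close>. Being below 1, it
      keeps the perturbed curve strictly inside the radius \<open>R0 + 1\<close> on
      \<open>{0..T1}\<close>, so this curve solves the original equation slightly beyond
      \<open>T1\<close>.\<close>
    define d where "d = min 1 e / (2 * K)"
    have d: "0 < d" using K e by (simp add: d_def)
    have "\<exists>T' y. ereal T1 < T' \<and> ode_sol F y0 T' y \<and> (\<forall>t\<in>{0..T1}. norm (y t - x t) < e)"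
      if y0: "norm (y0 - x0) < d" for y0
    proof -
      obtain z where z: "ode_sol (FR R) y0 \<infinity> z" using FR_exists[OF R] by blast
      have "ode_sol F x0 (ereal T2) x"
        by (rule ode_sol_mono[OF xsol]) (use T2 in auto)
      then have xF: "ode_sol (FR R) x0 (ereal T2) x"
        by (subst FR_sol_iff) (auto simp: R_def intro!: add_increasing2 R0(2))
      have stab: "norm (z t - x t) \<le> K * d" if t: "t \<in> {0..T1}" for t
      proof -
        have "norm (z t - x t) \<le> 2 * norm (y0 - x0) * exp (2 * (2 * L R) * T1)"
          by (rule FR_stability[OF R z xF _ _ t]) (use T2 in auto)
        also have "\<dots> \<le> K * d" using y0 by (simp add: K_def)
        finally show ?thesis .
      qed
      have Kd: "K * d < e" "K * d < 1" using K e by (auto simp: d_def min_def)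
      have zR: "norm (z t) < R" if t: "t \<in> {0..T1}" for t
        using stab[OF t] Kd(2) R0(2)[of t] t T2(1) norm_triangle_ineq2[of "z t" "x t"] by (simp add: R_def)
      have cz: "continuous_on {T1..} z"
        using z T1 unfolding ode_sol_def by (auto elim: continuous_on_subset)
      obtain b where b: "T1 < b" "\<And>s. T1 \<le> s \<Longrightarrow> s < b \<Longrightarrow> norm (z s) < R"
        using exit_time[OF cz, of R] zR[of T1] T1 by auto
      have "ode_sol (FR R) y0 (ereal b) z"
        using z unfolding ode_sol_def by (auto elim: continuous_on_subset)
      then have "ode_sol F y0 (ereal b) z"
      proof (subst (asm) FR_sol_iff)
        show "norm (z s) \<le> R" if "0 \<le> s" "ereal s < ereal b" for s
          using zR[of s] b(2)[of s] that by (cases "s \<le> T1") auto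
      qed
      moreover have "\<forall>t\<in>{0..T1}. norm (z t - x t) < e" using stab Kd(1) by force
      ultimately show ?thesis using b(1) by (intro exI[of _ "ereal b"] exI[of _ z]) auto
    qed
    then show ?thesis using d by blast
  qed
  show ?thesis
    by (rule exI[of _ T], rule exI[of _ x]) (use Apos xsol uniq blow dep in blast)
qed

end

section \<open>The Plancherel transform\<close>

lemma lborel_nn_integral_affine:
  fixes f :: "'a::euclidean_space \<Rightarrow> ennreal"
  assumes [measurable]: "f \<in> borel_measurable borel" and c: "c \<noteq> 0"
  shows "(\<integral>\<^sup>+x. f x \<partial>lborel) = ennreal (\<bar>c\<bar>^DIM('a)) * (\<integral>\<^sup>+x. f (t + c *\<^sub>R x) \<partial>lborel)"
  by (subst lborel_affine[OF c, of t])
     (simp add: nn_integral_density nn_integral_distr nn_integral_cmult ennreal_power)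

lemma lborel_integrable_affine:
  fixes f :: "'a::euclidean_space \<Rightarrow> 'b::{banach, second_countable_topology}"
  assumes f: "integrable lborel f" and c: "c \<noteq> 0"
  shows "integrable lborel (\<lambda>x. f (t + c *\<^sub>R x))"
proof -
  have [measurable]: "f \<in> borel_measurable borel" using f by auto
  have "(\<integral>\<^sup>+x. ennreal (norm (f x)) \<partial>lborel) < \<infinity>" using f by (simp add: integrable_iff_bounded)
  then have "(\<integral>\<^sup>+x. ennreal (norm (f (t + c *\<^sub>R x))) \<partial>lborel) < \<infinity>"
    using c by (subst (asm) lborel_nn_integral_affine[where c=c and t=t]) (auto simp: ennreal_mult_less_top)
  then show ?thesis by (simp add: integrable_iff_bounded)
qed

lemma lborel_integral_affine:
  fixes f :: "'a::euclidean_space \<Rightarrow> 'b::{banach, second_countable_topology}"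
  assumes f: "f \<in> borel_measurable borel" and c: "c \<noteq> 0"
  shows "(LINT x|lborel. f x) = \<bar>c\<bar>^DIM('a) *\<^sub>R (LINT x|lborel. f (t + c *\<^sub>R x))"
  by (subst lborel_affine[OF c, of t])
     (use f c in \<open>simp add: integral_density integral_distr\<close>)

lemma borel_measurable_cis [measurable (raw)]:
  "f \<in> borel_measurable M \<Longrightarrow> (\<lambda>x. cis (f x)) \<in> borel_measurable M"
  by (rule measurable_compose[OF _ borel_measurable_continuous_onI]) (auto intro: continuous_intros)

lemma integrable_product:
  fixes f g :: "_ \<Rightarrow> complex"
  assumes "integrable lborel f" "integrable lborel g"
  shows "integrable (lborel \<Otimes>\<^sub>M lborel) (\<lambda>p. f (fst p) * g (snd p))"
    "(LINT p|(lborel \<Otimes>\<^sub>M lborel). f (fst p) * g (snd p)) = (LINT x|lborel. f x) * (LINT y|lborel. g y)"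
proof -
  show i: "integrable (lborel \<Otimes>\<^sub>M lborel) (\<lambda>p. f (fst p) * g (snd p))"
  proof (rule lborel_pair.Fubini_integrable)
    show "(\<lambda>p. f (fst p) * g (snd p)) \<in> borel_measurable (lborel \<Otimes>\<^sub>M lborel)"
      using assms by measurable
    have "integrable lborel (\<lambda>x. cmod (f x) * (LINT y|lborel. cmod (g y)))"
      using assms by (intro integrable_mult_left integrable_norm)
    then show "integrable lborel (\<lambda>x. LINT y|lborel. norm (f (fst (x, y)) * g (snd (x, y))))"
      by (simp add: norm_mult)
    show "AE x in lborel. integrable lborel (\<lambda>y. f (fst (x, y)) * g (snd (x, y)))"
      using assms by simp
  qed
  show "(LINT p|(lborel \<Otimes>\<^sub>M lborel). f (fst p) * g (snd p)) = (LINT x|lborel. f x) * (LINT y|lborel. g y)"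
    using lborel_pair.integral_fst'[OF i] by simp
qed

subsection \<open>Gaussians\<close>

text \<open>The characteristic function of the standard normal distribution, rescaled by
  \<open>sqrt s\<close>.\<close>

lemma gauss_real:
  fixes s t :: real
  assumes s: "0 < s"
  shows "integrable lborel (\<lambda>x. complex_of_real (exp (- (s * x\<^sup>2 / 2))) * cis (x * t))"
    "(LINT x|lborel. complex_of_real (exp (- (s * x\<^sup>2 / 2))) * cis (x * t))
      = complex_of_real (sqrt (2 * pi / s) * exp (- (t\<^sup>2 / (2 * s))))"
proof -
  define h where "h r x = complex_of_real (exp (- (x\<^sup>2 / 2))) * cis (x * r)" for r x :: real
  have [measurable]: "h r \<in> borel_measurable borel" for r unfolding h_def by measurable
  have ih: "integrable lborel (h r)" for r
  proof (rule Bochner_Integration.integrable_bound)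
    have "integrable lborel (\<lambda>x. sqrt (2 * pi) * std_normal_density x)"
      by (intro integrable_mult_right) simp
    then show "integrable lborel (\<lambda>x. sqrt (2 * pi) * std_normal_density x)" .
  qed (auto simp: h_def norm_mult std_normal_density_def)
  have h: "(LINT x|lborel. h r x) = complex_of_real (sqrt (2 * pi) * exp (- (r\<^sup>2 / 2)))" for r
  proof -
    have "char std_normal_distribution r = (LINT x|lborel. std_normal_density x *\<^sub>R iexp (r * x))"
      unfolding char_def by (rule integral_density) (auto simp: normal_density_nonneg)
    also have "\<dots> = (LINT x|lborel. complex_of_real (1 / sqrt (2 * pi)) * h r x)"
      by (simp add: h_def std_normal_density_def cis_conv_exp scaleR_conv_of_real mult_ac)
    also have "\<dots> = complex_of_real (1 / sqrt (2 * pi)) * (LINT x|lborel. h r x)"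
      by (rule integral_mult_right_zero)
    finally have "complex_of_real (exp (- (r\<^sup>2) / 2)) = complex_of_real (1 / sqrt (2 * pi)) * (LINT x|lborel. h r x)"
      by (simp add: char_std_normal_distribution)
    then show ?thesis by (simp add: field_simps flip: of_real_mult)
  qed
  have eq: "h (t / sqrt s) (0 + sqrt s * x) = complex_of_real (exp (- (s * x\<^sup>2 / 2))) * cis (x * t)" for x
    using s by (simp add: h_def power_mult_distrib mult_ac)
  show "integrable lborel (\<lambda>x. complex_of_real (exp (- (s * x\<^sup>2 / 2))) * cis (x * t))"
    using lborel_integrable_real_affine[OF ih, of "sqrt s" "t / sqrt s" 0] s unfolding eq by simp
  have "(LINT x|lborel. h (t / sqrt s) x) = \<bar>sqrt s\<bar> *\<^sub>R (LINT x|lborel. complex_of_real (exp (- (s * x\<^sup>2 / 2))) * cis (x * t))"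
    using lborel_integral_real_affine[of "sqrt s" "h (t / sqrt s)" 0] s unfolding eq by simp
  then have "complex_of_real (sqrt (2 * pi) * exp (- ((t / sqrt s)\<^sup>2 / 2)))
      = complex_of_real (sqrt s) * (LINT x|lborel. complex_of_real (exp (- (s * x\<^sup>2 / 2))) * cis (x * t))"
    unfolding h using s by (simp add: scaleR_conv_of_real)
  moreover have "(t / sqrt s)\<^sup>2 / 2 = t\<^sup>2 / (2 * s)" using s by (simp add: power_divide)
  ultimately show "(LINT x|lborel. complex_of_real (exp (- (s * x\<^sup>2 / 2))) * cis (x * t))
      = complex_of_real (sqrt (2 * pi / s) * exp (- (t\<^sup>2 / (2 * s))))"
    using s by (simp add: real_sqrt_divide field_simps)
qed

lemma lborel_prod_integral:
  fixes f :: "'a::euclidean_space \<Rightarrow> real \<Rightarrow> complex"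
  assumes f: "\<And>b. b \<in> Basis \<Longrightarrow> integrable lborel (f b)"
  shows "integrable lborel (\<lambda>x::'a. \<Prod>b\<in>Basis. f b (x \<bullet> b))"
    "(LINT x|lborel. (\<Prod>b\<in>Basis. f b (x \<bullet> b))) = (\<Prod>b\<in>Basis. LINT x|lborel. f b x)"
proof -
  interpret product_sigma_finite "\<lambda>_::'a. lborel :: real measure" by standard
  have [measurable]: "b \<in> Basis \<Longrightarrow> f b \<in> borel_measurable borel" for b using f by auto
  have [measurable]: "(\<lambda>g. \<Sum>b\<in>Basis. g b *\<^sub>R b) \<in> (\<Pi>\<^sub>M b\<in>(Basis::'a set). lborel) \<rightarrow>\<^sub>M borel"
    by (intro borel_measurable_sum borel_measurable_scaleR) auto
  have eq: "(\<Prod>b\<in>Basis. f b ((\<Sum>c\<in>Basis. g c *\<^sub>R c) \<bullet> b)) = (\<Prod>b\<in>Basis. f b (g b))" for g :: "'a \<Rightarrow> real"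
    by (intro prod.cong) (auto simp: inner_sum_left_Basis)
  show "integrable lborel (\<lambda>x::'a. \<Prod>b\<in>Basis. f b (x \<bullet> b))"
    by (subst lborel_eq, subst integrable_distr_eq) (auto simp: eq intro!: product_integrable_prod f)
  show "(LINT x|lborel. (\<Prod>b\<in>Basis. f b (x \<bullet> b))) = (\<Prod>b\<in>Basis. LINT x|lborel. f b x)"
    by (subst lborel_eq, subst integral_distr) (auto simp: eq intro!: product_integral_prod f)
qed

text \<open>For \<open>s > 0\<close>, \<open>heat s\<close> is the density of a centred Gaussian
  vector with variance \<open>s\<close> in each coordinate, and \<open>gauss s\<close> is its
  characteristic function. Since \<open>heat s\<close> has mass 1, averaging against it is a
  contraction.\<close>

definition gauss :: "real \<Rightarrow> real^3 \<Rightarrow> real" where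
  "gauss s x = exp (- (s * (norm x)\<^sup>2 / 2))"

definition heat :: "real \<Rightarrow> real^3 \<Rightarrow> real" where
  "heat s x = (2 * pi * s) powr (-3/2) * exp (- ((norm x)\<^sup>2 / (2 * s)))"

lemma gauss_measurable [measurable]: "gauss s \<in> borel_measurable borel"
  unfolding gauss_def[abs_def] by measurable

lemma heat_measurable [measurable]: "heat s \<in> borel_measurable borel"
  unfolding heat_def[abs_def] by measurable

lemma gauss_nonneg [simp]: "0 \<le> gauss s x" by (simp add: gauss_def)
lemma heat_nonneg [simp]: "0 \<le> heat s x" by (simp add: heat_def)

lemma gauss_fourier:
  assumes s: "0 < s"
  shows "integrable lborel (\<lambda>x. complex_of_real (gauss s x) * cis (x \<bullet> z))"
    "(LINT x|lborel. complex_of_real (gauss s x) * cis (x \<bullet> z)) = complex_of_real ((2 * pi) ^ 3 * heat s z)"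
proof -
  define f where "f b x = complex_of_real (exp (- (s * x\<^sup>2 / 2))) * cis (x * (z \<bullet> b))" for b :: "real^3" and x
  have fe: "f b x = exp (complex_of_real (- (s * x\<^sup>2 / 2)) + \<i> * complex_of_real (x * (z \<bullet> b)))" for b x
    unfolding f_def exp_add cis_conv_exp exp_of_real ..
  have norm_sq: "(norm x)\<^sup>2 = (\<Sum>b\<in>Basis. (x \<bullet> b)\<^sup>2)" for x :: "real^3"
    unfolding power2_norm_eq_inner by (subst euclidean_inner) (simp add: power2_eq_square)
  have eq: "(\<Prod>b\<in>Basis. f b (x \<bullet> b)) = complex_of_real (gauss s x) * cis (x \<bullet> z)" for x
  proof -
    have "(\<Prod>b\<in>Basis. f b (x \<bullet> b)) = exp (\<Sum>b\<in>Basis. complex_of_real (- (s * (x \<bullet> b)\<^sup>2 / 2)) + \<i> * complex_of_real ((x \<bullet> b) * (z \<bullet> b)))"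
      unfolding fe by (rule exp_sum[symmetric]) simp
    also have "(\<Sum>b\<in>Basis. complex_of_real (- (s * (x \<bullet> b)\<^sup>2 / 2)) + \<i> * complex_of_real ((x \<bullet> b) * (z \<bullet> b)))
        = complex_of_real (- (s * (norm x)\<^sup>2 / 2)) + \<i> * complex_of_real (x \<bullet> z)"
      unfolding sum.distrib norm_sq euclidean_inner[of x z]
      by (simp add: sum_negf sum_divide_distrib[symmetric] sum_distrib_left)
    finally show ?thesis unfolding exp_add cis_conv_exp exp_of_real gauss_def .
  qed
  note g = gauss_real[OF s]
  have fi: "integrable lborel (f b)" for b unfolding f_def by (rule g)
  show "integrable lborel (\<lambda>x. complex_of_real (gauss s x) * cis (x \<bullet> z))"
    using lborel_prod_integral(1)[of f] fi unfolding eq by simp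
  have "(LINT x|lborel. complex_of_real (gauss s x) * cis (x \<bullet> z)) = (\<Prod>b\<in>Basis. LINT x|lborel. f b x)"
    using lborel_prod_integral(2)[of f] fi unfolding eq by simp
  also have "\<dots> = (\<Prod>b\<in>(Basis::(real^3) set). complex_of_real (sqrt (2 * pi / s) * exp (- ((z \<bullet> b)\<^sup>2 / (2 * s)))))"
    unfolding f_def g(2) ..
  also have "\<dots> = complex_of_real (sqrt (2 * pi / s) ^ 3 * exp (- ((norm z)\<^sup>2 / (2 * s))))"
    unfolding norm_sq by (simp add: prod.distrib exp_sum[symmetric] sum_negf sum_divide_distrib flip: of_real_prod)
  also have "sqrt (2 * pi / s) ^ 3 = (2 * pi) ^ 3 * (2 * pi * s) powr (-3/2)"
  proof -
    have "sqrt (2 * pi / s) ^ 3 = ((2 * pi / s) powr (1/2)) powr 3"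
      using s by (simp add: powr_half_sqrt)
    also have "\<dots> = (2 * pi) powr (3/2) * s powr (-3/2)"
      using s by (simp add: powr_powr powr_divide powr_minus divide_simps)
    also have "(2 * pi) powr (3/2) = (2 * pi) powr 3 * (2 * pi) powr (-3/2)"
      by (subst powr_add[symmetric]) simp
    also have "(2 * pi) powr 3 = (2 * pi) ^ 3" by simp
    finally show ?thesis using s by (simp add: powr_mult mult_ac)
  qed
  finally show "(LINT x|lborel. complex_of_real (gauss s x) * cis (x \<bullet> z)) = complex_of_real ((2 * pi) ^ 3 * heat s z)"
    by (simp add: heat_def)
qed

lemma gauss_integrable: "0 < s \<Longrightarrow> integrable lborel (gauss s)"
  using integrable_Re[OF gauss_fourier(1)[of s 0]] by simp

lemma heat_integral:
  assumes s: "0 < s" shows "integrable lborel (heat s)" "(LINT x|lborel. heat s x) = 1"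
proof -
  have eq: "heat s x = (2 * pi * s) powr (-3/2) * gauss (1/s) x" for x
    using s by (simp add: heat_def gauss_def)
  show "integrable lborel (heat s)"
    unfolding eq[abs_def] using s by (intro integrable_mult_right gauss_integrable) simp
  have "complex_of_real (LINT x|lborel. gauss (1/s) x) = complex_of_real ((2 * pi) ^ 3 * heat (1/s) 0)"
    using gauss_fourier(2)[of "1/s" 0] s by simp
  then have "(LINT x|lborel. gauss (1/s) x) = (2 * pi) ^ 3 * (2 * pi * (1/s)) powr (-3/2)"
    by (simp only: of_real_eq_iff heat_def) simp
  moreover have "(2 * pi * s) powr (-3/2) * ((2 * pi) ^ 3 * (2 * pi * (1/s)) powr (-3/2)) = 1"
  proof -
    have "(2 * pi * s) powr (-3/2) * (2 * pi * (1/s)) powr (-3/2) = ((2 * pi) * (2 * pi)) powr (-3/2)"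
      using s by (subst powr_mult[symmetric]) (auto simp: field_simps)
    also have "\<dots> = (2 * pi) powr (-3)" by (subst powr_mult) (auto simp flip: powr_add)
    also have "\<dots> = inverse ((2 * pi) ^ 3)" by (simp add: powr_minus powr_numeral)
    finally show ?thesis by (simp add: field_simps)
  qed
  ultimately show "(LINT x|lborel. heat s x) = 1"
    unfolding eq[abs_def] by simp
qed

lemma nn_integral_heat: "0 < s \<Longrightarrow> (\<integral>\<^sup>+ x. ennreal (heat s (x - y)) \<partial>lborel) = 1"
  "0 < s \<Longrightarrow> (\<integral>\<^sup>+ x. ennreal (heat s (y - x)) \<partial>lborel) = 1"
proof -
  assume s: "0 < s"
  have *: "(\<integral>\<^sup>+ x. ennreal (heat s x) \<partial>lborel) = 1"
    using nn_integral_eq_integral[OF heat_integral(1)[OF s]] heat_integral(2)[OF s] by simp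
  show "(\<integral>\<^sup>+ x. ennreal (heat s (x - y)) \<partial>lborel) = 1"
    using lborel_nn_integral_affine[of "\<lambda>x. ennreal (heat s x)" 1 "-y"] * by simp
  show "(\<integral>\<^sup>+ x. ennreal (heat s (y - x)) \<partial>lborel) = 1"
    using lborel_nn_integral_affine[of "\<lambda>x. ennreal (heat s x)" "-1" "y"] * by simp
qed

text \<open>Writing \<open>heat s (x - y)\<close> as the Fourier integral of \<open>gauss s\<close>
  splits the kernel into a phase in \<open>x\<close> times a phase in \<open>y\<close>. The factor
  \<open>gauss s\<close> makes the triple integral absolutely convergent for all integrable
  \<open>f\<close> and \<open>g\<close>. With \<open>g\<close> the conjugate of \<open>f\<close>
  this leads to Plancherel's identity, with products of L2 functions to the estimate of the Hartree
  form.\<close>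

lemma heat_fubini:
  fixes f g :: "real^3 \<Rightarrow> complex"
  assumes f: "integrable lborel f" and g: "integrable lborel g" and s: "0 < s"
  shows "(LINT p|(lborel \<Otimes>\<^sub>M lborel). complex_of_real (heat s (fst p - snd p)) * (g (fst p) * f (snd p)))
    = complex_of_real (1 / (2 * pi) ^ 3) * (LINT h|lborel. complex_of_real (gauss s h) *
        ((LINT y|lborel. cis (- (y \<bullet> h)) * f y) * (LINT x|lborel. cis (x \<bullet> h) * g x)))"
proof -
  have [measurable]: "f \<in> borel_measurable borel" "g \<in> borel_measurable borel" using f g by auto
  interpret P: pair_sigma_finite "lborel :: (real^3) measure" "lborel \<Otimes>\<^sub>M lborel :: ((real^3) \<times> (real^3)) measure"
    by (intro pair_sigma_finite.intro lborel.sigma_finite_measure_axioms lborel_pair.sigma_finite_measure_axioms)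
  define H where "H p = g (fst p) * f (snd p)" for p
  have iH: "integrable (lborel \<Otimes>\<^sub>M lborel) H"
    unfolding H_def by (rule integrable_product[OF g f])
  then have [measurable]: "H \<in> borel_measurable (lborel \<Otimes>\<^sub>M lborel)" by auto
  define Q where "Q h p = complex_of_real (gauss s h) * cis (h \<bullet> (fst p - snd p)) * H p" for h p
  have Qm [measurable]: "(\<lambda>(h, p). Q h p) \<in> borel_measurable (lborel \<Otimes>\<^sub>M (lborel \<Otimes>\<^sub>M lborel))"
    unfolding Q_def by measurable
  have normQ: "norm (Q h p) = gauss s h * norm (H p)" for h p
    by (simp add: Q_def norm_mult)
  have iQ: "integrable (lborel \<Otimes>\<^sub>M (lborel \<Otimes>\<^sub>M lborel)) (\<lambda>(h, p). Q h p)"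
  proof (rule P.Fubini_integrable[OF Qm])
    show "integrable lborel (\<lambda>h. LINT p|(lborel \<Otimes>\<^sub>M lborel). norm (case (h, p) of (h, p) \<Rightarrow> Q h p))"
      by (simp add: normQ gauss_integrable[OF s])
    show "AE h in lborel. integrable (lborel \<Otimes>\<^sub>M lborel) (\<lambda>p. case (h, p) of (h, p) \<Rightarrow> Q h p)"
    proof (rule AE_I2)
      fix h
      have "integrable (lborel \<Otimes>\<^sub>M lborel) (\<lambda>p. gauss s h * norm (H p))"
        using iH by (intro integrable_mult_right integrable_norm)
      then show "integrable (lborel \<Otimes>\<^sub>M lborel) (\<lambda>p. case (h, p) of (h, p) \<Rightarrow> Q h p)"
        by (rule Bochner_Integration.integrable_bound) (auto simp: normQ)
    qed
  qed
  have "(LINT h|lborel. LINT p|(lborel \<Otimes>\<^sub>M lborel). Q h p) = (LINT p|(lborel \<Otimes>\<^sub>M lborel). LINT h|lborel. Q h p)"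
    using P.Fubini_integral[OF iQ] by simp
  moreover have "(LINT h|lborel. Q h p) = complex_of_real ((2 * pi) ^ 3 * heat s (fst p - snd p)) * H p" for p
    unfolding Q_def by (simp add: gauss_fourier[OF s])
  moreover have "(LINT p|(lborel \<Otimes>\<^sub>M lborel). Q h p) = complex_of_real (gauss s h) *
        ((LINT y|lborel. cis (- (y \<bullet> h)) * f y) * (LINT x|lborel. cis (x \<bullet> h) * g x))" for h
  proof -
    have Qeq: "Q h p = complex_of_real (gauss s h) * ((cis (fst p \<bullet> h) * g (fst p)) * (cis (- (snd p \<bullet> h)) * f (snd p)))" for p
    proof -
      have "cis (h \<bullet> (fst p - snd p)) = cis (fst p \<bullet> h) * cis (- (snd p \<bullet> h))"
        by (simp add: cis_mult inner_diff_right inner_commute)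
      then show ?thesis by (simp add: Q_def H_def)
    qed
    have i: "integrable lborel (\<lambda>x. cis (x \<bullet> h) * g x)" "integrable lborel (\<lambda>y. cis (- (y \<bullet> h)) * f y)"
      using f g by (auto intro: Bochner_Integration.integrable_bound simp: norm_mult)
    show ?thesis
      unfolding Qeq integral_mult_right_zero integrable_product(2)[OF i] by (simp only: mult.commute)
  qed
  ultimately have "(LINT h|lborel. complex_of_real (gauss s h) *
        ((LINT y|lborel. cis (- (y \<bullet> h)) * f y) * (LINT x|lborel. cis (x \<bullet> h) * g x)))
    = (LINT p|(lborel \<Otimes>\<^sub>M lborel). complex_of_real ((2 * pi) ^ 3) * (complex_of_real (heat s (fst p - snd p)) * H p))"
    by (simp add: mult_ac)
  also have "\<dots> = complex_of_real ((2 * pi) ^ 3) * (LINT p|(lborel \<Otimes>\<^sub>M lborel). complex_of_real (heat s (fst p - snd p)) * H p)"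
    by (rule integral_mult_right_zero)
  finally show ?thesis by (simp add: H_def)
qed

subsection \<open>The transform on the intersection of L1 and L2\<close>

abbreviation fconst :: real where "fconst \<equiv> (2 * pi) powr (-3/2)"

lemma fconst_sq: "fconst\<^sup>2 = 1 / (2 * pi) ^ 3"
proof -
  have "fconst\<^sup>2 = (2 * pi) powr (-3)"
    unfolding power2_eq_square by (subst powr_add[symmetric]) simp
  also have "\<dots> = 1 / (2 * pi) ^ 3" by (simp add: powr_minus_divide)
  finally show ?thesis .
qed

lemma fourier_L1_measurable [measurable]:
  assumes [measurable]: "u \<in> borel_measurable borel"
  shows "fourier_L1 u \<in> borel_measurable borel"
  unfolding fourier_L1_def[abs_def] by measurable

lemma fourier_L1_cong_AE:
  assumes "u \<in> borel_measurable borel" "v \<in> borel_measurable borel" "AE x in lborel. u x = v x"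
  shows "fourier_L1 u = fourier_L1 v"
proof
  fix h
  note [measurable] = assms(1,2)
  have "(LINT x|lborel. cis (- (x \<bullet> h)) * u x) = (LINT x|lborel. cis (- (x \<bullet> h)) * v x)"
    by (rule integral_cong_AE) (measurable, use assms(3) in eventually_elim, simp)
  then show "fourier_L1 u h = fourier_L1 v h" by (simp add: fourier_L1_def)
qed

lemma integrable_cis_mult: "integrable lborel u \<Longrightarrow> integrable lborel (\<lambda>x. cis (f x) * u x)"
  if "f \<in> borel_measurable borel"
  using that by (auto intro: Bochner_Integration.integrable_bound simp: norm_mult)

lemma fourier_L1_diff:
  assumes "integrable lborel u" "integrable lborel v"
  shows "fourier_L1 (\<lambda>x. u x - v x) h = fourier_L1 u h - fourier_L1 v h"
proof -
  have "integrable lborel (\<lambda>x. cis (- (x \<bullet> h)) * u x)" "integrable lborel (\<lambda>x. cis (- (x \<bullet> h)) * v x)"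
    using assms by (auto intro!: integrable_cis_mult)
  then show ?thesis by (simp add: fourier_L1_def right_diff_distrib)
qed

lemma fourier_L1_add:
  assumes "integrable lborel u" "integrable lborel v"
  shows "fourier_L1 (\<lambda>x. u x + v x) h = fourier_L1 u h + fourier_L1 v h"
proof -
  have "integrable lborel (\<lambda>x. cis (- (x \<bullet> h)) * u x)" "integrable lborel (\<lambda>x. cis (- (x \<bullet> h)) * v x)"
    using assms by (auto intro!: integrable_cis_mult)
  then show ?thesis by (simp add: fourier_L1_def distrib_left)
qed

lemma fourier_L1_cmult: "fourier_L1 (\<lambda>x. c * u x) h = c * fourier_L1 u h"
  by (simp add: fourier_L1_def mult.left_commute)

lemma fourier_L1_heat:
  assumes u: "integrable lborel u" and s: "0 < s"
  shows "(LINT p|(lborel \<Otimes>\<^sub>M lborel). complex_of_real (heat s (fst p - snd p)) * (cnj (u (fst p)) * u (snd p)))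
    = (LINT h|lborel. complex_of_real (gauss s h * (cmod (fourier_L1 u h))\<^sup>2))"
proof -
  have c: "(LINT x|lborel. cis (x \<bullet> h) * cnj (u x)) = cnj (LINT y|lborel. cis (- (y \<bullet> h)) * u y)" for h
  proof -
    have "(LINT x|lborel. cis (x \<bullet> h) * cnj (u x)) = (LINT x|lborel. cnj (cis (- (x \<bullet> h)) * u x))"
      by (simp add: cis_cnj)
    also have "\<dots> = cnj (LINT y|lborel. cis (- (y \<bullet> h)) * u y)" by (rule Bochner_Integration.integral_cnj)
    finally show ?thesis .
  qed
  have sq: "(LINT y|lborel. cis (- (y \<bullet> h)) * u y) * (LINT x|lborel. cis (x \<bullet> h) * cnj (u x))
      = complex_of_real ((2 * pi) ^ 3 * (cmod (fourier_L1 u h))\<^sup>2)" for h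
    unfolding c complex_norm_square[symmetric] fourier_L1_def norm_mult norm_of_real abs_of_nonneg[OF powr_ge_zero] power_mult_distrib fconst_sq
    by simp
  have "(LINT h|lborel. complex_of_real (gauss s h) *
        ((LINT y|lborel. cis (- (y \<bullet> h)) * u y) * (LINT x|lborel. cis (x \<bullet> h) * cnj (u x))))
     = (LINT h|lborel. complex_of_real ((2 * pi) ^ 3) * complex_of_real (gauss s h * (cmod (fourier_L1 u h))\<^sup>2))"
    unfolding sq by (simp add: mult_ac)
  also have "\<dots> = complex_of_real ((2 * pi) ^ 3) * (LINT h|lborel. complex_of_real (gauss s h * (cmod (fourier_L1 u h))\<^sup>2))"
    by (rule integral_mult_right_zero)
  finally show ?thesis
    using heat_fubini[OF u integrable_cnj[OF u] s] by simp
qed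

lemma norm_integral_le:
  fixes f :: "_ \<Rightarrow> _ :: {banach, second_countable_topology}"
  assumes "integrable M g" "\<And>x. norm (f x) \<le> g x"
  shows "norm (LINT x|M. f x) \<le> (LINT x|M. g x)"
proof -
  have "norm (LINT x|M. f x) \<le> (LINT x|M. norm (f x))" by (rule integral_norm_bound)
  also have "\<dots> \<le> (LINT x|M. g x)"
    by (rule integral_mono'[OF assms]) (use order_trans[OF norm_ge_zero assms(2)] in auto)
  finally show ?thesis .
qed

lemma fourier_L1_bounded:
  assumes "integrable lborel u" shows "cmod (fourier_L1 u h) \<le> fconst * (LINT x|lborel. cmod (u x))"
proof -
  have "cmod (LINT x|lborel. cis (- (x \<bullet> h)) * u x) \<le> (LINT x|lborel. cmod (cis (- (x \<bullet> h)) * u x))"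
    by (rule integral_norm_bound)
  also have "\<dots> = (LINT x|lborel. cmod (u x))" by (simp add: norm_mult)
  finally show ?thesis by (simp add: fourier_L1_def norm_mult mult_left_mono)
qed

lemma gauss_fourier_integrable:
  assumes u: "integrable lborel u" and s: "0 < s"
  shows "integrable lborel (\<lambda>h. gauss s h * (cmod (fourier_L1 u h))\<^sup>2)"
proof -
  have [measurable]: "u \<in> borel_measurable borel" using u by auto
  define C where "C = fconst * (LINT x|lborel. cmod (u x))"
  have C: "(cmod (fourier_L1 u h))\<^sup>2 \<le> C\<^sup>2" for h
    unfolding C_def by (rule power_mono[OF fourier_L1_bounded[OF u]]) simp
  have "integrable lborel (\<lambda>h. gauss s h * C\<^sup>2)"
    by (intro integrable_mult_left gauss_integrable s)
  then show ?thesis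
    by (rule Bochner_Integration.integrable_bound)
       (measurable, rule AE_I2, auto intro!: mult_left_mono C simp: abs_mult)
qed

text \<open>A Schur test: \<open>heat s\<close> has mass 1 in either variable, and a product of two
  values is at most half the sum of their squares. The bound does not involve
  \<open>s\<close>.\<close>

lemma fourier_L1_gauss_le:
  assumes u: "integrable lborel u" "L2 u" and s: "0 < s"
  shows "(\<integral>\<^sup>+ h. ennreal (gauss s h * (cmod (fourier_L1 u h))\<^sup>2) \<partial>lborel) \<le> ennreal ((norm (cl u))\<^sup>2)"
proof -
  have [measurable]: "u \<in> borel_measurable borel" using u by auto
  have i: "integrable lborel (\<lambda>h. gauss s h * (cmod (fourier_L1 u h))\<^sup>2)"
    by (rule gauss_fourier_integrable[OF u(1) s])
  have swap: "(\<integral>\<^sup>+ p. f p \<partial>(lborel \<Otimes>\<^sub>M lborel)) = (\<integral>\<^sup>+ x. \<integral>\<^sup>+ y. f (x, y) \<partial>lborel \<partial>lborel)"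
     "(\<integral>\<^sup>+ p. f p \<partial>(lborel \<Otimes>\<^sub>M lborel)) = (\<integral>\<^sup>+ y. \<integral>\<^sup>+ x. f (x, y) \<partial>lborel \<partial>lborel)"
    if [measurable]: "f \<in> borel_measurable (lborel \<Otimes>\<^sub>M lborel)" for f :: "(real^3) \<times> (real^3) \<Rightarrow> ennreal"
    by (rule lborel.nn_integral_fst[symmetric, OF that], rule lborel_pair.nn_integral_snd[symmetric, OF that, simplified])
  have e1: "ennreal r * (ennreal a * ennreal b) + ennreal r * (ennreal a * ennreal c) = ennreal (r * (a * b) + r * (a * c))"
    if "0 \<le> r" "0 \<le> a" "0 \<le> b" "0 \<le> c" for r a b c
    using that by (simp add: ennreal_mult ennreal_plus)
  have "ennreal (LINT h|lborel. gauss s h * (cmod (fourier_L1 u h))\<^sup>2)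
      = ennreal (cmod (LINT h|lborel. complex_of_real (gauss s h * (cmod (fourier_L1 u h))\<^sup>2)))"
    by (simp only: integral_complex_of_real norm_of_real) (simp add: integral_nonneg_AE)
  also have "\<dots> = ennreal (cmod (LINT p|(lborel \<Otimes>\<^sub>M lborel). complex_of_real (heat s (fst p - snd p)) * (cnj (u (fst p)) * u (snd p))))"
    by (simp only: fourier_L1_heat[OF u(1) s])
  also have "\<dots> \<le> (\<integral>\<^sup>+ p. ennreal (cmod (complex_of_real (heat s (fst p - snd p)) * (cnj (u (fst p)) * u (snd p)))) \<partial>(lborel \<Otimes>\<^sub>M lborel))"
  proof (cases "integrable (lborel \<Otimes>\<^sub>M lborel) (\<lambda>p. complex_of_real (heat s (fst p - snd p)) * (cnj (u (fst p)) * u (snd p)))")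
    case True then show ?thesis by (rule integral_norm_bound_ennreal)
  qed (simp add: not_integrable_integral_eq)
  also have "\<dots> \<le> (\<integral>\<^sup>+ p. (ennreal (1/2) * (ennreal (heat s (fst p - snd p)) * ennreal ((cmod (u (fst p)))\<^sup>2))
        + ennreal (1/2) * (ennreal (heat s (fst p - snd p)) * ennreal ((cmod (u (snd p)))\<^sup>2))) \<partial>(lborel \<Otimes>\<^sub>M lborel))"
  proof (rule nn_integral_mono)
    fix p :: "(real^3) \<times> (real^3)"
    have "2 * (cmod (u (fst p)) * cmod (u (snd p))) \<le> (cmod (u (fst p)))\<^sup>2 + (cmod (u (snd p)))\<^sup>2"
      using sum_squares_bound[of "cmod (u (fst p))" "cmod (u (snd p))"] by simp
    then have "heat s (fst p - snd p) * (cmod (u (fst p)) * cmod (u (snd p)))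
       \<le> heat s (fst p - snd p) * ((cmod (u (fst p)))\<^sup>2 / 2 + (cmod (u (snd p)))\<^sup>2 / 2)"
      by (intro mult_left_mono) auto
    then have "ennreal (cmod (complex_of_real (heat s (fst p - snd p)) * (cnj (u (fst p)) * u (snd p))))
      \<le> ennreal (1/2 * (heat s (fst p - snd p) * (cmod (u (fst p)))\<^sup>2) + 1/2 * (heat s (fst p - snd p) * (cmod (u (snd p)))\<^sup>2))"
      by (intro ennreal_leI) (simp add: norm_mult distrib_left)
    also have "\<dots> = ennreal (1/2) * (ennreal (heat s (fst p - snd p)) * ennreal ((cmod (u (fst p)))\<^sup>2))
        + ennreal (1/2) * (ennreal (heat s (fst p - snd p)) * ennreal ((cmod (u (snd p)))\<^sup>2))"
      by (rule e1[symmetric]) auto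
    finally show "ennreal (cmod (complex_of_real (heat s (fst p - snd p)) * (cnj (u (fst p)) * u (snd p))))
      \<le> ennreal (1/2) * (ennreal (heat s (fst p - snd p)) * ennreal ((cmod (u (fst p)))\<^sup>2))
        + ennreal (1/2) * (ennreal (heat s (fst p - snd p)) * ennreal ((cmod (u (snd p)))\<^sup>2))" .
  qed
  also have "\<dots> = ennreal (1/2) * (\<integral>\<^sup>+ p. ennreal (heat s (fst p - snd p)) * ennreal ((cmod (u (fst p)))\<^sup>2) \<partial>(lborel \<Otimes>\<^sub>M lborel))
      + ennreal (1/2) * (\<integral>\<^sup>+ p. ennreal (heat s (fst p - snd p)) * ennreal ((cmod (u (snd p)))\<^sup>2) \<partial>(lborel \<Otimes>\<^sub>M lborel))"
    by (simp add: nn_integral_add nn_integral_cmult del: ennreal_half)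
  also have "(\<integral>\<^sup>+ p. ennreal (heat s (fst p - snd p)) * ennreal ((cmod (u (fst p)))\<^sup>2) \<partial>(lborel \<Otimes>\<^sub>M lborel)) = ennreal ((norm (cl u))\<^sup>2)"
    by (subst swap(1)) (measurable, simp add: nn_integral_multc nn_integral_heat s nn_integral_L2 u)
  also have "(\<integral>\<^sup>+ p. ennreal (heat s (fst p - snd p)) * ennreal ((cmod (u (snd p)))\<^sup>2) \<partial>(lborel \<Otimes>\<^sub>M lborel)) = ennreal ((norm (cl u))\<^sup>2)"
    by (subst swap(2)) (measurable, simp add: nn_integral_multc nn_integral_heat s nn_integral_L2 u)
  also have "ennreal (1/2) * ennreal ((norm (cl u))\<^sup>2) + ennreal (1/2) * ennreal ((norm (cl u))\<^sup>2) = ennreal ((norm (cl u))\<^sup>2)"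
    using e1[of "1/2" 1 "(norm (cl u))\<^sup>2" "(norm (cl u))\<^sup>2"] by simp
  finally show ?thesis
    using nn_integral_eq_integral[OF i] by simp
qed

lemma gauss_tendsto: "(\<lambda>n. gauss (1 / real (Suc n)) h) \<longlonglongrightarrow> 1"
proof -
  have "(\<lambda>n. exp (- (1 / real (Suc n) * (norm h)\<^sup>2 / 2))) \<longlonglongrightarrow> exp (- (0 * (norm h)\<^sup>2 / 2))"
    by (intro tendsto_intros LIMSEQ_Suc lim_1_over_n) auto
  then show ?thesis by (simp add: gauss_def)
qed

text \<open>As \<open>s\<close> tends to 0, \<open>gauss s\<close> increases to 1, and Fatou's lemma
  passes the bound that is uniform in \<open>s\<close> to the limit. Equality needs pointwise
  convergence on the other side as well and is left to \<open>fourier_L1_isometry\<close>.\<close>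

lemma fourier_L1_L2:
  assumes u: "integrable lborel u" "L2 u"
  shows "L2 (fourier_L1 u)" "norm (cl (fourier_L1 u)) \<le> norm (cl u)"
proof -
  have [measurable]: "u \<in> borel_measurable borel" using u by auto
  have "(\<integral>\<^sup>+ h. ennreal ((cmod (fourier_L1 u h))\<^sup>2) \<partial>lborel)
      = (\<integral>\<^sup>+ h. liminf (\<lambda>n. ennreal (gauss (1 / real (Suc n)) h * (cmod (fourier_L1 u h))\<^sup>2)) \<partial>lborel)"
  proof (rule nn_integral_cong)
    fix h
    have "(\<lambda>n. ennreal (gauss (1 / real (Suc n)) h * (cmod (fourier_L1 u h))\<^sup>2)) \<longlonglongrightarrow> ennreal (1 * (cmod (fourier_L1 u h))\<^sup>2)"
      by (intro tendsto_intros gauss_tendsto)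
    from lim_imp_Liminf[OF trivial_limit_sequentially this]
    show "ennreal ((cmod (fourier_L1 u h))\<^sup>2) = liminf (\<lambda>n. ennreal (gauss (1 / real (Suc n)) h * (cmod (fourier_L1 u h))\<^sup>2))"
      by simp
  qed
  also have "\<dots> \<le> liminf (\<lambda>n. \<integral>\<^sup>+ h. ennreal (gauss (1 / real (Suc n)) h * (cmod (fourier_L1 u h))\<^sup>2) \<partial>lborel)"
    by (rule nn_integral_liminf) measurable
  also have "\<dots> \<le> liminf (\<lambda>n::nat. ennreal ((norm (cl u))\<^sup>2))"
    by (intro Liminf_mono always_eventually allI fourier_L1_gauss_le u) simp
  also have "\<dots> = ennreal ((norm (cl u))\<^sup>2)" by (simp add: Liminf_const)
  finally have le: "(\<integral>\<^sup>+ h. ennreal ((cmod (fourier_L1 u h))\<^sup>2) \<partial>lborel) \<le> ennreal ((norm (cl u))\<^sup>2)" .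
  show "L2 (fourier_L1 u)" "norm (cl (fourier_L1 u)) \<le> norm (cl u)"
    by (rule L2_norm_le[OF _ le]; simp)+
qed

text \<open>Both sides of \<open>fourier_L1_heat\<close> converge as \<open>s\<close> tends to 0. On
  the Fourier side the square-integrability already known provides the dominating function; on the
  other side heat averages of a bounded continuous function converge pointwise.\<close>

lemma fourier_L1_isometry:
  assumes u: "integrable lborel u" "L2 u" and cont: "continuous_on UNIV u" and B: "\<And>x. cmod (u x) \<le> B"
  shows "norm (cl (fourier_L1 u)) = norm (cl u)"
proof -
  have [measurable]: "u \<in> borel_measurable borel" using u by auto
  have B0: "0 \<le> B" using order_trans[OF norm_ge_zero B] .
  define s where "s n = 1 / real (Suc n)" for n
  have s: "0 < s n" for n by (simp add: s_def)
  have s0: "s \<longlonglongrightarrow> 0" unfolding s_def by (intro LIMSEQ_Suc lim_1_over_n)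
  have LF: "L2 (fourier_L1 u)" by (rule fourier_L1_L2[OF u])
  have "(\<lambda>n. LINT h|lborel. gauss (s n) h * (cmod (fourier_L1 u h))\<^sup>2) \<longlonglongrightarrow> (LINT h|lborel. (cmod (fourier_L1 u h))\<^sup>2)"
  proof (rule integral_dominated_convergence[where w="\<lambda>h. (cmod (fourier_L1 u h))\<^sup>2"])
    show "AE h in lborel. (\<lambda>n. gauss (s n) h * (cmod (fourier_L1 u h))\<^sup>2) \<longlonglongrightarrow> (cmod (fourier_L1 u h))\<^sup>2"
    proof (rule AE_I2)
      fix h
      have "(\<lambda>n. gauss (s n) h * (cmod (fourier_L1 u h))\<^sup>2) \<longlonglongrightarrow> 1 * (cmod (fourier_L1 u h))\<^sup>2"
        unfolding s_def by (intro tendsto_intros gauss_tendsto)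
      then show "(\<lambda>n. gauss (s n) h * (cmod (fourier_L1 u h))\<^sup>2) \<longlonglongrightarrow> (cmod (fourier_L1 u h))\<^sup>2" by simp
    qed
    have "gauss (s n) h \<le> 1" for n h using s[of n] by (simp add: gauss_def)
    then show "AE h in lborel. norm (gauss (s n) h * (cmod (fourier_L1 u h))\<^sup>2) \<le> (cmod (fourier_L1 u h))\<^sup>2" for n
      by (auto simp: abs_mult intro!: mult_left_le_one_le)
  qed (use L2_integrable[OF LF] in auto)
  then have lim1: "(\<lambda>n. complex_of_real (LINT h|lborel. gauss (s n) h * (cmod (fourier_L1 u h))\<^sup>2)) \<longlonglongrightarrow> complex_of_real ((norm (cl (fourier_L1 u)))\<^sup>2)"
    unfolding norm_cl_sq[OF LF] by (rule tendsto_of_real)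
  \<comment> \<open>After the substitution \<open>y = x - sqrt (s n) *\<^sub>R z\<close> the heat
    average has the fixed kernel \<open>heat 1\<close>, which serves as dominating function up to
    the factor \<open>B\<close>.\<close>
  define A where "A n x = (LINT z|lborel. heat 1 z *\<^sub>R u (x - sqrt (s n) *\<^sub>R z))" for n x
  have [measurable]: "A n \<in> borel_measurable borel" for n unfolding A_def by measurable
  have ih: "integrable lborel (\<lambda>z. B * heat 1 z)" by (intro integrable_mult_right heat_integral) simp
  have bh: "norm (heat 1 z *\<^sub>R u y) \<le> B * heat 1 z" for z y
    using mult_right_mono[OF B, of "heat 1 z" y] by (simp add: mult.commute)
  have Ab: "cmod (A n x) \<le> B" for n x
  proof -
    have "cmod (A n x) \<le> (LINT z|lborel. B * heat 1 z)"
      unfolding A_def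
by (rule norm_integral_le[OF ih bh])
    then show ?thesis by (simp add: heat_integral)
  qed
  have Alim: "(\<lambda>n. A n x) \<longlonglongrightarrow> u x" for x
  proof -
    have "(\<lambda>n. A n x) \<longlonglongrightarrow> (LINT z|lborel. heat 1 z *\<^sub>R u x)"
      unfolding A_def
    proof (rule integral_dominated_convergence[OF _ _ ih])
      show "AE z in lborel. (\<lambda>n. heat 1 z *\<^sub>R u (x - sqrt (s n) *\<^sub>R z)) \<longlonglongrightarrow> heat 1 z *\<^sub>R u x"
      proof (rule AE_I2, intro tendsto_intros)
        fix z
        have "(\<lambda>n. x - sqrt (s n) *\<^sub>R z) \<longlonglongrightarrow> x - sqrt 0 *\<^sub>R z" by (intro tendsto_intros s0)
        then have "(\<lambda>n. x - sqrt (s n) *\<^sub>R z) \<longlonglongrightarrow> x" by simp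
        then show "(\<lambda>n. u (x - sqrt (s n) *\<^sub>R z)) \<longlonglongrightarrow> u x"
          using cont by (metis continuous_on_eq_continuous_at isCont_tendsto_compose open_UNIV UNIV_I)
      qed
    qed (use bh in auto)
    then show ?thesis by (simp add: heat_integral)
  qed
  have lim2: "(\<lambda>n. LINT x|lborel. A n x * cnj (u x)) \<longlonglongrightarrow> (LINT x|lborel. u x * cnj (u x))"
  proof (rule integral_dominated_convergence[where w="\<lambda>x. B * cmod (u x)"])
    show "AE x in lborel. (\<lambda>n. A n x * cnj (u x)) \<longlonglongrightarrow> u x * cnj (u x)"
      by (intro AE_I2 tendsto_intros Alim)
    show "AE x in lborel. norm (A n x * cnj (u x)) \<le> B * cmod (u x)" for n
      by (rule AE_I2) (auto simp: norm_mult intro!: mult_right_mono Ab)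
  qed (use u in auto)
  have eq: "complex_of_real (LINT h|lborel. gauss (s n) h * (cmod (fourier_L1 u h))\<^sup>2) = (LINT x|lborel. A n x * cnj (u x))" for n
  proof -
    have i: "integrable (lborel \<Otimes>\<^sub>M lborel) (\<lambda>p. complex_of_real (heat (s n) (fst p - snd p)) * (cnj (u (fst p)) * u (snd p)))"
    proof (rule lborel_pair.Fubini_integrable)
      show "AE x in lborel. integrable lborel (\<lambda>y. complex_of_real (heat (s n) (fst (x, y) - snd (x, y))) * (cnj (u (fst (x, y))) * u (snd (x, y))))"
      proof (rule AE_I2)
        fix x
        have "integrable lborel (\<lambda>y. heat (s n) (x - y))"
          using lborel_integrable_affine[OF heat_integral(1)[OF s[of n]], of "-1" x] by simp
        then have "integrable lborel (\<lambda>y. heat (s n) (x - y) * (B * B))" by (rule integrable_mult_left)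
        then show "integrable lborel (\<lambda>y. complex_of_real (heat (s n) (fst (x, y) - snd (x, y))) * (cnj (u (fst (x, y))) * u (snd (x, y))))"
          by (rule Bochner_Integration.integrable_bound)
             (use B0 in \<open>auto simp: norm_mult abs_mult intro!: mult_left_mono mult_mono B\<close>)
      qed
      have "integrable lborel (\<lambda>x. B * cmod (u x))" using u by auto
      then show "integrable lborel (\<lambda>x. LINT y|lborel. norm (complex_of_real (heat (s n) (fst (x, y) - snd (x, y))) * (cnj (u (fst (x, y))) * u (snd (x, y)))))"
      proof (rule Bochner_Integration.integrable_bound)
        show "AE x in lborel. norm (LINT y|lborel. norm (complex_of_real (heat (s n) (fst (x, y) - snd (x, y))) * (cnj (u (fst (x, y))) * u (snd (x, y))))) \<le> norm (B * cmod (u x))"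
        proof (rule AE_I2)
          fix x
          have ihx: "integrable lborel (\<lambda>y. heat (s n) (x - y))"
            using lborel_integrable_affine[OF heat_integral(1)[OF s[of n]], of "-1" x] by simp
          have i1: "(LINT y|lborel. heat (s n) (x - y)) = 1"
            using lborel_integral_affine[of "heat (s n)" "-1" x] heat_integral(2)[OF s[of n]] by simp
          have "norm (LINT y|lborel. norm (complex_of_real (heat (s n) (x - y)) * (cnj (u x) * u y))) \<le> (LINT y|lborel. heat (s n) (x - y) * (B * cmod (u x)))"
          proof (rule norm_integral_le)
            show "norm (norm (complex_of_real (heat (s n) (x - y)) * (cnj (u x) * u y))) \<le> heat (s n) (x - y) * (B * cmod (u x))" for y
              by (auto simp: norm_mult mult.commute[of "cmod (u x)"] intro!: mult_left_mono mult_right_mono B)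
            show "integrable lborel (\<lambda>y. heat (s n) (x - y) * (B * cmod (u x)))"
              using ihx by (rule integrable_mult_left)
          qed
          then show "norm (LINT y|lborel. norm (complex_of_real (heat (s n) (fst (x, y) - snd (x, y))) * (cnj (u (fst (x, y))) * u (snd (x, y))))) \<le> norm (B * cmod (u x))"
            using i1 B0 by simp
        qed
      qed measurable
    qed measurable
    have inner: "(LINT y|lborel. complex_of_real (heat (s n) (x - y)) * (cnj (u x) * u y)) = A n x * cnj (u x)" for x
    proof -
      have sc: "heat (s n) (sqrt (s n) *\<^sub>R z) * sqrt (s n) ^ 3 = heat 1 z" for z :: "real^3"
      proof -
        have "sqrt (s n) ^ 3 = s n powr (3/2)"
        proof -
          have "sqrt (s n) ^ 3 = (s n powr (1/2)) powr 3"
            using s[of n] by (simp add: powr_half_sqrt)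
          then show ?thesis by (simp add: powr_powr)
        qed
        moreover have "(2 * pi * s n) powr (-3/2) = (2 * pi) powr (-3/2) * s n powr (-3/2)"
          using s[of n] by (simp add: powr_mult)
        moreover have "s n powr (-3/2) * s n powr (3/2) = 1"
          using s[of n] by (simp flip: powr_add)
        ultimately show ?thesis
          using s[of n] by (simp add: heat_def power_mult_distrib)
      qed
      have "(LINT y|lborel. complex_of_real (heat (s n) (x - y)) * (cnj (u x) * u y))
          = sqrt (s n) ^ 3 *\<^sub>R (LINT z|lborel. complex_of_real (heat (s n) (sqrt (s n) *\<^sub>R z)) * (cnj (u x) * u (x - sqrt (s n) *\<^sub>R z)))"
        using lborel_integral_affine[of "\<lambda>y. complex_of_real (heat (s n) (x - y)) * (cnj (u x) * u y)" "- sqrt (s n)" x] s[of n]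
        by simp
      also have "\<dots> = (LINT z|lborel. sqrt (s n) ^ 3 *\<^sub>R (complex_of_real (heat (s n) (sqrt (s n) *\<^sub>R z)) * (cnj (u x) * u (x - sqrt (s n) *\<^sub>R z))))"
        by (rule integral_scaleR_right[symmetric])
      also have "\<dots> = (LINT z|lborel. (heat 1 z *\<^sub>R u (x - sqrt (s n) *\<^sub>R z)) * cnj (u x))"
      proof (rule Bochner_Integration.integral_cong)
        fix z
        have "sqrt (s n) ^ 3 *\<^sub>R (complex_of_real (heat (s n) (sqrt (s n) *\<^sub>R z)) * (cnj (u x) * u (x - sqrt (s n) *\<^sub>R z)))
          = complex_of_real (heat (s n) (sqrt (s n) *\<^sub>R z) * sqrt (s n) ^ 3) * u (x - sqrt (s n) *\<^sub>R z) * cnj (u x)"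
          by (simp add: scaleR_conv_of_real mult_ac)
        then show "sqrt (s n) ^ 3 *\<^sub>R (complex_of_real (heat (s n) (sqrt (s n) *\<^sub>R z)) * (cnj (u x) * u (x - sqrt (s n) *\<^sub>R z)))
          = (heat 1 z *\<^sub>R u (x - sqrt (s n) *\<^sub>R z)) * cnj (u x)"
          unfolding sc by (simp add: scaleR_conv_of_real)
      qed simp
      also have "\<dots> = A n x * cnj (u x)" unfolding A_def by (rule integral_mult_left_zero)
      finally show ?thesis .
    qed
    have "complex_of_real (LINT h|lborel. gauss (s n) h * (cmod (fourier_L1 u h))\<^sup>2)
      = (LINT p|(lborel \<Otimes>\<^sub>M lborel). complex_of_real (heat (s n) (fst p - snd p)) * (cnj (u (fst p)) * u (snd p)))"
      unfolding fourier_L1_heat[OF u(1) s[of n]] by (rule integral_complex_of_real[symmetric])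
    also have "\<dots> = (LINT x|lborel. A n x * cnj (u x))"
      unfolding lborel_pair.integral_fst'[OF i, symmetric] by (simp add: inner)
    finally show ?thesis .
  qed
  have "complex_of_real ((norm (cl (fourier_L1 u)))\<^sup>2) = (LINT x|lborel. u x * cnj (u x))"
    using LIMSEQ_unique[OF lim1[unfolded eq] lim2] .
  also have "\<dots> = complex_of_real ((norm (cl u))\<^sup>2)"
    unfolding complex_norm_square[symmetric] norm_cl_sq[OF u(2)] by (rule integral_complex_of_real)
  finally have "(norm (cl (fourier_L1 u)))\<^sup>2 = (norm (cl u))\<^sup>2" by (simp only: of_real_eq_iff)
  then show ?thesis by (simp add: power2_eq_iff_nonneg)
qed

subsection \<open>The transform on L2\<close>

definition ball_cut :: "real \<Rightarrow> real^3 \<Rightarrow> complex" where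
  "ball_cut R x = indicator (ball 0 R) x"

lemma ball_cut_measurable [measurable]: "ball_cut R \<in> borel_measurable borel"
  unfolding ball_cut_def[abs_def] by (intro borel_measurable_indicator) simp

lemma cmod_ball_cut: "cmod (ball_cut R x) \<le> 1"
  by (simp add: ball_cut_def indicator_def)

lemma bmult_ball_cut [simp]: "bmult (ball_cut R)"
  by (rule bmultI[OF _ cmod_ball_cut]) simp

lemma ball_cut_L1_L2:
  assumes "L2 u" shows "L2 (\<lambda>x. ball_cut R x * u x)" "integrable lborel (\<lambda>x. ball_cut R x * u x)"
proof -
  show "L2 (\<lambda>x. ball_cut R x * u x)" by (rule L2_mult_bmult[OF _ assms]) simp
  have "L2 (ball_cut R)"
    by (rule L2_bounded_support(1)[OF _ cmod_ball_cut, where R=R]) (auto simp: ball_cut_def indicator_def)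
  then show "integrable lborel (\<lambda>x. ball_cut R x * u x)" using assms by (rule L2_mult_integrable)
qed

lemma mlt_ball_cut_tendsto:
  assumes "filterlim R at_top sequentially"
  shows "(\<lambda>n. mlt (ball_cut (R n)) f) \<longlonglongrightarrow> f"
proof -
  have "(\<lambda>n. mlt (ball_cut (R n)) f) \<longlonglongrightarrow> mlt (\<lambda>_. 1) f"
  proof (rule mlt_tendsto[OF _ cmod_ball_cut])
    fix x :: "real^3"
    have "eventually (\<lambda>n. norm x < R n) sequentially"
      using assms by (simp add: filterlim_at_top_dense)
    then have "eventually (\<lambda>n. ball_cut (R n) x = 1) sequentially"
      by eventually_elim (simp add: ball_cut_def)
    then show "(\<lambda>n. ball_cut (R n) x) \<longlonglongrightarrow> 1" by (rule tendsto_eventually)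
  qed simp
  then show ?thesis by simp
qed

lemma fourier_L1_dist:
  assumes "integrable lborel u" "L2 u" "integrable lborel v" "L2 v"
  shows "norm (cl (fourier_L1 u) - cl (fourier_L1 v)) \<le> norm (cl u - cl v)"
proof -
  have "fourier_L1 (\<lambda>x. u x - v x) = (\<lambda>h. fourier_L1 u h - fourier_L1 v h)"
    by (rule ext, rule fourier_L1_diff) (use assms in auto)
  then have "cl (fourier_L1 u) - cl (fourier_L1 v) = cl (fourier_L1 (\<lambda>x. u x - v x))"
    by (subst cl_diff[symmetric]) (use assms in \<open>auto intro: fourier_L1_L2\<close>)
  also have "norm \<dots> \<le> norm (cl (\<lambda>x. u x - v x))"
    by (rule fourier_L1_L2) (use assms in \<open>auto intro: L2_diff\<close>)
  finally show ?thesis using assms by (simp add: cl_diff)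
qed

definition FTcut :: "real \<Rightarrow> l2 \<Rightarrow> l2" where
  "FTcut R f = cl (fourier_L1 (\<lambda>x. ball_cut R x * rp f x))"

definition FT :: "l2 \<Rightarrow> l2" where
  "FT f = lim (\<lambda>n. FTcut (real n) f)"

lemma FTcut_dist: "norm (FTcut R f - cl (fourier_L1 u)) \<le> norm (mlt (ball_cut R) f - cl u)"
  if "integrable lborel u" "L2 u"
  unfolding FTcut_def mlt_def by (intro fourier_L1_dist that ball_cut_L1_L2 L2_rp)

lemma FTcut_FTcut_dist: "norm (FTcut R f - FTcut R' g) \<le> norm (mlt (ball_cut R) f - mlt (ball_cut R') g)"
  unfolding FTcut_def mlt_def by (intro fourier_L1_dist ball_cut_L1_L2 L2_rp)

lemma FTcut_tendsto_nat: "(\<lambda>n. FTcut (real n) f) \<longlonglongrightarrow> FT f"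
proof -
  have "Cauchy (\<lambda>n. mlt (ball_cut (real n)) f)"
    by (rule LIMSEQ_imp_Cauchy[OF mlt_ball_cut_tendsto[OF filterlim_real_sequentially]])
  then have "Cauchy (\<lambda>n. FTcut (real n) f)"
    unfolding Cauchy_iff using FTcut_FTcut_dist by (meson le_less_trans)
  then show ?thesis
    unfolding FT_def by (simp add: Cauchy_convergent_iff convergent_LIMSEQ_iff)
qed

text \<open>The problem lets a real radius tend to infinity, whereas \<open>FT\<close> is defined
  with integer radii. Two truncations with large radii differ little before the transform, hence
  also after it.\<close>

lemma FTcut_tendsto:
  assumes "filterlim R at_top sequentially" shows "(\<lambda>n. FTcut (R n) f) \<longlonglongrightarrow> FT f"
proof -
  have "(\<lambda>n. mlt (ball_cut (R n)) f - mlt (ball_cut (real n)) f) \<longlonglongrightarrow> f - f"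
    by (intro tendsto_diff mlt_ball_cut_tendsto assms filterlim_real_sequentially)
  then have "(\<lambda>n. norm (mlt (ball_cut (R n)) f - mlt (ball_cut (real n)) f)) \<longlonglongrightarrow> 0"
    using tendsto_norm_zero by fastforce
  then have "(\<lambda>n. FTcut (R n) f - FTcut (real n) f) \<longlonglongrightarrow> 0"
    by (rule Lim_null_comparison[rotated]) (simp add: FTcut_FTcut_dist)
  from tendsto_add[OF this FTcut_tendsto_nat[of f]] show ?thesis by simp
qed

lemma FT_cl:
  assumes u: "integrable lborel u" "L2 u" shows "FT (cl u) = cl (fourier_L1 u)"
proof (rule LIMSEQ_unique[OF FTcut_tendsto_nat])
  have "(\<lambda>n. mlt (ball_cut (real n)) (cl u) - cl u) \<longlonglongrightarrow> cl u - cl u"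
    by (intro tendsto_diff mlt_ball_cut_tendsto filterlim_real_sequentially tendsto_const)
  then have "(\<lambda>n. norm (mlt (ball_cut (real n)) (cl u) - cl u)) \<longlonglongrightarrow> 0"
    using tendsto_norm_zero by fastforce
  then have "(\<lambda>n. FTcut (real n) (cl u) - cl (fourier_L1 u)) \<longlonglongrightarrow> 0"
    by (rule Lim_null_comparison[rotated]) (simp add: FTcut_dist u)
  then show "(\<lambda>n. FTcut (real n) (cl u)) \<longlonglongrightarrow> cl (fourier_L1 u)" by (rule LIM_zero_cancel)
qed

lemma FTcut_add: "FTcut R (f + g) = FTcut R f + FTcut R g"
proof -
  have "fourier_L1 (\<lambda>x. ball_cut R x * rp (f + g) x) = fourier_L1 (\<lambda>x. ball_cut R x * rp f x + ball_cut R x * rp g x)"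
    by (rule fourier_L1_cong_AE) (measurable, use rp_add[of f g] in eventually_elim, simp add: distrib_left)
  also have "\<dots> = (\<lambda>h. fourier_L1 (\<lambda>x. ball_cut R x * rp f x) h + fourier_L1 (\<lambda>x. ball_cut R x * rp g x) h)"
    by (rule ext, rule fourier_L1_add) (auto intro: ball_cut_L1_L2)
  finally show ?thesis unfolding FTcut_def by (simp add: cl_add fourier_L1_L2 ball_cut_L1_L2)
qed

lemma FTcut_cmult: "FTcut R (mlt (\<lambda>_. c) f) = mlt (\<lambda>_. c) (FTcut R f)"
proof -
  have "fourier_L1 (\<lambda>x. ball_cut R x * rp (mlt (\<lambda>_. c) f) x) = fourier_L1 (\<lambda>x. c * (ball_cut R x * rp f x))"
    by (rule fourier_L1_cong_AE) (measurable, use rp_mlt[OF bmult_const, of c f] in eventually_elim, simp)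
  also have "\<dots> = (\<lambda>h. c * fourier_L1 (\<lambda>x. ball_cut R x * rp f x) h)"
    by (rule ext, rule fourier_L1_cmult)
  finally show ?thesis unfolding FTcut_def by (simp add: mlt_cl fourier_L1_L2 ball_cut_L1_L2)
qed

lemma FT_add: "FT (f + g) = FT f + FT g"
proof (rule LIMSEQ_unique[OF FTcut_tendsto_nat])
  show "(\<lambda>n. FTcut (real n) (f + g)) \<longlonglongrightarrow> FT f + FT g"
    unfolding FTcut_add by (intro tendsto_add FTcut_tendsto_nat)
qed

lemma FT_cmult: "FT (mlt (\<lambda>_. c) f) = mlt (\<lambda>_. c) (FT f)"
proof (rule LIMSEQ_unique[OF FTcut_tendsto_nat])
  show "(\<lambda>n. FTcut (real n) (mlt (\<lambda>_. c) f)) \<longlonglongrightarrow> mlt (\<lambda>_. c) (FT f)"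
    unfolding FTcut_cmult
    by (rule bounded_linear.tendsto[OF bounded_linear_mlt[OF bmult_const] FTcut_tendsto_nat])
qed

lemma FT_scaleR: "FT (r *\<^sub>R f) = r *\<^sub>R FT f"
  using FT_cmult[of "complex_of_real r" f] by (simp add: mlt_real)

lemma norm_FT_le: "norm (FT f) \<le> norm f"
proof (rule LIMSEQ_le[OF tendsto_norm[OF FTcut_tendsto_nat] tendsto_const])
  have "norm (FTcut (real n) f) \<le> norm f" for n
  proof -
    have "norm (FTcut (real n) f) \<le> norm (mlt (ball_cut (real n)) f)"
      unfolding FTcut_def mlt_def by (intro fourier_L1_L2 ball_cut_L1_L2 L2_rp)
    also have "\<dots> \<le> 1 * norm f" by (rule norm_mlt_le[OF _ cmod_ball_cut]) simp
    finally show ?thesis by simp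
  qed
  then show "\<exists>N. \<forall>n\<ge>N. norm (FTcut (real n) f) \<le> norm f" by blast
qed

lemma bounded_linear_FT: "bounded_linear FT"
  by (rule bounded_linear_intro[where K=1]) (auto simp: FT_add FT_scaleR norm_FT_le)

lemma FT_diff: "FT (f - g) = FT f - FT g"
  by (rule linear_diff[OF bounded_linear.linear[OF bounded_linear_FT]])

text \<open>Equality holds on the dense class of \<open>continuous_L1_dense\<close>, and the
  contraction bound \<open>norm_FT_le\<close> carries it to all of L2.\<close>

lemma norm_FT [simp]: "norm (FT f) = norm f"
proof (rule antisym[OF norm_FT_le])
  show "norm f \<le> norm (FT f)"
  proof (rule field_le_epsilon)
    fix e :: real assume "0 < e"
    then have "0 < e / 2" by simp
    then obtain u B where u: "continuous_on UNIV u" "\<And>x. cmod (u x) \<le> B" "integrable lborel u" "L2 u" "norm (f - cl u) < e / 2"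
      using continuous_L1_dense by blast
    have "norm (FT (cl u)) = norm (cl u)"
      using fourier_L1_isometry[OF u(3,4,1,2)] by (simp add: FT_cl u)
    moreover have "norm (FT (f - cl u)) \<le> norm (f - cl u)" by (rule norm_FT_le)
    moreover have "norm f \<le> norm (f - cl u) + norm (cl u)" using norm_triangle_ineq[of "f - cl u" "cl u"] by simp
    moreover have "norm (FT (cl u)) \<le> norm (FT f) + norm (FT (f - cl u))"
      using norm_triangle_ineq4[of "FT f" "FT (f - cl u)"] by (simp add: FT_diff)
    ultimately show "norm f \<le> norm (FT f) + e" using u(5) by linarith
  qed
qed

text \<open>Polarisation, for which additivity and preservation of norms suffice.\<close>

lemma inner_isometry:
  fixes L :: "l2 \<Rightarrow> l2"
  assumes add: "\<And>f g. L (f + g) = L f + L g" and norm: "\<And>f. norm (L f) = norm f"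
  shows "inner (L f) (L g) = inner f g"
  by (simp add: dot_norm norm flip: add)

lemma inner_FT [simp]: "inner (FT f) (FT g) = inner f g"
  by (rule inner_isometry) (simp_all add: FT_add)

section \<open>The inverse transform\<close>

text \<open>Conjugating before and after reverses the sign of the phase, and makes isometry
  immediate. That this map inverts \<open>FT\<close> on both sides follows from
  \<open>FT_adjoint\<close> and the two isometries, with no inversion formula for integrals.\<close>

definition FTi :: "l2 \<Rightarrow> l2" where "FTi f = cnjl (FT (cnjl f))"

lemma FTi_add: "FTi (f + g) = FTi f + FTi g"
  by (simp add: FTi_def cnjl_add FT_add)

lemma FTi_scaleR: "FTi (r *\<^sub>R f) = r *\<^sub>R FTi f"
  by (simp add: FTi_def cnjl_scaleR FT_scaleR)

lemma norm_FTi [simp]: "norm (FTi f) = norm f"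
  by (simp add: FTi_def)

lemma bounded_linear_FTi: "bounded_linear FTi"
  by (rule bounded_linear_intro[where K=1]) (auto simp: FTi_add FTi_scaleR)

lemma inner_FTi [simp]: "inner (FTi f) (FTi g) = inner f g"
  by (rule inner_isometry) (simp_all add: FTi_add)

text \<open>Fubini's theorem for the phase, legitimate because both functions are integrable;
  \<open>FT_adjoint\<close> then reaches all of L2 by cutting off to balls.\<close>

lemma FT_adjoint_L1:
  assumes u: "integrable lborel u" "L2 u" and v: "integrable lborel v" "L2 v"
  shows "inner (FT (cl u)) (cl v) = inner (cl u) (FTi (cl v))"
proof -
  have [measurable]: "u \<in> borel_measurable borel" "v \<in> borel_measurable borel" using u v by auto
  have vc: "integrable lborel (\<lambda>x. cnj (v x))" "L2 (\<lambda>x. cnj (v x))" using v by (auto intro: L2_cnj)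
  define Q where "Q x h = cis (- (x \<bullet> h)) * u x * cnj (v h)" for x h
  have iQ: "integrable (lborel \<Otimes>\<^sub>M lborel) (\<lambda>(x, h). Q x h)"
  proof (rule Bochner_Integration.integrable_bound[OF integrable_product(1)[OF u(1) vc(1)]])
    show "(\<lambda>(x, h). Q x h) \<in> borel_measurable (lborel \<Otimes>\<^sub>M lborel)" unfolding Q_def by measurable
    show "AE p in lborel \<Otimes>\<^sub>M lborel. norm (case p of (x, h) \<Rightarrow> Q x h) \<le> norm (u (fst p) * cnj (v (snd p)))"
      by (rule AE_I2) (auto simp: Q_def norm_mult split: prod.split)
  qed
  have "(LINT h|lborel. fourier_L1 u h * cnj (v h)) = (LINT h|lborel. complex_of_real fconst * (LINT x|lborel. Q x h))"
    unfolding Q_def integral_mult_left_zero fourier_L1_def by (simp add: mult.assoc)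
  also have "\<dots> = complex_of_real fconst * (LINT h|lborel. LINT x|lborel. Q x h)"
    by (rule integral_mult_right_zero)
  also have "(LINT h|lborel. LINT x|lborel. Q x h) = (LINT x|lborel. LINT h|lborel. Q x h)"
    using lborel_pair.Fubini_integral[OF iQ] by simp
  also have "complex_of_real fconst * (LINT x|lborel. LINT h|lborel. Q x h)
     = (LINT x|lborel. complex_of_real fconst * (LINT h|lborel. Q x h))"
    by (rule integral_mult_right_zero[symmetric])
  also have "\<dots> = (LINT x|lborel. u x * cnj (cnj (fourier_L1 (\<lambda>h. cnj (v h)) x)))"
  proof (rule Bochner_Integration.integral_cong[OF refl])
    fix x
    have "(LINT h|lborel. Q x h) = (LINT h|lborel. u x * (cis (- (h \<bullet> x)) * cnj (v h)))"
      by (simp add: Q_def inner_commute mult_ac)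
    also have "\<dots> = u x * (LINT h|lborel. cis (- (h \<bullet> x)) * cnj (v h))" by (rule integral_mult_right_zero)
    finally show "complex_of_real fconst * (LINT h|lborel. Q x h) = u x * cnj (cnj (fourier_L1 (\<lambda>h. cnj (v h)) x))"
      by (simp add: fourier_L1_def)
  qed
  finally have "(LINT h|lborel. fourier_L1 u h * cnj (v h)) = (LINT x|lborel. u x * cnj (cnj (fourier_L1 (\<lambda>h. cnj (v h)) x)))" .
  then show ?thesis
    using u v vc by (simp add: FT_cl FTi_def cnjl_cl inner_cl fourier_L1_L2 L2_cnj)
qed

lemma FT_adjoint: "inner (FT f) g = inner f (FTi g)"
proof (rule LIMSEQ_unique)
  note b = mlt_ball_cut_tendsto[OF filterlim_real_sequentially]
  show "(\<lambda>n. inner (FT (mlt (ball_cut (real n)) f)) (mlt (ball_cut (real n)) g)) \<longlonglongrightarrow> inner (FT f) g"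
    by (intro tendsto_inner bounded_linear.tendsto[OF bounded_linear_FT] b)
  have "inner (FT (mlt (ball_cut R) f)) (mlt (ball_cut R) g) = inner (mlt (ball_cut R) f) (FTi (mlt (ball_cut R) g))" for R
    unfolding mlt_def by (intro FT_adjoint_L1 ball_cut_L1_L2 L2_rp)
  then show "(\<lambda>n. inner (FT (mlt (ball_cut (real n)) f)) (mlt (ball_cut (real n)) g)) \<longlonglongrightarrow> inner f (FTi g)"
    by (simp only:) (intro tendsto_inner bounded_linear.tendsto[OF bounded_linear_FTi] b)
qed

lemma inner_ext: "(\<And>h. inner f h = inner g h) \<Longrightarrow> f = (g :: l2)"
  using inner_eq_zero_iff[of "f - g"] by (simp add: inner_diff_left)

lemma FTi_FT [simp]: "FTi (FT f) = f"
proof (rule inner_ext)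
  fix h
  have "inner (FTi (FT f)) h = inner (FT h) (FT f)" by (simp only: FT_adjoint inner_commute[of h])
  then show "inner (FTi (FT f)) h = inner f h" by (simp add: inner_commute)
qed

lemma FT_FTi [simp]: "FT (FTi f) = f"
  by (rule inner_ext) (simp add: FT_adjoint)

subsection \<open>The transform of the problem statement\<close>

text \<open>\<open>fourier u\<close> is a choice among all measurable limits of the truncated
  transforms. \<open>FT (cl u)\<close> is one such limit, and by the triangle inequality any two
  have distance 0, so the choice is determined almost everywhere.\<close>

lemma fourier_spec:
  assumes u: "L2 u"
  shows "fourier u \<in> borel_measurable borel" "AE h in lborel. fourier u h = rp (FT (cl u)) h"
proof -
  define D where "D R g = (\<integral>\<^sup>+ h. ennreal ((cmod (fourier_L1 (\<lambda>x. indicator (ball 0 R) x * u x) h - g h))\<^sup>2) \<partial>lborel)"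
    for R :: real and g :: "real^3 \<Rightarrow> complex"
  define P where "P g \<longleftrightarrow> g \<in> borel_measurable lborel \<and> ((\<lambda>R. D R g) \<longlongrightarrow> 0) at_top" for g
  have fP: "fourier u = (SOME g. P g)" unfolding fourier_def P_def D_def ..
  note [measurable] = L2_measurable[OF u]
  have cut: "fourier_L1 (\<lambda>x. indicator (ball 0 R) x * u x) = fourier_L1 (\<lambda>x. ball_cut R x * rp (cl u) x)" for R
    unfolding ball_cut_def[symmetric]
    by (rule fourier_L1_cong_AE) (measurable, use rp_cl[OF u] in eventually_elim, simp)
  have LF: "L2 (fourier_L1 (\<lambda>x. ball_cut R x * rp (cl u) x))" for R
    by (intro fourier_L1_L2 ball_cut_L1_L2 L2_rp)
  have D_FT: "D R (rp (FT (cl u))) = ennreal ((norm (FTcut R (cl u) - FT (cl u)))\<^sup>2)" for R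
    unfolding D_def cut FTcut_def
    using nn_integral_L2[OF L2_diff[OF LF[of R] L2_rp[of "FT (cl u)"]]] cl_diff[OF LF[of R] L2_rp[of "FT (cl u)"]]
    by simp
  have "P (rp (FT (cl u)))"
    unfolding P_def
  proof
    show "((\<lambda>R. D R (rp (FT (cl u)))) \<longlongrightarrow> 0) at_top"
    proof (rule tendsto_at_topI_sequentially)
      fix R :: "nat \<Rightarrow> real" assume "filterlim R at_top sequentially"
      from tendsto_diff[OF FTcut_tendsto[OF this] tendsto_const]
      have "(\<lambda>n. FTcut (R n) (cl u) - FT (cl u)) \<longlonglongrightarrow> FT (cl u) - FT (cl u)" .
      then have "(\<lambda>n. ennreal ((norm (FTcut (R n) (cl u) - FT (cl u)))\<^sup>2)) \<longlonglongrightarrow> ennreal ((norm (FT (cl u) - FT (cl u)))\<^sup>2)"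
        by (intro tendsto_ennrealI tendsto_power tendsto_norm)
      then show "(\<lambda>n. D (R n) (rp (FT (cl u)))) \<longlonglongrightarrow> 0" unfolding D_FT by simp
    qed
  qed simp
  then have Pf: "P (fourier u)" unfolding fP by (rule someI[of P])
  then show m [measurable]: "fourier u \<in> borel_measurable borel" by (simp add: P_def)
  let ?g = "rp (FT (cl u))"
  have "(\<integral>\<^sup>+ h. ennreal ((cmod (fourier u h - ?g h))\<^sup>2) \<partial>lborel) \<le> 0"
  proof (rule tendsto_lowerbound)
    have "((\<lambda>R. 2 * D R (fourier u) + 2 * D R ?g) \<longlongrightarrow> 2 * 0 + 2 * 0) at_top"
      using Pf \<open>P ?g\<close> unfolding P_def by (intro tendsto_add ennreal_tendsto_cmult) auto
    then show "((\<lambda>R. 2 * D R (fourier u) + 2 * D R ?g) \<longlongrightarrow> 0) at_top" by simp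
    show "\<forall>\<^sub>F R in at_top. (\<integral>\<^sup>+ h. ennreal ((cmod (fourier u h - ?g h))\<^sup>2) \<partial>lborel) \<le> 2 * D R (fourier u) + 2 * D R ?g"
    proof (rule always_eventually, rule allI)
      fix R
      let ?F = "fourier_L1 (\<lambda>x. indicator (ball 0 R) x * u x)"
      have [measurable]: "?F \<in> borel_measurable borel" unfolding ball_cut_def[symmetric] by measurable
      have "(\<integral>\<^sup>+ h. ennreal ((cmod (fourier u h - ?g h))\<^sup>2) \<partial>lborel)
         \<le> (\<integral>\<^sup>+ h. (2 * ennreal ((cmod (?F h - fourier u h))\<^sup>2) + 2 * ennreal ((cmod (?F h - ?g h))\<^sup>2)) \<partial>lborel)"
      proof (rule nn_integral_mono)
        fix h
        have "(cmod (fourier u h - ?g h))\<^sup>2 \<le> 2 * (cmod (?F h - fourier u h))\<^sup>2 + 2 * (cmod (?F h - ?g h))\<^sup>2"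
          using cmod_add_sq_le[of "- (?F h - fourier u h)" "?F h - ?g h"] by (simp add: norm_minus_commute)
        from ennreal_leI[OF this]
        show "ennreal ((cmod (fourier u h - ?g h))\<^sup>2) \<le> 2 * ennreal ((cmod (?F h - fourier u h))\<^sup>2) + 2 * ennreal ((cmod (?F h - ?g h))\<^sup>2)"
          by (simp add: ennreal_mult)
      qed
      also have "\<dots> = 2 * D R (fourier u) + 2 * D R ?g"
        unfolding D_def by (simp add: nn_integral_add nn_integral_cmult)
      finally show "(\<integral>\<^sup>+ h. ennreal ((cmod (fourier u h - ?g h))\<^sup>2) \<partial>lborel) \<le> 2 * D R (fourier u) + 2 * D R ?g" .
    qed
  qed simp
  then have "AE h in lborel. ennreal ((cmod (fourier u h - ?g h))\<^sup>2) = 0"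
    by (subst nn_integral_0_iff_AE[symmetric]) auto
  then show "AE h in lborel. fourier u h = ?g h" by eventually_elim simp
qed

lemma L2_fourier: "L2 u \<Longrightarrow> L2 (fourier u)"
  by (rule L2_cong_AE[OF L2_rp[of "FT (cl u)"]]) (use fourier_spec[of u] in \<open>auto simp: eq_commute\<close>)

lemma cl_fourier: "L2 u \<Longrightarrow> cl (fourier u) = FT (cl u)"
  by (rule cl_eqI[OF L2_fourier fourier_spec(2)])

subsection \<open>Modulation and translation\<close>

definition transl :: "real^3 \<Rightarrow> l2 \<Rightarrow> l2" where
  "transl a f = cl (\<lambda>x. rp f (x - a))"

lemma AE_translate:
  assumes "AE x in lborel. P x" shows "AE x in lborel. P (x - a :: 'a::euclidean_space)"
proof -
  have "AE x in distr lborel borel (\<lambda>x. - a + x). P x"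
    by (subst lborel_distr_plus) (rule assms)
  then have "AE x in lborel. P (- a + x)" by (rule AE_distrD[rotated]) simp
  then show ?thesis by simp
qed

lemma L2_translate:
  assumes "L2 u" shows "L2 (\<lambda>x. u (x - a))"
  using lborel_integrable_affine[OF L2_integrable[OF assms], of 1 "-a"] assms
  by (auto simp: L2_def)

lemma rp_transl: "AE x in lborel. rp (transl a f) x = rp f (x - a)"
  unfolding transl_def by (intro rp_cl L2_translate L2_rp)

lemma transl_cl: "L2 u \<Longrightarrow> transl a (cl u) = cl (\<lambda>x. u (x - a))"
  unfolding transl_def by (rule cl_cong) (auto intro: L2_translate AE_translate rp_cl)

lemma transl_add: "transl a (f + g) = transl a f + transl a g"
  by (rule l2_eqI) (use rp_transl[of a "f + g"] rp_transl[of a f] rp_transl[of a g]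
      AE_translate[OF rp_add[of f g], of a] rp_add[of "transl a f" "transl a g"] in eventually_elim, simp)

lemma transl_scaleR: "transl a (r *\<^sub>R f) = r *\<^sub>R transl a f"
  by (rule l2_eqI) (use rp_transl[of a "r *\<^sub>R f"] rp_transl[of a f]
      AE_translate[OF rp_scaleR[of r f], of a] rp_scaleR[of r "transl a f"] in eventually_elim, simp)

lemma norm_transl [simp]: "norm (transl a f) = norm f"
proof -
  have "(norm (transl a f))\<^sup>2 = (norm f)\<^sup>2"
    using lborel_integral_affine[of "\<lambda>x. (cmod (rp f x))\<^sup>2" 1 "-a"]
    unfolding transl_def norm_cl_sq[OF L2_translate[OF L2_rp]] norm_l2_sq[of f] by simp
  then show ?thesis by (simp add: power2_eq_iff_nonneg)
qed

lemma bounded_linear_transl: "bounded_linear (transl a)"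
  by (rule bounded_linear_intro[where K=1]) (auto simp: transl_add transl_scaleR)

abbreviation modul :: "real^3 \<Rightarrow> real^3 \<Rightarrow> complex" where "modul a x \<equiv> cis (x \<bullet> a)"

lemma bmult_modul [simp]: "bmult (modul a)"
  by (rule bmultI[of _ 1]) auto

lemma FT_modul: "FT (mlt (modul a) f) = transl a (FT f)"
proof (rule LIMSEQ_unique)
  note b = mlt_ball_cut_tendsto[OF filterlim_real_sequentially]
  show "(\<lambda>n. FT (mlt (modul a) (mlt (ball_cut (real n)) f))) \<longlonglongrightarrow> FT (mlt (modul a) f)"
    by (intro bounded_linear.tendsto[OF bounded_linear_FT] bounded_linear.tendsto[OF bounded_linear_mlt] b) simp
  have "FT (mlt (modul a) (mlt (ball_cut R) f)) = transl a (FT (mlt (ball_cut R) f))" for R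
  proof -
    let ?u = "\<lambda>x. ball_cut R x * rp f x"
    have u: "L2 ?u" "integrable lborel ?u" by (auto intro: ball_cut_L1_L2)
    have v: "L2 (\<lambda>x. modul a x * ?u x)" "integrable lborel (\<lambda>x. modul a x * ?u x)"
      using u by (auto intro!: L2_mult_bmult integrable_cis_mult)
    have "fourier_L1 (\<lambda>x. modul a x * ?u x) = (\<lambda>h. fourier_L1 ?u (h - a))"
    proof
      fix h
      have e: "cis (- (x \<bullet> h)) * (modul a x * ?u x) = cis (- (x \<bullet> (h - a))) * ?u x" for x
        by (simp add: inner_diff_right cis_mult mult.assoc[symmetric])
      show "fourier_L1 (\<lambda>x. modul a x * ?u x) h = fourier_L1 ?u (h - a)" by (simp only: fourier_L1_def e)
    qed
    then show ?thesis
      unfolding mlt_def[of "ball_cut R"] using u v by (simp add: mlt_cl FT_cl transl_cl fourier_L1_L2)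
  qed
  then show "(\<lambda>n. FT (mlt (modul a) (mlt (ball_cut (real n)) f))) \<longlonglongrightarrow> transl a (FT f)"
    by (simp only:) (intro bounded_linear.tendsto[OF bounded_linear_FT] bounded_linear.tendsto[OF bounded_linear_transl] b)
qed

lemma parseval:
  assumes u: "L2 u" and v: "L2 v"
  shows "(LINT x|lborel. u x * cnj (v x)) = (LINT h|lborel. rp (FT (cl u)) h * cnj (rp (FT (cl v)) h))"
  using integral_mult_cnj[OF u v] integral_mult_cnj[OF L2_rp[of "FT (cl u)"] L2_rp[of "FT (cl v)"]]
  by (simp flip: FT_cmult)

text \<open>Absorbing the phase into \<open>v\<close> turns, by Parseval, the transform of a product
  into a correlation of two transforms. Keeping only moduli leads to integrals of nonnegative
  functions, to which Tonelli's theorem applies.\<close>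

lemma fourier_product_le:
  assumes u: "L2 u" and v: "L2 v"
  shows "ennreal (cmod (LINT x|lborel. cis (- (x \<bullet> h)) * (u x * cnj (v x))))
    \<le> (\<integral>\<^sup>+ a. ennreal (cmod (rp (FT (cl u)) a)) * ennreal (cmod (rp (FT (cl v)) (a - h))) \<partial>lborel)"
proof -
  have v': "L2 (\<lambda>x. modul h x * v x)" using v by (rule L2_mult_bmult[OF bmult_modul])
  have FTv: "FT (cl (\<lambda>x. modul h x * v x)) = transl h (FT (cl v))"
    using FT_modul[of h "cl v"] v by (simp add: mlt_cl)
  have "(LINT x|lborel. cis (- (x \<bullet> h)) * (u x * cnj (v x))) = (LINT x|lborel. u x * cnj (modul h x * v x))"
    by (simp add: cis_cnj mult_ac)
  also have "\<dots> = (LINT a|lborel. rp (FT (cl u)) a * cnj (rp (transl h (FT (cl v))) a))"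
    unfolding parseval[OF u v'] FTv ..
  finally have eq: "(LINT x|lborel. cis (- (x \<bullet> h)) * (u x * cnj (v x))) = (LINT a|lborel. rp (FT (cl u)) a * cnj (rp (transl h (FT (cl v))) a))" .
  have "ennreal (cmod (LINT x|lborel. cis (- (x \<bullet> h)) * (u x * cnj (v x))))
      \<le> (\<integral>\<^sup>+ a. ennreal (cmod (rp (FT (cl u)) a * cnj (rp (transl h (FT (cl v))) a))) \<partial>lborel)"
    unfolding eq by (intro integral_norm_bound_ennreal L2_mult_integrable L2_cnj L2_rp)
  also have "\<dots> = (\<integral>\<^sup>+ a. ennreal (cmod (rp (FT (cl u)) a)) * ennreal (cmod (rp (FT (cl v)) (a - h))) \<partial>lborel)"
    by (rule nn_integral_cong_AE) (use rp_transl[of h "FT (cl v)"] in eventually_elim, simp add: norm_mult ennreal_mult)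
  finally show ?thesis .
qed

section \<open>Schur tests\<close>

lemma dyadic_below:
  fixes t :: real assumes "0 < t" "t < 1"
  shows "\<exists>k::nat. (1/2)^(Suc k) \<le> t \<and> t < (1/2)^k"
proof -
  define n where "n = (LEAST n::nat. (1/2)^n \<le> t)"
  obtain m :: nat where "(1/2)^m < t" using real_arch_pow_inv[of t "1/2"] assms by auto
  then have n: "(1/2)^n \<le> t" unfolding n_def by (intro LeastI[of "\<lambda>n. (1/2)^n \<le> t" m] less_imp_le)
  then have "n \<noteq> 0" using assms by (cases n) auto
  then obtain k where k: "n = Suc k" by (cases n) auto
  then have "\<not> (1/2)^k \<le> t" using not_less_Least[of k "\<lambda>n. (1/2)^n \<le> t"] unfolding n_def by auto
  then show ?thesis using n k by auto
qed

lemma dyadic_above: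
  fixes t :: real assumes "1 \<le> t"
  shows "\<exists>k::nat. 2^k \<le> t \<and> t < 2^(Suc k)"
proof -
  define n where "n = (LEAST n::nat. t < 2^n)"
  obtain m :: nat where "t < 2^m" using real_arch_pow[of 2 t] by auto
  then have n: "t < 2^n" unfolding n_def by (rule LeastI)
  then have "n \<noteq> 0" using assms by (cases n) auto
  then obtain k where k: "n = Suc k" by (cases n) auto
  then have "\<not> t < 2^k" using not_less_Least[of k "\<lambda>n. t < 2^n"] unfolding n_def by auto
  then show ?thesis using n k by (intro exI[of _ k]) auto
qed

lemma term_le_suminf: "(f :: nat \<Rightarrow> ennreal) k \<le> suminf f"
  using sum_le_suminf[of f "{k}"] by (simp add: summableI)

text \<open>Crude on purpose: the largest value of the weight on the shell times the volume of the
  ball of radius \<open>2 * r\<close>. Only the resulting power of \<open>r\<close> matters.\<close>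

lemma shell_integral_le:
  fixes x r :: real
  assumes x: "0 \<le> x" and r: "0 < r"
  shows "(\<integral>\<^sup>+ y. ennreal (indicator {y. r \<le> norm y \<and> norm y < 2 * r} y * norm (y::real^3) powr (-x)) \<partial>lborel)
    \<le> ennreal (8 * unit_ball_vol 3 * r powr (3 - x))"
proof -
  have "(\<integral>\<^sup>+ y. ennreal (indicator {y. r \<le> norm y \<and> norm y < 2 * r} y * norm (y::real^3) powr (-x)) \<partial>lborel)
      \<le> (\<integral>\<^sup>+ y. ennreal (r powr (-x)) * indicator (ball (0::real^3) (2 * r)) y \<partial>lborel)"
  proof (rule nn_integral_mono)
    fix y :: "real^3"
    show "ennreal (indicator {y. r \<le> norm y \<and> norm y < 2 * r} y * norm y powr (-x))
      \<le> ennreal (r powr (-x)) * indicator (ball 0 (2 * r)) y"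
      using r x by (auto simp: indicator_def intro!: powr_mono2')
  qed
  also have "\<dots> = ennreal (r powr (-x)) * ennreal (unit_ball_vol 3 * (2 * r) ^ 3)"
    using r by (subst nn_integral_cmult_indicator) (auto simp: emeasure_ball)
  also have "\<dots> = ennreal (8 * unit_ball_vol 3 * (r powr (-x) * r powr 3))"
    using r by (subst ennreal_mult[symmetric]) (auto simp: power_mult_distrib algebra_simps)
  also have "r powr (-x) * r powr 3 = r powr (3 - x)" by (subst powr_add[symmetric]) simp
  finally show ?thesis .
qed

lemma geometric_shells:
  fixes q :: real assumes q: "0 < q" "q < 1" and K: "0 \<le> K"
  shows "(\<Sum>k. ennreal (K * q ^ k)) = ennreal (K / (1 - q))"
proof -
  have s: "(\<lambda>k. K * q ^ k) sums (K * (1 / (1 - q)))"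
    by (intro sums_mult geometric_sums) (use q in simp)
  have "(\<Sum>k. ennreal (K * q ^ k)) = ennreal (\<Sum>k. K * q ^ k)"
    by (rule suminf_ennreal2[OF _ sums_summable[OF s]]) (use q K in simp)
  then show ?thesis unfolding sums_unique[OF s, symmetric] by simp
qed

text \<open>Halving the radius multiplies the bound for a shell by \<open>2 powr (x - 3)\<close>,
  which is below 1 because \<open>x < 3\<close>; the shells sum to a geometric series.\<close>

lemma ball_integral_le:
  fixes x :: real assumes x: "0 \<le> x" "x < 3"
  shows "\<exists>C\<ge>0. \<forall>r>0. (\<integral>\<^sup>+ y. ennreal (indicator {y. norm y < r} y * norm (y::real^3) powr (-x)) \<partial>lborel)
    \<le> ennreal (C * r powr (3 - x))"
proof (intro exI conjI allI impI)
  define q :: real where "q = 2 powr (x - 3)"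
  define K :: real where "K = 8 * unit_ball_vol 3 * q"
  have q: "0 < q" "q < 1" using x powr_less_mono[of "x - 3" 0 2] by (auto simp: q_def)
  have K: "0 \<le> K" using q by (simp add: K_def)
  show "0 \<le> K / (1 - q)" using q K by simp
  fix r :: real assume r: "0 < r"
  have pw: "(r * (1/2)^Suc k) powr (3 - x) = r powr (3 - x) * q * q ^ k" for k
  proof -
    have "(1/2::real)^Suc k = 2 powr (- real (Suc k))"
      by (simp only: powr_minus powr_realpow[OF zero_less_numeral] power_one_over inverse_eq_divide)
    then have "((1/2)^Suc k) powr (3 - x) = q ^ Suc k"
      unfolding q_def by (simp only: powr_powr powr_power) (simp add: algebra_simps)
    then show ?thesis using r by (subst powr_mult) (simp_all only: power_Suc mult_ac)
  qed
  have "(\<integral>\<^sup>+ y. ennreal (indicator {y. norm y < r} y * norm (y::real^3) powr (-x)) \<partial>lborel)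
    \<le> (\<integral>\<^sup>+ y. (\<Sum>k. ennreal (indicator {y. r * (1/2)^Suc k \<le> norm y \<and> norm y < 2 * (r * (1/2)^Suc k)} y * norm (y::real^3) powr (-x))) \<partial>lborel)"
  proof (rule nn_integral_mono)
    fix y :: "real^3"
    show "ennreal (indicator {y. norm y < r} y * norm y powr (-x))
      \<le> (\<Sum>k. ennreal (indicator {y. r * (1/2)^Suc k \<le> norm y \<and> norm y < 2 * (r * (1/2)^Suc k)} y * norm y powr (-x)))"
    \<comment> \<open>The origin lies in no shell, but the integrand is 0 there, because
      \<open>0 powr a = 0\<close>.\<close>
    proof (cases "y \<noteq> 0 \<and> norm y < r")
      case True
      then obtain k where k: "(1/2)^(Suc k) \<le> norm y / r" "norm y / r < (1/2)^k"
        using dyadic_below[of "norm y / r"] r by auto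
      let ?f = "\<lambda>k. ennreal (indicator {y. r * (1/2)^Suc k \<le> norm y \<and> norm y < 2 * (r * (1/2)^Suc k)} y * norm y powr (-x))"
      have "ennreal (indicator {y. norm y < r} y * norm y powr (-x)) = ?f k"
        using True k r by (simp add: indicator_def field_simps)
      also have "?f k \<le> suminf ?f"
        by (rule term_le_suminf)
      finally show ?thesis .
    qed (auto simp: indicator_def)
  qed
  also have "\<dots> = (\<Sum>k. \<integral>\<^sup>+ y. ennreal (indicator {y. r * (1/2)^Suc k \<le> norm y \<and> norm y < 2 * (r * (1/2)^Suc k)} y * norm (y::real^3) powr (-x)) \<partial>lborel)"
    by (rule nn_integral_suminf) measurable
  also have "\<dots> \<le> (\<Sum>k. ennreal (K * r powr (3 - x) * q ^ k))"
  proof (rule suminf_le)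
    fix k
    have "(\<integral>\<^sup>+ y. ennreal (indicator {y. r * (1/2)^Suc k \<le> norm y \<and> norm y < 2 * (r * (1/2)^Suc k)} y * norm (y::real^3) powr (-x)) \<partial>lborel)
      \<le> ennreal (8 * unit_ball_vol 3 * (r * (1/2)^Suc k) powr (3 - x))"
      by (rule shell_integral_le) (use x r in auto)
    then show "(\<integral>\<^sup>+ y. ennreal (indicator {y. r * (1/2)^Suc k \<le> norm y \<and> norm y < 2 * (r * (1/2)^Suc k)} y * norm (y::real^3) powr (-x)) \<partial>lborel)
      \<le> ennreal (K * r powr (3 - x) * q ^ k)" unfolding pw K_def by (simp only: mult_ac)
  qed (auto intro: summableI)
  also have "\<dots> = ennreal (K * r powr (3 - x) / (1 - q))"
    by (rule geometric_shells) (use q K in auto)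
  finally show "(\<integral>\<^sup>+ y. ennreal (indicator {y. norm y < r} y * norm (y::real^3) powr (-x)) \<partial>lborel) \<le> ennreal (K / (1 - q) * r powr (3 - x))"
    by (simp add: mult.commute)
qed

text \<open>The same series with doubling radii, whose ratio \<open>2 powr (3 - x)\<close> is below
  1 because \<open>3 < x\<close>.\<close>

lemma outer_integral_le:
  fixes x :: real assumes x: "3 < x"
  shows "\<exists>C\<ge>0. \<forall>r>0. (\<integral>\<^sup>+ y. ennreal (indicator {y. r \<le> norm y} y * norm (y::real^3) powr (-x)) \<partial>lborel)
    \<le> ennreal (C * r powr (3 - x))"
proof (intro exI conjI allI impI)
  define q :: real where "q = 2 powr (3 - x)"
  define K :: real where "K = 8 * unit_ball_vol 3"
  have q: "0 < q" "q < 1" using x powr_less_mono[of "3 - x" 0 2] by (auto simp: q_def)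
  have K: "0 \<le> K" by (simp add: K_def)
  show "0 \<le> K / (1 - q)" using q K by simp
  fix r :: real assume r: "0 < r"
  have pw: "(r * 2^k) powr (3 - x) = r powr (3 - x) * q ^ k" for k
  proof -
    have "(2::real)^k = 2 powr (real k)" by (simp only: powr_realpow[OF zero_less_numeral])
    then have "(2^k) powr (3 - x) = q ^ k"
      unfolding q_def by (simp only: powr_powr) (simp add: powr_power mult.commute)
    then show ?thesis using r by (subst powr_mult) (simp_all only: power_Suc mult_ac)
  qed
  have "(\<integral>\<^sup>+ y. ennreal (indicator {y. r \<le> norm y} y * norm (y::real^3) powr (-x)) \<partial>lborel)
    \<le> (\<integral>\<^sup>+ y. (\<Sum>k. ennreal (indicator {y. r * 2^k \<le> norm y \<and> norm y < 2 * (r * 2^k)} y * norm (y::real^3) powr (-x))) \<partial>lborel)"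
  proof (rule nn_integral_mono)
    fix y :: "real^3"
    show "ennreal (indicator {y. r \<le> norm y} y * norm y powr (-x))
      \<le> (\<Sum>k. ennreal (indicator {y. r * 2^k \<le> norm y \<and> norm y < 2 * (r * 2^k)} y * norm y powr (-x)))"
    proof (cases "r \<le> norm y")
      case True
      then obtain k where k: "2^k \<le> norm y / r" "norm y / r < 2^(Suc k)"
        using dyadic_above[of "norm y / r"] r by auto
      let ?f = "\<lambda>k. ennreal (indicator {y. r * 2^k \<le> norm y \<and> norm y < 2 * (r * 2^k)} y * norm y powr (-x))"
      have "ennreal (indicator {y. r \<le> norm y} y * norm y powr (-x)) = ?f k"
        using True k r by (simp add: indicator_def field_simps)
      also have "?f k \<le> suminf ?f"
        by (rule term_le_suminf)
      finally show ?thesis .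
    qed (auto simp: indicator_def)
  qed
  also have "\<dots> = (\<Sum>k. \<integral>\<^sup>+ y. ennreal (indicator {y. r * 2^k \<le> norm y \<and> norm y < 2 * (r * 2^k)} y * norm (y::real^3) powr (-x)) \<partial>lborel)"
    by (rule nn_integral_suminf) measurable
  also have "\<dots> \<le> (\<Sum>k. ennreal (K * r powr (3 - x) * q ^ k))"
  proof (rule suminf_le)
    fix k
    have "(\<integral>\<^sup>+ y. ennreal (indicator {y. r * 2^k \<le> norm y \<and> norm y < 2 * (r * 2^k)} y * norm (y::real^3) powr (-x)) \<partial>lborel)
      \<le> ennreal (8 * unit_ball_vol 3 * (r * 2^k) powr (3 - x))"
      by (rule shell_integral_le) (use x r in auto)
    then show "(\<integral>\<^sup>+ y. ennreal (indicator {y. r * 2^k \<le> norm y \<and> norm y < 2 * (r * 2^k)} y * norm (y::real^3) powr (-x)) \<partial>lborel)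
      \<le> ennreal (K * r powr (3 - x) * q ^ k)" unfolding pw K_def by (simp only: mult_ac)
  qed (auto intro: summableI)
  also have "\<dots> = ennreal (K * r powr (3 - x) / (1 - q))"
    by (rule geometric_shells) (use q K in auto)
  finally show "(\<integral>\<^sup>+ y. ennreal (indicator {y. r \<le> norm y} y * norm (y::real^3) powr (-x)) \<partial>lborel) \<le> ennreal (K / (1 - q) * r powr (3 - x))"
    by (simp add: mult.commute)
qed

lemma nn_integral_shift:
  fixes f :: "real^3 \<Rightarrow> ennreal"
  assumes "f \<in> borel_measurable borel"
  shows "(\<integral>\<^sup>+ y. f (y - a) \<partial>lborel) = (\<integral>\<^sup>+ y. f y \<partial>lborel)"
    "(\<integral>\<^sup>+ y. f (y + a) \<partial>lborel) = (\<integral>\<^sup>+ y. f y \<partial>lborel)"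
    "(\<integral>\<^sup>+ y. f (a - y) \<partial>lborel) = (\<integral>\<^sup>+ y. f y \<partial>lborel)"
  using lborel_nn_integral_affine[OF assms, of 1 "-a"] lborel_nn_integral_affine[OF assms, of 1 a]
    lborel_nn_integral_affine[OF assms, of "-1" a] by (simp_all add: add.commute)

lemma ennreal_collect:
  "0 \<le> a \<Longrightarrow> 0 \<le> b \<Longrightarrow> 0 \<le> c \<Longrightarrow> 0 \<le> d \<Longrightarrow> 0 \<le> e \<Longrightarrow> 0 \<le> f \<Longrightarrow>
    ennreal a * ennreal b + (ennreal c * ennreal d + (ennreal e + ennreal f)) = ennreal (a * b + (c * d + (e + f)))"
  by (simp add: ennreal_mult ennreal_plus)

text \<open>\<open>x < 3\<close> and \<open>y < 3\<close> give integrability at the two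
  singularities, \<open>3 < x + y\<close> gives it at infinity, and scaling dictates the exponent.
  Within distance \<open>norm a / 2\<close> of one singularity the other factor is at most its value
  at that distance; elsewhere the product is bounded by the power \<open>- (x + y)\<close> of the
  smaller of the two norms.\<close>

lemma riesz_composition:
  fixes x y :: real assumes xy: "0 \<le> x" "x < 3" "0 \<le> y" "y < 3" "3 < x + y"
  shows "\<exists>C\<ge>0. \<forall>a. a \<noteq> 0 \<longrightarrow> (\<integral>\<^sup>+ e. ennreal (norm (a - e) powr (-x) * norm (e::real^3) powr (-y)) \<partial>lborel)
    \<le> ennreal (C * norm a powr (3 - x - y))"
proof -
  obtain C1 where C1: "0 \<le> C1" "\<And>r. 0 < r \<Longrightarrow> (\<integral>\<^sup>+ e. ennreal (indicator {e. norm e < r} e * norm (e::real^3) powr (-x)) \<partial>lborel)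
    \<le> ennreal (C1 * r powr (3 - x))" using ball_integral_le[OF xy(1,2)] by blast
  obtain C2 where C2: "0 \<le> C2" "\<And>r. 0 < r \<Longrightarrow> (\<integral>\<^sup>+ e. ennreal (indicator {e. norm e < r} e * norm (e::real^3) powr (-y)) \<partial>lborel)
    \<le> ennreal (C2 * r powr (3 - y))" using ball_integral_le[OF xy(3,4)] by blast
  obtain C3 where C3: "0 \<le> C3" "\<And>r. 0 < r \<Longrightarrow> (\<integral>\<^sup>+ e. ennreal (indicator {e. r \<le> norm e} e * norm (e::real^3) powr (-(x+y))) \<partial>lborel)
    \<le> ennreal (C3 * r powr (3 - (x + y)))" using outer_integral_le[OF xy(5)] by blast
  define C where "C = (C1 + C2 + 2 * C3) * (1/2) powr (3 - x - y)"
  have "(\<integral>\<^sup>+ e. ennreal (norm (a - e) powr (-x) * norm (e::real^3) powr (-y)) \<partial>lborel) \<le> ennreal (C * norm a powr (3 - x - y))"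
    if a: "a \<noteq> 0" for a
  proof -
    define r where "r = norm a / 2"
    have r: "0 < r" using a by (simp add: r_def)
    let ?A = "\<lambda>e::real^3. ennreal (indicator {e. norm e < r} e * norm e powr (-x))"
    let ?B = "\<lambda>e::real^3. ennreal (indicator {e. norm e < r} e * norm e powr (-y))"
    let ?D = "\<lambda>e::real^3. ennreal (indicator {e. r \<le> norm e} e * norm e powr (-(x+y)))"
    have pt: "ennreal (norm (a - e) powr (-x) * norm e powr (-y))
      \<le> ennreal (r powr (-y)) * ?A (a - e) + (ennreal (r powr (-x)) * ?B e + (?D e + ?D (a - e)))" for e
    proof -
      have tri: "2 * r \<le> norm (a - e) + norm e" using norm_triangle_ineq[of "a - e" e] by (simp add: r_def)
      consider "norm (a - e) < r" | "r \<le> norm (a - e)" "norm e < r" | "r \<le> norm (a - e)" "r \<le> norm e" "norm e \<le> norm (a - e)"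
        | "r \<le> norm (a - e)" "r \<le> norm e" "norm (a - e) \<le> norm e" by linarith
      then show ?thesis
      proof cases
        case 1
        have "norm e powr (-y) \<le> r powr (-y)" by (rule powr_mono2') (use 1 tri r xy in auto)
        then have "ennreal (norm (a - e) powr (-x) * norm e powr (-y)) \<le> ennreal (r powr (-y)) * ?A (a - e)"
          using 1 by (subst ennreal_mult[symmetric]) (auto simp: mult.commute intro!: ennreal_leI mult_left_mono mult_right_mono)
        then show ?thesis by (rule order_trans) simp
      next
        case 2
        have "norm (a - e) powr (-x) \<le> r powr (-x)" by (rule powr_mono2') (use 2 r xy in auto)
        then have "ennreal (norm (a - e) powr (-x) * norm e powr (-y)) \<le> ennreal (r powr (-x)) * ?B e"
          using 2 by (subst ennreal_mult[symmetric]) (auto intro!: ennreal_leI mult_right_mono)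
        then show ?thesis by (rule order_trans) (simp add: add_increasing)
      next
        case 3
        have "norm (a - e) powr (-x) \<le> norm e powr (-x)" by (rule powr_mono2') (use 3 r xy in auto)
        then have "norm (a - e) powr (-x) * norm e powr (-y) \<le> norm e powr (-x) * norm e powr (-y)"
          by (rule mult_right_mono) simp
        also have "\<dots> = norm e powr (-(x+y))" by (subst powr_add[symmetric]) simp
        finally have "ennreal (norm (a - e) powr (-x) * norm e powr (-y)) \<le> ?D e"
          using 3 by (auto intro!: ennreal_leI)
        then show ?thesis by (rule order_trans) (simp add: add_increasing add_increasing2)
      next
        case 4
        have "norm e powr (-y) \<le> norm (a - e) powr (-y)" by (rule powr_mono2') (use 4 r xy in auto)
        then have "norm (a - e) powr (-x) * norm e powr (-y) \<le> norm (a - e) powr (-x) * norm (a - e) powr (-y)"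
          by (rule mult_left_mono) simp
        also have "\<dots> = norm (a - e) powr (-(x+y))" by (subst powr_add[symmetric]) simp
        finally have "ennreal (norm (a - e) powr (-x) * norm e powr (-y)) \<le> ?D (a - e)"
          using 4 by (auto intro!: ennreal_leI)
        then show ?thesis by (rule order_trans) (simp add: add_increasing)
      qed
    qed
    have "(\<integral>\<^sup>+ e. ennreal (norm (a - e) powr (-x) * norm e powr (-y)) \<partial>lborel)
      \<le> (\<integral>\<^sup>+ e. (ennreal (r powr (-y)) * ?A (a - e) + (ennreal (r powr (-x)) * ?B e + (?D e + ?D (a - e)))) \<partial>lborel)"
      by (rule nn_integral_mono) (rule pt)
    also have "\<dots> = ennreal (r powr (-y)) * (\<integral>\<^sup>+ e. ?A (a - e) \<partial>lborel) + (ennreal (r powr (-x)) * (\<integral>\<^sup>+ e. ?B e \<partial>lborel) + ((\<integral>\<^sup>+ e. ?D e \<partial>lborel) + (\<integral>\<^sup>+ e. ?D (a - e) \<partial>lborel)))"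
      by (simp add: nn_integral_add nn_integral_cmult)
    also have "\<dots> = ennreal (r powr (-y)) * (\<integral>\<^sup>+ e. ?A e \<partial>lborel) + (ennreal (r powr (-x)) * (\<integral>\<^sup>+ e. ?B e \<partial>lborel) + ((\<integral>\<^sup>+ e. ?D e \<partial>lborel) + (\<integral>\<^sup>+ e. ?D e \<partial>lborel)))"
      by (subst nn_integral_shift(3)[of ?A], measurable, subst nn_integral_shift(3)[of ?D], measurable)
    also have "\<dots> \<le> ennreal (r powr (-y)) * ennreal (C1 * r powr (3 - x)) + (ennreal (r powr (-x)) * ennreal (C2 * r powr (3 - y))
       + (ennreal (C3 * r powr (3 - (x+y))) + ennreal (C3 * r powr (3 - (x+y)))))"
      by (intro add_mono mult_left_mono C1 C2 C3 r) auto
    also have "\<dots> = ennreal (r powr (-y) * (C1 * r powr (3 - x)) + (r powr (-x) * (C2 * r powr (3 - y)) + (C3 * r powr (3 - (x+y)) + C3 * r powr (3 - (x+y)))))"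
      by (rule ennreal_collect) (use C1(1) C2(1) C3(1) in auto)
    also have "r powr (-y) * (C1 * r powr (3 - x)) + (r powr (-x) * (C2 * r powr (3 - y)) + (C3 * r powr (3 - (x+y)) + C3 * r powr (3 - (x+y))))
      = (C1 + C2 + 2 * C3) * r powr (3 - x - y)"
    proof -
      have e: "r powr (-y) * r powr (3 - x) = r powr (3 - x - y)" "r powr (-x) * r powr (3 - y) = r powr (3 - x - y)"
        by (subst powr_add[symmetric], simp add: algebra_simps)+
      have e3: "3 - (x + y) = 3 - x - y" by simp
      show ?thesis
        unfolding e3 mult.left_commute[of "r powr (-y)"] mult.left_commute[of "r powr (-x)"] e
        by (simp add: distrib_right)
    qed
    also have "\<dots> = C * norm a powr (3 - x - y)"
    proof -
      have "r powr (3 - x - y) = (1/2) powr (3 - x - y) * norm a powr (3 - x - y)"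
        unfolding r_def using powr_mult[of "1/2" "norm a" "3 - x - y"] by simp
      then show ?thesis by (simp only: C_def mult.assoc)
    qed
    finally show ?thesis .
  qed
  moreover have "0 \<le> C" using C1 C2 C3 by (simp add: C_def)
  ultimately show ?thesis by blast
qed

subsection \<open>The quadrilinear form of the Hartree term on the Fourier side\<close>

definition JB :: "real^3 \<Rightarrow> real" where "JB x = (1 + (norm x)\<^sup>2) powr (1/4)"

lemma JB_sqrt: "JB x = sqrt (sqrt (1 + (norm x)\<^sup>2))"
proof -
  have "0 < 1 + (norm x)\<^sup>2" by (simp add: add_pos_nonneg)
  then have "(1 + (norm x)\<^sup>2) powr (1/4) = ((1 + (norm x)\<^sup>2) powr (1/2)) powr (1/2)"
    by (simp add: powr_powr)
  then show ?thesis by (simp add: JB_def powr_half_sqrt)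
qed

lemma JB_measurable [measurable]: "JB \<in> borel_measurable borel"
  unfolding JB_def[abs_def] by measurable

lemma JB_ge_1: "1 \<le> JB x"
  by (simp add: JB_sqrt)

lemma JB_pos [simp]: "0 < JB x" "0 \<le> JB x" "JB x \<noteq> 0"
  using JB_ge_1[of x] by linarith+

lemma norm_powr_half_le_JB: "norm x powr (1/2) \<le> JB x"
proof -
  have "norm x \<le> sqrt (1 + (norm x)\<^sup>2)" by (rule real_le_rsqrt) simp
  then show ?thesis by (simp add: JB_sqrt powr_half_sqrt)
qed

lemma inverse_JB_le: "x \<noteq> 0 \<Longrightarrow> 1 / JB x \<le> norm x powr (-1/2)"
  using norm_powr_half_le_JB[of x] by (simp add: powr_minus_divide frac_le)

text \<open>The substitute for a fractional product rule: half a derivative of a product falls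
  either on the factor with frequency \<open>x\<close> or on the remaining frequency
  \<open>y\<close>. It is the triangle inequality for \<open>sqrt (1 + (norm x)\<^sup>2)\<close>
  followed by subadditivity of the square root.\<close>

lemma JB_add_le: "JB (x + y) \<le> norm y powr (1/2) + JB x"
proof -
  have "sqrt (1 + (norm (x + y))\<^sup>2) \<le> norm y + sqrt (1 + (norm x)\<^sup>2)"
  proof (rule real_le_lsqrt)
    have "(norm (x + y))\<^sup>2 \<le> (norm x + norm y)\<^sup>2" by (intro power_mono norm_triangle_ineq norm_ge_zero)
    moreover have "norm x \<le> sqrt (1 + (norm x)\<^sup>2)" by (rule real_le_rsqrt) simp
    then have "norm y * norm x \<le> norm y * sqrt (1 + (norm x)\<^sup>2)" by (rule mult_left_mono) simp
    ultimately show "1 + (norm (x + y))\<^sup>2 \<le> (norm y + sqrt (1 + (norm x)\<^sup>2))\<^sup>2"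
      by (simp add: power2_sum algebra_simps)
  qed simp
  then have "sqrt (sqrt (1 + (norm (x + y))\<^sup>2)) \<le> sqrt (norm y + sqrt (1 + (norm x)\<^sup>2))"
    by (rule real_sqrt_le_mono)
  also have "\<dots> \<le> sqrt (norm y) + sqrt (sqrt (1 + (norm x)\<^sup>2))"
    by (rule sqrt_add_le_add_sqrt) auto
  finally show ?thesis by (simp add: JB_sqrt powr_half_sqrt)
qed

text \<open>The pointwise core of a Schur test: a kernel below the geometric mean of two weights is
  split into the two squares, each of which then needs only the integral of its own weight in one
  variable.\<close>

lemma weighted_am_gm:
  fixes x y u v m :: real
  assumes "0 \<le> x" "0 \<le> y" "0 \<le> u" "0 \<le> v" "m\<^sup>2 \<le> u * v"
  shows "2 * (x * y * m) \<le> x\<^sup>2 * u + y\<^sup>2 * v"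
proof -
  have "m \<le> sqrt (u * v)" using assms(5) by (rule real_le_rsqrt)
  then have "x * y * m \<le> x * y * sqrt (u * v)" using assms by (intro mult_left_mono) auto
  also have "2 * (x * y * sqrt (u * v)) \<le> x\<^sup>2 * u + y\<^sup>2 * v"
    using sum_squares_bound[of "x * sqrt u" "y * sqrt v"] assms
    by (simp add: power_mult_distrib real_sqrt_mult mult_ac)
  finally show ?thesis by simp
qed

text \<open>Schur weights for the two frequency regimes: \<open>k1\<close> serves \<open>|a - b|^(1/2) \<le> J(c)\<close>, whereas
  \<open>k2\<close> and \<open>k3\<close> serve \<open>J(c) < |a - b|^(1/2)\<close>, where \<open>|c| < |a - b|\<close>.\<close>

definition k1 :: "real^3 \<Rightarrow> real^3 \<Rightarrow> real" where
  "k1 x y = norm x powr (1/2) * (norm (x - y) powr (-2) * norm y powr (-3/2))"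

definition k2 :: "real^3 \<Rightarrow> real^3 \<Rightarrow> real" where
  "k2 x y = norm x powr (1/4) * (norm (x - y) powr (-11/4) * norm y powr (-1/2))"

definition k3 :: "real^3 \<Rightarrow> real^3 \<Rightarrow> real" where
  "k3 x y = norm x powr (-1/2) * (indicator {y. norm y < 2 * norm x} y * norm y powr (-5/2))"

lemma kernel_measurable [measurable]:
  "(\<lambda>p. k1 (fst p) (snd p)) \<in> borel_measurable (borel \<Otimes>\<^sub>M borel)"
  "(\<lambda>p. k2 (fst p) (snd p)) \<in> borel_measurable (borel \<Otimes>\<^sub>M borel)"
  "(\<lambda>p. k3 (fst p) (snd p)) \<in> borel_measurable (borel \<Otimes>\<^sub>M borel)"
proof -
  show "(\<lambda>p. k1 (fst p) (snd p)) \<in> borel_measurable (borel \<Otimes>\<^sub>M borel)" unfolding k1_def by measurable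
  show "(\<lambda>p. k2 (fst p) (snd p)) \<in> borel_measurable (borel \<Otimes>\<^sub>M borel)" unfolding k2_def by measurable
  show "(\<lambda>p. k3 (fst p) (snd p)) \<in> borel_measurable (borel \<Otimes>\<^sub>M borel)"
    unfolding k3_def indicator_def by measurable
qed

lemma kernel_measurable_raw [measurable (raw)]:
  assumes [measurable]: "f \<in> M \<rightarrow>\<^sub>M borel" "g \<in> M \<rightarrow>\<^sub>M borel"
  shows "(\<lambda>x. k1 (f x) (g x)) \<in> borel_measurable M" "(\<lambda>x. k2 (f x) (g x)) \<in> borel_measurable M"
    "(\<lambda>x. k3 (f x) (g x)) \<in> borel_measurable M"
  using measurable_compose[OF measurable_Pair[OF assms] kernel_measurable(1)]
    measurable_compose[OF measurable_Pair[OF assms] kernel_measurable(2)]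
    measurable_compose[OF measurable_Pair[OF assms] kernel_measurable(3)] by simp_all

lemma kernel_nonneg [simp]: "0 \<le> k1 x y" "0 \<le> k2 x y" "0 \<le> k3 x y"
  by (simp_all add: k1_def k2_def k3_def)

text \<open>Each kernel is homogeneous of degree -3 in its pair of arguments, so its integral in
  \<open>y\<close> scales like a constant, and one bound serves every \<open>x \<noteq> 0\<close>.
  At \<open>x = 0\<close> the kernels vanish because \<open>0 powr a = 0\<close>.\<close>

lemma kernel_integrals:
  "\<exists>K\<ge>0. \<forall>x. (\<integral>\<^sup>+ y. ennreal (k1 x y) \<partial>lborel) \<le> ennreal K \<and> (\<integral>\<^sup>+ y. ennreal (k2 x y) \<partial>lborel) \<le> ennreal K
    \<and> (\<integral>\<^sup>+ y. ennreal (k3 x y) \<partial>lborel) \<le> ennreal K"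
proof -
  obtain C1 where C1: "0 \<le> C1" "\<And>x. x \<noteq> 0 \<Longrightarrow> (\<integral>\<^sup>+ y. ennreal (norm (x - y) powr (-2) * norm (y::real^3) powr (-3/2)) \<partial>lborel) \<le> ennreal (C1 * norm x powr (-1/2))"
    using riesz_composition[of 2 "3/2"] by auto
  obtain C2 where C2: "0 \<le> C2" "\<And>x. x \<noteq> 0 \<Longrightarrow> (\<integral>\<^sup>+ y. ennreal (norm (x - y) powr (-11/4) * norm (y::real^3) powr (-1/2)) \<partial>lborel) \<le> ennreal (C2 * norm x powr (-1/4))"
    using riesz_composition[of "11/4" "1/2"] by auto
  obtain C3 where C3: "0 \<le> C3" "\<And>r. 0 < r \<Longrightarrow> (\<integral>\<^sup>+ y. ennreal (indicator {y. norm y < r} y * norm (y::real^3) powr (-5/2)) \<partial>lborel) \<le> ennreal (C3 * r powr (1/2))"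
    using ball_integral_le[of "5/2"] by auto
  define K where "K = C1 + C2 + C3 * 2 powr (1/2)"
  have K: "0 \<le> K" "C1 \<le> K" "C2 \<le> K" "C3 * 2 powr (1/2) \<le> K" using C1 C2 C3 by (auto simp: K_def)
  have "(\<integral>\<^sup>+ y. ennreal (k1 x y) \<partial>lborel) \<le> ennreal K" for x
  proof (cases "x = 0")
    case False
    have "(\<integral>\<^sup>+ y. ennreal (k1 x y) \<partial>lborel) = ennreal (norm x powr (1/2)) * (\<integral>\<^sup>+ y. ennreal (norm (x - y) powr (-2) * norm y powr (-3/2)) \<partial>lborel)"
      unfolding k1_def by (subst nn_integral_cmult[symmetric]) (auto simp: ennreal_mult)
    also have "\<dots> \<le> ennreal (norm x powr (1/2)) * ennreal (C1 * norm x powr (-1/2))"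
      by (intro mult_left_mono C1 False) simp
    also have "\<dots> = ennreal C1"
      using False C1 by (subst ennreal_mult[symmetric]) (auto simp: mult.left_commute powr_add[symmetric])
    also have "\<dots> \<le> ennreal K" using K by (intro ennreal_leI) auto
    finally show ?thesis .
  qed (simp add: k1_def)
  moreover have "(\<integral>\<^sup>+ y. ennreal (k2 x y) \<partial>lborel) \<le> ennreal K" for x
  proof (cases "x = 0")
    case False
    have "(\<integral>\<^sup>+ y. ennreal (k2 x y) \<partial>lborel) = ennreal (norm x powr (1/4)) * (\<integral>\<^sup>+ y. ennreal (norm (x - y) powr (-11/4) * norm y powr (-1/2)) \<partial>lborel)"
      unfolding k2_def by (subst nn_integral_cmult[symmetric]) (auto simp: ennreal_mult)
    also have "\<dots> \<le> ennreal (norm x powr (1/4)) * ennreal (C2 * norm x powr (-1/4))"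
      by (intro mult_left_mono C2 False) simp
    also have "\<dots> = ennreal C2"
      using False C2 by (subst ennreal_mult[symmetric]) (auto simp: mult.left_commute powr_add[symmetric])
    also have "\<dots> \<le> ennreal K" using K by (intro ennreal_leI) auto
    finally show ?thesis .
  qed (simp add: k2_def)
  moreover have "(\<integral>\<^sup>+ y. ennreal (k3 x y) \<partial>lborel) \<le> ennreal K" for x
  proof (cases "x = 0")
    case False
    define g where "g y = indicator {y. norm y < 2 * norm x} y * norm y powr (-5/2)" for y :: "real^3"
    have [measurable]: "g \<in> borel_measurable borel" unfolding g_def by measurable
    have "(\<integral>\<^sup>+ y. ennreal (k3 x y) \<partial>lborel) = (\<integral>\<^sup>+ y. ennreal (norm x powr (-1/2)) * ennreal (g y) \<partial>lborel)"
      unfolding k3_def g_def by (intro nn_integral_cong ennreal_mult) auto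
    also have "\<dots> = ennreal (norm x powr (-1/2)) * (\<integral>\<^sup>+ y. ennreal (g y) \<partial>lborel)"
      by (rule nn_integral_cmult) measurable
    also have "\<dots> \<le> ennreal (norm x powr (-1/2)) * ennreal (C3 * (2 * norm x) powr (1/2))"
      unfolding g_def by (intro mult_left_mono C3) (use False in auto)
    also have "\<dots> = ennreal (C3 * 2 powr (1/2))"
    proof -
      have "norm x powr (-1/2) * (C3 * (2 * norm x) powr (1/2)) = C3 * 2 powr (1/2) * (norm x powr (-1/2) * norm x powr (1/2))"
        by (simp add: powr_mult)
      also have "norm x powr (-1/2) * norm x powr (1/2) = 1"
        using False by (subst powr_add[symmetric]) simp
      finally show ?thesis using C3 by (subst ennreal_mult[symmetric]) auto
    qed
    also have "\<dots> \<le> ennreal K" using K by (intro ennreal_leI) auto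
    finally show ?thesis .
  qed (simp add: k3_def)
  ultimately show ?thesis using K by blast
qed

text \<open>The square of the kernel is \<open>k1 a b * k1 b a\<close>. Off the diagonal each weight
  is the kernel times \<open>norm a / norm b\<close> or the inverse ratio; without this shift the
  integral in one variable would diverge at infinity.\<close>

lemma low_frequency_bound:
  fixes f g :: real
  assumes nz: "a \<noteq> 0" "b \<noteq> 0" and fg: "0 \<le> f" "0 \<le> g"
  shows "2 * (f * g * (norm a powr (-1/2) * norm b powr (-1/2) * norm (a - b) powr (-2))) \<le> f\<^sup>2 * k1 a b + g\<^sup>2 * k1 b a"
proof (rule weighted_am_gm)
  define A B E where "A = norm a" and "B = norm b" and "E = norm (a - b)"
  have pos: "0 < A" "0 < B" using nz by (auto simp: A_def B_def)
  have e: "norm (b - a) = E" by (simp add: E_def norm_minus_commute)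
  have "(A powr (-1/2) * B powr (-1/2) * E powr (-2))\<^sup>2 = A powr (-1) * B powr (-1) * E powr (-4)"
    by (cases "E = 0") (auto simp: power2_eq_square powr_add[symmetric] mult_ac algebra_simps intro: arg_cong2[where f="(*)"])
  also have "\<dots> = (A powr (1/2) * A powr (-3/2)) * (B powr (-3/2) * B powr (1/2)) * (E powr (-2) * E powr (-2))"
    by (simp add: powr_add[symmetric])
  finally show "(norm a powr (-1/2) * norm b powr (-1/2) * norm (a - b) powr (-2))\<^sup>2 \<le> k1 a b * k1 b a"
    unfolding k1_def e A_def[symmetric] B_def[symmetric] E_def[symmetric] by (simp add: mult_ac)
qed (use fg in auto)

text \<open>The weight \<open>k2 a b\<close> does not contain \<open>c\<close>, which is thus left
  to \<open>h\<close>; the rest is a weight \<open>v\<close> for the pair \<open>g\<close>,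
  \<open>p\<close>. As \<open>norm c < norm (a - b)\<close>, the remaining power of
  \<open>norm (a - b)\<close> in \<open>v\<close> may be traded for one of \<open>norm c\<close>.
  Then \<open>a\<close> and \<open>c\<close> enter symmetrically and decouple into two copies of
  \<open>k3\<close>. Both lie in the ball of radius \<open>2 * norm b\<close>, where the indicator
  in \<open>k3 b\<close> is 1.\<close>

lemma high_frequency_bound:
  fixes f g h p :: real
  assumes nz: "a \<noteq> 0" "b \<noteq> 0" "c \<noteq> 0" "a \<noteq> b" and fg: "0 \<le> f" "0 \<le> g" "0 \<le> h" "0 \<le> p"
    and ce: "norm c < norm (a - b)" and ab: "norm a \<le> norm b"
  shows "2 * (f * g * h * p * (norm a powr (-1/2) * norm b powr (-1/2) * norm c powr (-1/2) * norm (a - b) powr (-3/2)))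
    \<le> f\<^sup>2 * k2 a b * h\<^sup>2 + g\<^sup>2 * k3 b a * p\<^sup>2 + g\<^sup>2 * k3 b c * p\<^sup>2"
proof -
  define A B C E where "A = norm a" and "B = norm b" and "C = norm c" and "E = norm (a - b)"
  have pos: "0 < A" "0 < B" "0 < C" "0 < E" using nz by (auto simp: A_def B_def C_def E_def)
  have EB: "E \<le> 2 * B" using norm_triangle_ineq4[of a b] ab by (simp add: A_def B_def E_def)
  have CE: "C < E" using ce by (simp add: C_def E_def)
  \<comment> \<open>The square of the kernel divided by \<open>k2 a b\<close>.\<close>
  define v where "v = B powr (-1/2) * (A powr (-5/4) * (C powr (-1) * E powr (-1/4)))"
  have k2: "k2 a b = A powr (1/4) * (E powr (-11/4) * B powr (-1/2))"
    by (simp add: k2_def A_def B_def E_def)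
  have "(A powr (-1/2) * B powr (-1/2) * C powr (-1/2) * E powr (-3/2))\<^sup>2
     = (A powr (-1/2) * A powr (-1/2)) * (B powr (-1/2) * B powr (-1/2)) * (C powr (-1/2) * C powr (-1/2)) * (E powr (-3/2) * E powr (-3/2))"
    by (simp add: power2_eq_square mult_ac)
  also have "\<dots> = (A powr (1/4) * A powr (-5/4)) * (B powr (-1/2) * B powr (-1/2)) * C powr (-1) * (E powr (-11/4) * E powr (-1/4))"
    by (simp add: powr_add[symmetric])
  finally have "(A powr (-1/2) * B powr (-1/2) * C powr (-1/2) * E powr (-3/2))\<^sup>2 \<le> k2 a b * v"
    unfolding k2 v_def by (simp add: mult_ac)
  then have "2 * ((f * h) * (g * p) * (A powr (-1/2) * B powr (-1/2) * C powr (-1/2) * E powr (-3/2)))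
     \<le> (f * h)\<^sup>2 * k2 a b + (g * p)\<^sup>2 * v"
    by (intro weighted_am_gm) (use fg in \<open>auto simp: v_def\<close>)
  also have "v \<le> k3 b a + k3 b c"
  proof -
    have "C powr (-1) * E powr (-1/4) \<le> C powr (-1) * C powr (-1/4)"
      using CE pos by (intro mult_left_mono powr_mono2') auto
    also have "\<dots> = C powr (-5/4)" by (subst powr_add[symmetric]) simp
    finally have "A powr (-5/4) * (C powr (-1) * E powr (-1/4)) \<le> A powr (-5/4) * C powr (-5/4)"
      by (rule mult_left_mono) simp
    also have "\<dots> \<le> A powr (-5/2) + C powr (-5/2)"
    proof -
      have "A powr (-5/2) = (A powr (-5/4))\<^sup>2" "C powr (-5/2) = (C powr (-5/4))\<^sup>2"
        by (simp_all add: power2_eq_square powr_add[symmetric])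
      moreover have "0 \<le> A powr (-5/4) * C powr (-5/4)" by simp
      ultimately show ?thesis using sum_squares_bound[of "A powr (-5/4)" "C powr (-5/4)"] by linarith
    qed
    finally have "v \<le> B powr (-1/2) * (A powr (-5/2) + C powr (-5/2))"
      unfolding v_def by (rule mult_left_mono) simp
    also have "\<dots> = k3 b a + k3 b c"
      using ab CE EB pos by (simp add: k3_def A_def[symmetric] B_def[symmetric] C_def[symmetric] distrib_left)
    finally show ?thesis .
  qed
  finally have "2 * ((f * h) * (g * p) * (A powr (-1/2) * B powr (-1/2) * C powr (-1/2) * E powr (-3/2)))
     \<le> (f * h)\<^sup>2 * k2 a b + (g * p)\<^sup>2 * (k3 b a + k3 b c)"
    by (simp add: mult_left_mono)
  then show ?thesis
    by (simp add: A_def[symmetric] B_def[symmetric] C_def[symmetric] E_def[symmetric] power_mult_distrib algebra_simps)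
qed

text \<open>The numerator is at most twice the larger of \<open>norm (a - b) powr (1/2)\<close> and
  \<open>JB c\<close>. If \<open>JB c\<close> is the larger one, it cancels and \<open>c\<close>
  survives only in \<open>h\<close> and \<open>p\<close>. Otherwise the half power weakens the
  singularity from order 2 to order 3/2, and the smaller of \<open>norm a\<close> and
  \<open>norm b\<close> decides which variable plays which role.\<close>

lemma quadrilinear_pointwise:
  fixes f g h p :: real
  assumes nz: "a \<noteq> 0" "b \<noteq> 0" "c \<noteq> 0" and fg: "0 \<le> f" "0 \<le> g" "0 \<le> h" "0 \<le> p"
  shows "f * g * h * p * (JB (c + (a - b)) / (JB a * JB b * JB c)) * norm (a - b) powr (-2)
    \<le> (f\<^sup>2 * k1 a b * h\<^sup>2 + f\<^sup>2 * k1 a b * p\<^sup>2) + (g\<^sup>2 * k1 b a * h\<^sup>2 + g\<^sup>2 * k1 b a * p\<^sup>2)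
     + (f\<^sup>2 * k2 a b * h\<^sup>2 + g\<^sup>2 * k3 b a * p\<^sup>2 + g\<^sup>2 * k3 b c * p\<^sup>2)
     + (g\<^sup>2 * k2 b a * h\<^sup>2 + f\<^sup>2 * k3 a b * p\<^sup>2 + f\<^sup>2 * k3 a c * p\<^sup>2)"
  (is "?W \<le> ?S1 + ?S2 + ?S3 + ?S4")
\<comment> \<open>On the diagonal the left side is 0, since \<open>0 powr (-2) = 0\<close>.\<close>
proof (cases "a = b")
  case True
  have "0 \<le> ?S1 + ?S2 + ?S3 + ?S4" by (intro add_nonneg_nonneg mult_nonneg_nonneg) auto
  then show ?thesis using True by simp
next
  case ab: False
  define A B C E where "A = norm a" and "B = norm b" and "C = norm c" and "E = norm (a - b)"
  have pos: "0 < A" "0 < B" "0 < C" "0 < E" using nz ab by (auto simp: A_def B_def C_def E_def)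
  have S: "0 \<le> ?S1" "0 \<le> ?S2" "0 \<le> ?S3" "0 \<le> ?S4" by (intro add_nonneg_nonneg mult_nonneg_nonneg; simp)+
  have ia: "1 / JB a \<le> A powr (-1/2)" "1 / JB b \<le> B powr (-1/2)" "1 / JB c \<le> C powr (-1/2)"
    unfolding A_def B_def C_def by (intro inverse_JB_le nz)+
  have fg0: "0 \<le> f * g * h * p" using fg by simp
  have d: "JB (c + (a - b)) \<le> E powr (1/2) + JB c" unfolding E_def by (rule JB_add_le)
  show ?thesis
  proof (cases "E powr (1/2) \<le> JB c")
    case True
    have "JB (c + (a - b)) / (JB a * JB b * JB c) \<le> (2 * JB c) / (JB a * JB b * JB c)"
      using d True by (intro divide_right_mono) auto
    also have "\<dots> = 2 * ((1 / JB a) * (1 / JB b))" by simp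
    also have "\<dots> \<le> 2 * (A powr (-1/2) * B powr (-1/2))"
      using ia by (intro mult_left_mono mult_mono) auto
    finally have "?W \<le> f * g * h * p * (2 * (A powr (-1/2) * B powr (-1/2))) * E powr (-2)"
      unfolding E_def[symmetric] using fg0 by (intro mult_right_mono mult_left_mono) auto
    also have "\<dots> = (2 * (f * g * (A powr (-1/2) * B powr (-1/2) * E powr (-2)))) * (h * p)" by (simp add: mult_ac)
    also have "\<dots> \<le> (f\<^sup>2 * k1 a b + g\<^sup>2 * k1 b a) * (h\<^sup>2 + p\<^sup>2)"
    proof (rule mult_mono)
      show "2 * (f * g * (A powr (-1/2) * B powr (-1/2) * E powr (-2))) \<le> f\<^sup>2 * k1 a b + g\<^sup>2 * k1 b a"
        unfolding A_def B_def E_def by (rule low_frequency_bound) (use nz fg in auto)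
      have "0 \<le> h * p" using fg by simp
      then show "h * p \<le> h\<^sup>2 + p\<^sup>2" using sum_squares_bound[of h p] by linarith
    qed (use fg in auto)
    also have "\<dots> = ?S1 + ?S2" by (simp add: algebra_simps)
    finally show ?thesis using S by linarith
  next
    case False
    then have cE: "JB c < E powr (1/2)" by simp
    have "C powr (1/2) < E powr (1/2)" using norm_powr_half_le_JB[of c] cE by (simp add: C_def)
    then have CE: "C < E" using pos by (simp add: powr_less_cancel_iff powr_half_sqrt)
    have "JB (c + (a - b)) / (JB a * JB b * JB c) \<le> (2 * E powr (1/2)) / (JB a * JB b * JB c)"
      using d cE by (intro divide_right_mono) auto
    also have "\<dots> = 2 * (((1 / JB a) * (1 / JB b)) * (1 / JB c)) * E powr (1/2)" by simp
    also have "\<dots> \<le> 2 * ((A powr (-1/2) * B powr (-1/2)) * C powr (-1/2)) * E powr (1/2)"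
      using ia by (intro mult_right_mono mult_left_mono mult_mono) auto
    finally have "?W \<le> f * g * h * p * (2 * ((A powr (-1/2) * B powr (-1/2)) * C powr (-1/2)) * E powr (1/2)) * E powr (-2)"
      unfolding E_def[symmetric] using fg0 by (intro mult_right_mono mult_left_mono) auto
    also have "\<dots> = 2 * (f * g * h * p * (A powr (-1/2) * B powr (-1/2) * C powr (-1/2) * (E powr (1/2) * E powr (-2))))"
      by (simp add: mult_ac)
    also have "E powr (1/2) * E powr (-2) = E powr (-3/2)" by (simp add: powr_add[symmetric])
    finally have W: "?W \<le> 2 * (f * g * h * p * (A powr (-1/2) * B powr (-1/2) * C powr (-1/2) * E powr (-3/2)))" .
    show ?thesis
    proof (cases "A \<le> B")
      case True
      have "2 * (f * g * h * p * (A powr (-1/2) * B powr (-1/2) * C powr (-1/2) * E powr (-3/2))) \<le> ?S3"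
        using high_frequency_bound[of a b c f g h p] nz ab fg CE True by (simp add: A_def B_def C_def E_def)
      then show ?thesis using W S by linarith
    next
      case False
      have "2 * (g * f * h * p * (B powr (-1/2) * A powr (-1/2) * C powr (-1/2) * E powr (-3/2))) \<le> ?S4"
        using high_frequency_bound[of b a c g f h p] nz ab fg CE False
        by (simp add: A_def B_def C_def E_def norm_minus_commute[of b a])
      then show ?thesis using W S by (simp only: mult_ac)
    qed
  qed
qed

section \<open>Triple integrals and the Schur estimates\<close>

definition I3 :: "(real^3 \<Rightarrow> real^3 \<Rightarrow> real^3 \<Rightarrow> ennreal) \<Rightarrow> ennreal" where
  "I3 T = (\<integral>\<^sup>+ x. \<integral>\<^sup>+ y. \<integral>\<^sup>+ z. T x y z \<partial>lborel \<partial>lborel \<partial>lborel)"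

definition meas3 :: "(real^3 \<Rightarrow> real^3 \<Rightarrow> real^3 \<Rightarrow> ennreal) \<Rightarrow> bool" where
  "meas3 T \<longleftrightarrow> (\<lambda>p. T (fst p) (fst (snd p)) (snd (snd p))) \<in> borel_measurable (borel \<Otimes>\<^sub>M (borel \<Otimes>\<^sub>M borel))"

lemma meas3_compose:
  assumes "meas3 T" and [measurable]: "f \<in> M \<rightarrow>\<^sub>M borel" "g \<in> M \<rightarrow>\<^sub>M borel" "h \<in> M \<rightarrow>\<^sub>M borel"
  shows "(\<lambda>x. T (f x) (g x) (h x)) \<in> borel_measurable M"
proof -
  have "(\<lambda>x. (f x, (g x, h x))) \<in> M \<rightarrow>\<^sub>M (borel \<Otimes>\<^sub>M (borel \<Otimes>\<^sub>M borel))" by measurable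
  from measurable_compose[OF this assms(1)[unfolded meas3_def]] show ?thesis by simp
qed

lemma meas3_inner:
  assumes T: "meas3 T" and [measurable]: "f \<in> M \<rightarrow>\<^sub>M borel" "g \<in> M \<rightarrow>\<^sub>M borel"
  shows "(\<lambda>x. \<integral>\<^sup>+ z. T (f x) (g x) z \<partial>lborel) \<in> borel_measurable M"
  by (rule lborel.borel_measurable_nn_integral, unfold split_beta', rule meas3_compose[OF T]; measurable)

lemma I3_swap12:
  assumes T: "meas3 T" shows "I3 T = I3 (\<lambda>x y z. T y x z)"
  unfolding I3_def
  by (rule lborel_pair.Fubini'[symmetric], unfold split_beta', rule meas3_inner[OF T]; measurable)

lemma I3_swap23:
  assumes T: "meas3 T" shows "I3 T = I3 (\<lambda>x y z. T x z y)"
  unfolding I3_def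
  by (rule nn_integral_cong, rule lborel_pair.Fubini'[symmetric], unfold split_beta', rule meas3_compose[OF T]; measurable)

lemma I3_add:
  assumes T: "meas3 T" and S: "meas3 S"
  shows "I3 (\<lambda>x y z. T x y z + S x y z) = I3 T + I3 S"
proof -
  have m1: "(\<lambda>z. T x y z) \<in> borel_measurable lborel" if "meas3 T" for T x y
    by (rule meas3_compose[OF that]; measurable)
  have m2: "(\<lambda>y. \<integral>\<^sup>+ z. T x y z \<partial>lborel) \<in> borel_measurable lborel" if "meas3 T" for T x
    by (rule meas3_inner[OF that]; measurable)
  have m3: "(\<lambda>x. \<integral>\<^sup>+ y. \<integral>\<^sup>+ z. T x y z \<partial>lborel \<partial>lborel) \<in> borel_measurable lborel" if "meas3 T" for T
    by (rule lborel.borel_measurable_nn_integral, unfold split_beta', rule meas3_inner[OF that]; measurable)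
  show ?thesis
    unfolding I3_def nn_integral_add[OF m1[OF T] m1[OF S]] nn_integral_add[OF m2[OF T] m2[OF S]]
      nn_integral_add[OF m3[OF T] m3[OF S]] ..
qed

lemma meas3_add: "meas3 T \<Longrightarrow> meas3 S \<Longrightarrow> meas3 (\<lambda>x y z. T x y z + S x y z)"
  unfolding meas3_def by measurable

text \<open>The normal form of a Schur term: the innermost integral is at most 1, then the kernel
  contributes \<open>K\<close>, then the outer factor at most 1.\<close>

lemma I3_product_le:
  fixes F :: "real^3 \<Rightarrow> ennreal"
  assumes F: "F \<in> borel_measurable borel" "(\<integral>\<^sup>+ x. F x \<partial>lborel) \<le> 1"
    and k: "\<And>x. k x \<in> borel_measurable borel" "\<And>x. (\<integral>\<^sup>+ y. k x y \<partial>lborel) \<le> K"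
    and H: "\<And>x y. H x y \<in> borel_measurable borel" "\<And>x y. (\<integral>\<^sup>+ z. H x y z \<partial>lborel) \<le> 1"
  shows "I3 (\<lambda>x y z. F x * k x y * H x y z) \<le> K"
proof -
  have "I3 (\<lambda>x y z. F x * k x y * H x y z) = (\<integral>\<^sup>+ x. \<integral>\<^sup>+ y. F x * k x y * (\<integral>\<^sup>+ z. H x y z \<partial>lborel) \<partial>lborel \<partial>lborel)"
    unfolding I3_def using H(1) by (simp add: nn_integral_cmult)
  also have "\<dots> \<le> (\<integral>\<^sup>+ x. \<integral>\<^sup>+ y. F x * k x y * 1 \<partial>lborel \<partial>lborel)"
    by (intro nn_integral_mono mult_left_mono H(2)) simp
  also have "\<dots> = (\<integral>\<^sup>+ x. F x * (\<integral>\<^sup>+ y. k x y \<partial>lborel) \<partial>lborel)"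
    using k(1) by (simp add: nn_integral_cmult)
  also have "\<dots> \<le> (\<integral>\<^sup>+ x. F x * K \<partial>lborel)"
    by (intro nn_integral_mono mult_left_mono k(2)) simp
  also have "\<dots> = (\<integral>\<^sup>+ x. F x \<partial>lborel) * K" using F(1) by (simp add: nn_integral_multc)
  also have "\<dots> \<le> 1 * K" by (intro mult_right_mono F(2)) simp
  finally show ?thesis by simp
qed

text \<open>Each of the ten terms of the pointwise bound is a square, a kernel and another square,
  and the constant \<open>10 * K\<close> counts them. The variable missing from the kernel occurs
  only in \<open>H\<close> or in a reflected or translated copy of \<open>P\<close>, so it can be
  integrated first.\<close>

lemma quadrilinear_schur:
  "\<exists>C\<ge>0. \<forall>f g h p :: real^3 \<Rightarrow> real.
    (\<forall>u\<in>{f, g, h, p}. u \<in> borel_measurable borel \<and> (\<forall>x. 0 \<le> u x) \<and> (\<integral>\<^sup>+ x. ennreal ((u x)\<^sup>2) \<partial>lborel) \<le> 1) \<longrightarrow>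
    I3 (\<lambda>a b c. ennreal (f a * g b * h c * p (c + (a - b)) * (JB (c + (a - b)) / (JB a * JB b * JB c)) * norm (a - b) powr (-2))) \<le> ennreal C"
proof -
  obtain K where K: "0 \<le> K" "\<And>x. (\<integral>\<^sup>+ y. ennreal (k1 x y) \<partial>lborel) \<le> ennreal K"
      "\<And>x. (\<integral>\<^sup>+ y. ennreal (k2 x y) \<partial>lborel) \<le> ennreal K" "\<And>x. (\<integral>\<^sup>+ y. ennreal (k3 x y) \<partial>lborel) \<le> ennreal K"
    using kernel_integrals by blast
  have "I3 (\<lambda>a b c. ennreal (f a * g b * h c * p (c + (a - b)) * (JB (c + (a - b)) / (JB a * JB b * JB c)) * norm (a - b) powr (-2))) \<le> ennreal (10 * K)"
    if A: "\<forall>u\<in>{f, g, h, p}. u \<in> borel_measurable borel \<and> (\<forall>x. 0 \<le> u x) \<and> (\<integral>\<^sup>+ x. ennreal ((u x)\<^sup>2) \<partial>lborel) \<le> 1"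
    for f g h p :: "real^3 \<Rightarrow> real"
  proof -
    have [measurable]: "f \<in> borel_measurable borel" "g \<in> borel_measurable borel" "h \<in> borel_measurable borel" "p \<in> borel_measurable borel"
      using A by auto
    define F G H P where "F x = ennreal ((f x)\<^sup>2)" and "G x = ennreal ((g x)\<^sup>2)" and "H x = ennreal ((h x)\<^sup>2)" and "P x = ennreal ((p x)\<^sup>2)" for x
    have [measurable]: "F \<in> borel_measurable borel" "G \<in> borel_measurable borel" "H \<in> borel_measurable borel" "P \<in> borel_measurable borel"
      unfolding F_def G_def H_def P_def by measurable
    have one: "(\<integral>\<^sup>+ x. F x \<partial>lborel) \<le> 1" "(\<integral>\<^sup>+ x. G x \<partial>lborel) \<le> 1" "(\<integral>\<^sup>+ x. H x \<partial>lborel) \<le> 1" "(\<integral>\<^sup>+ x. P x \<partial>lborel) \<le> 1"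
      using A unfolding F_def G_def H_def P_def by auto
    define K1 K2 K3 where "K1 x y = ennreal (k1 x y)" and "K2 x y = ennreal (k2 x y)" and "K3 x y = ennreal (k3 x y)" for x y
    have Km [measurable (raw)]: "(\<lambda>x. K1 (f x) (g x)) \<in> borel_measurable M" "(\<lambda>x. K2 (f x) (g x)) \<in> borel_measurable M"
        "(\<lambda>x. K3 (f x) (g x)) \<in> borel_measurable M"
      if [measurable]: "f \<in> M \<rightarrow>\<^sub>M borel" "g \<in> M \<rightarrow>\<^sub>M borel" for f g and M :: "'m measure"
      unfolding K1_def K2_def K3_def by measurable
    have Kx: "K1 x \<in> borel_measurable borel" "K2 x \<in> borel_measurable borel" "K3 x \<in> borel_measurable borel" for x
      by measurable
    have KK: "(\<integral>\<^sup>+ y. K1 x y \<partial>lborel) \<le> ennreal K" "(\<integral>\<^sup>+ y. K2 x y \<partial>lborel) \<le> ennreal K" "(\<integral>\<^sup>+ y. K3 x y \<partial>lborel) \<le> ennreal K" for x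
      unfolding K1_def K2_def K3_def by (rule K)+
    have Pz: "(\<integral>\<^sup>+ z. P (z + (x - y)) \<partial>lborel) \<le> 1" "(\<integral>\<^sup>+ z. P (x + (z - y)) \<partial>lborel) \<le> 1" "(\<integral>\<^sup>+ z. P (x + (y - z)) \<partial>lborel) \<le> 1" for x y
      using nn_integral_shift(2)[of P "x - y"] nn_integral_shift(2)[of P "x - y"] nn_integral_shift(3)[of P "x + y"] one
      by (simp_all add: algebra_simps)
    have Pm: "(\<lambda>z. P (z + (x - y))) \<in> borel_measurable borel" "(\<lambda>z. P (x + (z - y))) \<in> borel_measurable borel"
      "(\<lambda>z. P (x + (y - z))) \<in> borel_measurable borel" for x y by measurable
    note prod = I3_product_le[OF _ _ Kx(1) KK(1)] I3_product_le[OF _ _ Kx(2) KK(2)] I3_product_le[OF _ _ Kx(3) KK(3)]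
    let ?d = "\<lambda>a b c. c + (a - b)"
    have m [simp]: "meas3 (\<lambda>a b c. F a * K1 a b * H c)" "meas3 (\<lambda>a b c. F a * K1 a b * P (?d a b c))"
      "meas3 (\<lambda>a b c. G b * K1 b a * H c)" "meas3 (\<lambda>a b c. G b * K1 b a * P (?d a b c))"
      "meas3 (\<lambda>a b c. F a * K2 a b * H c)" "meas3 (\<lambda>a b c. G b * K3 b a * P (?d a b c))" "meas3 (\<lambda>a b c. G b * K3 b c * P (?d a b c))"
      "meas3 (\<lambda>a b c. G b * K2 b a * H c)" "meas3 (\<lambda>a b c. F a * K3 a b * P (?d a b c))" "meas3 (\<lambda>a b c. F a * K3 a c * P (?d a b c))"
      "meas3 (\<lambda>b a c. G b * K3 b c * P (?d a b c))"
      unfolding meas3_def by measurable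
    have "I3 (\<lambda>a b c. ennreal (f a * g b * h c * p (?d a b c) * (JB (?d a b c) / (JB a * JB b * JB c)) * norm (a - b) powr (-2)))
      \<le> I3 (\<lambda>a b c. (F a * K1 a b * H c + F a * K1 a b * P (?d a b c)) + (G b * K1 b a * H c + G b * K1 b a * P (?d a b c))
         + (F a * K2 a b * H c + G b * K3 b a * P (?d a b c) + G b * K3 b c * P (?d a b c))
         + (G b * K2 b a * H c + F a * K3 a b * P (?d a b c) + F a * K3 a c * P (?d a b c)))"
      unfolding I3_def
    \<comment> \<open>The pointwise bound requires \<open>a\<close>, \<open>b\<close> and
      \<open>c\<close> to be nonzero; in each variable the exceptional set is null.\<close>
    proof (rule nn_integral_mono_AE, use AE_lborel_singleton[of "0::real^3"] in eventually_elim)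
      fix a :: "real^3" assume a: "a \<noteq> 0"
      show "(\<integral>\<^sup>+ b. \<integral>\<^sup>+ c. ennreal (f a * g b * h c * p (?d a b c) * (JB (?d a b c) / (JB a * JB b * JB c)) * norm (a - b) powr (-2)) \<partial>lborel \<partial>lborel)
        \<le> (\<integral>\<^sup>+ b. \<integral>\<^sup>+ c. (F a * K1 a b * H c + F a * K1 a b * P (?d a b c)) + (G b * K1 b a * H c + G b * K1 b a * P (?d a b c))
         + (F a * K2 a b * H c + G b * K3 b a * P (?d a b c) + G b * K3 b c * P (?d a b c))
         + (G b * K2 b a * H c + F a * K3 a b * P (?d a b c) + F a * K3 a c * P (?d a b c)) \<partial>lborel \<partial>lborel)"
      proof (rule nn_integral_mono_AE, use AE_lborel_singleton[of "0::real^3"] in eventually_elim)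
        fix b :: "real^3" assume b: "b \<noteq> 0"
        show "(\<integral>\<^sup>+ c. ennreal (f a * g b * h c * p (?d a b c) * (JB (?d a b c) / (JB a * JB b * JB c)) * norm (a - b) powr (-2)) \<partial>lborel)
          \<le> (\<integral>\<^sup>+ c. (F a * K1 a b * H c + F a * K1 a b * P (?d a b c)) + (G b * K1 b a * H c + G b * K1 b a * P (?d a b c))
           + (F a * K2 a b * H c + G b * K3 b a * P (?d a b c) + G b * K3 b c * P (?d a b c))
           + (G b * K2 b a * H c + F a * K3 a b * P (?d a b c) + F a * K3 a c * P (?d a b c)) \<partial>lborel)"
        proof (rule nn_integral_mono_AE, use AE_lborel_singleton[of "0::real^3"] in eventually_elim)
          fix c :: "real^3" assume c: "c \<noteq> 0"
          have nn: "0 \<le> f a" "0 \<le> g b" "0 \<le> h c" "0 \<le> p (?d a b c)" using A by auto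
          show "ennreal (f a * g b * h c * p (?d a b c) * (JB (?d a b c) / (JB a * JB b * JB c)) * norm (a - b) powr (-2))
            \<le> (F a * K1 a b * H c + F a * K1 a b * P (?d a b c)) + (G b * K1 b a * H c + G b * K1 b a * P (?d a b c))
             + (F a * K2 a b * H c + G b * K3 b a * P (?d a b c) + G b * K3 b c * P (?d a b c))
             + (G b * K2 b a * H c + F a * K3 a b * P (?d a b c) + F a * K3 a c * P (?d a b c))"
            using ennreal_leI[OF quadrilinear_pointwise[OF a b c nn]]
            unfolding F_def G_def H_def P_def K1_def K2_def K3_def
            by (simp add: ennreal_plus ennreal_mult del: ennreal_le_iff)
        qed
      qed
    qed
    also have "\<dots> = (I3 (\<lambda>a b c. F a * K1 a b * H c) + I3 (\<lambda>a b c. F a * K1 a b * P (?d a b c)))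
       + (I3 (\<lambda>a b c. G b * K1 b a * H c) + I3 (\<lambda>a b c. G b * K1 b a * P (?d a b c)))
       + (I3 (\<lambda>a b c. F a * K2 a b * H c) + I3 (\<lambda>a b c. G b * K3 b a * P (?d a b c)) + I3 (\<lambda>a b c. G b * K3 b c * P (?d a b c)))
       + (I3 (\<lambda>a b c. G b * K2 b a * H c) + I3 (\<lambda>a b c. F a * K3 a b * P (?d a b c)) + I3 (\<lambda>a b c. F a * K3 a c * P (?d a b c)))"
      by (simp add: I3_add meas3_add)
    also have "\<dots> \<le> (ennreal K + ennreal K) + (ennreal K + ennreal K) + (ennreal K + ennreal K + ennreal K) + (ennreal K + ennreal K + ennreal K)"
    proof (intro add_mono)
      show "I3 (\<lambda>a b c. F a * K1 a b * H c) \<le> ennreal K" by (rule prod) (auto simp: one)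
      show "I3 (\<lambda>a b c. F a * K1 a b * P (?d a b c)) \<le> ennreal K" by (rule prod) (auto simp: one Pz Pm)
      show "I3 (\<lambda>a b c. G b * K1 b a * H c) \<le> ennreal K"
        by (subst I3_swap12, simp, rule prod) (auto simp: one)
      show "I3 (\<lambda>a b c. G b * K1 b a * P (?d a b c)) \<le> ennreal K"
        by (subst I3_swap12, simp, rule prod) (auto simp: one Pz Pm)
      show "I3 (\<lambda>a b c. F a * K2 a b * H c) \<le> ennreal K" by (rule prod) (auto simp: one)
      show "I3 (\<lambda>a b c. G b * K3 b a * P (?d a b c)) \<le> ennreal K"
        by (subst I3_swap12, simp, rule prod) (auto simp: one Pz Pm)
      \<comment> \<open>Here \<open>a\<close> occurs only inside \<open>P\<close>, so two swaps
        bring the variables into the order \<open>b\<close>, \<open>c\<close>,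
        \<open>a\<close>.\<close>
      show "I3 (\<lambda>a b c. G b * K3 b c * P (?d a b c)) \<le> ennreal K"
        by (subst I3_swap12, simp, subst I3_swap23, simp, rule prod) (auto simp: one Pz Pm)
      show "I3 (\<lambda>a b c. G b * K2 b a * H c) \<le> ennreal K"
        by (subst I3_swap12, simp, rule prod) (auto simp: one)
      show "I3 (\<lambda>a b c. F a * K3 a b * P (?d a b c)) \<le> ennreal K" by (rule prod) (auto simp: one Pz Pm)
      show "I3 (\<lambda>a b c. F a * K3 a c * P (?d a b c)) \<le> ennreal K"
        by (subst I3_swap23, simp, rule prod) (auto simp: one Pz Pm)
    qed
    also have "\<dots> = ennreal (10 * K)" using K(1) by (simp flip: ennreal_plus)
    finally show ?thesis .
  qed
  then show ?thesis using K(1) by (intro exI[of _ "10 * K"]) auto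
qed

text \<open>The kernel of the low-frequency regime alone. It is the Fourier side of Kato's
  inequality, which bounds the potential pointwise.\<close>

lemma bilinear_schur:
  "\<exists>C\<ge>0. \<forall>f :: real^3 \<Rightarrow> real.
    f \<in> borel_measurable borel \<and> (\<forall>x. 0 \<le> f x) \<and> (\<integral>\<^sup>+ x. ennreal ((f x)\<^sup>2) \<partial>lborel) \<le> 1 \<longrightarrow>
    (\<integral>\<^sup>+ a. \<integral>\<^sup>+ b. ennreal (f a * f b / (JB a * JB b) * norm (a - b) powr (-2)) \<partial>lborel \<partial>lborel) \<le> ennreal C"
proof -
  obtain K where K: "0 \<le> K" "\<And>x. (\<integral>\<^sup>+ y. ennreal (k1 x y) \<partial>lborel) \<le> ennreal K"
    using kernel_integrals by blast
  have "(\<integral>\<^sup>+ a. \<integral>\<^sup>+ b. ennreal (f a * f b / (JB a * JB b) * norm (a - b) powr (-2)) \<partial>lborel \<partial>lborel) \<le> ennreal (2 * K)"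
    if [measurable]: "f \<in> borel_measurable borel" and f0: "\<And>x. 0 \<le> f x" and f1: "(\<integral>\<^sup>+ x. ennreal ((f x)\<^sup>2) \<partial>lborel) \<le> 1" for f :: "real^3 \<Rightarrow> real"
  proof -
    have M: "(\<integral>\<^sup>+ a. \<integral>\<^sup>+ b. ennreal ((f a)\<^sup>2) * ennreal (k1 a b) \<partial>lborel \<partial>lborel) \<le> ennreal K"
    proof -
      have "(\<integral>\<^sup>+ a. \<integral>\<^sup>+ b. ennreal ((f a)\<^sup>2) * ennreal (k1 a b) \<partial>lborel \<partial>lborel)
        = (\<integral>\<^sup>+ a. ennreal ((f a)\<^sup>2) * (\<integral>\<^sup>+ b. ennreal (k1 a b) \<partial>lborel) \<partial>lborel)"
        by (simp add: nn_integral_cmult)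
      also have "\<dots> \<le> (\<integral>\<^sup>+ a. ennreal ((f a)\<^sup>2) * ennreal K \<partial>lborel)"
        by (intro nn_integral_mono mult_left_mono K) simp
      also have "\<dots> = (\<integral>\<^sup>+ a. ennreal ((f a)\<^sup>2) \<partial>lborel) * ennreal K" by (simp add: nn_integral_multc)
      also have "\<dots> \<le> 1 * ennreal K" by (intro mult_right_mono f1) simp
      finally show ?thesis by simp
    qed
    have "(\<integral>\<^sup>+ a. \<integral>\<^sup>+ b. ennreal (f a * f b / (JB a * JB b) * norm (a - b) powr (-2)) \<partial>lborel \<partial>lborel)
      \<le> (\<integral>\<^sup>+ a. \<integral>\<^sup>+ b. (ennreal ((f a)\<^sup>2) * ennreal (k1 a b) + ennreal ((f b)\<^sup>2) * ennreal (k1 b a)) \<partial>lborel \<partial>lborel)"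
    proof (rule nn_integral_mono_AE, use AE_lborel_singleton[of "0::real^3"] in eventually_elim)
      fix a :: "real^3" assume a: "a \<noteq> 0"
      show "(\<integral>\<^sup>+ b. ennreal (f a * f b / (JB a * JB b) * norm (a - b) powr (-2)) \<partial>lborel)
        \<le> (\<integral>\<^sup>+ b. (ennreal ((f a)\<^sup>2) * ennreal (k1 a b) + ennreal ((f b)\<^sup>2) * ennreal (k1 b a)) \<partial>lborel)"
      proof (rule nn_integral_mono_AE, use AE_lborel_singleton[of "0::real^3"] in eventually_elim)
        fix b :: "real^3" assume b: "b \<noteq> 0"
        have "f a * f b / (JB a * JB b) * norm (a - b) powr (-2) = f a * f b * ((1 / JB a) * (1 / JB b) * norm (a - b) powr (-2))"
          by simp
        also have "\<dots> \<le> f a * f b * (norm a powr (-1/2) * norm b powr (-1/2) * norm (a - b) powr (-2))"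
          using f0 a b by (intro mult_left_mono mult_right_mono mult_mono inverse_JB_le) auto
        also have "\<dots> \<le> 2 * (f a * f b * (norm a powr (-1/2) * norm b powr (-1/2) * norm (a - b) powr (-2)))"
          using f0[of a] f0[of b] by simp
        also have "\<dots> \<le> (f a)\<^sup>2 * k1 a b + (f b)\<^sup>2 * k1 b a"
          by (rule low_frequency_bound[OF a b f0 f0])
        finally show "ennreal (f a * f b / (JB a * JB b) * norm (a - b) powr (-2)) \<le> ennreal ((f a)\<^sup>2) * ennreal (k1 a b) + ennreal ((f b)\<^sup>2) * ennreal (k1 b a)"
          by (simp add: ennreal_leI flip: ennreal_mult ennreal_plus)
      qed
    qed
    also have "\<dots> = (\<integral>\<^sup>+ a. \<integral>\<^sup>+ b. ennreal ((f a)\<^sup>2) * ennreal (k1 a b) \<partial>lborel \<partial>lborel) + (\<integral>\<^sup>+ a. \<integral>\<^sup>+ b. ennreal ((f b)\<^sup>2) * ennreal (k1 b a) \<partial>lborel \<partial>lborel)"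
      by (simp add: nn_integral_add)
    also have "(\<integral>\<^sup>+ a. \<integral>\<^sup>+ b. ennreal ((f b)\<^sup>2) * ennreal (k1 b a) \<partial>lborel \<partial>lborel) = (\<integral>\<^sup>+ b. \<integral>\<^sup>+ a. ennreal ((f b)\<^sup>2) * ennreal (k1 b a) \<partial>lborel \<partial>lborel)"
      by (rule lborel_pair.Fubini'[symmetric]) (simp add: split_beta)
    also have "(\<integral>\<^sup>+ a. \<integral>\<^sup>+ b. ennreal ((f a)\<^sup>2) * ennreal (k1 a b) \<partial>lborel \<partial>lborel) + (\<integral>\<^sup>+ b. \<integral>\<^sup>+ a. ennreal ((f b)\<^sup>2) * ennreal (k1 b a) \<partial>lborel \<partial>lborel) \<le> ennreal K + ennreal K"
      by (intro add_mono M)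
    also have "\<dots> = ennreal (2 * K)" using K(1) by (simp flip: ennreal_plus)
    finally show ?thesis .
  qed
  then show ?thesis using K(1) by (intro exI[of _ "2 * K"]) auto
qed

section \<open>The Yukawa potential as a superposition of heat kernels\<close>

definition yukawa :: "real \<Rightarrow> real^3 \<Rightarrow> real" where
  "yukawa mu x = exp (- mu * norm x) / norm x"

definition wt :: "real \<Rightarrow> real \<Rightarrow> real" where
  "wt mu s = indicator {0<..} s * exp (- (mu\<^sup>2 * s / 2))"

lemma yukawa_measurable [measurable]: "yukawa mu \<in> borel_measurable borel"
  unfolding yukawa_def[abs_def] by measurable

lemma wt_measurable [measurable]: "wt mu \<in> borel_measurable borel"
  unfolding wt_def[abs_def] by measurable

lemma yukawa_nonneg [simp]: "0 \<le> yukawa mu x" by (simp add: yukawa_def)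
lemma wt_nonneg [simp]: "0 \<le> wt mu s" by (simp add: wt_def)

lemma heat_measurable2 [measurable (raw)]:
  assumes [measurable]: "f \<in> borel_measurable M" "g \<in> M \<rightarrow>\<^sub>M borel"
  shows "(\<lambda>x. heat (f x) (g x)) \<in> borel_measurable M"
  unfolding heat_def by measurable

lemma gauss_measurable2 [measurable (raw)]:
  assumes [measurable]: "f \<in> borel_measurable M" "g \<in> M \<rightarrow>\<^sub>M borel"
  shows "(\<lambda>x. gauss (f x) (g x)) \<in> borel_measurable M"
  unfolding gauss_def by measurable

text \<open>The antiderivative normalised to vanish at 0 is odd, because
  \<open>\<lambda>y. E y + E (- y)\<close> has derivative 0. Oddness transfers the limit at
  infinity, known from the Gaussian moment, to minus infinity.\<close>

lemma error_function_exists: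
  "\<exists>E :: real \<Rightarrow> real. (\<forall>x. (E has_real_derivative exp (- x\<^sup>2)) (at x)) \<and>
     (E \<longlongrightarrow> sqrt pi / 2) at_top \<and> (E \<longlongrightarrow> - (sqrt pi / 2)) at_bot"
proof -
  have "\<exists>F. \<forall>x :: real. (-\<infinity>::ereal) < x \<longrightarrow> x < (\<infinity>::ereal) \<longrightarrow> (F has_vector_derivative exp (- x\<^sup>2)) (at x)"
    by (rule einterval_antiderivative) auto
  then obtain E0 :: "real \<Rightarrow> real" where E0: "\<And>x. (E0 has_real_derivative exp (- x\<^sup>2)) (at x)"
    by (auto simp: has_real_derivative_iff_has_vector_derivative)
  define E where "E x = E0 x - E0 0" for x
  have E: "(E has_real_derivative exp (- x\<^sup>2)) (at x)" for x
    unfolding E_def by (auto intro!: derivative_eq_intros E0)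
  have "\<forall>x. ((\<lambda>y. E y + E (- y)) has_real_derivative 0) (at x)"
  proof
    fix x
    have "((\<lambda>y. E (- y)) has_real_derivative exp (- (- x)\<^sup>2) * (- 1)) (at x)"
      by (rule DERIV_chain2[OF E]) (auto intro!: derivative_eq_intros)
    from DERIV_add[OF E this] show "((\<lambda>y. E y + E (- y)) has_real_derivative 0) (at x)" by simp
  qed
  then have "E y + E (- y) = E 0 + E (- 0)" for y by (rule DERIV_isconst_all)
  moreover have "E 0 = 0" by (simp add: E_def)
  ultimately have "E y + E (- y) = 0" for y by simp
  then have odd: "E (- y) = - E y" for y by (simp only: add_eq_0_iff)
  have m: "integrable lborel (\<lambda>x::real. indicator {0..} x *\<^sub>R exp (- x\<^sup>2))"
    "(LINT x|lborel. indicator {0..} x *\<^sub>R exp (- x\<^sup>2)) = sqrt pi / 2"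
    using gaussian_moment_0 by (simp_all only: has_bochner_integral_iff)
  have "((\<lambda>y. LINT x|lborel. indicator {..y} x *\<^sub>R (indicator {0..} x *\<^sub>R exp (- x\<^sup>2))) \<longlongrightarrow> sqrt pi / 2) at_top"
    unfolding m(2)[symmetric] by (rule tendsto_integral_at_top[OF sets_lborel m(1)])
  moreover have "eventually (\<lambda>y. (LINT x|lborel. indicator {..y} x *\<^sub>R (indicator {0..} x *\<^sub>R exp (- x\<^sup>2))) = E y) at_top"
  proof (rule eventually_at_top_linorderI[of 0])
    fix y :: real assume y: "0 \<le> y"
    have I: "(LINT x|lborel. exp (- x\<^sup>2) * indicator {0..y} x) = E y - E 0"
      by (rule integral_FTC_Icc_real[OF y E]) auto
    have e: "indicator {..y} x *\<^sub>R (indicator {0..} x *\<^sub>R exp (- x\<^sup>2)) = exp (- x\<^sup>2) * indicator {0..y} x" for x :: real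
      by (auto simp: indicator_def)
    show "(LINT x|lborel. indicator {..y} x *\<^sub>R (indicator {0..} x *\<^sub>R exp (- x\<^sup>2))) = E y"
      unfolding e I by (simp add: E_def)
  qed
  ultimately have top: "(E \<longlongrightarrow> sqrt pi / 2) at_top" by (rule Lim_transform_eventually)
  have "((\<lambda>y. - E (- y)) \<longlongrightarrow> - (sqrt pi / 2)) at_bot"
    by (intro tendsto_minus filterlim_compose[OF top] filterlim_uminus_at_top_at_bot)
  then have "(E \<longlongrightarrow> - (sqrt pi / 2)) at_bot" by (simp add: odd)
  then show ?thesis using E top by blast
qed

text \<open>The integrand is, up to a factor, the density of the first hitting time of r by a Brownian
  motion with drift mu, whose distribution function is an explicit combination of error functions.\<close>

lemma inverse_gaussian_integral:
  fixes mu r :: real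
  assumes r: "0 < r" and mu: "0 \<le> mu"
  shows "(\<integral>\<^sup>+ s. ennreal (indicator {0<..} s * (2 * r / (2 * s * sqrt (2 * s)) * exp (- (mu\<^sup>2 * s / 2) - r\<^sup>2 / (2 * s)))) \<partial>lborel)
    = ennreal (sqrt pi * exp (- mu * r))"
proof -
  obtain E :: "real \<Rightarrow> real" where E: "\<And>x. (E has_real_derivative exp (- x\<^sup>2)) (at x)"
    "(E \<longlongrightarrow> sqrt pi / 2) at_top" "(E \<longlongrightarrow> - (sqrt pi / 2)) at_bot"
    using error_function_exists by blast
  define p q where "p s = (mu * s - r) / sqrt (2 * s)" and "q s = (mu * s + r) / sqrt (2 * s)" for s
  define G where "G s = exp (- mu * r) * E (p s) - exp (mu * r) * E (q s)" for s
  define g where "g s = 2 * r / (2 * s * sqrt (2 * s)) * exp (- (mu\<^sup>2 * s / 2) - r\<^sup>2 / (2 * s))" for s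
  have dG: "(G has_real_derivative g s) (at s)" if s: "0 < s" for s
  proof -
    define t where "t = sqrt (2 * s)"
    have t: "0 < t" "t * t = 2 * s" "t\<^sup>2 = 2 * s" using s by (auto simp: t_def)
    have dsq: "((\<lambda>s. sqrt (2 * s)) has_real_derivative 1 / t) (at s)"
      using s by (auto intro!: derivative_eq_intros simp: t_def field_simps)
    have t0: "sqrt (2 * s) \<noteq> 0" using s by simp
    have num: "((\<lambda>s. mu * s - r) has_real_derivative mu) (at s)" "((\<lambda>s. mu * s + r) has_real_derivative mu) (at s)"
      by (auto intro!: derivative_eq_intros)
    have dp: "(p has_real_derivative (mu * t - (mu * s - r) * (1 / t)) / (t * t)) (at s)"
      using DERIV_divide[OF num(1) dsq t0] unfolding p_def t_def[symmetric] .
    have dq: "(q has_real_derivative (mu * t - (mu * s + r) * (1 / t)) / (t * t)) (at s)"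
      using DERIV_divide[OF num(2) dsq t0] unfolding q_def t_def[symmetric] .
    have "(G has_real_derivative exp (- mu * r) * (exp (- (p s)\<^sup>2) * ((mu * t - (mu * s - r) * (1 / t)) / (t * t)))
         - exp (mu * r) * (exp (- (q s)\<^sup>2) * ((mu * t - (mu * s + r) * (1 / t)) / (t * t)))) (at s)"
      unfolding G_def by (intro DERIV_diff DERIV_cmult DERIV_chain2[OF E(1)] dp dq)
    \<comment> \<open>Completing the square: the cross terms of \<open>p\<close> and
      \<open>q\<close> cancel the prefactors, so both summands of \<open>G\<close> carry the same
      exponential and only the derivatives of \<open>p\<close> and \<open>q\<close> are
      subtracted.\<close>
    moreover have "exp (- mu * r) * exp (- (p s)\<^sup>2) = exp (- (mu\<^sup>2 * s / 2) - r\<^sup>2 / (2 * s))"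
    proof -
      have "(p s)\<^sup>2 = (mu * s - r)\<^sup>2 / (2 * s)" using s by (simp add: p_def power_divide)
      also have "\<dots> = mu\<^sup>2 * s / 2 - mu * r + r\<^sup>2 / (2 * s)" using s by (simp add: power2_eq_square field_simps)
      finally show ?thesis by (simp add: exp_add[symmetric])
    qed
    moreover have "exp (mu * r) * exp (- (q s)\<^sup>2) = exp (- (mu\<^sup>2 * s / 2) - r\<^sup>2 / (2 * s))"
    proof -
      have "(q s)\<^sup>2 = (mu * s + r)\<^sup>2 / (2 * s)" using s by (simp add: q_def power_divide)
      also have "\<dots> = mu\<^sup>2 * s / 2 + mu * r + r\<^sup>2 / (2 * s)" using s by (simp add: power2_eq_square field_simps)
      finally show ?thesis by (simp add: exp_add[symmetric])
    qed
    moreover have "(mu * t - (mu * s - r) * (1 / t)) / (t * t) - (mu * t - (mu * s + r) * (1 / t)) / (t * t) = 2 * r / (2 * s * t)"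
    proof -
      have "(mu * t - (mu * s - r) * (1 / t)) / (t * t) - (mu * t - (mu * s + r) * (1 / t)) / (t * t) = (2 * r * (1 / t)) / (t * t)"
        unfolding diff_divide_distrib[symmetric] by (simp add: diff_divide_distrib add_divide_distrib)
      also have "\<dots> = 2 * r / (2 * s * t)" unfolding t(2) by simp
      finally show ?thesis .
    qed
    ultimately show ?thesis
      unfolding g_def t_def[symmetric] by (simp only: mult.assoc[symmetric] right_diff_distrib[symmetric]) (simp only: mult.commute)
  qed
  have p0: "filterlim p at_bot (at_right 0)" unfolding p_def using r by real_asymp
  have q0: "filterlim q at_top (at_right 0)" unfolding q_def using r by real_asymp
  have A: "(G \<longlongrightarrow> exp (- mu * r) * (- (sqrt pi / 2)) - exp (mu * r) * (sqrt pi / 2)) (at_right 0)"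
    unfolding G_def by (intro tendsto_intros filterlim_compose[OF E(3) p0] filterlim_compose[OF E(2) q0])
  have B: "(G \<longlongrightarrow> exp (- mu * r) * (sqrt pi / 2) - exp (mu * r) * (sqrt pi / 2)) at_top"
  \<comment> \<open>For \<open>mu = 0\<close> the arguments \<open>p\<close> and \<open>q\<close>
    tend to 0 instead of infinity; the two error terms then cancel, in agreement with the general
    formula.\<close>
  proof (cases "mu = 0")
    case True
    have pq: "q s = - p s" for s by (simp add: p_def q_def True)
    have "(p \<longlongrightarrow> 0) at_top" "(q \<longlongrightarrow> 0) at_top" unfolding p_def q_def True using r by real_asymp+
    then have "((\<lambda>s. E (p s)) \<longlongrightarrow> E 0) at_top" "((\<lambda>s. E (q s)) \<longlongrightarrow> E 0) at_top"
      by (auto intro!: isCont_tendsto_compose[OF DERIV_isCont[OF E(1)]])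
    then have "(G \<longlongrightarrow> exp (- mu * r) * E 0 - exp (mu * r) * E 0) at_top" unfolding G_def by (intro tendsto_intros)
    then show ?thesis using True by simp
  next
    case False
    then have mu: "0 < mu" using mu by simp
    have pt: "filterlim p at_top at_top" unfolding p_def using r mu by real_asymp
    have qt: "filterlim q at_top at_top" unfolding q_def using r mu by real_asymp
    show ?thesis
      unfolding G_def by (intro tendsto_intros filterlim_compose[OF E(2) pt] filterlim_compose[OF E(2) qt])
  qed
  have dG': "DERIV G x :> g x" if "0 < ereal x" "ereal x < \<infinity>" for x using dG[of x] that by simp
  have cg: "isCont g x" if "0 < ereal x" "ereal x < \<infinity>" for x
    unfolding g_def using that by (intro continuous_intros) auto
  have gn: "AE x in lborel. 0 < ereal x \<longrightarrow> ereal x < \<infinity> \<longrightarrow> 0 \<le> g x"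
    using r by (intro AE_I2) (auto simp: g_def)
  have A': "((G \<circ> real_of_ereal) \<longlongrightarrow> exp (- mu * r) * (- (sqrt pi / 2)) - exp (mu * r) * (sqrt pi / 2)) (at_right 0)"
    using A by (simp add: zero_ereal_def ereal_tendsto_simps)
  have B': "((G \<circ> real_of_ereal) \<longlongrightarrow> exp (- mu * r) * (sqrt pi / 2) - exp (mu * r) * (sqrt pi / 2)) (at_left \<infinity>)"
    using B by (simp add: ereal_tendsto_simps)
  note FTC = interval_integral_FTC_nonneg[of 0 \<infinity>, OF _ dG' cg gn A' B']
  have ein: "einterval 0 \<infinity> = {0<..}" by (auto simp: einterval_def)
  have i: "integrable lborel (\<lambda>s. indicator {0<..} s * g s)"
    using FTC(1) by (simp add: set_integrable_def ein)
  have "(LINT s|lborel. indicator {0<..} s * g s) = sqrt pi * exp (- mu * r)"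
    using FTC(2) by (simp add: interval_lebesgue_integral_def ein set_lebesgue_integral_def)
  moreover have "AE s in lborel. 0 \<le> indicator {0<..} s * g s"
    using r by (intro AE_I2) (auto simp: g_def indicator_def)
  ultimately show ?thesis
    using nn_integral_eq_integral[OF i] unfolding g_def by simp
qed

text \<open>Subordination. The left side is the Green function of the operator
  \<open>(mu\<^sup>2 - \<Delta>) / 2\<close>, written as the Laplace transform of its heat
  semigroup; the one half explains the factor \<open>2 * pi\<close> in place of
  \<open>4 * pi\<close>. The Coulomb case \<open>mu = 0\<close> is included.\<close>

lemma yukawa_heat:
  assumes x: "x \<noteq> 0" and mu: "0 \<le> mu"
  shows "(\<integral>\<^sup>+ s. ennreal (wt mu s * heat s x) \<partial>lborel) = ennreal (yukawa mu x / (2 * pi))"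
proof -
  define r where "r = norm x"
  have r: "0 < r" using x by (simp add: r_def)
  \<comment> \<open>The quotient of the heat prefactor \<open>(2 * pi * s) powr (-3/2)\<close> by
    the prefactor in \<open>inverse_gaussian_integral\<close>.\<close>
  define K where "K = 1 / (2 * r * pi * sqrt pi)"
  have K: "0 \<le> K" using r by (simp add: K_def)
  have eq: "wt mu s * heat s x = K * (indicator {0<..} s * (2 * r / (2 * s * sqrt (2 * s)) * exp (- (mu\<^sup>2 * s / 2) - r\<^sup>2 / (2 * s))))" for s
  proof (cases "0 < s")
    case True
    have "(2 * pi * s) powr (-3/2) = 1 / ((2 * pi * s) powr 1 * (2 * pi * s) powr (1/2))"
      by (subst powr_add[symmetric]) (simp add: powr_minus_divide)
    also have "\<dots> = 1 / (2 * pi * s * (sqrt pi * sqrt (2 * s)))"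
      using True by (simp add: powr_half_sqrt real_sqrt_mult mult_ac)
    also have "\<dots> = K * (2 * r / (2 * s * sqrt (2 * s)))"
      using True r by (simp add: K_def field_simps)
    finally have P: "(2 * pi * s) powr (-3/2) = K * (2 * r / (2 * s * sqrt (2 * s)))" .
    have e: "exp (- (mu\<^sup>2 * s / 2) - r\<^sup>2 / (2 * s)) = exp (- (mu\<^sup>2 * s / 2)) * exp (- (r\<^sup>2 / (2 * s)))"
      by (simp add: exp_add[symmetric])
    have i: "indicator {0<..} s = (1::real)" using True by simp
    show ?thesis
      unfolding wt_def heat_def r_def[symmetric] P e i by (simp only: mult_ac)
  qed (simp add: wt_def)
  have "(\<integral>\<^sup>+ s. ennreal (wt mu s * heat s x) \<partial>lborel) = ennreal K * ennreal (sqrt pi * exp (- mu * r))"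
    unfolding eq inverse_gaussian_integral[OF r mu, symmetric] using K r
    by (subst nn_integral_cmult[symmetric], measurable, intro nn_integral_cong ennreal_mult) (auto simp: indicator_def)
  also have "\<dots> = ennreal (yukawa mu x / (2 * pi))"
    using K r by (subst ennreal_mult[symmetric]) (auto simp: K_def yukawa_def r_def field_simps)
  finally show ?thesis .
qed

text \<open>Dropping the factor that contains \<open>mu\<close> leaves the Coulomb case, an
  exponential integral with rate \<open>(norm h)\<^sup>2 / 2\<close>. This is why all later
  constants are uniform in \<open>mu\<close>.\<close>

lemma wt_gauss_integral:
  assumes h: "h \<noteq> 0"
  shows "(\<integral>\<^sup>+ s. ennreal (wt mu s * gauss s h) \<partial>lborel) \<le> ennreal (2 * norm h powr (-2))"
proof -
  define c where "c = (norm h)\<^sup>2 / 2"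
  have c: "0 < c" using h by (simp add: c_def)
  have "(\<integral>\<^sup>+ s. ennreal (wt mu s * gauss s h) \<partial>lborel) \<le> (\<integral>\<^sup>+ s. ennreal (exp (- (c * s))) * indicator {0..} s \<partial>lborel)"
  proof (rule nn_integral_mono)
    fix s :: real
    have "exp (- (mu\<^sup>2 * s / 2)) \<le> 1" if "0 < s" using that by simp
    then show "ennreal (wt mu s * gauss s h) \<le> ennreal (exp (- (c * s))) * indicator {0..} s"
      by (auto simp: wt_def gauss_def c_def indicator_def mult.commute intro!: ennreal_leI mult_left_le)
  qed
  also have "\<dots> = ennreal (0 - (- (exp (- (c * 0)) / c)))"
  proof (rule nn_integral_FTC_atLeast)
    show "((\<lambda>s. - (exp (- (c * s)) / c)) \<longlongrightarrow> 0) at_top" using c by real_asymp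
    show "((\<lambda>s. - (exp (- (c * s)) / c)) has_real_derivative exp (- (c * s))) (at s)" for s
      using c by (auto intro!: derivative_eq_intros)
  qed auto
  also have "0 - (- (exp (- (c * 0)) / c)) = 2 * norm h powr (-2)"
    using h by (simp add: c_def powr_minus_divide powr_numeral)
  finally show ?thesis .
qed

lemma wt_gauss_le:
  fixes A :: "real^3 \<Rightarrow> ennreal"
  assumes [measurable]: "A \<in> borel_measurable borel"
  shows "(\<integral>\<^sup>+ s. ennreal (wt mu s) * (\<integral>\<^sup>+ h. ennreal (gauss s h) * A h \<partial>lborel) \<partial>lborel)
    \<le> (\<integral>\<^sup>+ h. ennreal (2 * norm h powr (-2)) * A h \<partial>lborel)"
proof -
  have "(\<integral>\<^sup>+ s. ennreal (wt mu s) * (\<integral>\<^sup>+ h. ennreal (gauss s h) * A h \<partial>lborel) \<partial>lborel)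
      = (\<integral>\<^sup>+ s. \<integral>\<^sup>+ h. ennreal (wt mu s * gauss s h) * A h \<partial>lborel \<partial>lborel)"
    by (simp add: nn_integral_cmult[symmetric] ennreal_mult mult.assoc)
  also have "\<dots> = (\<integral>\<^sup>+ h. \<integral>\<^sup>+ s. ennreal (wt mu s * gauss s h) * A h \<partial>lborel \<partial>lborel)"
    by (rule lborel_pair.Fubini'[symmetric]) measurable
  also have "\<dots> = (\<integral>\<^sup>+ h. (\<integral>\<^sup>+ s. ennreal (wt mu s * gauss s h) \<partial>lborel) * A h \<partial>lborel)"
    by (simp add: nn_integral_multc)
  also have "\<dots> \<le> (\<integral>\<^sup>+ h. ennreal (2 * norm h powr (-2)) * A h \<partial>lborel)"
    by (rule nn_integral_mono_AE, use AE_lborel_singleton[of "0::real^3"] in eventually_elim)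
       (intro mult_right_mono wt_gauss_integral, auto)
  finally show ?thesis .
qed

text \<open>For a function that is not integrable the Bochner integral is 0, and the bound is
  trivial.\<close>

lemma norm_integral_le_nn:
  fixes f :: "_ \<Rightarrow> _ :: {banach, second_countable_topology}"
  shows "ennreal (norm (LINT x|M. f x)) \<le> (\<integral>\<^sup>+ x. ennreal (norm (f x)) \<partial>M)"
  by (cases "integrable M f") (auto intro: integral_norm_bound_ennreal simp: not_integrable_integral_eq)

text \<open>The counterpart of \<open>heat_fubini\<close> at a fixed point \<open>x\<close>, which
  then enters the right side only through a phase.\<close>

lemma heat_fourier_single:
  fixes f :: "real^3 \<Rightarrow> complex"
  assumes f: "integrable lborel f" and s: "0 < s"
  shows "(LINT y|lborel. complex_of_real (heat s (x - y)) * f y)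
    = complex_of_real (1 / (2 * pi) ^ 3) * (LINT h|lborel. complex_of_real (gauss s h) *
        (cis (x \<bullet> h) * (LINT y|lborel. cis (- (y \<bullet> h)) * f y)))"
proof -
  have [measurable]: "f \<in> borel_measurable borel" using f by auto
  define Q where "Q h y = complex_of_real (gauss s h) * cis (h \<bullet> (x - y)) * f y" for h y
  have Qm: "(\<lambda>(h, y). Q h y) \<in> borel_measurable (lborel \<Otimes>\<^sub>M lborel)" unfolding Q_def by measurable
  have ig: "integrable lborel (\<lambda>h. complex_of_real (gauss s h))" using gauss_integrable[OF s] by simp
  have iQ: "integrable (lborel \<Otimes>\<^sub>M lborel) (\<lambda>(h, y). Q h y)"
    by (rule Bochner_Integration.integrable_bound[OF integrable_product(1)[OF ig f] Qm])
       (auto simp: Q_def norm_mult)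
  have "(LINT h|lborel. LINT y|lborel. Q h y) = (LINT y|lborel. LINT h|lborel. Q h y)"
    using lborel_pair.Fubini_integral[OF iQ] by simp
  moreover have "(LINT h|lborel. Q h y) = complex_of_real ((2 * pi) ^ 3) * (complex_of_real (heat s (x - y)) * f y)" for y
    unfolding Q_def integral_mult_left_zero gauss_fourier(2)[OF s] by (simp add: mult_ac)
  moreover have "(LINT y|lborel. Q h y) = complex_of_real (gauss s h) * (cis (x \<bullet> h) * (LINT y|lborel. cis (- (y \<bullet> h)) * f y))" for h
  proof -
    have "Q h y = complex_of_real (gauss s h) * (cis (x \<bullet> h) * (cis (- (y \<bullet> h)) * f y))" for y
    proof -
      have "cis (h \<bullet> (x - y)) = cis (x \<bullet> h) * cis (- (y \<bullet> h))"
        by (simp add: cis_mult inner_diff_right inner_commute)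
      then show ?thesis by (simp add: Q_def)
    qed
    then show ?thesis by (simp only: integral_mult_right_zero)
  qed
  ultimately have "(LINT h|lborel. complex_of_real (gauss s h) * (cis (x \<bullet> h) * (LINT y|lborel. cis (- (y \<bullet> h)) * f y)))
    = (LINT y|lborel. complex_of_real ((2 * pi) ^ 3) * (complex_of_real (heat s (x - y)) * f y))" by simp
  also have "\<dots> = complex_of_real ((2 * pi) ^ 3) * (LINT y|lborel. complex_of_real (heat s (x - y)) * f y)"
    by (rule integral_mult_right_zero)
  finally show ?thesis by simp
qed

section \<open>The Hartree term\<close>

abbreviation iJB :: "real^3 \<Rightarrow> complex" where "iJB x \<equiv> complex_of_real (1 / JB x)"

lemma bmult_iJB [simp]: "bmult iJB"
  by (rule bmultI[where C=1]) (use JB_ge_1 in \<open>auto simp: norm_divide\<close>)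

text \<open>Elements of H^{1/2} are parametrised isometrically by L2: the function with parameter f
  has Fourier transform f / JB.\<close>

definition Hs :: "l2 \<Rightarrow> l2" where "Hs f = FTi (mlt iJB f)"

lemma Hs_add: "Hs (f + g) = Hs f + Hs g" unfolding Hs_def mlt_add[OF bmult_iJB] FTi_add ..
lemma Hs_scaleR: "Hs (r *\<^sub>R f) = r *\<^sub>R Hs f" unfolding Hs_def mlt_scaleR[OF bmult_iJB] FTi_scaleR ..

lemma FT_Hs: "FT (Hs f) = mlt iJB f" by (simp add: Hs_def)

lemma rp_FT_Hs: "AE h in lborel. rp (FT (Hs f)) h = rp f h / JB h"
  unfolding FT_Hs using rp_mlt[OF bmult_iJB, of f] by eventually_elim simp

abbreviation uf :: "l2 \<Rightarrow> real^3 \<Rightarrow> complex" where "uf f \<equiv> rp (Hs f)"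

text \<open>Almost everywhere this is the modulus of the Fourier transform of
  \<open>uf f\<close>.\<close>

definition wm :: "l2 \<Rightarrow> real^3 \<Rightarrow> real" where "wm f a = cmod (rp f a) / JB a"

lemma wm_measurable [measurable]: "wm f \<in> borel_measurable borel"
  unfolding wm_def[abs_def] by measurable

lemma wm_nonneg [simp]: "0 \<le> wm f a" by (simp add: wm_def)

lemma fourier_product_wm:
  "ennreal (cmod (LINT x|lborel. cis (- (x \<bullet> h)) * (uf f x * cnj (uf g x))))
    \<le> (\<integral>\<^sup>+ a. ennreal (wm f a) * ennreal (wm g (a - h)) \<partial>lborel)"
proof -
  have "ennreal (cmod (LINT x|lborel. cis (- (x \<bullet> h)) * (uf f x * cnj (uf g x))))
    \<le> (\<integral>\<^sup>+ a. ennreal (cmod (rp (FT (cl (uf f))) a)) * ennreal (cmod (rp (FT (cl (uf g))) (a - h))) \<partial>lborel)"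
    by (rule fourier_product_le) auto
  also have "\<dots> = (\<integral>\<^sup>+ a. ennreal (wm f a) * ennreal (wm g (a - h)) \<partial>lborel)"
    by (rule nn_integral_cong_AE)
       (use rp_FT_Hs[of f] AE_translate[OF rp_FT_Hs[of g], of h] in eventually_elim, simp add: wm_def norm_divide)
  finally show ?thesis .
qed

section \<open>Kato's inequality\<close>

lemma AE_neq: "AE y in lborel. x - y \<noteq> (0 :: real^3)"
  using AE_lborel_singleton[of x] by eventually_elim auto

lemma norm_le_1_nn: "norm f \<le> 1 \<Longrightarrow> (\<integral>\<^sup>+ x. ennreal ((cmod (rp f x))\<^sup>2) \<partial>lborel) \<le> 1"
  unfolding nn_integral_rp using power_mono[of "norm f" 1 2] by simp

text \<open>On the Fourier side \<open>x\<close> occurs only in a phase, which is lost on taking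
  moduli; hence the bound is uniform in \<open>x\<close>. What remains is
  \<open>bilinear_schur\<close> after the substitution \<open>b = a - h\<close>.\<close>

lemma kato_unit:
  "\<exists>C\<ge>0. \<forall>mu f x. 0 \<le> mu \<longrightarrow> norm f \<le> 1 \<longrightarrow>
    (\<integral>\<^sup>+ y. ennreal (yukawa mu (x - y)) * ennreal ((cmod (uf f y))\<^sup>2) \<partial>lborel) \<le> ennreal C"
proof -
  obtain C where C: "0 \<le> C" "\<And>f :: real^3 \<Rightarrow> real.
    f \<in> borel_measurable borel \<and> (\<forall>x. 0 \<le> f x) \<and> (\<integral>\<^sup>+ x. ennreal ((f x)\<^sup>2) \<partial>lborel) \<le> 1 \<Longrightarrow>
    (\<integral>\<^sup>+ a. \<integral>\<^sup>+ b. ennreal (f a * f b / (JB a * JB b) * norm (a - b) powr (-2)) \<partial>lborel \<partial>lborel) \<le> ennreal C"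
    using bilinear_schur by blast
  define c where "c = 1 / (2 * pi) ^ 3"
  have c: "0 \<le> c" by (simp add: c_def)
  have "(\<integral>\<^sup>+ y. ennreal (yukawa mu (x - y)) * ennreal ((cmod (uf f y))\<^sup>2) \<partial>lborel) \<le> ennreal (2 * pi) * (ennreal c * (ennreal 2 * ennreal C))"
    if mu: "0 \<le> mu" and f: "norm f \<le> 1" for mu f x
  proof -
    let ?u = "uf f"
    define A where "A h = (LINT y|lborel. cis (- (y \<bullet> h)) * (?u y * cnj (?u y)))" for h
    have [measurable]: "A \<in> borel_measurable borel" unfolding A_def by measurable
    have iu: "integrable lborel (\<lambda>y. ?u y * cnj (?u y))" by (intro L2_mult_integrable L2_cnj L2_rp)
    have "(\<integral>\<^sup>+ y. ennreal (yukawa mu (x - y)) * ennreal ((cmod (?u y))\<^sup>2) \<partial>lborel)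
      = (\<integral>\<^sup>+ y. ennreal (2 * pi) * (\<integral>\<^sup>+ s. ennreal (wt mu s * heat s (x - y)) * ennreal ((cmod (?u y))\<^sup>2) \<partial>lborel) \<partial>lborel)"
    proof (rule nn_integral_cong_AE, use AE_neq[of x] in eventually_elim)
      fix y assume xy: "x - y \<noteq> 0"
      have "(\<integral>\<^sup>+ s. ennreal (wt mu s * heat s (x - y)) * ennreal ((cmod (?u y))\<^sup>2) \<partial>lborel)
          = ennreal (yukawa mu (x - y) / (2 * pi)) * ennreal ((cmod (?u y))\<^sup>2)"
        by (subst nn_integral_multc) (auto simp: yukawa_heat[OF xy mu])
      moreover have "ennreal (2 * pi) * ennreal (yukawa mu (x - y) / (2 * pi)) = ennreal (yukawa mu (x - y))"
        by (subst ennreal_mult[symmetric]) auto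
      ultimately show "ennreal (yukawa mu (x - y)) * ennreal ((cmod (?u y))\<^sup>2)
        = ennreal (2 * pi) * (\<integral>\<^sup>+ s. ennreal (wt mu s * heat s (x - y)) * ennreal ((cmod (?u y))\<^sup>2) \<partial>lborel)"
        by (simp only: mult.assoc[symmetric])
    qed
    also have "\<dots> = ennreal (2 * pi) * (\<integral>\<^sup>+ y. \<integral>\<^sup>+ s. ennreal (wt mu s * heat s (x - y)) * ennreal ((cmod (?u y))\<^sup>2) \<partial>lborel \<partial>lborel)"
      by (rule nn_integral_cmult) measurable
    also have "(\<integral>\<^sup>+ y. \<integral>\<^sup>+ s. ennreal (wt mu s * heat s (x - y)) * ennreal ((cmod (?u y))\<^sup>2) \<partial>lborel \<partial>lborel)
      = (\<integral>\<^sup>+ s. \<integral>\<^sup>+ y. ennreal (wt mu s * heat s (x - y)) * ennreal ((cmod (?u y))\<^sup>2) \<partial>lborel \<partial>lborel)"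
      by (rule lborel_pair.Fubini') measurable
    also have "\<dots> = (\<integral>\<^sup>+ s. ennreal (wt mu s) * (\<integral>\<^sup>+ y. ennreal (heat s (x - y)) * ennreal ((cmod (?u y))\<^sup>2) \<partial>lborel) \<partial>lborel)"
      by (simp add: nn_integral_cmult[symmetric] ennreal_mult mult.assoc)
    also have "\<dots> \<le> (\<integral>\<^sup>+ s. ennreal (wt mu s) * (ennreal c * (\<integral>\<^sup>+ h. ennreal (gauss s h) * ennreal (cmod (A h)) \<partial>lborel)) \<partial>lborel)"
    proof (rule nn_integral_mono)
      fix s :: real
      show "ennreal (wt mu s) * (\<integral>\<^sup>+ y. ennreal (heat s (x - y)) * ennreal ((cmod (?u y))\<^sup>2) \<partial>lborel)
        \<le> ennreal (wt mu s) * (ennreal c * (\<integral>\<^sup>+ h. ennreal (gauss s h) * ennreal (cmod (A h)) \<partial>lborel))"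
      proof (cases "0 < s")
        case s: True
        have hb: "heat s z \<le> (2 * pi * s) powr (-3/2)" for z
          using s by (auto simp: heat_def intro!: mult_left_le)
        have i: "integrable lborel (\<lambda>y. heat s (x - y) * (cmod (?u y))\<^sup>2)"
        proof (rule Bochner_Integration.integrable_bound)
          show "integrable lborel (\<lambda>y. (2 * pi * s) powr (-3/2) * (cmod (?u y))\<^sup>2)"
            by (intro integrable_mult_right L2_integrable L2_rp)
          show "AE y in lborel. norm (heat s (x - y) * (cmod (?u y))\<^sup>2) \<le> norm ((2 * pi * s) powr (-3/2) * (cmod (?u y))\<^sup>2)"
            by (rule AE_I2) (use hb in \<open>auto simp: abs_mult intro!: mult_right_mono\<close>)
        qed measurable
        have "(\<integral>\<^sup>+ y. ennreal (heat s (x - y)) * ennreal ((cmod (?u y))\<^sup>2) \<partial>lborel) = ennreal (LINT y|lborel. heat s (x - y) * (cmod (?u y))\<^sup>2)"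
          using nn_integral_eq_integral[OF i] by (simp add: ennreal_mult)
        also have "(LINT y|lborel. heat s (x - y) * (cmod (?u y))\<^sup>2) = cmod (LINT y|lborel. complex_of_real (heat s (x - y) * (cmod (?u y))\<^sup>2))"
          by (simp only: integral_complex_of_real norm_of_real) (simp add: integral_nonneg_AE)
        also have "(LINT y|lborel. complex_of_real (heat s (x - y) * (cmod (?u y))\<^sup>2)) = (LINT y|lborel. complex_of_real (heat s (x - y)) * (?u y * cnj (?u y)))"
          by (simp only: complex_norm_square[symmetric] of_real_mult)
        also have "\<dots> = complex_of_real c * (LINT h|lborel. complex_of_real (gauss s h) * (cis (x \<bullet> h) * A h))"
          unfolding heat_fourier_single[OF iu s] c_def A_def ..
        also have "ennreal (cmod \<dots>) = ennreal c * ennreal (cmod (LINT h|lborel. complex_of_real (gauss s h) * (cis (x \<bullet> h) * A h)))"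
          using c by (simp add: norm_mult ennreal_mult)
        also have "\<dots> \<le> ennreal c * (\<integral>\<^sup>+ h. ennreal (gauss s h) * ennreal (cmod (A h)) \<partial>lborel)"
          using norm_integral_le_nn[of lborel "\<lambda>h. complex_of_real (gauss s h) * (cis (x \<bullet> h) * A h)"]
          by (intro mult_left_mono) (auto simp: norm_mult ennreal_mult)
        finally show ?thesis by (rule mult_left_mono) simp
      qed (simp add: wt_def)
    qed
    also have "\<dots> = ennreal c * (\<integral>\<^sup>+ s. ennreal (wt mu s) * (\<integral>\<^sup>+ h. ennreal (gauss s h) * ennreal (cmod (A h)) \<partial>lborel) \<partial>lborel)"
      by (subst nn_integral_cmult[symmetric]) (measurable, simp add: mult.left_commute)
    also have "\<dots> \<le> ennreal c * (\<integral>\<^sup>+ h. ennreal (2 * norm h powr (-2)) * ennreal (cmod (A h)) \<partial>lborel)"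
      by (intro mult_left_mono wt_gauss_le) auto
    also have "(\<integral>\<^sup>+ h. ennreal (2 * norm h powr (-2)) * ennreal (cmod (A h)) \<partial>lborel)
      \<le> (\<integral>\<^sup>+ h. ennreal (2 * norm h powr (-2)) * (\<integral>\<^sup>+ a. ennreal (wm f a) * ennreal (wm f (a - h)) \<partial>lborel) \<partial>lborel)"
      unfolding A_def by (intro nn_integral_mono mult_left_mono fourier_product_wm) simp
    also have "\<dots> = (\<integral>\<^sup>+ h. \<integral>\<^sup>+ a. ennreal 2 * ennreal (wm f a * wm f (a - h) * norm h powr (-2)) \<partial>lborel \<partial>lborel)"
      by (subst nn_integral_cmult[symmetric]) (measurable, simp add: ennreal_mult mult_ac)
    also have "\<dots> = (\<integral>\<^sup>+ a. \<integral>\<^sup>+ h. ennreal 2 * ennreal (wm f a * wm f (a - h) * norm h powr (-2)) \<partial>lborel \<partial>lborel)"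
      by (rule lborel_pair.Fubini') measurable
    also have "\<dots> = ennreal 2 * (\<integral>\<^sup>+ a. \<integral>\<^sup>+ h. ennreal (wm f a * wm f (a - h) * norm h powr (-2)) \<partial>lborel \<partial>lborel)"
      by (simp add: nn_integral_cmult)
    also have "(\<integral>\<^sup>+ a. \<integral>\<^sup>+ h. ennreal (wm f a * wm f (a - h) * norm h powr (-2)) \<partial>lborel \<partial>lborel)
       = (\<integral>\<^sup>+ a. \<integral>\<^sup>+ b. ennreal (wm f a * wm f b * norm (a - b) powr (-2)) \<partial>lborel \<partial>lborel)"
    proof (rule nn_integral_cong)
      fix a :: "real^3"
      show "(\<integral>\<^sup>+ h. ennreal (wm f a * wm f (a - h) * norm h powr (-2)) \<partial>lborel) = (\<integral>\<^sup>+ b. ennreal (wm f a * wm f b * norm (a - b) powr (-2)) \<partial>lborel)"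
        using nn_integral_shift(3)[of "\<lambda>b. ennreal (wm f a * wm f b * norm (a - b) powr (-2))" a] by simp
    qed
    also have "\<dots> = (\<integral>\<^sup>+ a. \<integral>\<^sup>+ b. ennreal (cmod (rp f a) * cmod (rp f b) / (JB a * JB b) * norm (a - b) powr (-2)) \<partial>lborel \<partial>lborel)"
      by (simp add: wm_def)
    also have "\<dots> \<le> ennreal C"
      by (rule C(2)) (use norm_le_1_nn[OF f] in auto)
    finally show ?thesis by (simp add: mult_left_mono)
  qed
  moreover have "ennreal (2 * pi) * (ennreal c * (ennreal 2 * ennreal C)) = ennreal (2 * pi * (c * (2 * C)))"
    by (simp only: ennreal_mult mult_nonneg_nonneg c C(1) pi_ge_zero zero_le_numeral)
  ultimately show ?thesis using c C(1) by (intro exI[of _ "2 * pi * (c * (2 * C))"]) auto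
qed

lemma uf_scaleR: "AE y in lborel. uf (r *\<^sub>R f) y = r *\<^sub>R uf f y"
  unfolding Hs_scaleR by (rule rp_scaleR)

lemma uf_add: "AE y in lborel. uf (f + g) y = uf f y + uf g y"
  unfolding Hs_add by (rule rp_add)

lemma l2_unit_cases:
  fixes f :: "'a::real_normed_vector"
  obtains r g where "0 \<le> r" "norm g \<le> 1" "f = r *\<^sub>R g" "r = norm f"
proof (cases "f = 0")
  case True
  then show ?thesis by (intro that[of 0 0]) auto
next
  case False
  then show ?thesis by (intro that[of "norm f" "f /\<^sub>R norm f"]) auto
qed

lemma kato:
  "\<exists>C\<ge>0. \<forall>mu f x. 0 \<le> mu \<longrightarrow>
    (\<integral>\<^sup>+ y. ennreal (yukawa mu (x - y)) * ennreal ((cmod (uf f y))\<^sup>2) \<partial>lborel) \<le> ennreal (C * (norm f)\<^sup>2)"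
proof -
  obtain C where C: "0 \<le> C" "\<And>mu f x. 0 \<le> mu \<Longrightarrow> norm f \<le> 1 \<Longrightarrow>
    (\<integral>\<^sup>+ y. ennreal (yukawa mu (x - y)) * ennreal ((cmod (uf f y))\<^sup>2) \<partial>lborel) \<le> ennreal C"
    using kato_unit by blast
  have "(\<integral>\<^sup>+ y. ennreal (yukawa mu (x - y)) * ennreal ((cmod (uf f y))\<^sup>2) \<partial>lborel) \<le> ennreal (C * (norm f)\<^sup>2)"
    if mu: "0 \<le> mu" for mu f x
  proof -
    obtain r g where g: "0 \<le> r" "norm g \<le> 1" "f = r *\<^sub>R g" "r = norm f" using l2_unit_cases .
    have "(\<integral>\<^sup>+ y. ennreal (yukawa mu (x - y)) * ennreal ((cmod (uf f y))\<^sup>2) \<partial>lborel)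
      = (\<integral>\<^sup>+ y. ennreal (r\<^sup>2) * (ennreal (yukawa mu (x - y)) * ennreal ((cmod (uf g y))\<^sup>2)) \<partial>lborel)"
      by (rule nn_integral_cong_AE, use uf_scaleR[of r g] in eventually_elim)
         (simp add: g(3) power_mult_distrib ennreal_mult mult_ac)
    also have "\<dots> = ennreal (r\<^sup>2) * (\<integral>\<^sup>+ y. ennreal (yukawa mu (x - y)) * ennreal ((cmod (uf g y))\<^sup>2) \<partial>lborel)"
      by (rule nn_integral_cmult) measurable
    also have "\<dots> \<le> ennreal (r\<^sup>2) * ennreal C" by (intro mult_left_mono C(2) mu g) simp
    also have "\<dots> = ennreal (C * (norm f)\<^sup>2)" using C(1) g(4) by (simp add: ennreal_mult[symmetric] mult.commute)
    finally show ?thesis .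
  qed
  then show ?thesis using C(1) by blast
qed

text \<open>This is the absolute integrability behind the exchange of integrals in
  \<open>hartree_form_bound\<close>.\<close>

lemma kato_product:
  "\<exists>C\<ge>0. \<forall>mu f g x. 0 \<le> mu \<longrightarrow> norm f \<le> 1 \<longrightarrow> norm g \<le> 1 \<longrightarrow>
    (\<integral>\<^sup>+ y. ennreal (yukawa mu (x - y) * cmod (uf f y * cnj (uf g y))) \<partial>lborel) \<le> ennreal C"
proof -
  obtain C where C: "0 \<le> C" "\<And>mu f x. 0 \<le> mu \<Longrightarrow> norm f \<le> 1 \<Longrightarrow>
    (\<integral>\<^sup>+ y. ennreal (yukawa mu (x - y)) * ennreal ((cmod (uf f y))\<^sup>2) \<partial>lborel) \<le> ennreal C"
    using kato_unit by blast
  have "(\<integral>\<^sup>+ y. ennreal (yukawa mu (x - y) * cmod (uf f y * cnj (uf g y))) \<partial>lborel) \<le> ennreal (C + C)"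
    if A: "0 \<le> mu" "norm f \<le> 1" "norm g \<le> 1" for mu f g x
  proof -
    have "(\<integral>\<^sup>+ y. ennreal (yukawa mu (x - y) * cmod (uf f y * cnj (uf g y))) \<partial>lborel)
      \<le> (\<integral>\<^sup>+ y. (ennreal (yukawa mu (x - y)) * ennreal ((cmod (uf f y))\<^sup>2) + ennreal (yukawa mu (x - y)) * ennreal ((cmod (uf g y))\<^sup>2)) \<partial>lborel)"
    proof (rule nn_integral_mono)
      fix y
      have "2 * (cmod (uf f y) * cmod (uf g y)) \<le> (cmod (uf f y))\<^sup>2 + (cmod (uf g y))\<^sup>2"
        using sum_squares_bound[of "cmod (uf f y)" "cmod (uf g y)"] by simp
      moreover have "0 \<le> cmod (uf f y) * cmod (uf g y)" by simp
      ultimately have "cmod (uf f y) * cmod (uf g y) \<le> (cmod (uf f y))\<^sup>2 + (cmod (uf g y))\<^sup>2" by linarith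
      then have "yukawa mu (x - y) * (cmod (uf f y) * cmod (uf g y)) \<le> yukawa mu (x - y) * ((cmod (uf f y))\<^sup>2 + (cmod (uf g y))\<^sup>2)"
        by (rule mult_left_mono) simp
      then have "ennreal (yukawa mu (x - y) * cmod (uf f y * cnj (uf g y))) \<le> ennreal (yukawa mu (x - y) * ((cmod (uf f y))\<^sup>2 + (cmod (uf g y))\<^sup>2))"
        by (intro ennreal_leI) (simp add: norm_mult)
      also have "\<dots> = ennreal (yukawa mu (x - y)) * ennreal ((cmod (uf f y))\<^sup>2) + ennreal (yukawa mu (x - y)) * ennreal ((cmod (uf g y))\<^sup>2)"
        by (simp add: ennreal_mult ennreal_plus distrib_left)
      finally show "ennreal (yukawa mu (x - y) * cmod (uf f y * cnj (uf g y)))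
        \<le> ennreal (yukawa mu (x - y)) * ennreal ((cmod (uf f y))\<^sup>2) + ennreal (yukawa mu (x - y)) * ennreal ((cmod (uf g y))\<^sup>2)" .
    qed
    also have "\<dots> = (\<integral>\<^sup>+ y. ennreal (yukawa mu (x - y)) * ennreal ((cmod (uf f y))\<^sup>2) \<partial>lborel) + (\<integral>\<^sup>+ y. ennreal (yukawa mu (x - y)) * ennreal ((cmod (uf g y))\<^sup>2) \<partial>lborel)"
      by (rule nn_integral_add) measurable
    also have "\<dots> \<le> ennreal C + ennreal C" by (intro add_mono C(2) A)
    also have "\<dots> = ennreal (C + C)" by (rule ennreal_plus[symmetric, OF C(1) C(1)])
    finally show ?thesis .
  qed
  then show ?thesis using C(1) by (intro exI[of _ "C + C"]) auto
qed

section \<open>The Hartree form tested by duality\<close>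

text \<open>The test function \<open>ps\<close> lies in L2 and \<open>p\<close> controls its norm in
  \<open>H^(-1/2)\<close>, so the bound says by duality that the trilinear term lies in
  \<open>H^(1/2)\<close>. For each heat kernel, \<open>heat_fubini\<close> yields the transforms of
  \<open>uf f * cnj (uf g)\<close> and \<open>uf h * cnj (rp ps)\<close>. Both are dominated by
  correlations, and integration in \<open>s\<close> by \<open>wt_gauss_le\<close> produces the
  singular weight of \<open>quadrilinear_schur\<close>.\<close>

lemma hartree_form_bound:
  "\<exists>C\<ge>0. \<forall>mu f g h p ps. 0 \<le> mu \<longrightarrow> norm f \<le> 1 \<longrightarrow> norm g \<le> 1 \<longrightarrow> norm h \<le> 1 \<longrightarrow> norm p \<le> 1 \<longrightarrow>
    (AE z in lborel. cmod (rp (FT ps) z) \<le> JB z * cmod (rp p z)) \<longrightarrow>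
    cmod (LINT x|lborel. (LINT y|lborel. complex_of_real (yukawa mu (x - y)) * (uf f y * cnj (uf g y))) * (uf h x * cnj (rp ps x))) \<le> C"
proof -
  obtain C where C: "0 \<le> C" "\<And>f g h p :: real^3 \<Rightarrow> real.
    (\<forall>u\<in>{f, g, h, p}. u \<in> borel_measurable borel \<and> (\<forall>x. 0 \<le> u x) \<and> (\<integral>\<^sup>+ x. ennreal ((u x)\<^sup>2) \<partial>lborel) \<le> 1) \<Longrightarrow>
    I3 (\<lambda>a b c. ennreal (f a * g b * h c * p (c + (a - b)) * (JB (c + (a - b)) / (JB a * JB b * JB c)) * norm (a - b) powr (-2))) \<le> ennreal C"
    using quadrilinear_schur by blast
  obtain C0 where C0: "0 \<le> C0" "\<And>mu f g x. 0 \<le> mu \<Longrightarrow> norm f \<le> 1 \<Longrightarrow> norm g \<le> 1 \<Longrightarrow>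
    (\<integral>\<^sup>+ y. ennreal (yukawa mu (x - y) * cmod (uf f y * cnj (uf g y))) \<partial>lborel) \<le> ennreal C0"
    using kato_product by blast
  define c where "c = 1 / (2 * pi) ^ 3"
  have c: "0 \<le> c" by (simp add: c_def)
  have "cmod (LINT x|lborel. (LINT y|lborel. complex_of_real (yukawa mu (x - y)) * (uf f y * cnj (uf g y))) * (uf h x * cnj (rp ps x))) \<le> 2 * pi * (c * (2 * C))"
    if mu: "0 \<le> mu" and n: "norm f \<le> 1" "norm g \<le> 1" "norm h \<le> 1" "norm p \<le> 1"
      and ps: "AE z in lborel. cmod (rp (FT ps) z) \<le> JB z * cmod (rp p z)" for mu f g h p ps
  proof -
    define F G where "F y = uf f y * cnj (uf g y)" and "G x = uf h x * cnj (rp ps x)" for x y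
    have iF: "integrable lborel F" and iG: "integrable lborel G"
      unfolding F_def G_def by (intro L2_mult_integrable L2_cnj L2_rp)+
    have [measurable]: "F \<in> borel_measurable borel" "G \<in> borel_measurable borel" using iF iG by auto
    interpret P: pair_sigma_finite "lborel :: real measure" "lborel \<Otimes>\<^sub>M lborel :: ((real^3) \<times> (real^3)) measure"
      by (intro pair_sigma_finite.intro lborel.sigma_finite_measure_axioms lborel_pair.sigma_finite_measure_axioms)
    define R where "R s q = complex_of_real (wt mu s * heat s (fst q - snd q)) * (G (fst q) * F (snd q))" for s q
    have Rm [measurable]: "(\<lambda>(s, q). R s q) \<in> borel_measurable (lborel \<Otimes>\<^sub>M (lborel \<Otimes>\<^sub>M lborel))"
      unfolding R_def by measurable
    have Rs: "(\<integral>\<^sup>+ s. ennreal (wt mu s * heat s (x - y)) \<partial>lborel) = ennreal (yukawa mu (x - y) / (2 * pi))" if "x - y \<noteq> 0" for x y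
      by (rule yukawa_heat[OF that mu])
    \<comment> \<open>Absolute convergence in all three variables: the integral in \<open>s\<close>
      yields a multiple of the potential, the one in \<open>y\<close> is bounded uniformly in
      \<open>x\<close> by Kato's inequality, and \<open>G\<close> is integrable.\<close>
    have iR: "integrable (lborel \<Otimes>\<^sub>M (lborel \<Otimes>\<^sub>M lborel)) (\<lambda>(s, q). R s q)"
    proof (rule integrableI_bounded[OF Rm])
      have "(\<integral>\<^sup>+ z. ennreal (norm (case z of (s, q) \<Rightarrow> R s q)) \<partial>(lborel \<Otimes>\<^sub>M (lborel \<Otimes>\<^sub>M lborel)))
        = (\<integral>\<^sup>+ q. \<integral>\<^sup>+ s. ennreal (norm (R s q)) \<partial>lborel \<partial>(lborel \<Otimes>\<^sub>M lborel))"
        by (subst P.nn_integral_snd[symmetric]) auto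
      also have "\<dots> = (\<integral>\<^sup>+ x. \<integral>\<^sup>+ y. \<integral>\<^sup>+ s. ennreal (norm (R s (x, y))) \<partial>lborel \<partial>lborel \<partial>lborel)"
        by (rule lborel.nn_integral_fst[symmetric]) measurable
      also have "\<dots> \<le> (\<integral>\<^sup>+ x. ennreal (cmod (G x)) * ennreal C0 \<partial>lborel)"
      proof (rule nn_integral_mono)
        fix x
        have "(\<integral>\<^sup>+ y. \<integral>\<^sup>+ s. ennreal (norm (R s (x, y))) \<partial>lborel \<partial>lborel)
          \<le> (\<integral>\<^sup>+ y. ennreal (cmod (G x)) * ennreal (yukawa mu (x - y) * cmod (F y)) \<partial>lborel)"
        proof (rule nn_integral_mono_AE, use AE_neq[of x] in eventually_elim)
          fix y assume xy: "x - y \<noteq> 0"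
          have "(\<integral>\<^sup>+ s. ennreal (norm (R s (x, y))) \<partial>lborel) = (\<integral>\<^sup>+ s. ennreal (wt mu s * heat s (x - y)) * ennreal (cmod (G x) * cmod (F y)) \<partial>lborel)"
            by (simp add: R_def norm_mult abs_mult ennreal_mult)
          also have "\<dots> = ennreal (yukawa mu (x - y) / (2 * pi)) * ennreal (cmod (G x) * cmod (F y))"
            by (subst nn_integral_multc) (auto simp: Rs[OF xy])
          also have "\<dots> = ennreal (yukawa mu (x - y) / (2 * pi) * (cmod (G x) * cmod (F y)))"
            by (rule ennreal_mult[symmetric]) auto
          also have "\<dots> \<le> ennreal (cmod (G x) * (yukawa mu (x - y) * cmod (F y)))"
          proof (rule ennreal_leI)
            have "yukawa mu (x - y) / (2 * pi) \<le> yukawa mu (x - y)"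
              using pi_gt3 mult_left_mono[of 1 "2 * pi" "yukawa mu (x - y)"] by (simp add: divide_le_eq)
            then have "yukawa mu (x - y) / (2 * pi) * (cmod (G x) * cmod (F y)) \<le> yukawa mu (x - y) * (cmod (G x) * cmod (F y))"
              by (rule mult_right_mono) simp
            then show "yukawa mu (x - y) / (2 * pi) * (cmod (G x) * cmod (F y)) \<le> cmod (G x) * (yukawa mu (x - y) * cmod (F y))"
              by (simp only: mult.left_commute)
          qed
          also have "\<dots> = ennreal (cmod (G x)) * ennreal (yukawa mu (x - y) * cmod (F y))" by (rule ennreal_mult) auto
          finally show "(\<integral>\<^sup>+ s. ennreal (norm (R s (x, y))) \<partial>lborel) \<le> ennreal (cmod (G x)) * ennreal (yukawa mu (x - y) * cmod (F y))" .
        qed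
        also have "\<dots> = ennreal (cmod (G x)) * (\<integral>\<^sup>+ y. ennreal (yukawa mu (x - y) * cmod (F y)) \<partial>lborel)"
          by (rule nn_integral_cmult) measurable
        also have "\<dots> \<le> ennreal (cmod (G x)) * ennreal C0"
          unfolding F_def by (intro mult_left_mono C0 mu n) simp
        finally show "(\<integral>\<^sup>+ y. \<integral>\<^sup>+ s. ennreal (norm (R s (x, y))) \<partial>lborel \<partial>lborel) \<le> ennreal (cmod (G x)) * ennreal C0" .
      qed
      also have "\<dots> = (\<integral>\<^sup>+ x. ennreal (cmod (G x)) \<partial>lborel) * ennreal C0" by (rule nn_integral_multc) measurable
      also have "\<dots> < \<infinity>" using iG by (simp add: integrable_iff_bounded ennreal_mult_less_top)
      finally show "(\<integral>\<^sup>+ z. ennreal (norm (case z of (s, q) \<Rightarrow> R s q)) \<partial>(lborel \<Otimes>\<^sub>M (lborel \<Otimes>\<^sub>M lborel))) < \<infinity>" .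
    qed
    have "(LINT s|lborel. LINT q|(lborel \<Otimes>\<^sub>M lborel). R s q) = (LINT q|(lborel \<Otimes>\<^sub>M lborel). LINT s|lborel. R s q)"
      using P.Fubini_integral[OF iR] by simp
    also have "\<dots> = (LINT x|lborel. LINT y|lborel. LINT s|lborel. R s (x, y))"
      by (rule lborel_pair.integral_fst'[symmetric]) (rule P.integrable_snd[OF iR])
    also have "\<dots> = (LINT x|lborel. complex_of_real (1 / (2 * pi)) * ((LINT y|lborel. complex_of_real (yukawa mu (x - y)) * F y) * G x))"
    proof (rule Bochner_Integration.integral_cong[OF refl])
      fix x
      have "(LINT y|lborel. LINT s|lborel. R s (x, y)) = (LINT y|lborel. (complex_of_real (1 / (2 * pi)) * G x) * (complex_of_real (yukawa mu (x - y)) * F y))"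
      proof (rule integral_cong_AE)
        show "AE y in lborel. (LINT s|lborel. R s (x, y)) = (complex_of_real (1 / (2 * pi)) * G x) * (complex_of_real (yukawa mu (x - y)) * F y)"
          using AE_neq[of x]
        proof eventually_elim
          fix y assume xy: "x - y \<noteq> 0"
          have "(LINT s|lborel. wt mu s * heat s (x - y)) = yukawa mu (x - y) / (2 * pi)"
            by (subst integral_eq_nn_integral) (auto simp: Rs[OF xy])
          then have "(LINT s|lborel. complex_of_real (wt mu s * heat s (x - y))) = complex_of_real (yukawa mu (x - y) / (2 * pi))"
            by (simp only: integral_complex_of_real)
          then show "(LINT s|lborel. R s (x, y)) = (complex_of_real (1 / (2 * pi)) * G x) * (complex_of_real (yukawa mu (x - y)) * F y)"
            unfolding R_def fst_conv snd_conv integral_mult_left_zero by simp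
        qed
        have [measurable]: "(\<lambda>y. LINT s|lborel. complex_of_real (wt mu s * heat s (x - y)) * (G x * F y)) \<in> borel_measurable borel"
          by (rule lborel.borel_measurable_lebesgue_integral) measurable
        then show "(\<lambda>y. LINT s|lborel. R s (x, y)) \<in> borel_measurable lborel" by (simp add: R_def)
        show "(\<lambda>y. complex_of_real (1 / (2 * pi)) * G x * (complex_of_real (yukawa mu (x - y)) * F y)) \<in> borel_measurable lborel"
          by measurable
      qed
      also have "\<dots> = (complex_of_real (1 / (2 * pi)) * G x) * (LINT y|lborel. complex_of_real (yukawa mu (x - y)) * F y)"
        by (rule integral_mult_right_zero)
      finally show "(LINT y|lborel. LINT s|lborel. R s (x, y)) = complex_of_real (1 / (2 * pi)) * ((LINT y|lborel. complex_of_real (yukawa mu (x - y)) * F y) * G x)"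
        by (simp only: mult_ac)
    qed
    also have "\<dots> = complex_of_real (1 / (2 * pi)) * (LINT x|lborel. (LINT y|lborel. complex_of_real (yukawa mu (x - y)) * F y) * G x)"
      by (rule integral_mult_right_zero)
    finally have D: "(LINT x|lborel. (LINT y|lborel. complex_of_real (yukawa mu (x - y)) * F y) * G x)
      = complex_of_real (2 * pi) * (LINT s|lborel. LINT q|(lborel \<Otimes>\<^sub>M lborel). R s q)" by simp
    define Fm Gp where "Fm z = (LINT y|lborel. cis (- (y \<bullet> z)) * F y)" and "Gp z = (LINT x|lborel. cis (x \<bullet> z) * G x)" for z
    have [measurable]: "Fm \<in> borel_measurable borel" "Gp \<in> borel_measurable borel" unfolding Fm_def Gp_def by measurable
    have "ennreal (cmod (LINT s|lborel. LINT q|(lborel \<Otimes>\<^sub>M lborel). R s q)) \<le> (\<integral>\<^sup>+ s. ennreal (cmod (LINT q|(lborel \<Otimes>\<^sub>M lborel). R s q)) \<partial>lborel)"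
      by (rule norm_integral_le_nn)
    also have "\<dots> \<le> (\<integral>\<^sup>+ s. ennreal c * (ennreal (wt mu s) * (\<integral>\<^sup>+ z. ennreal (gauss s z) * (ennreal (cmod (Fm z)) * ennreal (cmod (Gp z))) \<partial>lborel)) \<partial>lborel)"
    proof (rule nn_integral_mono)
      fix s :: real
      show "ennreal (cmod (LINT q|(lborel \<Otimes>\<^sub>M lborel). R s q)) \<le> ennreal c * (ennreal (wt mu s) * (\<integral>\<^sup>+ z. ennreal (gauss s z) * (ennreal (cmod (Fm z)) * ennreal (cmod (Gp z))) \<partial>lborel))"
      proof (cases "0 < s")
        case s: True
        have "(LINT q|(lborel \<Otimes>\<^sub>M lborel). R s q) = (LINT q|(lborel \<Otimes>\<^sub>M lborel). complex_of_real (wt mu s) * (complex_of_real (heat s (fst q - snd q)) * (G (fst q) * F (snd q))))"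
          by (simp add: R_def mult.assoc)
        also have "\<dots> = complex_of_real (wt mu s) * (complex_of_real c * (LINT z|lborel. complex_of_real (gauss s z) * (Fm z * Gp z)))"
          unfolding integral_mult_right_zero heat_fubini[OF iF iG s] c_def Fm_def Gp_def ..
        finally have "ennreal (cmod (LINT q|(lborel \<Otimes>\<^sub>M lborel). R s q)) = ennreal c * (ennreal (wt mu s) * ennreal (cmod (LINT z|lborel. complex_of_real (gauss s z) * (Fm z * Gp z))))"
          using c by (simp add: norm_mult ennreal_mult mult.left_commute)
        also have "\<dots> \<le> ennreal c * (ennreal (wt mu s) * (\<integral>\<^sup>+ z. ennreal (gauss s z) * (ennreal (cmod (Fm z)) * ennreal (cmod (Gp z))) \<partial>lborel))"
          using norm_integral_le_nn[of lborel "\<lambda>z. complex_of_real (gauss s z) * (Fm z * Gp z)"]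
          by (intro mult_left_mono) (auto simp: norm_mult ennreal_mult)
        finally show ?thesis .
      next
        case False
        then have "R s q = 0" for q by (simp add: R_def wt_def)
        then show ?thesis by simp
      qed
    qed
    also have "\<dots> = ennreal c * (\<integral>\<^sup>+ s. ennreal (wt mu s) * (\<integral>\<^sup>+ z. ennreal (gauss s z) * (ennreal (cmod (Fm z)) * ennreal (cmod (Gp z))) \<partial>lborel) \<partial>lborel)"
      by (rule nn_integral_cmult) measurable
    also have "\<dots> \<le> ennreal c * (\<integral>\<^sup>+ z. ennreal (2 * norm z powr (-2)) * (ennreal (cmod (Fm z)) * ennreal (cmod (Gp z))) \<partial>lborel)"
      by (intro mult_left_mono wt_gauss_le) auto
    also have "(\<integral>\<^sup>+ z. ennreal (2 * norm z powr (-2)) * (ennreal (cmod (Fm z)) * ennreal (cmod (Gp z))) \<partial>lborel)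
      \<le> (\<integral>\<^sup>+ z. ennreal (2 * norm z powr (-2)) * ((\<integral>\<^sup>+ a. ennreal (wm f a) * ennreal (wm g (a - z)) \<partial>lborel)
          * (\<integral>\<^sup>+ b. ennreal (wm h b) * ennreal (JB (b + z) * cmod (rp p (b + z))) \<partial>lborel)) \<partial>lborel)"
    proof (intro nn_integral_mono mult_left_mono mult_mono)
      fix z
      show "ennreal (cmod (Fm z)) \<le> (\<integral>\<^sup>+ a. ennreal (wm f a) * ennreal (wm g (a - z)) \<partial>lborel)"
        unfolding Fm_def F_def by (rule fourier_product_wm)
      \<comment> \<open>\<open>Gp\<close> carries the opposite phase, hence the frequency
        \<open>- z\<close> and the shift to \<open>b + z\<close>.\<close>
      have "ennreal (cmod (Gp z)) \<le> (\<integral>\<^sup>+ a. ennreal (cmod (rp (FT (cl (uf h))) a)) * ennreal (cmod (rp (FT (cl (rp ps))) (a - (- z)))) \<partial>lborel)"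
        using fourier_product_le[of "uf h" "rp ps" "- z"] by (simp add: Gp_def G_def)
      also have "\<dots> \<le> (\<integral>\<^sup>+ b. ennreal (wm h b) * ennreal (JB (b + z) * cmod (rp p (b + z))) \<partial>lborel)"
      proof (rule nn_integral_mono_AE)
        show "AE b in lborel. ennreal (cmod (rp (FT (cl (uf h))) b)) * ennreal (cmod (rp (FT (cl (rp ps))) (b - (- z))))
          \<le> ennreal (wm h b) * ennreal (JB (b + z) * cmod (rp p (b + z)))"
          using rp_FT_Hs[of h] AE_translate[OF ps, of "- z"]
          by eventually_elim (auto simp: wm_def norm_divide intro!: mult_left_mono ennreal_leI)
      qed
      finally show "ennreal (cmod (Gp z)) \<le> (\<integral>\<^sup>+ b. ennreal (wm h b) * ennreal (JB (b + z) * cmod (rp p (b + z))) \<partial>lborel)" .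
    qed auto
    also have "\<dots> = (\<integral>\<^sup>+ z. ennreal 2 * (\<integral>\<^sup>+ a. \<integral>\<^sup>+ b. ennreal (norm z powr (-2) * (wm f a * wm g (a - z)) * (wm h b * (JB (b + z) * cmod (rp p (b + z))))) \<partial>lborel \<partial>lborel) \<partial>lborel)"
    proof (rule nn_integral_cong)
      fix z :: "real^3"
      let ?B = "\<integral>\<^sup>+ b. ennreal (wm h b) * ennreal (JB (b + z) * cmod (rp p (b + z))) \<partial>lborel"
      have "(\<integral>\<^sup>+ b. ennreal (norm z powr (-2) * (wm f a * wm g (a - z)) * (wm h b * (JB (b + z) * cmod (rp p (b + z))))) \<partial>lborel)
         = ennreal (norm z powr (-2)) * ((ennreal (wm f a) * ennreal (wm g (a - z))) * ?B)" for a
        by (simp add: ennreal_mult nn_integral_cmult mult.assoc)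
      then have "(\<integral>\<^sup>+ a. \<integral>\<^sup>+ b. ennreal (norm z powr (-2) * (wm f a * wm g (a - z)) * (wm h b * (JB (b + z) * cmod (rp p (b + z))))) \<partial>lborel \<partial>lborel)
         = ennreal (norm z powr (-2)) * ((\<integral>\<^sup>+ a. ennreal (wm f a) * ennreal (wm g (a - z)) \<partial>lborel) * ?B)"
        by (simp add: nn_integral_cmult nn_integral_multc)
      then show "ennreal (2 * norm z powr (-2)) * ((\<integral>\<^sup>+ a. ennreal (wm f a) * ennreal (wm g (a - z)) \<partial>lborel) * ?B)
        = ennreal 2 * (\<integral>\<^sup>+ a. \<integral>\<^sup>+ b. ennreal (norm z powr (-2) * (wm f a * wm g (a - z)) * (wm h b * (JB (b + z) * cmod (rp p (b + z))))) \<partial>lborel \<partial>lborel)"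
        by (simp add: ennreal_mult mult.assoc)
    qed
    also have "\<dots> = ennreal 2 * I3 (\<lambda>z a b. ennreal (norm z powr (-2) * (wm f a * wm g (a - z)) * (wm h b * (JB (b + z) * cmod (rp p (b + z))))))"
      unfolding I3_def by (rule nn_integral_cmult) measurable
    \<comment> \<open>With \<open>a\<close> outermost, \<open>z\<close> can be replaced by
      \<open>a - b\<close> for a new variable \<open>b\<close>, the old \<open>b\<close> becoming
      \<open>c\<close>; the output frequency \<open>b + z\<close> then reads
      \<open>c + (a - b)\<close>.\<close>
    also have "I3 (\<lambda>z a b. ennreal (norm z powr (-2) * (wm f a * wm g (a - z)) * (wm h b * (JB (b + z) * cmod (rp p (b + z))))))
      = I3 (\<lambda>a z b. ennreal (norm z powr (-2) * (wm f a * wm g (a - z)) * (wm h b * (JB (b + z) * cmod (rp p (b + z))))))"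
      by (rule I3_swap12) (unfold meas3_def, measurable)
    also have "\<dots> = I3 (\<lambda>a b c. ennreal (norm (a - b) powr (-2) * (wm f a * wm g b) * (wm h c * (JB (c + (a - b)) * cmod (rp p (c + (a - b)))))))"
      unfolding I3_def
    proof (rule nn_integral_cong)
      fix a :: "real^3"
      have "(\<lambda>b. \<integral>\<^sup>+ c. ennreal (norm (a - b) powr (-2) * (wm f a * wm g b) * (wm h c * (JB (c + (a - b)) * cmod (rp p (c + (a - b)))))) \<partial>lborel) \<in> borel_measurable borel"
        by measurable
      from nn_integral_shift(3)[OF this, of a]
      show "(\<integral>\<^sup>+ z. \<integral>\<^sup>+ b. ennreal (norm z powr (-2) * (wm f a * wm g (a - z)) * (wm h b * (JB (b + z) * cmod (rp p (b + z))))) \<partial>lborel \<partial>lborel)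
        = (\<integral>\<^sup>+ b. \<integral>\<^sup>+ c. ennreal (norm (a - b) powr (-2) * (wm f a * wm g b) * (wm h c * (JB (c + (a - b)) * cmod (rp p (c + (a - b)))))) \<partial>lborel \<partial>lborel)"
        by simp
    qed
    also have "\<dots> = I3 (\<lambda>a b c. ennreal (cmod (rp f a) * cmod (rp g b) * cmod (rp h c) * cmod (rp p (c + (a - b))) * (JB (c + (a - b)) / (JB a * JB b * JB c)) * norm (a - b) powr (-2)))"
    proof -
      have "norm (a - b) powr (-2) * (wm f a * wm g b) * (wm h c * (JB (c + (a - b)) * cmod (rp p (c + (a - b)))))
        = cmod (rp f a) * cmod (rp g b) * cmod (rp h c) * cmod (rp p (c + (a - b))) * (JB (c + (a - b)) / (JB a * JB b * JB c)) * norm (a - b) powr (-2)" for a b c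
        by (simp add: wm_def)
      then show ?thesis by (simp only:)
    qed
    also have "\<dots> \<le> ennreal C"
      by (rule C(2)) (use norm_le_1_nn[OF n(1)] norm_le_1_nn[OF n(2)] norm_le_1_nn[OF n(3)] norm_le_1_nn[OF n(4)] in auto)
    finally have "ennreal (cmod (LINT s|lborel. LINT q|(lborel \<Otimes>\<^sub>M lborel). R s q)) \<le> ennreal c * (ennreal 2 * ennreal C)"
      by (simp add: mult_left_mono)
    also have "\<dots> = ennreal (c * (2 * C))" using c C(1) by (simp add: ennreal_mult)
    finally have "cmod (LINT s|lborel. LINT q|(lborel \<Otimes>\<^sub>M lborel). R s q) \<le> c * (2 * C)"
      using c C(1) by (simp add: ennreal_le_iff)
    then have "2 * pi * cmod (LINT s|lborel. LINT q|(lborel \<Otimes>\<^sub>M lborel). R s q) \<le> 2 * pi * (c * (2 * C))"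
      by (rule mult_left_mono) simp
    then show ?thesis using D unfolding F_def G_def by (simp add: norm_mult)
  qed
  then show ?thesis using c C(1) by (intro exI[of _ "2 * pi * (c * (2 * C))"]) auto
qed

section \<open>The potential and the trilinear Hartree map\<close>

text \<open>Polarising the density \<open>|u|^2\<close> makes the cubic nonlinearity the diagonal of
  a map additive in each argument, which the Lipschitz estimate exploits.\<close>

definition pot :: "real \<Rightarrow> l2 \<Rightarrow> l2 \<Rightarrow> real^3 \<Rightarrow> complex" where
  "pot mu f g x = (LINT y|lborel. complex_of_real (yukawa mu (x - y)) * (uf f y * cnj (uf g y)))"

lemma pot_measurable [measurable]: "pot mu f g \<in> borel_measurable borel"
  unfolding pot_def[abs_def] by measurable

lemma uf_product_nn_le:
  assumes C: "0 \<le> C" "\<And>mu f x. 0 \<le> mu \<Longrightarrow>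
    (\<integral>\<^sup>+ y. ennreal (yukawa mu (x - y)) * ennreal ((cmod (uf f y))\<^sup>2) \<partial>lborel) \<le> ennreal (C * (norm f)\<^sup>2)"
    and mu: "0 \<le> mu"
  shows "(\<integral>\<^sup>+ y. ennreal (cmod (complex_of_real (yukawa mu (x - y)) * (uf f y * cnj (uf g y)))) \<partial>lborel)
    \<le> ennreal (C * (norm f)\<^sup>2 + C * (norm g)\<^sup>2)"
proof -
  have "(\<integral>\<^sup>+ y. ennreal (cmod (complex_of_real (yukawa mu (x - y)) * (uf f y * cnj (uf g y)))) \<partial>lborel)
    \<le> (\<integral>\<^sup>+ y. (ennreal (yukawa mu (x - y)) * ennreal ((cmod (uf f y))\<^sup>2) + ennreal (yukawa mu (x - y)) * ennreal ((cmod (uf g y))\<^sup>2)) \<partial>lborel)"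
  proof (rule nn_integral_mono)
    fix y
    have "2 * (cmod (uf f y) * cmod (uf g y)) \<le> (cmod (uf f y))\<^sup>2 + (cmod (uf g y))\<^sup>2"
      using sum_squares_bound[of "cmod (uf f y)" "cmod (uf g y)"] by simp
    moreover have "0 \<le> cmod (uf f y) * cmod (uf g y)" by simp
    ultimately have "cmod (uf f y) * cmod (uf g y) \<le> (cmod (uf f y))\<^sup>2 + (cmod (uf g y))\<^sup>2" by linarith
    then have "yukawa mu (x - y) * (cmod (uf f y) * cmod (uf g y)) \<le> yukawa mu (x - y) * ((cmod (uf f y))\<^sup>2 + (cmod (uf g y))\<^sup>2)"
      by (rule mult_left_mono) simp
    then have "ennreal (cmod (complex_of_real (yukawa mu (x - y)) * (uf f y * cnj (uf g y)))) \<le> ennreal (yukawa mu (x - y) * ((cmod (uf f y))\<^sup>2 + (cmod (uf g y))\<^sup>2))"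
      by (intro ennreal_leI) (simp add: norm_mult)
    also have "\<dots> = ennreal (yukawa mu (x - y)) * ennreal ((cmod (uf f y))\<^sup>2) + ennreal (yukawa mu (x - y)) * ennreal ((cmod (uf g y))\<^sup>2)"
      by (simp add: ennreal_mult ennreal_plus distrib_left)
    finally show "ennreal (cmod (complex_of_real (yukawa mu (x - y)) * (uf f y * cnj (uf g y))))
      \<le> ennreal (yukawa mu (x - y)) * ennreal ((cmod (uf f y))\<^sup>2) + ennreal (yukawa mu (x - y)) * ennreal ((cmod (uf g y))\<^sup>2)" .
  qed
  also have "\<dots> = (\<integral>\<^sup>+ y. ennreal (yukawa mu (x - y)) * ennreal ((cmod (uf f y))\<^sup>2) \<partial>lborel) + (\<integral>\<^sup>+ y. ennreal (yukawa mu (x - y)) * ennreal ((cmod (uf g y))\<^sup>2) \<partial>lborel)"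
    by (rule nn_integral_add) measurable
  also have "\<dots> \<le> ennreal (C * (norm f)\<^sup>2) + ennreal (C * (norm g)\<^sup>2)" by (intro add_mono C mu)
  also have "\<dots> = ennreal (C * (norm f)\<^sup>2 + C * (norm g)\<^sup>2)"
    by (rule ennreal_plus[symmetric]) (use C(1) in auto)
  finally show ?thesis .
qed

context
  fixes mu :: real
  assumes mu: "0 \<le> mu"
begin

lemma pot_integrable: "integrable lborel (\<lambda>y. complex_of_real (yukawa mu (x - y)) * (uf f y * cnj (uf g y)))"
proof -
  obtain C where C: "0 \<le> C" "\<And>mu f x. 0 \<le> mu \<Longrightarrow>
    (\<integral>\<^sup>+ y. ennreal (yukawa mu (x - y)) * ennreal ((cmod (uf f y))\<^sup>2) \<partial>lborel) \<le> ennreal (C * (norm f)\<^sup>2)"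
    using kato by blast
  show ?thesis
  proof (rule integrableI_bounded)
    show "(\<integral>\<^sup>+ y. ennreal (cmod (complex_of_real (yukawa mu (x - y)) * (uf f y * cnj (uf g y)))) \<partial>lborel) < \<infinity>"
      unfolding infinity_ennreal_def by (rule le_less_trans[OF uf_product_nn_le[OF C mu] ennreal_less_top])
  qed measurable
qed

lemma pot_bounded: "\<exists>C. \<forall>x. cmod (pot mu f g x) \<le> C"
proof -
  obtain C where C: "0 \<le> C" "\<And>mu f x. 0 \<le> mu \<Longrightarrow>
    (\<integral>\<^sup>+ y. ennreal (yukawa mu (x - y)) * ennreal ((cmod (uf f y))\<^sup>2) \<partial>lborel) \<le> ennreal (C * (norm f)\<^sup>2)"
    using kato by blast
  have "cmod (pot mu f g x) \<le> C * (norm f)\<^sup>2 + C * (norm g)\<^sup>2" for x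
  proof -
    have "ennreal (cmod (pot mu f g x)) \<le> ennreal (C * (norm f)\<^sup>2 + C * (norm g)\<^sup>2)"
      unfolding pot_def by (rule order_trans[OF norm_integral_le_nn uf_product_nn_le[OF C mu]])
    then show ?thesis by (subst (asm) ennreal_le_iff) (use C(1) in auto)
  qed
  then show ?thesis by blast
qed

lemma bmult_pot [simp]: "bmult (pot mu f g)"
  using pot_bounded by (auto simp: bmult_def)

lemma pot_add_left: "pot mu (f + f') g x = pot mu f g x + pot mu f' g x"
proof -
  have "pot mu (f + f') g x = (LINT y|lborel. complex_of_real (yukawa mu (x - y)) * (uf f y * cnj (uf g y)) + complex_of_real (yukawa mu (x - y)) * (uf f' y * cnj (uf g y)))"
    unfolding pot_def
    by (rule integral_cong_AE) (measurable, use uf_add[of f f'] in eventually_elim, simp add: distrib_left distrib_right)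
  then show ?thesis by (simp add: pot_def pot_integrable)
qed

lemma pot_add_right: "pot mu f (g + g') x = pot mu f g x + pot mu f g' x"
proof -
  have "pot mu f (g + g') x = (LINT y|lborel. complex_of_real (yukawa mu (x - y)) * (uf f y * cnj (uf g y)) + complex_of_real (yukawa mu (x - y)) * (uf f y * cnj (uf g' y)))"
    unfolding pot_def
    by (rule integral_cong_AE) (measurable, use uf_add[of g g'] in eventually_elim, simp add: distrib_left distrib_right)
  then show ?thesis by (simp add: pot_def pot_integrable)
qed

lemma pot_scaleR_left: "pot mu (r *\<^sub>R f) g x = complex_of_real r * pot mu f g x"
proof -
  have "pot mu (r *\<^sub>R f) g x = (LINT y|lborel. complex_of_real r * (complex_of_real (yukawa mu (x - y)) * (uf f y * cnj (uf g y))))"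
    unfolding pot_def
    by (rule integral_cong_AE) (measurable, use uf_scaleR[of r f] in eventually_elim, simp add: scaleR_conv_of_real)
  then show ?thesis by (simp only: pot_def integral_mult_right_zero)
qed

lemma pot_scaleR_right: "pot mu f (r *\<^sub>R g) x = complex_of_real r * pot mu f g x"
proof -
  have "pot mu f (r *\<^sub>R g) x = (LINT y|lborel. complex_of_real r * (complex_of_real (yukawa mu (x - y)) * (uf f y * cnj (uf g y))))"
    unfolding pot_def
    by (rule integral_cong_AE) (measurable, use uf_scaleR[of r g] in eventually_elim, simp add: scaleR_conv_of_real)
  then show ?thesis by (simp only: pot_def integral_mult_right_zero)
qed

definition HT :: "l2 \<Rightarrow> l2 \<Rightarrow> l2 \<Rightarrow> l2" where
  "HT f g h = mlt (pot mu f g) (Hs h)"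

lemma HT_add: "HT (f + f') g h = HT f g h + HT f' g h" "HT f (g + g') h = HT f g h + HT f g' h"
  "HT f g (h + h') = HT f g h + HT f g h'"
proof -
  have "pot mu (f + f') g = (\<lambda>x. pot mu f g x + pot mu f' g x)" "pot mu f (g + g') = (\<lambda>x. pot mu f g x + pot mu f g' x)"
    by (auto simp: pot_add_left pot_add_right)
  then show "HT (f + f') g h = HT f g h + HT f' g h" "HT f (g + g') h = HT f g h + HT f g' h"
    by (simp_all add: HT_def mlt_add_left)
  show "HT f g (h + h') = HT f g h + HT f g h'" by (simp add: HT_def Hs_add mlt_add)
qed

lemma HT_scaleR: "HT (r *\<^sub>R f) g h = r *\<^sub>R HT f g h" "HT f (r *\<^sub>R g) h = r *\<^sub>R HT f g h"
  "HT f g (r *\<^sub>R h) = r *\<^sub>R HT f g h"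
proof -
  have "pot mu (r *\<^sub>R f) g = (\<lambda>x. complex_of_real r * pot mu f g x)" "pot mu f (r *\<^sub>R g) = (\<lambda>x. complex_of_real r * pot mu f g x)"
    by (auto simp: pot_scaleR_left pot_scaleR_right)
  moreover have "mlt (\<lambda>x. complex_of_real r * pot mu f g x) (Hs h) = r *\<^sub>R mlt (pot mu f g) (Hs h)"
    unfolding mlt_mlt[OF bmult_const bmult_pot, symmetric] by (rule mlt_real)
  ultimately show "HT (r *\<^sub>R f) g h = r *\<^sub>R HT f g h" "HT f (r *\<^sub>R g) h = r *\<^sub>R HT f g h"
    by (simp_all add: HT_def)
  show "HT f g (r *\<^sub>R h) = r *\<^sub>R HT f g h" by (simp add: HT_def Hs_scaleR mlt_scaleR)
qed

lemma inner_mlt_real: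
  assumes "bmult (\<lambda>x. complex_of_real (m x))"
  shows "inner f (mlt (\<lambda>x. complex_of_real (m x)) g) = inner (mlt (\<lambda>x. complex_of_real (m x)) f) g"
  unfolding inner_l2_def
  by (rule integral_cong_AE)
     (measurable, use rp_mlt[OF assms, of f] rp_mlt[OF assms, of g] in eventually_elim, simp add: algebra_simps)

text \<open>The converse of the Cauchy-Schwarz inequality with a weight. As \<open>JB\<close> is
  unbounded, membership in L2 is part of the claim: the weight is cut off at radius
  \<open>n\<close>, the resulting vector is tested against its own direction, and Fatou's lemma
  removes the cutoff.\<close>

lemma weighted_duality:
  assumes C: "0 \<le> C" and D: "\<And>p ps. norm p \<le> 1 \<Longrightarrow> (AE z in lborel. cmod (rp (FT ps) z) \<le> JB z * cmod (rp p z)) \<Longrightarrow> \<bar>inner P (FT ps)\<bar> \<le> C"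
  shows "L2 (\<lambda>z. complex_of_real (JB z) * rp P z)" "norm (cl (\<lambda>z. complex_of_real (JB z) * rp P z)) \<le> C"
proof -
  define m where "m n z = indicator (ball 0 (real n)) z * JB z" for n :: nat and z :: "real^3"
  have mm [measurable]: "m n \<in> borel_measurable borel" for n
    unfolding m_def by (intro borel_measurable_times borel_measurable_indicator JB_measurable) simp
  have m0: "0 \<le> m n z" "m n z \<le> JB z" for n z by (auto simp: m_def indicator_def)
  have bm: "bmult (\<lambda>z. complex_of_real (m n z))" for n
  proof (rule bmultI)
    show "cmod (complex_of_real (m n z)) \<le> (1 + (real n)\<^sup>2) powr (1/4)" for z
    proof (cases "norm z < real n")
      case True
      then have "JB z \<le> (1 + (real n)\<^sup>2) powr (1/4)"
        unfolding JB_def by (intro powr_mono2) (auto intro!: power_mono add_nonneg_nonneg)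
      then show ?thesis using True by (simp add: m_def)
    qed (simp add: m_def)
  qed measurable
  define Y where "Y n = mlt (\<lambda>z. complex_of_real (m n z)) P" for n
  have Yn: "norm (Y n) \<le> C" for n
  proof (cases "Y n = 0")
    case False
    define p where "p = Y n /\<^sub>R norm (Y n)"
    \<comment> \<open>Applying the cut-off weight to the unit vector \<open>p\<close> makes
      \<open>ps\<close> admissible; moving the real weight over to \<open>P\<close> turns the
      pairing into \<open>norm (Y n)\<close>.\<close>
    define ps where "ps = FTi (mlt (\<lambda>z. complex_of_real (m n z)) p)"
    have "AE z in lborel. cmod (rp (FT ps) z) \<le> JB z * cmod (rp p z)"
      unfolding ps_def FT_FTi using rp_mlt[OF bm[of n], of p]
    proof eventually_elim
      case (elim z)
      then show ?case using m0[of n z] by (simp add: norm_mult mult_right_mono)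
    qed
    moreover have "norm p \<le> 1" using False by (simp add: p_def)
    ultimately have "\<bar>inner P (FT ps)\<bar> \<le> C" by (intro D)
    moreover have "inner P (FT ps) = norm (Y n)"
    proof -
      have "inner P (FT ps) = inner (Y n) p"
        by (simp add: ps_def Y_def inner_mlt_real[OF bm])
      also have "\<dots> = norm (Y n)" using False by (simp add: p_def power2_norm_eq_inner[symmetric] power2_eq_square)
      finally show ?thesis .
    qed
    ultimately show ?thesis by simp
  qed (use C in simp)
  have nY: "(\<integral>\<^sup>+ z. ennreal ((cmod (complex_of_real (m n z) * rp P z))\<^sup>2) \<partial>lborel) \<le> ennreal (C\<^sup>2)" for n
    unfolding nn_integral_L2[OF L2_mult_bmult[OF bm[of n] L2_rp[of P]]] mlt_def[symmetric] Y_def[symmetric]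
    by (intro ennreal_leI power_mono Yn norm_ge_zero)
  have "(\<integral>\<^sup>+ z. ennreal ((cmod (complex_of_real (JB z) * rp P z))\<^sup>2) \<partial>lborel)
     = (\<integral>\<^sup>+ z. liminf (\<lambda>n. ennreal ((cmod (complex_of_real (m n z) * rp P z))\<^sup>2)) \<partial>lborel)"
  proof (rule nn_integral_cong)
    fix z :: "real^3"
    obtain N :: nat where N: "norm z < N" using reals_Archimedean2 by blast
    have "eventually (\<lambda>n. ennreal ((cmod (complex_of_real (m n z) * rp P z))\<^sup>2) = ennreal ((cmod (complex_of_real (JB z) * rp P z))\<^sup>2)) sequentially"
      by (rule eventually_sequentiallyI[of N]) (use N in \<open>auto simp: m_def indicator_def\<close>)
    from lim_imp_Liminf[OF trivial_limit_sequentially tendsto_eventually[OF this]]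
    show "ennreal ((cmod (complex_of_real (JB z) * rp P z))\<^sup>2) = liminf (\<lambda>n. ennreal ((cmod (complex_of_real (m n z) * rp P z))\<^sup>2))"
      by simp
  qed
  also have "\<dots> \<le> liminf (\<lambda>n. \<integral>\<^sup>+ z. ennreal ((cmod (complex_of_real (m n z) * rp P z))\<^sup>2) \<partial>lborel)"
    by (rule nn_integral_liminf) measurable
  also have "\<dots> \<le> liminf (\<lambda>n::nat. ennreal (C\<^sup>2))"
    by (intro Liminf_mono always_eventually allI nY)
  also have "\<dots> = ennreal (C\<^sup>2)" by (simp add: Liminf_const)
  finally have le: "(\<integral>\<^sup>+ z. ennreal ((cmod (complex_of_real (JB z) * rp P z))\<^sup>2) \<partial>lborel) \<le> ennreal (C\<^sup>2)" .
  show "L2 (\<lambda>z. complex_of_real (JB z) * rp P z)" "norm (cl (\<lambda>z. complex_of_real (JB z) * rp P z)) \<le> C"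
    by (rule L2_norm_le[OF _ le C]; measurable)+
qed

text \<open>The nonlinearity in the L2 coordinates of \<open>H^(1/2)\<close>. The weight is
  unbounded, so identities for \<open>N3\<close> are checked after applying the bounded injective
  multiplier \<open>iJB\<close>.\<close>

definition N3 :: "l2 \<Rightarrow> l2 \<Rightarrow> l2 \<Rightarrow> l2" where
  "N3 f g h = cl (\<lambda>z. complex_of_real (JB z) * rp (FT (HT f g h)) z)"

lemma N3_unit:
  "\<exists>C\<ge>0. \<forall>f g h. norm f \<le> 1 \<longrightarrow> norm g \<le> 1 \<longrightarrow> norm h \<le> 1 \<longrightarrow>
    L2 (\<lambda>z. complex_of_real (JB z) * rp (FT (HT f g h)) z) \<and> norm (N3 f g h) \<le> C"
proof -
  obtain C where C: "0 \<le> C" "\<And>f g h p ps. norm f \<le> 1 \<Longrightarrow> norm g \<le> 1 \<Longrightarrow> norm h \<le> 1 \<Longrightarrow> norm p \<le> 1 \<Longrightarrow>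
    (AE z in lborel. cmod (rp (FT ps) z) \<le> JB z * cmod (rp p z)) \<Longrightarrow>
    cmod (LINT x|lborel. (LINT y|lborel. complex_of_real (yukawa mu (x - y)) * (uf f y * cnj (uf g y))) * (uf h x * cnj (rp ps x))) \<le> C"
    using hartree_form_bound mu by blast
  have "L2 (\<lambda>z. complex_of_real (JB z) * rp (FT (HT f g h)) z) \<and> norm (N3 f g h) \<le> C"
    if n: "norm f \<le> 1" "norm g \<le> 1" "norm h \<le> 1" for f g h
  proof -
    have "\<bar>inner (FT (HT f g h)) (FT ps)\<bar> \<le> C"
      if p: "norm p \<le> 1" "AE z in lborel. cmod (rp (FT ps) z) \<le> JB z * cmod (rp p z)" for p ps
    proof -
      have "inner (FT (HT f g h)) (FT ps) = inner (HT f g h) (cl (rp ps))" by simp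
      also have "\<dots> = Re (LINT x|lborel. (pot mu f g x * uf h x) * cnj (rp ps x))"
        unfolding HT_def mlt_def by (intro inner_cl L2_mult_bmult) auto
      also have "(LINT x|lborel. (pot mu f g x * uf h x) * cnj (rp ps x)) = (LINT x|lborel. pot mu f g x * (uf h x * cnj (rp ps x)))"
        by (simp only: mult.assoc)
      finally show ?thesis
        using order_trans[OF abs_Re_le_cmod C(2)[OF n p]] by (simp add: pot_def)
    qed
    from weighted_duality[OF C(1) this] show ?thesis by (simp add: N3_def)
  qed
  then show ?thesis using C(1) by blast
qed

lemma N3_bound: "\<exists>C\<ge>0. \<forall>f g h. L2 (\<lambda>z. complex_of_real (JB z) * rp (FT (HT f g h)) z) \<and> norm (N3 f g h) \<le> C * (norm f * norm g * norm h)"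
proof -
  obtain C where C: "0 \<le> C" "\<And>f g h. norm f \<le> 1 \<Longrightarrow> norm g \<le> 1 \<Longrightarrow> norm h \<le> 1 \<Longrightarrow>
    L2 (\<lambda>z. complex_of_real (JB z) * rp (FT (HT f g h)) z) \<and> norm (N3 f g h) \<le> C"
    using N3_unit by blast
  have "L2 (\<lambda>z. complex_of_real (JB z) * rp (FT (HT f g h)) z) \<and> norm (N3 f g h) \<le> C * (norm f * norm g * norm h)" for f g h
  proof -
    obtain r f' where f: "0 \<le> r" "norm f' \<le> 1" "f = r *\<^sub>R f'" "r = norm f" using l2_unit_cases .
    obtain s g' where g: "0 \<le> s" "norm g' \<le> 1" "g = s *\<^sub>R g'" "s = norm g" using l2_unit_cases .
    obtain t h' where h: "0 \<le> t" "norm h' \<le> 1" "h = t *\<^sub>R h'" "t = norm h" using l2_unit_cases .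
    define q where "q = r * s * t"
    have q: "0 \<le> q" using f(1) g(1) h(1) by (simp add: q_def)
    have "HT f g h = q *\<^sub>R HT f' g' h'"
      unfolding f(3) g(3) h(3) HT_scaleR by (simp add: q_def mult_ac)
    then have F: "FT (HT f g h) = q *\<^sub>R FT (HT f' g' h')" by (simp add: FT_scaleR)
    let ?u = "\<lambda>z. complex_of_real (JB z) * rp (FT (HT f' g' h')) z"
    let ?v = "\<lambda>z. complex_of_real (JB z) * rp (FT (HT f g h)) z"
    have L: "L2 ?u" and n: "norm (N3 f' g' h') \<le> C" using C(2)[OF f(2) g(2) h(2)] by auto
    have ae: "AE z in lborel. complex_of_real q * ?u z = ?v z"
      unfolding F using rp_scaleR[of q "FT (HT f' g' h')"] by eventually_elim (simp add: scaleR_conv_of_real)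
    have Lq: "L2 (\<lambda>z. complex_of_real q * ?u z)" by (rule L2_cmult[OF L])
    have Lv: "L2 ?v" by (rule L2_cong_AE[OF Lq _ ae]) measurable
    have "N3 f g h = cl (\<lambda>z. complex_of_real q * ?u z)" unfolding N3_def by (rule cl_cong[OF Lv Lq]) (use ae in auto)
    also have "\<dots> = q *\<^sub>R N3 f' g' h'"
      using mlt_cl[OF bmult_const L, of "complex_of_real q"] by (simp add: N3_def mlt_real)
    finally have "norm (N3 f g h) = q * norm (N3 f' g' h')" using q by simp
    also have "\<dots> \<le> q * C" using n q by (rule mult_left_mono)
    also have "q * C = C * (norm f * norm g * norm h)"
      unfolding q_def f(4) g(4) h(4) by (rule mult.commute)
    finally show ?thesis using Lv by blast
  qed
  then show ?thesis using C(1) by blast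
qed

lemma N3_L2: "L2 (\<lambda>z. complex_of_real (JB z) * rp (FT (HT f g h)) z)"
  using N3_bound by blast

lemma iJB_N3: "mlt iJB (N3 f g h) = FT (HT f g h)"
proof -
  have "mlt iJB (N3 f g h) = cl (\<lambda>z. iJB z * (complex_of_real (JB z) * rp (FT (HT f g h)) z))"
    unfolding N3_def by (rule mlt_cl[OF bmult_iJB N3_L2])
  also have "\<dots> = FT (HT f g h)" by (simp add: mult.assoc[symmetric])
  finally show ?thesis .
qed

lemma iJB_inj: "mlt iJB f = mlt iJB g \<Longrightarrow> f = g"
  by (rule mlt_inj[OF bmult_iJB]) auto

lemma N3_add: "N3 (f + f') g h = N3 f g h + N3 f' g h" "N3 f (g + g') h = N3 f g h + N3 f g' h"
  "N3 f g (h + h') = N3 f g h + N3 f g h'"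
  by (rule iJB_inj, unfold iJB_N3 mlt_add[OF bmult_iJB] HT_add FT_add, rule refl)+

definition NN :: "real \<Rightarrow> l2 \<Rightarrow> l2" where "NN lam f = lam *\<^sub>R N3 f f f"

lemma iJB_NN: "mlt iJB (NN lam f) = lam *\<^sub>R FT (HT f f f)"
  unfolding NN_def mlt_scaleR[OF bmult_iJB] iJB_N3 ..

text \<open>The difference of two cubes telescopes into three terms, each with \<open>f - g\<close>
  in one slot.\<close>

lemma NN_lipschitz:
  "\<exists>C\<ge>0. \<forall>R f g. norm f \<le> R \<longrightarrow> norm g \<le> R \<longrightarrow> norm (NN lam f - NN lam g) \<le> C * R\<^sup>2 * norm (f - g)"
proof -
  obtain C where C: "0 \<le> C" "\<And>f g h. norm (N3 f g h) \<le> C * (norm f * norm g * norm h)"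
    using N3_bound by blast
  have "norm (NN lam f - NN lam g) \<le> (3 * \<bar>lam\<bar> * C) * R\<^sup>2 * norm (f - g)"
    if f: "norm f \<le> R" and g: "norm g \<le> R" for R f g
  proof -
    have R: "0 \<le> R" using order_trans[OF norm_ge_zero f] .
    define d where "d = f - g"
    have fd: "f = d + g" by (simp add: d_def)
    have "N3 f f f - N3 g g g = N3 d f f + N3 g d f + N3 g g d"
    proof -
      have "N3 f f f = N3 d f f + N3 g f f" by (subst (1) fd) (rule N3_add)
      also have "N3 g f f = N3 g d f + N3 g g f" by (subst (1) fd) (rule N3_add)
      also have "N3 g g f = N3 g g d + N3 g g g" by (subst (1) fd) (rule N3_add)
      finally show ?thesis by simp
    qed
    then have "norm (N3 f f f - N3 g g g) \<le> norm (N3 d f f) + norm (N3 g d f) + norm (N3 g g d)"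
      using norm_triangle_ineq[of "N3 d f f + N3 g d f" "N3 g g d"] norm_triangle_ineq[of "N3 d f f" "N3 g d f"] by simp
    also have "\<dots> \<le> C * (norm d * R * R) + C * (R * norm d * R) + C * (R * R * norm d)"
      by (intro add_mono order_trans[OF C(2)] mult_left_mono mult_mono mult_nonneg_nonneg f g C(1) R norm_ge_zero order_refl)
    also have "\<dots> = 3 * C * R\<^sup>2 * norm d" by (simp add: power2_eq_square algebra_simps)
    finally have "\<bar>lam\<bar> * norm (N3 f f f - N3 g g g) \<le> \<bar>lam\<bar> * (3 * C * R\<^sup>2 * norm d)"
      by (rule mult_left_mono) simp
    then show ?thesis by (simp add: NN_def d_def mult_ac flip: scaleR_diff_right)
  qed
  then show ?thesis using C(1) by (intro exI[of _ "3 * \<bar>lam\<bar> * C"]) auto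
qed

lemma NN_0: "NN lam 0 = 0"
proof -
  obtain C where "\<And>f g h. norm (N3 f g h) \<le> C * (norm f * norm g * norm h)" using N3_bound by blast
  from this[of 0 0 0] show ?thesis by (simp add: NN_def)
qed

text \<open>A change of \<open>u\<close> on a null set leaves the convolution unchanged at every
  point, so the term of the problem and \<open>HT\<close> define the same class although
  \<open>u\<close> and \<open>uf y\<close> coincide only almost everywhere.\<close>

lemma hartree_HT:
  assumes u: "L2 u" "cl u = Hs y"
  shows "L2 (hartree lam mu u)" "cl (hartree lam mu u) = lam *\<^sub>R HT y y y"
proof -
  have ae: "AE x in lborel. uf y x = u x" using rp_cl[OF u(1)] u(2) by simp
  note [measurable] = L2_measurable[OF u(1)]
  have pu: "complex_of_real (LINT z|lborel. lam * exp (- mu * norm (x - z)) / norm (x - z) * (cmod (u z))\<^sup>2) = complex_of_real lam * pot mu y y x" for x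
  proof -
    have "(LINT z|lborel. lam * exp (- mu * norm (x - z)) / norm (x - z) * (cmod (u z))\<^sup>2)
      = (LINT z|lborel. lam * (yukawa mu (x - z) * (cmod (uf y z))\<^sup>2))"
      by (rule integral_cong_AE) (measurable, use ae in eventually_elim, simp add: yukawa_def)
    also have "\<dots> = lam * (LINT z|lborel. yukawa mu (x - z) * (cmod (uf y z))\<^sup>2)" by (rule integral_mult_right_zero)
    finally have e: "(LINT z|lborel. lam * exp (- mu * norm (x - z)) / norm (x - z) * (cmod (u z))\<^sup>2)
      = lam * (LINT z|lborel. yukawa mu (x - z) * (cmod (uf y z))\<^sup>2)" .
    have "complex_of_real (LINT z|lborel. lam * exp (- mu * norm (x - z)) / norm (x - z) * (cmod (u z))\<^sup>2)
      = complex_of_real lam * (LINT z|lborel. complex_of_real (yukawa mu (x - z) * (cmod (uf y z))\<^sup>2))"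
      unfolding e of_real_mult[of lam] integral_complex_of_real ..
    also have "(LINT z|lborel. complex_of_real (yukawa mu (x - z) * (cmod (uf y z))\<^sup>2)) = pot mu y y x"
      unfolding pot_def by (simp only: of_real_mult complex_norm_square)
    finally show ?thesis .
  qed
  have eq: "hartree lam mu u = (\<lambda>x. (complex_of_real lam * pot mu y y x) * u x)"
    by (rule ext) (simp only: hartree_def pu)
  have b: "bmult (\<lambda>x. complex_of_real lam * pot mu y y x)" by (intro bmult_mult bmult_const bmult_pot)
  show "L2 (hartree lam mu u)" unfolding eq by (rule L2_mult_bmult[OF b u(1)])
  show "cl (hartree lam mu u) = lam *\<^sub>R HT y y y"
    unfolding eq mlt_cl[OF b u(1), symmetric] u(2) HT_def mlt_real[symmetric]
    by (rule mlt_mlt[symmetric]) simp_all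
qed

end

section \<open>The free propagator\<close>

text \<open>The problem states its derivative by difference quotients in \<open>h\<close>, with
  \<open>t + h\<close> confined to the interval of existence; at \<open>t = 0\<close> this is the
  one-sided derivative.\<close>

lemma has_vector_derivative_shift_iff:
  fixes f :: "real \<Rightarrow> 'a::real_normed_vector"
  shows "(f has_vector_derivative d) (at t within I) \<longleftrightarrow>
    ((\<lambda>h. norm ((1 / h) *\<^sub>R (f (t + h) - f t) - d)) \<longlongrightarrow> 0) (at 0 within {h. t + h \<in> I})"
proof -
  define q where "q y = norm ((1 / (y - t)) *\<^sub>R (f y - f t) - d)" for y
  have e: "norm ((1 / norm (y - t)) *\<^sub>R (f y - (f t + (y - t) *\<^sub>R d))) = q y" if "y \<noteq> t" for y
  proof -
    have "(1 / (y - t)) *\<^sub>R (f y - f t) - d = (1 / (y - t)) *\<^sub>R (f y - (f t + (y - t) *\<^sub>R d))"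
    proof -
      have "(1 / (y - t)) *\<^sub>R (f y - (f t + (y - t) *\<^sub>R d)) = (1 / (y - t)) *\<^sub>R (f y - f t - (y - t) *\<^sub>R d)"
        by (simp only: diff_diff_add)
      also have "\<dots> = (1 / (y - t)) *\<^sub>R (f y - f t) - d"
        using that by (simp add: scaleR_diff_right[of _ "f y - f t"])
      finally show ?thesis ..
    qed
    then show ?thesis by (simp add: q_def)
  qed
  have "(f has_vector_derivative d) (at t within I) \<longleftrightarrow>
    ((\<lambda>y. norm ((1 / norm (y - t)) *\<^sub>R (f y - (f t + (y - t) *\<^sub>R d)))) \<longlongrightarrow> 0) (at t within I)"
    unfolding has_vector_derivative_def has_derivative_within tendsto_norm_zero_iff
    by (simp add: bounded_linear_scaleR_left)
  also have "\<dots> \<longleftrightarrow> (q \<longlongrightarrow> 0) (at t within I)"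
    by (rule tendsto_cong, unfold eventually_at_filter) (intro always_eventually allI impI e)
  also have "\<dots> \<longleftrightarrow> ((\<lambda>h. q (t + h)) \<longlongrightarrow> 0) (at 0 within {h. t + h \<in> I})"
  proof
    assume L: "(q \<longlongrightarrow> 0) (at t within I)"
    show "((\<lambda>h. q (t + h)) \<longlongrightarrow> 0) (at 0 within {h. t + h \<in> I})"
      unfolding Lim_within
    proof (intro allI impI)
      fix r :: real assume "0 < r"
      then obtain s where s: "s > 0" "\<And>y. y \<in> I \<Longrightarrow> 0 < dist y t \<and> dist y t < s \<Longrightarrow> dist (q y) 0 < r"
        using L unfolding Lim_within by blast
      show "\<exists>d>0. \<forall>x\<in>{h. t + h \<in> I}. 0 < dist x 0 \<and> dist x 0 < d \<longrightarrow> dist (q (t + x)) 0 < r"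
        by (rule exI[of _ s]) (use s in \<open>auto simp: dist_real_def\<close>)
    qed
  next
    assume R: "((\<lambda>h. q (t + h)) \<longlongrightarrow> 0) (at 0 within {h. t + h \<in> I})"
    show "(q \<longlongrightarrow> 0) (at t within I)"
      unfolding Lim_within
    proof (intro allI impI)
      fix r :: real assume "0 < r"
      then obtain s where s: "s > 0" "\<And>x. t + x \<in> I \<Longrightarrow> 0 < dist x 0 \<and> dist x 0 < s \<Longrightarrow> dist (q (t + x)) 0 < r"
        using R unfolding Lim_within by blast
      show "\<exists>d>0. \<forall>y\<in>I. 0 < dist y t \<and> dist y t < d \<longrightarrow> dist (q y) 0 < r"
      proof (intro exI conjI ballI impI)
        fix y assume "y \<in> I" "0 < dist y t \<and> dist y t < s"
        then show "dist (q y) 0 < r" using s(2)[of "y - t"] by (simp add: dist_real_def)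
      qed (fact s(1))
    qed
  qed
  finally show ?thesis by (simp add: q_def)
qed

definition om :: "real \<Rightarrow> real^3 \<Rightarrow> real" where "om m z = sqrt ((norm z)\<^sup>2 + m\<^sup>2)"

lemma om_measurable [measurable]: "om m \<in> borel_measurable borel"
  unfolding om_def[abs_def] by measurable

lemma JB_sq: "(JB z)\<^sup>2 = sqrt (1 + (norm z)\<^sup>2)"
  by (simp add: JB_sqrt)

text \<open>\<open>(JB z)\<^sup>2\<close> is the one derivative lost between \<open>H^(1/2)\<close>
  and \<open>H^(-1/2)\<close>, so the generator is bounded from the first space to the
  second.\<close>

lemma om_le: "om m z \<le> (1 + \<bar>m\<bar>) * (JB z)\<^sup>2"
proof -
  have "om m z \<le> norm z + \<bar>m\<bar>" unfolding om_def using sqrt_add_le_add_sqrt[of "(norm z)\<^sup>2" "m\<^sup>2"] by simp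
  also have "norm z \<le> (JB z)\<^sup>2" unfolding JB_sq by (rule real_le_rsqrt) simp
  also have "\<bar>m\<bar> \<le> \<bar>m\<bar> * (JB z)\<^sup>2" using mult_left_mono[of 1 "(JB z)\<^sup>2" "\<bar>m\<bar>"] by (simp add: JB_sq)
  finally show ?thesis by (simp add: algebra_simps)
qed

lemma om_nonneg [simp]: "0 \<le> om m z" by (simp add: om_def)

definition Ev :: "real \<Rightarrow> real \<Rightarrow> l2 \<Rightarrow> l2" where "Ev m t = mlt (\<lambda>z. cis (t * om m z))"

text \<open>In the L2 coordinates of \<open>H^(1/2)\<close> and of \<open>H^(-1/2)\<close>,
  \<open>sJ\<close> is the inclusion of the first space in the second, and \<open>omb\<close> below
  is the operator with symbol \<open>om\<close> between them.\<close>

definition sJ :: "real^3 \<Rightarrow> complex" where "sJ z = complex_of_real (1 / (JB z)\<^sup>2)"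

definition omb :: "real \<Rightarrow> real^3 \<Rightarrow> complex" where "omb m z = complex_of_real (om m z / (JB z)\<^sup>2)"

lemma sJ_measurable [measurable]: "sJ \<in> borel_measurable borel" unfolding sJ_def[abs_def] by measurable
lemma omb_measurable [measurable]: "omb m \<in> borel_measurable borel" unfolding omb_def[abs_def] by measurable

lemma JB_sq_ge_1: "1 \<le> (JB z)\<^sup>2" by (simp add: JB_sq)

lemma cmod_omb_le: "cmod (omb m z) \<le> 1 + \<bar>m\<bar>"
proof -
  have "om m z / (JB z)\<^sup>2 \<le> 1 + \<bar>m\<bar>"
    using om_le[of m z] JB_sq_ge_1[of z] by (simp add: pos_divide_le_eq)
  then show ?thesis by (simp add: omb_def norm_divide norm_power)
qed

lemma bmult_sJ [simp]: "bmult sJ"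
  by (rule bmultI[where C=1]) (measurable, use JB_sq_ge_1 in \<open>auto simp: sJ_def norm_divide norm_power\<close>)

lemma bmult_omb [simp]: "bmult (omb m)"
  by (rule bmultI[OF _ cmod_omb_le]) measurable

lemma bmult_phase [simp]: "bmult (\<lambda>z. cis (t * om m z))"
  by (rule bmult_unimod) auto

lemma norm_Ev [simp]: "norm (Ev m t f) = norm f"
  unfolding Ev_def by (rule norm_mlt_unimod) auto

lemma Ev_Ev: "Ev m s (Ev m t f) = Ev m (s + t) f"
  unfolding Ev_def by (subst mlt_mlt) (auto simp: cis_mult algebra_simps)

lemma Ev_0 [simp]: "Ev m 0 f = f" by (simp add: Ev_def)

lemma Ev_inverse [simp]: "Ev m (- t) (Ev m t f) = f" "Ev m t (Ev m (- t) f) = f"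
  by (simp_all add: Ev_Ev)

lemma bounded_linear_Ev: "bounded_linear (Ev m t)"
  unfolding Ev_def by (rule bounded_linear_mlt) simp

lemma Ev_add: "Ev m t (f + g) = Ev m t f + Ev m t g" unfolding Ev_def by (rule mlt_add) simp
lemma Ev_diff: "Ev m t (f - g) = Ev m t f - Ev m t g" unfolding Ev_def by (rule mlt_diff) simp
lemma Ev_scaleR: "Ev m t (r *\<^sub>R f) = r *\<^sub>R Ev m t f" unfolding Ev_def by (rule mlt_scaleR) simp

lemma mlt_commute: "bmult a \<Longrightarrow> bmult b \<Longrightarrow> mlt a (mlt b f) = mlt b (mlt a f)"
  by (simp add: mlt_mlt mult.commute)

text \<open>Strong continuity only: as \<open>om\<close> is unbounded, the phases do not converge
  uniformly in frequency. The factor \<open>k\<close> covers both directions of time.\<close>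

lemma Ev_continuous: "continuous_on UNIV (\<lambda>s. Ev m (k * s) f)"
proof (rule continuous_on_sequentiallyI)
  fix u :: "nat \<Rightarrow> real" and a assume "u \<longlonglongrightarrow> a"
  then have "(\<lambda>n. cis (k * u n * om m z)) \<longlonglongrightarrow> cis (k * a * om m z)" for z
    by (intro tendsto_intros)
  then show "(\<lambda>n. Ev m (k * u n) f) \<longlonglongrightarrow> Ev m (k * a) f"
    unfolding Ev_def by (intro mlt_tendsto[where C=1]) auto
qed

lemma Ev_continuous_joint:
  assumes "continuous_on S y" shows "continuous_on S (\<lambda>s. Ev m (k * s) (y s))"
  by (rule continuous_on_joint[OF Ev_continuous, where B=UNIV and L=1]) (use assms in \<open>auto simp flip: Ev_diff\<close>)

lemma cmod_cis_diff_le: "cmod (cis a - cis b) \<le> \<bar>a - b\<bar>"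
proof -
  have "cis a - cis b = cis b * (cis (a - b) - 1)" by (simp add: right_diff_distrib cis_mult)
  then have "cmod (cis a - cis b) = cmod (iexp (a - b) - 1)" by (simp add: norm_mult cis_conv_exp)
  also have "\<dots> \<le> \<bar>a - b\<bar>" using iexp_approx1[of "a - b" 0] by simp
  finally show ?thesis .
qed

lemma cis_quotient_tendsto:
  fixes X :: "nat \<Rightarrow> real"
  assumes X: "X \<longlonglongrightarrow> 0" "\<And>n. X n \<noteq> 0"
  shows "(\<lambda>n. (cis (b * (t + X n)) - cis (b * t)) / complex_of_real (X n)) \<longlonglongrightarrow> \<i> * complex_of_real b * cis (b * t)"
proof -
  have "((\<lambda>z. exp (\<i> * complex_of_real b * z)) has_field_derivative (exp (\<i> * complex_of_real b * 0) * (\<i> * complex_of_real b))) (at 0)"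
    by (auto intro!: derivative_eq_intros)
  then have "((\<lambda>h. (exp (\<i> * complex_of_real b * (0 + h)) - exp (\<i> * complex_of_real b * 0)) / h) \<longlongrightarrow> exp (\<i> * complex_of_real b * 0) * (\<i> * complex_of_real b)) (at 0)"
    by (rule DERIV_D)
  then have D: "((\<lambda>h. (exp (\<i> * complex_of_real b * h) - 1) / h) \<longlongrightarrow> \<i> * complex_of_real b) (at 0)" by simp
  have "(\<lambda>n. complex_of_real (X n)) \<longlonglongrightarrow> complex_of_real 0" by (intro tendsto_intros X)
  then have "filterlim (\<lambda>n. complex_of_real (X n)) (at 0) sequentially"
    using X(2) by (simp add: filterlim_at)
  from filterlim_compose[OF D this]
  have "(\<lambda>n. cis (b * t) * ((exp (\<i> * complex_of_real b * complex_of_real (X n)) - 1) / complex_of_real (X n))) \<longlonglongrightarrow> cis (b * t) * (\<i> * complex_of_real b)"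
    by (intro tendsto_intros)
  moreover have "cis (b * t) * ((exp (\<i> * complex_of_real b * complex_of_real (X n)) - 1) / complex_of_real (X n)) = (cis (b * (t + X n)) - cis (b * t)) / complex_of_real (X n)" for n
  proof -
    have "exp (\<i> * complex_of_real b * complex_of_real (X n)) = cis (b * X n)" by (simp add: cis_conv_exp mult.assoc)
    then show ?thesis by (simp add: right_diff_distrib cis_mult distrib_left)
  qed
  moreover have "cis (b * t) * (\<i> * complex_of_real b) = \<i> * complex_of_real b * cis (b * t)" by simp
  ultimately show ?thesis by (simp only:)
qed

lemma mlt_diff_left: "bmult a \<Longrightarrow> bmult b \<Longrightarrow> mlt (\<lambda>x. a x - b x) f = mlt a f - mlt b f"
proof -
  assume a: "bmult a" and b: "bmult b"
  have "bmult (\<lambda>x. (-1) * b x)" by (intro bmult_mult bmult_const b)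
  from mlt_add_left[OF a this, of f] mlt_mlt[OF bmult_const b, of "-1" f, symmetric] mlt_real[of "-1" "mlt b f"]
  show ?thesis by simp
qed

text \<open>On the range of \<open>sJ\<close> the propagator is differentiable: the difference
  quotients of the phases, multiplied by \<open>sJ\<close>, are bounded by
  \<open>\<bar>k\<bar> * (1 + \<bar>m\<bar>)\<close> uniformly in frequency, so
  \<open>mlt_tendsto\<close> applies.\<close>

lemma Ev_smoothed_derivative:
  "((\<lambda>h. norm ((1 / h) *\<^sub>R (Ev m (k * (t + h)) (mlt sJ f) - Ev m (k * t) (mlt sJ f)) - Ev m (k * t) (k *\<^sub>R mlt (\<lambda>_. \<i>) (mlt (omb m) f)))) \<longlongrightarrow> 0) (at 0)"
  unfolding tendsto_at_iff_sequentially comp_def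
proof (intro allI impI)
  fix X :: "nat \<Rightarrow> real" assume "\<forall>i. X i \<in> UNIV - {0}" and X: "X \<longlonglongrightarrow> 0"
  then have X0: "X n \<noteq> 0" for n by auto
  define A where "A n z = (cis (k * om m z * (t + X n)) - cis (k * om m z * t)) / complex_of_real (X n) * sJ z" for n z
  define A0 where "A0 z = \<i> * complex_of_real (k * om m z) * cis (k * om m z * t) * sJ z" for z
  have [measurable]: "A n \<in> borel_measurable borel" for n unfolding A_def by measurable
  have Ab: "cmod (A n z) \<le> \<bar>k\<bar> * (1 + \<bar>m\<bar>)" for n z
  proof -
    have "cmod (cis (k * om m z * (t + X n)) - cis (k * om m z * t)) \<le> \<bar>k * om m z * (t + X n) - k * om m z * t\<bar>"
      by (rule cmod_cis_diff_le)
    also have "\<dots> = \<bar>k\<bar> * om m z * \<bar>X n\<bar>" by (simp add: distrib_left abs_mult)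
    finally have "cmod (cis (k * om m z * (t + X n)) - cis (k * om m z * t)) / \<bar>X n\<bar> \<le> \<bar>k\<bar> * om m z"
      using X0[of n] by (simp add: pos_divide_le_eq)
    then have "cmod (cis (k * om m z * (t + X n)) - cis (k * om m z * t)) / \<bar>X n\<bar> * (1 / (JB z)\<^sup>2) \<le> \<bar>k\<bar> * om m z * (1 / (JB z)\<^sup>2)"
      by (rule mult_right_mono) simp
    also have "\<dots> = \<bar>k\<bar> * cmod (omb m z)" by (simp add: omb_def norm_divide norm_power)
    also have "\<dots> \<le> \<bar>k\<bar> * (1 + \<bar>m\<bar>)" by (intro mult_left_mono cmod_omb_le) simp
    finally show ?thesis by (simp add: A_def norm_mult norm_divide sJ_def norm_power)
  qed
  have "(\<lambda>n. mlt (A n) f) \<longlonglongrightarrow> mlt A0 f"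
  proof (rule mlt_tendsto[OF _ Ab])
    show "(\<lambda>n. A n z) \<longlonglongrightarrow> A0 z" for z
      unfolding A_def A0_def by (intro tendsto_mult_right cis_quotient_tendsto X X0)
  qed measurable
  moreover have "mlt (A n) f = (1 / X n) *\<^sub>R (Ev m (k * (t + X n)) (mlt sJ f) - Ev m (k * t) (mlt sJ f))" for n
  proof -
    have "(1 / X n) *\<^sub>R (Ev m (k * (t + X n)) (mlt sJ f) - Ev m (k * t) (mlt sJ f))
       = mlt (\<lambda>z. complex_of_real (1 / X n)) (mlt (\<lambda>z. cis (k * (t + X n) * om m z) - cis (k * t * om m z)) (mlt sJ f))"
      unfolding Ev_def mlt_real by (subst mlt_diff_left) auto
    also have "\<dots> = mlt (A n) f"
    proof -
      have b: "bmult (\<lambda>z. cis (k * (t + X n) * om m z) - cis (k * t * om m z))"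
        by (rule bmultI[where C="1 + 1"], measurable) (use norm_triangle_ineq4 in \<open>metis norm_cis\<close>)
      have "(\<lambda>z. complex_of_real (1 / X n) * ((cis (k * (t + X n) * om m z) - cis (k * t * om m z)) * sJ z)) = A n"
        by (auto simp: A_def mult_ac)
      then show ?thesis by (simp add: mlt_mlt b bmult_mult del: of_real_divide)
    qed
    finally show ?thesis ..
  qed
  moreover have "mlt A0 f = Ev m (k * t) (k *\<^sub>R mlt (\<lambda>_. \<i>) (mlt (omb m) f))"
  proof -
    have "(\<lambda>z. cis (k * t * om m z) * (complex_of_real k * (\<i> * omb m z))) = A0"
      by (auto simp: A0_def omb_def sJ_def mult_ac)
    then show ?thesis unfolding Ev_def mlt_real[of k, symmetric] by (simp add: mlt_mlt bmult_mult)
  qed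
  ultimately have "(\<lambda>n. (1 / X n) *\<^sub>R (Ev m (k * (t + X n)) (mlt sJ f) - Ev m (k * t) (mlt sJ f))) \<longlonglongrightarrow> Ev m (k * t) (k *\<^sub>R mlt (\<lambda>_. \<i>) (mlt (omb m) f))"
    by simp
  then show "(\<lambda>n. norm ((1 / X n) *\<^sub>R (Ev m (k * (t + X n)) (mlt sJ f) - Ev m (k * t) (mlt sJ f)) - Ev m (k * t) (k *\<^sub>R mlt (\<lambda>_. \<i>) (mlt (omb m) f)))) \<longlonglongrightarrow> 0"
    by (intro tendsto_norm_zero LIM_zero)
qed

text \<open>Only the smoothed curve is differentiable, so the derivative of the phase appears as the
  bounded \<open>omb\<close> acting on \<open>y t\<close>. The error splits into the quotient of the
  curve, which \<open>Ev\<close> transports isometrically, the variation of \<open>Ev\<close> on the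
  fixed vector \<open>z'\<close>, and the quotient of \<open>Ev\<close> on a fixed smoothed
  vector.\<close>

lemma Ev_product_rule:
  assumes d: "((\<lambda>s. mlt sJ (y s)) has_vector_derivative z') (at t within I)"
  shows "((\<lambda>s. Ev m (k * s) (mlt sJ (y s))) has_vector_derivative
    Ev m (k * t) (z' + k *\<^sub>R mlt (\<lambda>_. \<i>) (mlt (omb m) (y t)))) (at t within I)"
  unfolding has_vector_derivative_shift_iff
proof -
  define w where "w = k *\<^sub>R mlt (\<lambda>_. \<i>) (mlt (omb m) (y t))"
  define Y where "Y s = mlt sJ (y s)" for s
  define J where "J = {h. t + h \<in> I}"
  have l1: "((\<lambda>h. norm ((1 / h) *\<^sub>R (Y (t + h) - Y t) - z')) \<longlongrightarrow> 0) (at 0 within J)"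
    using d unfolding has_vector_derivative_shift_iff Y_def J_def .
  have "((\<lambda>h. Ev m (k * (t + h)) z' - Ev m (k * t) z') \<longlongrightarrow> Ev m (k * (t + 0)) z' - Ev m (k * t) z') (at 0 within J)"
  proof (intro tendsto_diff tendsto_const)
    have "isCont (\<lambda>s. Ev m (k * s) z') (t + 0)" using Ev_continuous continuous_on_eq_continuous_at by blast
    then show "((\<lambda>h. Ev m (k * (t + h)) z') \<longlongrightarrow> Ev m (k * (t + 0)) z') (at 0 within J)"
      by (rule isCont_tendsto_compose) (intro tendsto_intros)
  qed
  then have l2: "((\<lambda>h. norm (Ev m (k * (t + h)) z' - Ev m (k * t) z')) \<longlongrightarrow> 0) (at 0 within J)"
    by (intro tendsto_norm_zero) simp
  have l3: "((\<lambda>h. norm ((1 / h) *\<^sub>R (Ev m (k * (t + h)) (Y t) - Ev m (k * t) (Y t)) - Ev m (k * t) w)) \<longlongrightarrow> 0) (at 0 within J)"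
    unfolding Y_def w_def by (rule tendsto_within_subset[OF Ev_smoothed_derivative]) simp
  have "((\<lambda>h. norm ((1 / h) *\<^sub>R (Y (t + h) - Y t) - z') + norm (Ev m (k * (t + h)) z' - Ev m (k * t) z')
     + norm ((1 / h) *\<^sub>R (Ev m (k * (t + h)) (Y t) - Ev m (k * t) (Y t)) - Ev m (k * t) w)) \<longlongrightarrow> 0 + 0 + 0) (at 0 within J)"
    by (intro tendsto_add l1 l2 l3)
  then have lim: "((\<lambda>h. norm ((1 / h) *\<^sub>R (Y (t + h) - Y t) - z') + norm (Ev m (k * (t + h)) z' - Ev m (k * t) z')
     + norm ((1 / h) *\<^sub>R (Ev m (k * (t + h)) (Y t) - Ev m (k * t) (Y t)) - Ev m (k * t) w)) \<longlongrightarrow> 0) (at 0 within J)" by simp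
  have "((\<lambda>h. norm ((1 / h) *\<^sub>R (Ev m (k * (t + h)) (Y (t + h)) - Ev m (k * t) (Y t)) - Ev m (k * t) (z' + w))) \<longlongrightarrow> 0) (at 0 within J)"
  proof (rule Lim_null_comparison[OF _ lim], rule always_eventually, rule allI)
    fix h
    have eq: "(1 / h) *\<^sub>R (Ev m (k * (t + h)) (Y (t + h)) - Ev m (k * t) (Y t)) - Ev m (k * t) (z' + w)
      = Ev m (k * (t + h)) ((1 / h) *\<^sub>R (Y (t + h) - Y t) - z') + (Ev m (k * (t + h)) z' - Ev m (k * t) z')
       + ((1 / h) *\<^sub>R (Ev m (k * (t + h)) (Y t) - Ev m (k * t) (Y t)) - Ev m (k * t) w)"
      by (simp add: Ev_diff Ev_add Ev_scaleR scaleR_diff_right)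
    have Evn: "norm ((1 / h) *\<^sub>R (Y (t + h) - Y t) - z') = norm (Ev m (k * (t + h)) ((1 / h) *\<^sub>R (Y (t + h) - Y t) - z'))"
      by (rule norm_Ev[symmetric])
    show "norm (norm ((1 / h) *\<^sub>R (Ev m (k * (t + h)) (Y (t + h)) - Ev m (k * t) (Y t)) - Ev m (k * t) (z' + w)))
      \<le> norm ((1 / h) *\<^sub>R (Y (t + h) - Y t) - z') + norm (Ev m (k * (t + h)) z' - Ev m (k * t) z')
     + norm ((1 / h) *\<^sub>R (Ev m (k * (t + h)) (Y t) - Ev m (k * t) (Y t)) - Ev m (k * t) w)"
      unfolding eq real_norm_def abs_norm_cancel Evn
      by (rule order_trans[OF norm_triangle_ineq add_right_mono[OF norm_triangle_ineq]])
  qed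
  then show "((\<lambda>h. norm ((1 / h) *\<^sub>R (Ev m (k * (t + h)) (mlt sJ (y (t + h))) - Ev m (k * t) (mlt sJ (y t))) -
      Ev m (k * t) (z' + k *\<^sub>R mlt (\<lambda>_. \<i>) (mlt (omb m) (y t))))) \<longlongrightarrow> 0) (at 0 within {h. t + h \<in> I})"
    by (simp add: Y_def w_def J_def)
qed

section \<open>Solutions as curves in L2\<close>

text \<open>The L2 coordinate of an element of \<open>H^(1/2)\<close>. It preserves norms there, and
  \<open>uf\<close> inverts it up to equality almost everywhere (\<open>Hs_Xu\<close>,
  \<open>Xu_uf\<close>).\<close>

definition Xu :: "(real^3 \<Rightarrow> complex) \<Rightarrow> l2" where
  "Xu u = cl (\<lambda>z. complex_of_real (JB z) * fourier u z)"

lemma JB_powr: "(JB z)\<^sup>2 = (1 + (norm z)\<^sup>2) powr (1/2)" "(1 / JB z)\<^sup>2 = (1 + (norm z)\<^sup>2) powr (-1/2)"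
proof -
  show e: "(JB z)\<^sup>2 = (1 + (norm z)\<^sup>2) powr (1/2)"
    unfolding JB_def power2_eq_square by (subst powr_add[symmetric]) simp
  show "(1 / JB z)\<^sup>2 = (1 + (norm z)\<^sup>2) powr (-1/2)"
    by (simp add: power_divide e powr_minus_divide)
qed

lemma in_fsob_half:
  assumes [measurable]: "g \<in> borel_measurable borel"
  shows "in_fsob (1/2) g \<longleftrightarrow> L2 (\<lambda>z. complex_of_real (JB z) * g z)"
    "in_fsob (-1/2) g \<longleftrightarrow> L2 (\<lambda>z. iJB z * g z)"
  by (auto simp: in_fsob_def L2_def norm_mult power_mult_distrib norm_divide power_divide JB_powr powr_minus_divide)

lemma fsob_norm_half:
  shows "L2 (\<lambda>z. complex_of_real (JB z) * g z) \<Longrightarrow> fsob_norm (1/2) g = norm (cl (\<lambda>z. complex_of_real (JB z) * g z))"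
    "L2 (\<lambda>z. iJB z * g z) \<Longrightarrow> fsob_norm (-1/2) g = norm (cl (\<lambda>z. iJB z * g z))"
  by (simp_all add: fsob_norm_def norm_cl norm_mult power_mult_distrib norm_divide power_divide JB_powr powr_minus_divide)

lemma in_H_half: "in_H (1/2) u \<longleftrightarrow> L2 u \<and> L2 (\<lambda>z. complex_of_real (JB z) * fourier u z)"
  unfolding in_H_def using in_fsob_half(1)[OF fourier_spec(1)] by blast

lemma in_H_L2: "in_H (1/2) u \<Longrightarrow> L2 u" by (simp add: in_H_half)

lemma sob_norm_Xu: "in_H (1/2) u \<Longrightarrow> sob_norm (1/2) u = norm (Xu u)"
  unfolding sob_norm_def Xu_def in_H_half using fsob_norm_half(1) by blast

lemma iJB_Xu: "in_H (1/2) u \<Longrightarrow> mlt iJB (Xu u) = FT (cl u)"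
proof -
  assume u: "in_H (1/2) u"
  then have "mlt iJB (Xu u) = cl (\<lambda>z. iJB z * (complex_of_real (JB z) * fourier u z))"
    unfolding Xu_def in_H_half by (intro mlt_cl bmult_iJB) auto
  also have "\<dots> = cl (fourier u)" by (simp add: mult.assoc[symmetric])
  also have "\<dots> = FT (cl u)" using u by (intro cl_fourier in_H_L2)
  finally show ?thesis .
qed

lemma Hs_Xu: "in_H (1/2) u \<Longrightarrow> Hs (Xu u) = cl u"
  by (simp only: Hs_def iJB_Xu FTi_FT)

lemma fourier_uf: "AE z in lborel. complex_of_real (JB z) * fourier (uf y) z = rp y z"
  using fourier_spec(2)[OF L2_rp[of "Hs y"]] rp_FT_Hs[of y]
  by eventually_elim simp

lemma in_H_uf: "in_H (1/2) (uf y)"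
proof -
  have "fourier (uf y) \<in> borel_measurable borel" by (rule fourier_spec) simp
  then have "(\<lambda>z. complex_of_real (JB z) * fourier (uf y) z) \<in> borel_measurable borel" by measurable
  then have "L2 (\<lambda>z. complex_of_real (JB z) * fourier (uf y) z)"
    by (rule L2_cong_AE[OF L2_rp[of y]]) (use fourier_uf[of y] in \<open>auto simp: eq_commute\<close>)
  then show ?thesis by (simp add: in_H_half)
qed

lemma Xu_uf [simp]: "Xu (uf y) = y"
  unfolding Xu_def by (rule cl_eqI[OF _ fourier_uf]) (use in_H_uf[of y] in \<open>simp add: in_H_half\<close>)

lemma in_H_cong_AE:
  assumes "in_H (1/2) u" "L2 v" "cl v = cl u" shows "in_H (1/2) v" "Xu v = Xu u"
proof -
  have u: "L2 u" by (rule in_H_L2[OF assms(1)])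
  have "AE z in lborel. fourier u z = fourier v z"
    using fourier_spec(2)[OF u] fourier_spec(2)[OF assms(2)] assms(3) by (auto elim!: eventually_elim2)
  then have ae: "AE z in lborel. complex_of_real (JB z) * fourier u z = complex_of_real (JB z) * fourier v z"
    by eventually_elim simp
  have [measurable]: "fourier v \<in> borel_measurable borel" by (rule fourier_spec[OF assms(2)])
  have Lu: "L2 (\<lambda>z. complex_of_real (JB z) * fourier u z)" using assms(1) by (simp add: in_H_half)
  have Lv: "L2 (\<lambda>z. complex_of_real (JB z) * fourier v z)"
    by (rule L2_cong_AE[OF Lu _ ae]) measurable
  show "in_H (1/2) v" using assms(2) Lv by (simp add: in_H_half)
  show "Xu v = Xu u" unfolding Xu_def by (rule cl_cong[OF Lv Lu]) (use ae in auto)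
qed

lemma Xu_inj:
  assumes "in_H (1/2) u" "in_H (1/2) v" "Xu u = Xu v" shows "AE x in lborel. u x = v x"
proof -
  have "cl u = cl v" using Hs_Xu[OF assms(1)] Hs_Xu[OF assms(2)] assms(3) by simp
  then show ?thesis using assms by (simp add: cl_eq_iff in_H_L2)
qed

lemma Xu_diff:
  assumes "in_H (1/2) u" "in_H (1/2) v"
  shows "in_H (1/2) (\<lambda>x. u x - v x)" "Xu (\<lambda>x. u x - v x) = Xu u - Xu v"
proof -
  let ?y = "Xu u - Xu v"
  have L: "L2 (\<lambda>x. u x - v x)" using assms by (intro L2_diff in_H_L2)
  have "Hs ?y = cl u - cl v"
    using Hs_add[of "Xu u" "(-1) *\<^sub>R Xu v"] Hs_scaleR[of "-1" "Xu v"] Hs_Xu[OF assms(1)] Hs_Xu[OF assms(2)] by simp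
  then have "cl (\<lambda>x. u x - v x) = cl (uf ?y)" using assms by (simp add: cl_diff in_H_L2)
  from in_H_cong_AE[OF in_H_uf L this] show "in_H (1/2) (\<lambda>x. u x - v x)" "Xu (\<lambda>x. u x - v x) = Xu u - Xu v"
    by simp_all
qed

lemma sob_norm_diff: "in_H (1/2) u \<Longrightarrow> in_H (1/2) v \<Longrightarrow> sob_norm (1/2) (\<lambda>x. u x - v x) = norm (Xu u - Xu v)"
  using sob_norm_Xu[OF Xu_diff(1)] by (simp add: Xu_diff)

lemma sJ_Xu:
  assumes u: "in_H (1/2) u" shows "mlt sJ (Xu u) = cl (\<lambda>z. iJB z * fourier u z)" "L2 (\<lambda>z. iJB z * fourier u z)"
proof -
  show "L2 (\<lambda>z. iJB z * fourier u z)" by (intro L2_mult_bmult bmult_iJB L2_fourier in_H_L2 u)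
  have "mlt sJ (Xu u) = cl (\<lambda>z. sJ z * (complex_of_real (JB z) * fourier u z))"
    unfolding Xu_def using u by (intro mlt_cl) (auto simp: in_H_half)
  also have "\<dots> = cl (\<lambda>z. iJB z * fourier u z)"
    by (simp add: sJ_def power2_eq_square mult.assoc[symmetric])
  finally show "mlt sJ (Xu u) = cl (\<lambda>z. iJB z * fourier u z)" .
qed

lemma sJ_iJB: "mlt sJ f = mlt iJB (mlt iJB f)"
proof -
  have "sJ = (\<lambda>z. iJB z * iJB z)" by (auto simp: sJ_def power2_eq_square)
  then show ?thesis by (simp only: mlt_mlt[OF bmult_iJB bmult_iJB])
qed

lemma sJ_inj: "mlt sJ f = mlt sJ g \<Longrightarrow> f = g"
  by (rule mlt_inj[OF bmult_sJ]) (auto simp: sJ_def)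

section \<open>The equation in L2 coordinates\<close>

context
  fixes m lam mu :: real
  assumes mu: "0 \<le> mu"
begin

text \<open>The right-hand side times \<open>- \<i>\<close>, in the coordinate of
  \<open>H^(-1/2)\<close>: the factor \<open>1 / JB\<close> turns \<open>om\<close> times the
  transform into \<open>omb\<close> acting on \<open>y\<close>, and the transform of the Hartree
  term into \<open>mlt sJ (NN mu lam y)\<close>.\<close>

definition rhs :: "l2 \<Rightarrow> l2" where
  "rhs y = mlt (\<lambda>_. - \<i>) (mlt (omb m) y + mlt sJ (NN mu lam y))"

text \<open>Multiplication by the nowhere vanishing \<open>iJB\<close> and by \<open>- \<i>\<close>
  is reversible pointwise, so the equation almost everywhere is an equality of classes in
  L2.\<close>

lemma equation_iff:
  assumes u: "in_H (1/2) u" and w: "in_fsob (-1/2) w"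
  shows "(AE z in lborel. \<i> * w z = complex_of_real (sqrt ((norm z)\<^sup>2 + m\<^sup>2)) * fourier u z + fourier (hartree lam mu u) z)
    \<longleftrightarrow> cl (\<lambda>z. iJB z * w z) = rhs (Xu u)"
proof -
  note H = hartree_HT[OF mu in_H_L2[OF u] Hs_Xu[OF u, symmetric], of lam]
  have wm [measurable]: "w \<in> borel_measurable borel" using w by (simp add: in_fsob_def)
  have Lw: "L2 (\<lambda>z. iJB z * w z)" using w in_fsob_half(2)[OF wm] by blast
  have fH: "AE z in lborel. fourier (hartree lam mu u) z = rp (mlt iJB (NN mu lam (Xu u))) z"
    using fourier_spec(2)[OF H(1)] unfolding H(2) FT_scaleR iJB_NN[OF mu] .
  have fu: "AE z in lborel. complex_of_real (JB z) * fourier u z = rp (Xu u) z"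
    using rp_cl[of "\<lambda>z. complex_of_real (JB z) * fourier u z"] u unfolding Xu_def in_H_half
    by (auto elim!: eventually_mono)
  have s1: "AE z in lborel. rp (mlt sJ (NN mu lam (Xu u))) z = iJB z * rp (mlt iJB (NN mu lam (Xu u))) z"
    unfolding sJ_iJB by (rule rp_mlt[OF bmult_iJB])
  have r: "AE z in lborel. rp (rhs (Xu u)) z = - \<i> * (omb m z * (complex_of_real (JB z) * fourier u z) + iJB z * fourier (hartree lam mu u) z)"
    using rp_mlt[OF bmult_const, of "- \<i>" "mlt (omb m) (Xu u) + mlt sJ (NN mu lam (Xu u))"]
      rp_add[of "mlt (omb m) (Xu u)" "mlt sJ (NN mu lam (Xu u))"] rp_mlt[OF bmult_omb, of m "Xu u"] s1 fH fu
    unfolding rhs_def by eventually_elim simp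
  have pt: "\<i> * a = complex_of_real (om m z) * b + c \<longleftrightarrow> iJB z * a = - \<i> * (omb m z * (complex_of_real (JB z) * b) + iJB z * c)" for a b c z
  proof -
    have o: "omb m z * (complex_of_real (JB z) * b) = iJB z * (complex_of_real (om m z) * b)"
      by (simp add: omb_def power2_eq_square)
    have "- \<i> * (omb m z * (complex_of_real (JB z) * b) + iJB z * c) = iJB z * (- \<i> * (complex_of_real (om m z) * b + c))"
      unfolding o by (simp only: distrib_left mult.left_commute)
    moreover have "iJB z \<noteq> 0" by simp
    ultimately have "iJB z * a = - \<i> * (omb m z * (complex_of_real (JB z) * b) + iJB z * c) \<longleftrightarrow> a = - \<i> * (complex_of_real (om m z) * b + c)"
      by (metis mult_left_cancel)
    moreover have "\<i> * a = q \<longleftrightarrow> a = - \<i> * q" for q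
    proof
      assume "\<i> * a = q"
      then have "- \<i> * q = - \<i> * (\<i> * a)" by simp
      then show "a = - \<i> * q" by (simp add: mult.assoc[symmetric])
    qed (simp add: mult.assoc[symmetric])
    ultimately show ?thesis by simp
  qed
  have "(AE z in lborel. \<i> * w z = complex_of_real (sqrt ((norm z)\<^sup>2 + m\<^sup>2)) * fourier u z + fourier (hartree lam mu u) z)
    \<longleftrightarrow> (AE z in lborel. iJB z * w z = - \<i> * (omb m z * (complex_of_real (JB z) * fourier u z) + iJB z * fourier (hartree lam mu u) z))"
    unfolding om_def[symmetric] pt ..
  also have "\<dots> \<longleftrightarrow> (AE z in lborel. iJB z * w z = rp (rhs (Xu u)) z)"
    by (rule eventually_subst) (use r in \<open>auto elim!: eventually_mono\<close>)
  also have "\<dots> \<longleftrightarrow> cl (\<lambda>z. iJB z * w z) = rhs (Xu u)"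
    using cl_eq_iff[OF Lw L2_rp[of "rhs (Xu u)"]] by simp
  finally show ?thesis .
qed

lemma difference_quotient_norm:
  assumes "in_H (1/2) u" "in_H (1/2) v" and w: "in_fsob (-1/2) w"
  shows "fsob_norm (-1/2) (\<lambda>z. (fourier u z - fourier v z) / complex_of_real h - w z)
    = norm ((1 / h) *\<^sub>R (mlt sJ (Xu u) - mlt sJ (Xu v)) - cl (\<lambda>z. iJB z * w z))"
proof -
  have wm: "w \<in> borel_measurable borel" using w by (simp add: in_fsob_def)
  have Lw: "L2 (\<lambda>z. iJB z * w z)" using w in_fsob_half(2)[OF wm] by blast
  note Su = sJ_Xu[OF assms(1)] and Sv = sJ_Xu[OF assms(2)]
  have Ld: "L2 (\<lambda>z. complex_of_real (1 / h) * (iJB z * fourier u z - iJB z * fourier v z))"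
    by (intro L2_cmult L2_diff Su Sv)
  have eq: "(\<lambda>z. iJB z * ((fourier u z - fourier v z) / complex_of_real h - w z))
     = (\<lambda>z. complex_of_real (1 / h) * (iJB z * fourier u z - iJB z * fourier v z) - iJB z * w z)"
    by (auto simp: algebra_simps diff_divide_distrib)
  have "cl (\<lambda>z. iJB z * ((fourier u z - fourier v z) / complex_of_real h - w z))
     = (1 / h) *\<^sub>R (mlt sJ (Xu u) - mlt sJ (Xu v)) - cl (\<lambda>z. iJB z * w z)"
    unfolding eq cl_diff[OF Ld Lw] Su(1) Sv(1) cl_diff[OF Su(2) Sv(2), symmetric] mlt_real[symmetric]
    by (subst mlt_cl[OF bmult_const L2_diff[OF Su(2) Sv(2)]]) (rule refl)
  moreover have "L2 (\<lambda>z. iJB z * ((fourier u z - fourier v z) / complex_of_real h - w z))"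
    unfolding eq by (intro L2_diff Ld Lw)
  ultimately show ?thesis using fsob_norm_half(2) by simp
qed

lemma NN_continuous:
  fixes y :: "'t::metric_space \<Rightarrow> l2"
  assumes "continuous_on S y" shows "continuous_on S (\<lambda>s. NN mu lam (y s))"
  unfolding continuous_on_def
proof
  fix t assume t: "t \<in> S"
  obtain C where C: "0 \<le> C" "\<And>R f g. norm f \<le> R \<Longrightarrow> norm g \<le> R \<Longrightarrow> norm (NN mu lam f - NN mu lam g) \<le> C * R\<^sup>2 * norm (f - g)"
    using NN_lipschitz[OF mu, of lam] by blast
  have yt: "(y \<longlongrightarrow> y t) (at t within S)" using assms t by (auto simp: continuous_on_def)
  have "((\<lambda>s. C * (norm (y s) + norm (y t))\<^sup>2 * norm (y s - y t)) \<longlongrightarrow> C * (norm (y t) + norm (y t))\<^sup>2 * norm (y t - y t)) (at t within S)"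
    by (intro tendsto_intros yt)
  then have "((\<lambda>s. C * (norm (y s) + norm (y t))\<^sup>2 * norm (y s - y t)) \<longlongrightarrow> 0) (at t within S)" by simp
  then have "((\<lambda>s. NN mu lam (y s) - NN mu lam (y t)) \<longlongrightarrow> 0) (at t within S)"
    by (rule Lim_null_comparison[rotated]) (intro always_eventually allI C(2); simp)
  then show "((\<lambda>s. NN mu lam (y s)) \<longlongrightarrow> NN mu lam (y t)) (at t within S)" by (rule LIM_zero_cancel)
qed

lemma rhs_continuous:
  fixes y :: "'t::metric_space \<Rightarrow> l2"
  assumes "continuous_on S y" shows "continuous_on S (\<lambda>s. rhs (y s))"
  unfolding rhs_def
  by (intro continuous_on_add bounded_linear.continuous_on[OF bounded_linear_mlt] NN_continuous assms) simp_all

definition tdom :: "ereal \<Rightarrow> real set" where "tdom T = {t. 0 \<le> t \<and> ereal t < T}"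

text \<open>The existential \<open>w\<close> disappears: the equation determines its coordinate as
  \<open>rhs (Xu (u t))\<close>, and its continuity in time follows from that of the curve, because
  \<open>rhs\<close> is continuous on L2.\<close>

lemma is_solution_iff:
  "is_solution m lam mu u0 T u \<longleftrightarrow> 0 < T \<and> (\<forall>t\<in>tdom T. in_H (1/2) (u t)) \<and> (AE x in lborel. u 0 x = u0 x) \<and>
     continuous_on (tdom T) (\<lambda>t. Xu (u t)) \<and>
     (\<forall>t\<in>tdom T. ((\<lambda>s. mlt sJ (Xu (u s))) has_vector_derivative rhs (Xu (u t))) (at t within tdom T))"
proof (cases "0 < T \<and> (\<forall>t\<in>tdom T. in_H (1/2) (u t)) \<and> (AE x in lborel. u 0 x = u0 x)")
  case True
  then have H: "\<And>t. t \<in> tdom T \<Longrightarrow> in_H (1/2) (u t)" by blast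
  have c: "(\<forall>t. 0 \<le> t \<and> ereal t < T \<longrightarrow>
        ((\<lambda>s. sob_norm (1/2) (\<lambda>x. u s x - u t x)) \<longlongrightarrow> 0) (at t within {s. 0 \<le> s \<and> ereal s < T}))
     \<longleftrightarrow> continuous_on (tdom T) (\<lambda>t. Xu (u t))"
  proof -
    have "((\<lambda>s. sob_norm (1/2) (\<lambda>x. u s x - u t x)) \<longlongrightarrow> 0) (at t within tdom T)
      \<longleftrightarrow> ((\<lambda>s. Xu (u s)) \<longlongrightarrow> Xu (u t)) (at t within tdom T)" if t: "t \<in> tdom T" for t
    proof -
      have "((\<lambda>s. sob_norm (1/2) (\<lambda>x. u s x - u t x)) \<longlongrightarrow> 0) (at t within tdom T)
        \<longleftrightarrow> ((\<lambda>s. norm (Xu (u s) - Xu (u t))) \<longlongrightarrow> 0) (at t within tdom T)"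
        by (rule tendsto_cong) (auto simp: eventually_at_filter sob_norm_diff H t intro!: always_eventually)
      then show ?thesis by (simp add: tendsto_norm_zero_iff LIM_zero_iff)
    qed
    then show ?thesis unfolding continuous_on_def tdom_def by blast
  qed
  have d: "((\<lambda>h. fsob_norm (-1/2) (\<lambda>z. (fourier (u (t + h)) z - fourier (u t) z) / complex_of_real h - w z)) \<longlongrightarrow> 0)
        (at 0 within {h. 0 \<le> t + h \<and> ereal (t + h) < T})
     \<longleftrightarrow> ((\<lambda>s. mlt sJ (Xu (u s))) has_vector_derivative cl (\<lambda>z. iJB z * w z)) (at t within tdom T)"
    if t: "t \<in> tdom T" and w: "in_fsob (-1/2) w" for t w
  proof -
    have J: "{h. 0 \<le> t + h \<and> ereal (t + h) < T} = {h. t + h \<in> tdom T}" by (auto simp: tdom_def)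
    show ?thesis
      unfolding has_vector_derivative_shift_iff J
      by (rule tendsto_cong, unfold eventually_at_filter)
         (use H t w in \<open>intro always_eventually allI impI difference_quotient_norm; simp\<close>)
  qed
  have nd: "fsob_norm (-1/2) (\<lambda>z. w z - w' z) = norm (cl (\<lambda>z. iJB z * w z) - cl (\<lambda>z. iJB z * w' z))"
    if w: "in_fsob (-1/2) w" "in_fsob (-1/2) w'" for w w'
  proof -
    have L: "L2 (\<lambda>z. iJB z * w z)" "L2 (\<lambda>z. iJB z * w' z)"
      using w in_fsob_half(2)[of w] in_fsob_half(2)[of w'] by (auto simp: in_fsob_def)
    have eq: "(\<lambda>z. iJB z * (w z - w' z)) = (\<lambda>z. iJB z * w z - iJB z * w' z)" by (simp add: right_diff_distrib)
    have "L2 (\<lambda>z. iJB z * (w z - w' z))" unfolding eq by (intro L2_diff L)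
    from fsob_norm_half(2)[OF this] show ?thesis unfolding eq cl_diff[OF L] .
  qed
  have "(\<exists>w :: real \<Rightarrow> real^3 \<Rightarrow> complex. \<forall>t. 0 \<le> t \<and> ereal t < T \<longrightarrow>
        in_fsob (-1/2) (w t) \<and>
        ((\<lambda>h. fsob_norm (-1/2) (\<lambda>\<xi>. (fourier (u (t + h)) \<xi> - fourier (u t) \<xi>) / complex_of_real h - w t \<xi>))
           \<longlongrightarrow> 0) (at 0 within {h. 0 \<le> t + h \<and> ereal (t + h) < T}) \<and>
        ((\<lambda>s. fsob_norm (-1/2) (\<lambda>\<xi>. w s \<xi> - w t \<xi>)) \<longlongrightarrow> 0) (at t within {s. 0 \<le> s \<and> ereal s < T}) \<and>
        (AE \<xi> in lborel. \<i> * w t \<xi> =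
            complex_of_real (sqrt ((norm \<xi>)^2 + m^2)) * fourier (u t) \<xi> + fourier (hartree lam mu (u t)) \<xi>))
     \<longleftrightarrow> (\<forall>t\<in>tdom T. ((\<lambda>s. mlt sJ (Xu (u s))) has_vector_derivative rhs (Xu (u t))) (at t within tdom T))"
    (is "?L \<longleftrightarrow> ?R")
    if cont: "continuous_on (tdom T) (\<lambda>t. Xu (u t))"
  proof
    assume ?L
    then obtain w where w: "\<And>t. t \<in> tdom T \<Longrightarrow> in_fsob (-1/2) (w t)"
      "\<And>t. t \<in> tdom T \<Longrightarrow> ((\<lambda>h. fsob_norm (-1/2) (\<lambda>\<xi>. (fourier (u (t + h)) \<xi> - fourier (u t) \<xi>) / complex_of_real h - w t \<xi>))
           \<longlongrightarrow> 0) (at 0 within {h. 0 \<le> t + h \<and> ereal (t + h) < T})"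
      "\<And>t. t \<in> tdom T \<Longrightarrow> (AE \<xi> in lborel. \<i> * w t \<xi> =
            complex_of_real (sqrt ((norm \<xi>)^2 + m^2)) * fourier (u t) \<xi> + fourier (hartree lam mu (u t)) \<xi>)"
      unfolding tdom_def by blast
    show ?R
    proof
      fix t assume t: "t \<in> tdom T"
      have "cl (\<lambda>z. iJB z * w t z) = rhs (Xu (u t))"
        using equation_iff[OF H[OF t] w(1)[OF t]] w(3)[OF t] by blast
      then show "((\<lambda>s. mlt sJ (Xu (u s))) has_vector_derivative rhs (Xu (u t))) (at t within tdom T)"
        using d[OF t w(1)[OF t]] w(2)[OF t] by simp
    qed
  next
    assume R: ?R
    \<comment> \<open>The weight \<open>JB\<close> undoes the coordinate map of
      \<open>H^(-1/2)\<close>; the function \<open>w t\<close> itself need not be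
      square-integrable.\<close>
    define w where "w t z = complex_of_real (JB z) * rp (rhs (Xu (u t))) z" for t z
    have iw: "(\<lambda>z. iJB z * w t z) = rp (rhs (Xu (u t)))" for t
      by (auto simp: w_def mult.assoc[symmetric])
    have [measurable]: "w t \<in> borel_measurable borel" for t unfolding w_def by measurable
    have w: "in_fsob (-1/2) (w t)" for t
      using in_fsob_half(2)[of "w t"] iw[of t] by simp
    have "((\<lambda>s. fsob_norm (-1/2) (\<lambda>\<xi>. w s \<xi> - w t \<xi>)) \<longlongrightarrow> 0) (at t within tdom T)" if t: "t \<in> tdom T" for t
    proof -
      have "((\<lambda>s. rhs (Xu (u s))) \<longlongrightarrow> rhs (Xu (u t))) (at t within tdom T)"
        using rhs_continuous[OF cont] t by (auto simp: continuous_on_def)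
      then have "((\<lambda>s. norm (rhs (Xu (u s)) - rhs (Xu (u t)))) \<longlongrightarrow> 0) (at t within tdom T)"
        by (intro tendsto_norm_zero LIM_zero)
      then show ?thesis unfolding nd[OF w w] iw cl_rp .
    qed
    moreover have "((\<lambda>h. fsob_norm (-1/2) (\<lambda>z. (fourier (u (t + h)) z - fourier (u t) z) / complex_of_real h - w t z)) \<longlongrightarrow> 0)
        (at 0 within {h. 0 \<le> t + h \<and> ereal (t + h) < T})" if t: "t \<in> tdom T" for t
      using R t unfolding d[OF t w] iw cl_rp by blast
    moreover have "(AE \<xi> in lborel. \<i> * w t \<xi> =
            complex_of_real (sqrt ((norm \<xi>)^2 + m^2)) * fourier (u t) \<xi> + fourier (hartree lam mu (u t)) \<xi>)" if t: "t \<in> tdom T" for t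
      unfolding equation_iff[OF H[OF t] w] iw cl_rp ..
    ultimately show ?L using w unfolding tdom_def by (intro exI[of _ w]) blast
  qed
  then show ?thesis
    unfolding is_solution_def c using True unfolding tdom_def by blast
next
  case False
  then show ?thesis unfolding is_solution_def tdom_def by blast
qed

section \<open>The interaction picture\<close>

definition FE :: "real \<Rightarrow> l2 \<Rightarrow> l2" where
  "FE t g = mlt (\<lambda>_. - \<i>) (Ev m t (NN mu lam (Ev m (- t) g)))"

text \<open>\<open>Ev\<close> is isometric, so the Lipschitz constants of \<open>NN\<close> on balls
  carry over uniformly in time, and strong continuity of \<open>Ev\<close> gives continuity in
  time.\<close>

lemma local_ode_FE: "\<exists>L. local_ode FE L"
proof -
  obtain C where C: "0 \<le> C" "\<And>R f g. norm f \<le> R \<Longrightarrow> norm g \<le> R \<Longrightarrow> norm (NN mu lam f - NN mu lam g) \<le> C * R\<^sup>2 * norm (f - g)"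
    using NN_lipschitz[OF mu, of lam] by blast
  have ni: "norm (mlt (\<lambda>_. - \<i>) f) = norm f" for f by (rule norm_mlt_unimod) auto
  \<comment> \<open>The summand 1 keeps the constant positive, as the locale requires, also when
    \<open>C\<close> or \<open>R\<close> is 0.\<close>
  have "local_ode FE (\<lambda>R. C * R\<^sup>2 + 1)"
  proof
    show "continuous_on UNIV (\<lambda>t. FE t x)" for x
    proof -
      have "continuous_on UNIV (\<lambda>t. Ev m (1 * t) (NN mu lam (Ev m ((-1) * t) x)))"
        by (intro Ev_continuous_joint NN_continuous Ev_continuous)
      then show ?thesis
        unfolding FE_def by (intro bounded_linear.continuous_on[OF bounded_linear_mlt]) simp_all
    qed
    show "norm (FE t x - FE t y) \<le> (C * R\<^sup>2 + 1) * norm (x - y)" if "norm x \<le> R" "norm y \<le> R" for R t x y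
    proof -
      have "norm (FE t x - FE t y) = norm (NN mu lam (Ev m (- t) x) - NN mu lam (Ev m (- t) y))"
        unfolding FE_def by (simp add: ni flip: mlt_diff[OF bmult_const] Ev_diff)
      also have "\<dots> \<le> C * R\<^sup>2 * norm (Ev m (- t) x - Ev m (- t) y)" by (rule C(2)) (use that in auto)
      also have "\<dots> = C * R\<^sup>2 * norm (x - y)" by (simp flip: Ev_diff)
      also have "\<dots> \<le> (C * R\<^sup>2 + 1) * norm (x - y)" by (simp add: distrib_right)
      finally show ?thesis .
    qed
    show "0 < C * R\<^sup>2 + 1" for R using C(1) by (simp add: add_nonneg_pos)
    show "FE t 0 = 0" for t
    proof -
      have "Ev m (- t) 0 = 0" by (rule linear_0[OF bounded_linear.linear[OF bounded_linear_Ev]])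
      moreover have "Ev m t 0 = 0" by (rule linear_0[OF bounded_linear.linear[OF bounded_linear_Ev]])
      moreover have "mlt (\<lambda>_. - \<i>) 0 = 0" by (rule linear_0[OF bounded_linear.linear[OF bounded_linear_mlt[OF bmult_const]]])
      ultimately show ?thesis by (simp add: FE_def NN_0[OF mu])
    qed
  qed
  then show ?thesis by blast
qed

lemma FE_continuous:
  assumes "continuous_on S g" shows "continuous_on S (\<lambda>s. FE s (g s))"
proof -
  have "continuous_on S (\<lambda>s. Ev m (1 * s) (NN mu lam (Ev m ((-1) * s) (g s))))"
    by (intro Ev_continuous_joint NN_continuous assms)
  then show ?thesis
    unfolding FE_def by (intro bounded_linear.continuous_on[OF bounded_linear_mlt]) simp_all
qed

lemma sJ_commute: "mlt sJ (Ev m t f) = Ev m t (mlt sJ f)"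
  unfolding Ev_def by (rule mlt_commute) simp_all

lemma tdom_sub: "t \<in> tdom T \<Longrightarrow> {0..t} \<subseteq> tdom T"
  unfolding tdom_def by (auto intro: le_less_trans[of _ "ereal t"])

text \<open>In the product rule the derivative of the phase cancels the \<open>omb\<close> term of
  \<open>rhs\<close>, so only the nonlinearity remains, still under \<open>sJ\<close>.\<close>

lemma curve_imp_ode:
  assumes c: "continuous_on (tdom T) y"
    and d: "\<And>t. t \<in> tdom T \<Longrightarrow> ((\<lambda>s. mlt sJ (y s)) has_vector_derivative rhs (y t)) (at t within tdom T)"
  shows "ode_sol FE (y 0) T (\<lambda>t. Ev m t (y t))"
proof -
  let ?g = "\<lambda>t. Ev m t (y t)"
  have cg: "continuous_on (tdom T) ?g" using Ev_continuous_joint[OF c, of m 1] by simp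
  have dS: "((\<lambda>s. mlt sJ (?g s)) has_vector_derivative mlt sJ (FE t (?g t))) (at t within tdom T)" if t: "t \<in> tdom T" for t
  proof -
    have "((\<lambda>s. Ev m (1 * s) (mlt sJ (y s))) has_vector_derivative
        Ev m (1 * t) (rhs (y t) + 1 *\<^sub>R mlt (\<lambda>_. \<i>) (mlt (omb m) (y t)))) (at t within tdom T)"
      by (rule Ev_product_rule[OF d[OF t]])
    moreover have "rhs (y t) + mlt (\<lambda>_. \<i>) (mlt (omb m) (y t)) = mlt sJ (mlt (\<lambda>_. - \<i>) (NN mu lam (y t)))"
    proof -
      have "mlt (\<lambda>_. - \<i>) f + mlt (\<lambda>_. \<i>) f = 0" for f
        using mlt_add_left[of "\<lambda>_. - \<i>" "\<lambda>_. \<i>" f] mlt_real[of 0 f] by simp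
      moreover have add_cancel: "a + b + c = b" if "a + c = 0" for a b c :: l2
      proof -
        have "a + b + c = b + (a + c)" by (simp only: add.assoc add.left_commute)
        then show ?thesis by (simp add: that)
      qed
      ultimately have "rhs (y t) + mlt (\<lambda>_. \<i>) (mlt (omb m) (y t)) = mlt (\<lambda>_. - \<i>) (mlt sJ (NN mu lam (y t)))"
        unfolding rhs_def mlt_add[OF bmult_const] by (intro add_cancel)
      also have "\<dots> = mlt sJ (mlt (\<lambda>_. - \<i>) (NN mu lam (y t)))" by (rule mlt_commute) simp_all
      finally show ?thesis .
    qed
    moreover have "Ev m t (mlt sJ (mlt (\<lambda>_. - \<i>) (NN mu lam (y t)))) = mlt sJ (FE t (?g t))"
    proof -
      have "Ev m t (mlt (\<lambda>_. - \<i>) f) = mlt (\<lambda>_. - \<i>) (Ev m t f)" for f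
        unfolding Ev_def by (rule mlt_commute) simp_all
      then show ?thesis by (simp add: sJ_commute[symmetric] FE_def)
    qed
    ultimately show ?thesis by (simp add: sJ_commute)
  qed
  have "?g t = y 0 + integral {0..t} (\<lambda>s. FE s (?g s))" if t: "t \<in> tdom T" for t
  \<comment> \<open>The fundamental theorem is applied under \<open>sJ\<close>, where the curve is
    differentiable. The integral of the unsmoothed field exists too, by continuity;
    \<open>sJ\<close> passes outside it and is cancelled by injectivity.\<close>
  proof (rule sJ_inj)
    have t0: "0 \<le> t" using t by (simp add: tdom_def)
    have "((\<lambda>s. mlt sJ (FE s (?g s))) has_integral mlt sJ (?g t) - mlt sJ (?g 0)) {0..t}"
      by (rule fundamental_theorem_of_calculus[OF t0])
         (use tdom_sub[OF t] in \<open>auto intro!: has_vector_derivative_within_subset[OF dS]\<close>)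
    moreover have "(\<lambda>s. FE s (?g s)) integrable_on {0..t}"
      by (intro integrable_continuous_interval FE_continuous continuous_on_subset[OF cg tdom_sub[OF t]])
    then have "((\<lambda>s. mlt sJ (FE s (?g s))) has_integral mlt sJ (integral {0..t} (\<lambda>s. FE s (?g s)))) {0..t}"
      using has_integral_linear[OF integrable_integral bounded_linear_mlt[OF bmult_sJ]] by (simp add: comp_def)
    ultimately have "mlt sJ (?g t) - mlt sJ (?g 0) = mlt sJ (integral {0..t} (\<lambda>s. FE s (?g s)))"
      by (rule has_integral_unique)
    then show "mlt sJ (?g t) = mlt sJ (y 0 + integral {0..t} (\<lambda>s. FE s (?g s)))"
      by (simp add: mlt_add algebra_simps)
  qed
  then show ?thesis using cg unfolding ode_sol_def tdom_def by blast
qed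

text \<open>Here \<open>g\<close> is differentiable in L2 itself, being an integral of a continuous
  curve; smoothing enters only to differentiate the phase.\<close>

lemma ode_imp_curve:
  assumes g: "ode_sol FE x0 T g"
  shows "continuous_on (tdom T) (\<lambda>t. Ev m (- t) (g t))"
    "\<And>t. t \<in> tdom T \<Longrightarrow> ((\<lambda>s. mlt sJ (Ev m (- s) (g s))) has_vector_derivative rhs (Ev m (- t) (g t))) (at t within tdom T)"
proof -
  have cg: "continuous_on (tdom T) g" using g unfolding ode_sol_def tdom_def by blast
  show "continuous_on (tdom T) (\<lambda>t. Ev m (- t) (g t))" using Ev_continuous_joint[OF cg, of m "-1"] by simp
  fix t assume t: "t \<in> tdom T"
  have t0: "0 \<le> t" "ereal t < T" using t by (auto simp: tdom_def)
  \<comment> \<open>The derivative of an indefinite integral is available on a compact interval;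
    \<open>{0..b}\<close> agrees with \<open>tdom T\<close> near \<open>t\<close> because
    \<open>t < b\<close>.\<close>
  obtain b where b: "t < b" "ereal b < T" using t0(2) by (metis ereal_dense2 less_ereal.simps(1))
  have bT: "b \<in> tdom T" using b t0 by (simp add: tdom_def)
  have "((\<lambda>s. integral {0..s} (\<lambda>r. FE r (g r))) has_vector_derivative FE t (g t)) (at t within {0..b})"
    by (rule integral_has_vector_derivative)
       (use t0 b in \<open>auto intro!: FE_continuous continuous_on_subset[OF cg tdom_sub[OF bT]]\<close>)
  then have "((\<lambda>s. x0 + integral {0..s} (\<lambda>r. FE r (g r))) has_vector_derivative FE t (g t)) (at t within {0..b})"
    by (auto intro!: derivative_eq_intros)
  then have "(g has_vector_derivative FE t (g t)) (at t within {0..b})"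
    by (rule has_vector_derivative_transform[rotated 2])
       (use g t0 b tdom_sub[OF bT] in \<open>auto simp: ode_sol_def tdom_def\<close>)
  moreover have "at t within {0..b} = at t within tdom T"
    by (rule at_within_nhd[of _ "{..<b}"]) (use t0 b tdom_sub[OF bT] in \<open>auto simp: tdom_def\<close>)
  ultimately have "(g has_vector_derivative FE t (g t)) (at t within tdom T)" by simp
  then have "((\<lambda>s. mlt sJ (g s)) has_vector_derivative mlt sJ (FE t (g t))) (at t within tdom T)"
    by (rule bounded_linear.has_vector_derivative[OF bounded_linear_mlt[OF bmult_sJ]])
  from Ev_product_rule[OF this, of m "-1"]
  have "((\<lambda>s. mlt sJ (Ev m (- s) (g s))) has_vector_derivative
     Ev m (- t) (mlt sJ (FE t (g t)) - mlt (\<lambda>_. \<i>) (mlt (omb m) (g t)))) (at t within tdom T)"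
    by (simp add: sJ_commute)
  moreover have "Ev m (- t) (mlt sJ (FE t (g t)) - mlt (\<lambda>_. \<i>) (mlt (omb m) (g t))) = rhs (Ev m (- t) (g t))"
  proof -
    have c: "Ev m s (mlt a f) = mlt a (Ev m s f)" if "bmult a" for s a f
      unfolding Ev_def using that by (intro mlt_commute) simp_all
    have neg: "mlt (\<lambda>_. - \<i>) f = - mlt (\<lambda>_. \<i>) f" for f
      using mlt_add_left[of "\<lambda>_. - \<i>" "\<lambda>_. \<i>" f] mlt_real[of 0 f] by (simp add: eq_neg_iff_add_eq_0)
    have "Ev m (- t) (mlt sJ (FE t (g t))) = mlt (\<lambda>_. - \<i>) (mlt sJ (NN mu lam (Ev m (- t) (g t))))"
      unfolding FE_def c[OF bmult_sJ] c[OF bmult_const] Ev_inverse(1) by (rule mlt_commute) simp_all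
    moreover have "Ev m (- t) (mlt (\<lambda>_. \<i>) (mlt (omb m) (g t))) = mlt (\<lambda>_. \<i>) (mlt (omb m) (Ev m (- t) (g t)))"
      by (simp add: c)
    ultimately show ?thesis
      unfolding rhs_def mlt_add[OF bmult_const] Ev_diff by (simp add: neg)
  qed
  ultimately show "((\<lambda>s. mlt sJ (Ev m (- s) (g s))) has_vector_derivative rhs (Ev m (- t) (g t))) (at t within tdom T)"
    by simp
qed

lemma solution_imp_ode:
  assumes u: "is_solution m lam mu u0 T u" and u0: "in_H (1/2) u0"
  shows "ode_sol FE (Xu u0) T (\<lambda>t. Ev m t (Xu (u t)))"
proof -
  have T: "0 < T" and H: "\<And>t. t \<in> tdom T \<Longrightarrow> in_H (1/2) (u t)" and i: "AE x in lborel. u 0 x = u0 x"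
    and c: "continuous_on (tdom T) (\<lambda>t. Xu (u t))"
    and d: "\<And>t. t \<in> tdom T \<Longrightarrow> ((\<lambda>s. mlt sJ (Xu (u s))) has_vector_derivative rhs (Xu (u t))) (at t within tdom T)"
    using u unfolding is_solution_iff by auto
  have "0 \<in> tdom T" using T by (simp add: tdom_def zero_ereal_def[symmetric])
  then have "in_H (1/2) (u 0)" by (rule H)
  then have "Xu (u 0) = Xu u0"
    using i u0 by (intro in_H_cong_AE(2)[OF u0]) (auto intro: cl_cong in_H_L2)
  then show ?thesis using curve_imp_ode[OF c d] by simp
qed

lemma ode_imp_solution:
  assumes g: "ode_sol FE (Xu u0) T g" and T: "0 < T" and u0: "in_H (1/2) u0"
  shows "is_solution m lam mu u0 T (\<lambda>t. uf (Ev m (- t) (g t)))"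
  unfolding is_solution_iff
proof (intro conjI ballI)
  have "0 \<in> tdom T" using T by (simp add: tdom_def zero_ereal_def[symmetric])
  then have "g 0 = Xu u0" using g unfolding ode_sol_def tdom_def by auto
  then have "Xu (uf (Ev m (- 0) (g 0))) = Xu u0" by simp
  then show "AE x in lborel. uf (Ev m (- 0) (g 0)) x = u0 x" by (intro Xu_inj in_H_uf u0)
qed (use T in_H_uf ode_imp_curve[OF g] in simp_all)

end

lemma solution_eq_uf:
  assumes "0 \<le> mu" "is_solution m lam mu u0 T v" "in_H (1/2) u0" "0 \<le> t" "ereal t < T"
    and "Ev m t (Xu (v t)) = g"
  shows "AE x in lborel. v t x = uf (Ev m (- t) g) x"
proof (rule Xu_inj[OF _ in_H_uf])
  show "in_H (1/2) (v t)" using assms(2,4,5) by (simp add: is_solution_def)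
  show "Xu (v t) = Xu (uf (Ev m (- t) g))" unfolding assms(6)[symmetric] by simp
qed

theorem theorem1:
  fixes m lam mu :: real
  assumes "m \<ge> 0" and "mu \<ge> 0"
  shows "\<forall>u0. in_H (1/2) u0 \<longrightarrow>
    (\<exists>(T::ereal) u. 0 < T \<and> is_solution m lam mu u0 T u \<and>
       (\<forall>T' v. is_solution m lam mu u0 T' v \<longrightarrow>
           T' \<le> T \<and> (\<forall>t. 0 \<le> t \<and> ereal t < T' \<longrightarrow> (AE x in lborel. v t x = u t x))) \<and>
       (T = \<infinity> \<or> (T < \<infinity> \<and>
           filterlim (\<lambda>t. sob_norm (1/2) (u t)) at_top (at_left (real_of_ereal T)))) \<and>
       (\<forall>T1 \<epsilon>. 0 \<le> T1 \<and> ereal T1 < T \<and> 0 < \<epsilon> \<longrightarrow>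
          (\<exists>\<delta>>0. \<forall>v0. in_H (1/2) v0 \<and> sob_norm (1/2) (\<lambda>x. v0 x - u0 x) < \<delta> \<longrightarrow>
             (\<exists>T' v. ereal T1 < T' \<and> is_solution m lam mu v0 T' v \<and>
                (\<forall>t\<in>{0..T1}. sob_norm (1/2) (\<lambda>x. v t x - u t x) < \<epsilon>)))))"
proof (intro allI impI)
  fix u0 assume u0: "in_H (1/2) u0"
  let ?F = "FE m lam mu"
  obtain L where "local_ode ?F L" using local_ode_FE[OF assms(2)] by blast
  from local_ode.ode_wellposed[OF this, of "Xu u0"]
  obtain T x where T: "0 < T" and x: "ode_sol ?F (Xu u0) T x"
    and uniq: "\<And>T' y. ode_sol ?F (Xu u0) T' y \<Longrightarrow> T' \<le> T \<and> (\<forall>t. 0 \<le> t \<and> ereal t < T' \<longrightarrow> y t = x t)"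
    and blowup: "T = \<infinity> \<or> T < \<infinity> \<and> filterlim (\<lambda>t. norm (x t)) at_top (at_left (real_of_ereal T))"
    and dep: "\<And>T1 e. 0 \<le> T1 \<Longrightarrow> ereal T1 < T \<Longrightarrow> 0 < e \<Longrightarrow>
        \<exists>d>0. \<forall>y0. norm (y0 - Xu u0) < d \<longrightarrow>
          (\<exists>T' y. ereal T1 < T' \<and> ode_sol ?F y0 T' y \<and> (\<forall>t\<in>{0..T1}. norm (y t - x t) < e))"
    by blast
  \<comment> \<open>\<open>sol\<close> undoes both changes of coordinates isometrically at each
    time. Norms and distances in \<open>H^(1/2)\<close> equal those of the curves in L2, so blow-up
    and continuous dependence are inherited literally.\<close>
  define sol where "sol y t = uf (Ev m (- t) (y t))" for y t
  have sol: "is_solution m lam mu v0 T' (sol y)" if "ode_sol ?F (Xu v0) T' y" "0 < T'" "in_H (1/2) v0" for v0 T' y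
    using ode_imp_solution[OF assms(2) that] unfolding sol_def .
  have norm_sol: "sob_norm (1/2) (sol y t) = norm (y t)" for y t
    by (simp add: sol_def sob_norm_Xu in_H_uf)
  have norm_sol_diff: "sob_norm (1/2) (\<lambda>z. sol y t z - sol y' t z) = norm (y t - y' t)" for y y' t
    by (simp add: sol_def sob_norm_diff in_H_uf flip: Ev_diff)
  show "\<exists>(T::ereal) u. 0 < T \<and> is_solution m lam mu u0 T u \<and>
       (\<forall>T' v. is_solution m lam mu u0 T' v \<longrightarrow>
           T' \<le> T \<and> (\<forall>t. 0 \<le> t \<and> ereal t < T' \<longrightarrow> (AE x in lborel. v t x = u t x))) \<and>
       (T = \<infinity> \<or> (T < \<infinity> \<and>
           filterlim (\<lambda>t. sob_norm (1/2) (u t)) at_top (at_left (real_of_ereal T)))) \<and>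
       (\<forall>T1 \<epsilon>. 0 \<le> T1 \<and> ereal T1 < T \<and> 0 < \<epsilon> \<longrightarrow>
          (\<exists>\<delta>>0. \<forall>v0. in_H (1/2) v0 \<and> sob_norm (1/2) (\<lambda>x. v0 x - u0 x) < \<delta> \<longrightarrow>
             (\<exists>T' v. ereal T1 < T' \<and> is_solution m lam mu v0 T' v \<and>
                (\<forall>t\<in>{0..T1}. sob_norm (1/2) (\<lambda>x. v t x - u t x) < \<epsilon>))))"
  proof (intro exI conjI)
    show "0 < T" by (fact T)
    show "is_solution m lam mu u0 T (sol x)" by (rule sol[OF x T u0])
    show "\<forall>T' v. is_solution m lam mu u0 T' v \<longrightarrow>
           T' \<le> T \<and> (\<forall>t. 0 \<le> t \<and> ereal t < T' \<longrightarrow> (AE z in lborel. v t z = sol x t z))"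
    proof (intro allI impI)
      fix T' v assume v: "is_solution m lam mu u0 T' v"
      \<comment> \<open>An arbitrary solution in the class of the problem becomes a solution of the
        ordinary differential equation, so maximality and uniqueness hold in that whole
        class.\<close>
      from uniq[OF solution_imp_ode[OF assms(2) v u0]]
      show "T' \<le> T \<and> (\<forall>t. 0 \<le> t \<and> ereal t < T' \<longrightarrow> (AE z in lborel. v t z = sol x t z))"
        unfolding sol_def using solution_eq_uf[OF assms(2) v u0] by blast
    qed
    show "T = \<infinity> \<or> T < \<infinity> \<and> filterlim (\<lambda>t. sob_norm (1/2) (sol x t)) at_top (at_left (real_of_ereal T))"
      using blowup unfolding norm_sol .
    show "\<forall>T1 \<epsilon>. 0 \<le> T1 \<and> ereal T1 < T \<and> 0 < \<epsilon> \<longrightarrow>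
          (\<exists>\<delta>>0. \<forall>v0. in_H (1/2) v0 \<and> sob_norm (1/2) (\<lambda>x. v0 x - u0 x) < \<delta> \<longrightarrow>
             (\<exists>T' v. ereal T1 < T' \<and> is_solution m lam mu v0 T' v \<and>
                (\<forall>t\<in>{0..T1}. sob_norm (1/2) (\<lambda>z. v t z - sol x t z) < \<epsilon>)))"
    proof (intro allI impI, elim conjE)
      fix T1 e :: real assume T1: "0 \<le> T1" "ereal T1 < T" and e: "0 < e"
      from dep[OF this] obtain d where d: "0 < d" "\<And>y0. norm (y0 - Xu u0) < d \<Longrightarrow>
          \<exists>T' y. ereal T1 < T' \<and> ode_sol ?F y0 T' y \<and> (\<forall>t\<in>{0..T1}. norm (y t - x t) < e)" by blast
      show "\<exists>\<delta>>0. \<forall>v0. in_H (1/2) v0 \<and> sob_norm (1/2) (\<lambda>x. v0 x - u0 x) < \<delta> \<longrightarrow>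
             (\<exists>T' v. ereal T1 < T' \<and> is_solution m lam mu v0 T' v \<and>
                (\<forall>t\<in>{0..T1}. sob_norm (1/2) (\<lambda>z. v t z - sol x t z) < e))"
      proof (intro exI[of _ d] conjI d(1) allI impI, elim conjE)
        fix v0 assume v0: "in_H (1/2) v0" "sob_norm (1/2) (\<lambda>x. v0 x - u0 x) < d"
        obtain T' y where y: "ereal T1 < T'" "ode_sol ?F (Xu v0) T' y" "\<forall>t\<in>{0..T1}. norm (y t - x t) < e"
          using d(2)[of "Xu v0"] v0(2) unfolding sob_norm_diff[OF v0(1) u0] by blast
        have "0 < T'" using T1(1) y(1) by (metis ereal_less_eq(5) le_less_trans)
        with y show "\<exists>T' v. ereal T1 < T' \<and> is_solution m lam mu v0 T' v \<and>
                (\<forall>t\<in>{0..T1}. sob_norm (1/2) (\<lambda>z. v t z - sol x t z) < e)"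
          by (intro exI[of _ T'] exI[of _ "sol y"]) (simp add: norm_sol_diff sol v0(1))
      qed
    qed
  qed
qed

end
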